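(* Let $K$ be a $\sigma$-pseudo field and let $L$, $L'$ be $\sigma$-pseudo field extensions of $K$. Assume that one of them is finitely $\sigma$-generated over $K$ (as a $\sigma$-pseudo field). Then $L|K$ and $L'|K$ are compatible, i.e. there exists a $\sigma$-pseudo field extension $M$ of $K$ together with $K$-$\sigma$-embeddings $L\to M$ and $L'\to M$.
   Context: All rings are commutative with identity. A $\sigma$-ring is a ring together with a ring endomorphism $\sigma$; a $\sigma$-morphism is a ring morphism commuting with $\sigma$; a $\sigma$-ideal is an ideal $I$ with $\sigma(I)\subset I$. A $\sigma$-pseudo field is a (non-zero) noetherian $\sigma$-ring $K$ whose only $\sigma$-ideals are $0$ and $K$ and in which every non-zero-divisor is invertible. An extension $L|K$ of $\sigma$-pseudo fields means that $K$ is a $\sigma$-subring of the $\sigma$-pseudo field $L$. A $K$-$\sigma$-embedding is an injective $\sigma$-morphism of $K$-algebras. For a subset $S$ of $L$, $K\{S\}$ is the $K$-subalgebra generated by all $\sigma^i(s)$, $s\in S$, $i\ge0$, and $K\langle S\rangle\subset L$ is the smallest $\sigma$-pseudo subfield of $L$ containing $K$ and $S$; it is the total ring of quotients of $K\{S\}$. $L$ is finitely $\sigma$-generated over $K$ if $L=K\langle S\rangle$ for some finite subset $S\subset L$. *)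

theory Defs
  imports "HOL-Algebra.Ring_Divisibility" "HOL-Algebra.Subrings"
begin

locale sigma_ring = cring R for R (structure) +
  fixes \<sigma> :: "'a \<Rightarrow> 'a"
  assumes sigma_hom: "\<sigma> \<in> ring_hom R R"

definition sigma_ideal :: "('a, 'm) ring_scheme \<Rightarrow> ('a \<Rightarrow> 'a) \<Rightarrow> 'a set \<Rightarrow> bool" where
  "sigma_ideal R \<sigma> I \<longleftrightarrow> ideal I R \<and> \<sigma> ` I \<subseteq> I"

definition non_zero_divisor :: "('a, 'm) ring_scheme \<Rightarrow> 'a \<Rightarrow> bool" where
  "non_zero_divisor R a \<longleftrightarrow>
     a \<in> carrier R \<and> (\<forall>b \<in> carrier R. a \<otimes>\<^bsub>R\<^esub> b = \<zero>\<^bsub>R\<^esub> \<longrightarrow> b = \<zero>\<^bsub>R\<^esub>)"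

locale sigma_pseudo_field = sigma_ring R \<sigma> + noetherian_ring R
  for R (structure) and \<sigma> +
  assumes one_neq_zero: "\<one> \<noteq> \<zero>"
    and sigma_simple: "sigma_ideal R \<sigma> I \<Longrightarrow> I = {\<zero>} \<or> I = carrier R"
    and non_zero_divisor_invertible: "non_zero_divisor R a \<Longrightarrow> a \<in> Units R"

definition sigma_morphism ::
  "('a, 'm) ring_scheme \<Rightarrow> ('a \<Rightarrow> 'a) \<Rightarrow> ('b, 'n) ring_scheme \<Rightarrow> ('b \<Rightarrow> 'b) \<Rightarrow> ('a \<Rightarrow> 'b) \<Rightarrow> bool"
  where
  "sigma_morphism R \<sigma> S \<tau> f \<longleftrightarrow>
     f \<in> ring_hom R S \<and> (\<forall>x \<in> carrier R. f (\<sigma> x) = \<tau> (f x))"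

definition sigma_embedding ::
  "('a, 'm) ring_scheme \<Rightarrow> ('a \<Rightarrow> 'a) \<Rightarrow> ('b, 'n) ring_scheme \<Rightarrow> ('b \<Rightarrow> 'b) \<Rightarrow> ('a \<Rightarrow> 'b) \<Rightarrow> bool"
  where
  "sigma_embedding R \<sigma> S \<tau> f \<longleftrightarrow> sigma_morphism R \<sigma> S \<tau> f \<and> inj_on f (carrier R)"

text \<open>
  Two extensions of \<open>K\<close> need not live in one type, so the inclusion of \<open>K\<close> in \<open>L\<close> as a
  \<open>\<sigma>\<close>-subring is an injective \<open>\<sigma>\<close>-morphism \<open>i\<close>, which is also the structure map of the
  \<open>K\<close>-algebra \<open>L\<close>. A literal inclusion is the case where \<open>i\<close> is the identity.
\<close>

definition sigma_pseudo_field_extension ::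
  "('k, 'm) ring_scheme \<Rightarrow> ('k \<Rightarrow> 'k) \<Rightarrow> ('a, 'n) ring_scheme \<Rightarrow> ('a \<Rightarrow> 'a) \<Rightarrow> ('k \<Rightarrow> 'a) \<Rightarrow> bool"
  where
  "sigma_pseudo_field_extension K \<sigma>K L \<sigma>L i \<longleftrightarrow>
     sigma_pseudo_field K \<sigma>K \<and> sigma_pseudo_field L \<sigma>L \<and> sigma_embedding K \<sigma>K L \<sigma>L i"

definition K_sigma_embedding ::
  "('k, 'o) ring_scheme \<Rightarrow>
   ('a, 'm) ring_scheme \<Rightarrow> ('a \<Rightarrow> 'a) \<Rightarrow> ('k \<Rightarrow> 'a) \<Rightarrow>
   ('b, 'n) ring_scheme \<Rightarrow> ('b \<Rightarrow> 'b) \<Rightarrow> ('k \<Rightarrow> 'b) \<Rightarrow> ('a \<Rightarrow> 'b) \<Rightarrow> bool"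
  where
  "K_sigma_embedding K L \<sigma>L i M \<sigma>M j f \<longleftrightarrow>
     sigma_embedding L \<sigma>L M \<sigma>M f \<and> (\<forall>x \<in> carrier K. f (i x) = j x)"

definition sigma_pseudo_subfield ::
  "('a, 'm) ring_scheme \<Rightarrow> ('a \<Rightarrow> 'a) \<Rightarrow> 'a set \<Rightarrow> bool" where
  "sigma_pseudo_subfield L \<sigma>L F \<longleftrightarrow>
     subring F L \<and> \<sigma>L ` F \<subseteq> F \<and> sigma_pseudo_field (L\<lparr>carrier := F\<rparr>) \<sigma>L"

text \<open>
  \<open>K\<langle>S\<rangle>\<close>. A smallest \<open>\<sigma>\<close>-pseudo subfield of \<open>L\<close> containing (the image of) \<open>K\<close> and \<open>S\<close> exists,
  so it is the intersection of all of them.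
\<close>

definition sigma_pseudo_field_gen ::
  "('k, 'n) ring_scheme \<Rightarrow> ('a, 'm) ring_scheme \<Rightarrow> ('a \<Rightarrow> 'a) \<Rightarrow> ('k \<Rightarrow> 'a) \<Rightarrow> 'a set \<Rightarrow> 'a set"
  where
  "sigma_pseudo_field_gen K L \<sigma>L i S =
     \<Inter> {F. sigma_pseudo_subfield L \<sigma>L F \<and> i ` carrier K \<subseteq> F \<and> S \<subseteq> F}"

definition finitely_sigma_generated ::
  "('k, 'n) ring_scheme \<Rightarrow> ('a, 'm) ring_scheme \<Rightarrow> ('a \<Rightarrow> 'a) \<Rightarrow> ('k \<Rightarrow> 'a) \<Rightarrow> bool" where
  "finitely_sigma_generated K L \<sigma>L i \<longleftrightarrow>
     (\<exists>S. finite S \<and> S \<subseteq> carrier L \<and> carrier L = sigma_pseudo_field_gen K L \<sigma>L i S)"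

text \<open>
  HOL cannot quantify existentially over the type of elements of \<open>M\<close>, so one type is fixed that
  is large enough for every case. Given any \<open>M\<close> with embeddings \<open>f\<close> of \<open>L\<close> and \<open>g\<close> of \<open>L'\<close>,
  the \<open>\<sigma>\<close>-pseudo subfield of \<open>M\<close> generated by the two images is the total ring of quotients of
  the ring of finite sums of products \<open>f a \<cdot> g b\<close>. It also serves as \<open>M\<close>, and each of its
  elements is determined by two lists of pairs \<open>(a, b)\<close>, for numerator and denominator. Hence an
  \<open>M\<close> over any type can be replaced by one over this type.
\<close>

type_synonym ('a, 'b) compositum = "('a \<times> 'b) list \<times> ('a \<times> 'b) list"

definition compatible ::
  "('k, 'o) ring_scheme \<Rightarrow> ('k \<Rightarrow> 'k) \<Rightarrow>
   ('a, 'm) ring_scheme \<Rightarrow> ('a \<Rightarrow> 'a) \<Rightarrow> ('k \<Rightarrow> 'a) \<Rightarrow>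
   ('b, 'n) ring_scheme \<Rightarrow> ('b \<Rightarrow> 'b) \<Rightarrow> ('k \<Rightarrow> 'b) \<Rightarrow> bool"
  where
  "compatible K \<sigma>K L \<sigma>L i L' \<sigma>L' i' \<longleftrightarrow>
     (\<exists>(M :: ('a, 'b) compositum ring) \<sigma>M j f g.
        sigma_pseudo_field_extension K \<sigma>K M \<sigma>M j \<and>
        K_sigma_embedding K L \<sigma>L i M \<sigma>M j f \<and>
        K_sigma_embedding K L' \<sigma>L' i' M \<sigma>M j g)"

end

theory Submission
  imports Defs
begin

text \<open>
  A pseudo field is von Neumann regular, and \<open>\<sigma>\<close> permutes its finitely many primes transitively.
  Choosing primes of \<open>L\<close> and \<open>L'\<close> over the same prime of \<open>K\<close> and passing to a power of
  \<open>\<sigma>\<close> that fixes them, and then to direct limits along it, one reaches fields \<open>K \<subseteq> L, M\<close>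
  with an automorphism \<open>\<sigma>\<close>. It suffices to find a prime \<open>Q\<close> of \<open>A \<otimes> M\<close>, where \<open>A\<close> is
  generated as a field by \<open>K\<close> and \<open>\<sigma>\<^sup>i S\<close>, \<open>i \<ge> 0\<close>, with \<open>S\<close> finite, and
  a \<open>d > 0\<close> such that \<open>\<sigma>\<^sup>d\<close> fixes \<open>Q\<close>: if \<open>F\<close> is the residue field of \<open>Q\<close> with the induced
  \<open>\<tau>\<close>, then \<open>F\<^sup>d\<close> with \<open>(x\<^sub>0, \<dots>, x\<^bsub>d-1\<^esub>) \<mapsto> (x\<^sub>1, \<dots>, x\<^bsub>d-1\<^esub>, \<tau> x\<^sub>0)\<close> is a pseudo field
  receiving \<open>L\<close> and \<open>L'\<close> by \<open>x \<mapsto> (x, \<sigma> x, \<dots>, \<sigma>\<^bsup>d-1\<^esup> x)\<close>.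

  Let \<open>A\<^sub>n\<close> be generated by \<open>K\<close> and \<open>\<sigma>\<^sup>i S\<close>, \<open>0 \<le> i \<le> n\<close>, and \<open>B\<^sub>n\<close> by \<open>K\<close> and
  \<open>\<sigma>\<^sup>i S\<close>, \<open>1 \<le> i \<le> n\<close>. By the basis theorem \<open>A\<^sub>n \<otimes> M\<close> has finitely many minimal primes. Hence the
  restrictions of the \<open>\<sigma>\<close>-preimages of one minimal prime of \<open>L \<otimes> M\<close> give, at every
  single level \<open>n\<close>, a periodic sequence of minimal primes compatible with \<open>\<sigma>\<close>. For large \<open>n\<close> the
  fields \<open>A\<^sub>n\<close> and \<open>B\<^bsub>n+1\<^esub> = \<sigma> A\<^sub>n\<close> are linearly disjoint over \<open>B\<^sub>n\<close>, so minimal primes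
  of \<open>A\<^sub>n \<otimes> M\<close> and \<open>B\<^bsub>n+1\<^esub> \<otimes> M\<close> with the same restriction to \<open>B\<^sub>n \<otimes> M\<close> lie under a common minimal
  prime of \<open>A\<^bsub>n+1\<^esub> \<otimes> M\<close>. Therefore a sequence of period \<open>d\<close> at one large level extends to all
  higher levels without changing \<open>d\<close>.
\<close>

section \<open>Linear combinations over subsets of a ring\<close>

text \<open>The common extension must be noetherian, hence has finitely many primes, and \<sigma>
  returns each of them to itself after finitely many steps. This is why a periodic prime is sought.
  The obstacle is that the period found at level \<open>n\<close> may grow with \<open>n\<close>.
  Finite generation acts twice against this: each level is a localization of a noetherian ring, so
  an orbit of minimal primes must repeat there; and each generator either stays transcendental over
  the union of the smaller fields or has a minimal equation whose coefficients appear at a finite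
  level, which gives linear disjointness from then on. Minimal primes are the right ones because
  each level has only finitely many and because their restrictions, being comparable with minimal
  primes, are forced to be equal to them. Generation is meant in the sense of pseudo fields. It
  descends to residue fields because the elements whose iterates all have values in a given subfield
  form a pseudo subfield. Tensors are told apart by \<open>K\<close>-linear functionals, so that
  flatness becomes a coefficientwise computation. Rings are built as images of a coding map, so that
  the last one can be placed in the prescribed type.\<close>

inductive_set lspan :: "('a, 'm) ring_scheme \<Rightarrow> 'a set \<Rightarrow> 'a set \<Rightarrow> 'a set" for R E A where
  lspan_zero: "\<zero>\<^bsub>R\<^esub> \<in> lspan R E A"
| lspan_step: "x \<in> lspan R E A \<Longrightarrow> e \<in> E \<Longrightarrow> a \<in> A \<Longrightarrow> x \<oplus>\<^bsub>R\<^esub> e \<otimes>\<^bsub>R\<^esub> a \<in> lspan R E A"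

lemma lspan_mono: "E \<subseteq> E' \<Longrightarrow> A \<subseteq> A' \<Longrightarrow> lspan R E A \<subseteq> lspan R E' A'"
proof
  fix x assume "E \<subseteq> E'" "A \<subseteq> A'" "x \<in> lspan R E A"
  from this(3) this(1,2) show "x \<in> lspan R E' A'"
    by (induction rule: lspan.induct) (auto intro: lspan.intros)
qed

text \<open>Lists of unequal length are cut to the shorter one; statements carry a length hypothesis
  where this would matter.\<close>

fun dot :: "('a, 'm) ring_scheme \<Rightarrow> 'a list \<Rightarrow> 'a list \<Rightarrow> 'a" where
  "dot R (c # cs) (b # bs) = c \<otimes>\<^bsub>R\<^esub> b \<oplus>\<^bsub>R\<^esub> dot R cs bs"
| "dot R _ _ = \<zero>\<^bsub>R\<^esub>"

text \<open>A family rather than a set: over a field a repeated entry already counts as a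
  relation.\<close>

definition indep :: "('a, 'm) ring_scheme \<Rightarrow> 'a set \<Rightarrow> 'a list \<Rightarrow> bool" where
  "indep R E bs \<longleftrightarrow>
     (\<forall>cs. length cs = length bs \<longrightarrow> set cs \<subseteq> E \<longrightarrow> dot R cs bs = \<zero>\<^bsub>R\<^esub> \<longrightarrow> set cs \<subseteq> {\<zero>\<^bsub>R\<^esub>})"

text \<open>Polynomial expressions in \<open>s\<close> of degree strictly below \<open>r\<close>, so
  that \<open>r = 0\<close> leaves only zero and inductions on the degree start trivially.\<close>

primrec pspan :: "('a, 'm) ring_scheme \<Rightarrow> 'a set \<Rightarrow> 'a \<Rightarrow> nat \<Rightarrow> 'a set" where
  "pspan R E s 0 = {\<zero>\<^bsub>R\<^esub>}"
| "pspan R E s (Suc r) = {p \<oplus>\<^bsub>R\<^esub> e \<otimes>\<^bsub>R\<^esub> s [^]\<^bsub>R\<^esub> r | p e. p \<in> pspan R E s r \<and> e \<in> E}"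

definition adjoin :: "('a, 'm) ring_scheme \<Rightarrow> 'a set \<Rightarrow> 'a \<Rightarrow> 'a set" where
  "adjoin R E s = (\<Union>r. pspan R E s r)"

text \<open>A field inside a ring that need not be a field: the rings of interest are tensor
  products, in which several fields lie side by side.\<close>

definition sfield :: "('a, 'm) ring_scheme \<Rightarrow> 'a set \<Rightarrow> bool" where
  "sfield R E \<longleftrightarrow> subring E R \<and> \<one>\<^bsub>R\<^esub> \<noteq> \<zero>\<^bsub>R\<^esub> \<and> (\<forall>x\<in>E - {\<zero>\<^bsub>R\<^esub>}. \<exists>y\<in>E. x \<otimes>\<^bsub>R\<^esub> y = \<one>\<^bsub>R\<^esub>)"

text \<open>An intersection over no field at all would be everything, so the field property is
  claimed only inside an ambient field that contains \<open>T\<close>.\<close>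

definition fgen :: "('a, 'm) ring_scheme \<Rightarrow> 'a set \<Rightarrow> 'a set" where
  "fgen R T = \<Inter> {E. sfield R E \<and> T \<subseteq> E}"

lemma subring_closed:
  assumes "subring E R"
  shows "E \<subseteq> carrier R" "\<zero>\<^bsub>R\<^esub> \<in> E" "\<one>\<^bsub>R\<^esub> \<in> E"
    "x \<in> E \<Longrightarrow> y \<in> E \<Longrightarrow> x \<oplus>\<^bsub>R\<^esub> y \<in> E" "x \<in> E \<Longrightarrow> y \<in> E \<Longrightarrow> x \<otimes>\<^bsub>R\<^esub> y \<in> E"
    "x \<in> E \<Longrightarrow> \<ominus>\<^bsub>R\<^esub> x \<in> E" "x \<in> E \<Longrightarrow> x \<in> carrier R"
  using subringE[OF assms] by auto

context cring
begin

lemma subring_pow: "subring E R \<Longrightarrow> x \<in> E \<Longrightarrow> x [^] (n::nat) \<in> E"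
  by (induction n) (simp_all add: subring_closed)

lemma lspan_closed: "E \<subseteq> carrier R \<Longrightarrow> A \<subseteq> carrier R \<Longrightarrow> lspan R E A \<subseteq> carrier R"
proof
  fix x assume "E \<subseteq> carrier R" "A \<subseteq> carrier R" "x \<in> lspan R E A"
  from this(3) this(1,2) show "x \<in> carrier R" by (induction rule: lspan.induct) auto
qed

lemma lspan_add:
  assumes "E \<subseteq> carrier R" "A \<subseteq> carrier R" "x \<in> lspan R E A" "y \<in> lspan R E A"
  shows "x \<oplus> y \<in> lspan R E A"
  using assms(4)
proof (induction rule: lspan.induct)
  case lspan_zero
  then show ?case using assms lspan_closed by (metis r_zero subsetD)
next
  case (lspan_step y e a)
  have "x \<oplus> (y \<oplus> e \<otimes> a) = (x \<oplus> y) \<oplus> e \<otimes> a"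
    using lspan_step assms lspan_closed[OF assms(1,2)] by (intro a_assoc[symmetric]) auto
  then show ?case using lspan_step by (simp add: lspan.lspan_step)
qed

lemma lspan_smult:
  assumes "subring E R" "A \<subseteq> carrier R" "x \<in> lspan R E A" "c \<in> E"
  shows "c \<otimes> x \<in> lspan R E A"
  using assms(3)
proof (induction rule: lspan.induct)
  case lspan_zero
  then show ?case using assms by (simp add: subring_closed lspan.lspan_zero)
next
  case (lspan_step y e a)
  have "y \<in> carrier R" "e \<in> carrier R" "a \<in> carrier R" "c \<in> carrier R"
    using lspan_step assms lspan_closed subring_closed by blast+
  then have "c \<otimes> (y \<oplus> e \<otimes> a) = (c \<otimes> y) \<oplus> (c \<otimes> e) \<otimes> a" by (simp add: r_distr m_assoc)
  then show ?case using lspan_step assms by (simp add: lspan.lspan_step subring_closed)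
qed

lemma lspan_incl:
  assumes "subring E R" "A \<subseteq> carrier R" "a \<in> A"
  shows "a \<in> lspan R E A"
proof -
  have "\<zero> \<oplus> \<one> \<otimes> a \<in> lspan R E A" by (intro lspan.intros assms subring_closed)
  then show ?thesis using assms by auto
qed

lemma lspan_least:
  assumes "\<zero> \<in> B" "\<And>x e a. x \<in> B \<Longrightarrow> e \<in> E \<Longrightarrow> a \<in> A \<Longrightarrow> x \<oplus> e \<otimes> a \<in> B"
  shows "lspan R E A \<subseteq> B"
proof
  fix x assume "x \<in> lspan R E A"
  then show "x \<in> B" by (induction rule: lspan.induct) (auto intro: assms)
qed

text \<open>For two fields this is the ring compositum, the image of their tensor product; closure
  under products is (e m)(e' m') = (e e')(m m').\<close>

lemma lspan_subring:
  assumes E: "subring E R" and M: "subring M R"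
  shows "subring (lspan R E M) R"
proof (rule subringI)
  have EM: "E \<subseteq> carrier R" "M \<subseteq> carrier R" using assms subring_closed by blast+
  show sub: "lspan R E M \<subseteq> carrier R" using lspan_closed EM .
  show "\<one> \<in> lspan R E M" using lspan_incl[OF E EM(2)] M subring_closed by blast
  fix x y assume x: "x \<in> lspan R E M" and y: "y \<in> lspan R E M"
  have xy: "x \<in> carrier R" "y \<in> carrier R" using x y sub by auto
  show "x \<oplus> y \<in> lspan R E M" using lspan_add[OF EM x y] .
  have "\<ominus> x = (\<ominus> \<one>) \<otimes> x" using xy by (simp add: l_minus)
  then show "\<ominus> x \<in> lspan R E M"
    using lspan_smult[OF E EM(2) x] E subring_closed by metis
  have m: "m \<otimes> x \<in> lspan R E M" if "m \<in> M" for m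
    using x
  proof (induction rule: lspan.induct)
    case lspan_zero
    then have "m \<otimes> \<zero> = \<zero>" using that EM by auto
    then show ?case by (simp add: lspan.lspan_zero)
  next
    case (lspan_step z e a)
    have "z \<in> carrier R" "e \<in> carrier R" "a \<in> carrier R" "m \<in> carrier R"
      using lspan_step that EM lspan_closed by blast+
    then have "m \<otimes> (z \<oplus> e \<otimes> a) = m \<otimes> z \<oplus> e \<otimes> (m \<otimes> a)" by (simp add: r_distr m_lcomm)
    then show ?case using lspan_step that M by (simp add: lspan.lspan_step subring_closed)
  qed
  show "x \<otimes> y \<in> lspan R E M"
    using y
  proof (induction rule: lspan.induct)
    case lspan_zero
    then show ?case using xy by (simp add: lspan.lspan_zero)
  next
    case (lspan_step z e a)
    have c: "z \<in> carrier R" "e \<in> carrier R" "a \<in> carrier R"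
      using lspan_step EM lspan_closed by blast+
    then have "x \<otimes> (z \<oplus> e \<otimes> a) = x \<otimes> z \<oplus> e \<otimes> (a \<otimes> x)" using xy by (simp add: r_distr m_ac)
    moreover have "e \<otimes> (a \<otimes> x) \<in> lspan R E M"
      using lspan_smult[OF E EM(2) m] lspan_step by simp
    ultimately show ?case using lspan_step lspan_add[OF EM] by simp
  qed
qed

section \<open>Finite combinations and independent families\<close>

lemma dot_closed: "set cs \<subseteq> carrier R \<Longrightarrow> set bs \<subseteq> carrier R \<Longrightarrow> dot R cs bs \<in> carrier R"
  by (induction cs bs rule: list_induct2') auto

lemma dot_in_subring:
  "subring E R \<Longrightarrow> set cs \<subseteq> E \<Longrightarrow> set bs \<subseteq> E \<Longrightarrow> dot R cs bs \<in> E"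
  by (induction cs bs rule: list_induct2') (auto simp: subring_closed)

lemma dot_smult:
  "set cs \<subseteq> carrier R \<Longrightarrow> set bs \<subseteq> carrier R \<Longrightarrow> w \<in> carrier R \<Longrightarrow>
     dot R (map (\<lambda>c. c \<otimes> w) cs) bs = dot R cs bs \<otimes> w"
proof (induction cs arbitrary: bs)
  case (Cons c cs)
  then show ?case
    by (cases bs) (auto simp: dot_closed r_distr m_ac)
qed simp

lemma dot_add:
  "length cs = length bs \<Longrightarrow> length ds = length bs \<Longrightarrow> set cs \<subseteq> carrier R \<Longrightarrow>
    set ds \<subseteq> carrier R \<Longrightarrow> set bs \<subseteq> carrier R \<Longrightarrow>
     dot R (map2 (\<oplus>) cs ds) bs = dot R cs bs \<oplus> dot R ds bs"
proof (induction bs arbitrary: cs ds)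
  case (Cons b bs)
  then obtain c cs' d ds' where "cs = c # cs'" "ds = d # ds'" by (metis length_Suc_conv)
  with Cons show ?case
    by (auto simp: dot_closed l_distr a_ac)
qed simp

lemma map2_add_closed:
  assumes "\<And>x y. x \<in> S \<Longrightarrow> y \<in> S \<Longrightarrow> x \<oplus> y \<in> S"
  shows "set cs \<subseteq> S \<Longrightarrow> set ds \<subseteq> S \<Longrightarrow> set (map2 (\<oplus>) cs ds) \<subseteq> S"
  by (induction cs ds rule: list_induct2') (auto simp: assms)

lemma dot_in_lspan:
  assumes "E \<subseteq> carrier R" "B \<subseteq> carrier R"
  shows "set cs \<subseteq> E \<Longrightarrow> set bs \<subseteq> B \<Longrightarrow> dot R cs bs \<in> lspan R E B"
proof (induction cs bs rule: list_induct2')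
  case (4 c cs b bs)
  then have "dot R cs bs \<oplus> c \<otimes> b \<in> lspan R E B" by (simp add: lspan.lspan_step)
  moreover have "dot R cs bs \<in> carrier R" "c \<otimes> b \<in> carrier R"
    using 4 assms by (auto intro!: dot_closed)
  ultimately show ?case by (simp add: a_comm)
qed (auto intro: lspan.intros)

lemma dot_zeros: "set cs \<subseteq> {\<zero>} \<Longrightarrow> set bs \<subseteq> carrier R \<Longrightarrow> dot R cs bs = \<zero>"
  by (induction cs bs rule: list_induct2') auto

lemma dot_single:
  assumes "subring E R" "e \<in> E" "b \<in> set bs" "set bs \<subseteq> carrier R"
  shows "\<exists>cs. length cs = length bs \<and> set cs \<subseteq> E \<and> e \<otimes> b = dot R cs bs"
  using assms(3,4)
proof (induction bs)
  case (Cons a bs)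
  have eE: "e \<in> carrier R" using assms subring_closed by blast
  show ?case
  proof (cases "b = a")
    case True
    have "dot R (e # replicate (length bs) \<zero>) (a # bs) = e \<otimes> b"
      using Cons.prems eE True dot_zeros[of "replicate (length bs) \<zero>" bs]
      by (simp add: set_replicate_conv_if)
    then show ?thesis
      using assms subring_closed(2)[OF assms(1)]
      by (intro exI[of _ "e # replicate (length bs) \<zero>"]) auto
  next
    case False
    then obtain cs where cs: "length cs = length bs" "set cs \<subseteq> E" "e \<otimes> b = dot R cs bs"
      using Cons by auto
    have "set cs \<subseteq> carrier R" using cs(2) assms(1) subring_closed by blast
    then have "dot R (\<zero> # cs) (a # bs) = e \<otimes> b" using Cons.prems cs by (auto simp: dot_closed)
    then show ?thesis
      using cs subring_closed(2)[OF assms(1)] by (intro exI[of _ "\<zero> # cs"]) auto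
  qed
qed simp

lemma lspan_dot:
  assumes "subring E R" "set bs \<subseteq> carrier R" "x \<in> lspan R E (set bs)"
  shows "\<exists>cs. length cs = length bs \<and> set cs \<subseteq> E \<and> x = dot R cs bs"
  using assms(3)
proof (induction rule: lspan.induct)
  case lspan_zero
  have "dot R (replicate (length bs) \<zero>) bs = \<zero>"
    using assms by (intro dot_zeros) auto
  then show ?case
    using subring_closed(2)[OF assms(1)]
    by (intro exI[of _ "replicate (length bs) \<zero>"]) auto
next
  case (lspan_step x e a)
  then obtain cs where cs: "length cs = length bs" "set cs \<subseteq> E" "x = dot R cs bs" by auto
  obtain ds where ds: "length ds = length bs" "set ds \<subseteq> E" "e \<otimes> a = dot R ds bs"
    using dot_single[OF assms(1) lspan_step(2,3) assms(2)] by blast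
  have E: "E \<subseteq> carrier R" using assms subring_closed by blast
  have "set (map2 (\<oplus>) cs ds) \<subseteq> E"
    using cs ds subring_closed(4)[OF assms(1)] by (intro map2_add_closed)
  moreover have "dot R (map2 (\<oplus>) cs ds) bs = x \<oplus> e \<otimes> a"
    using cs ds E assms by (subst dot_add) auto
  ultimately show ?case using cs ds by (intro exI[of _ "map2 (\<oplus>) cs ds"]) auto
qed

lemma sfield_subring: "sfield R E \<Longrightarrow> subring E R"
  by (simp add: sfield_def)

lemma sfield_inverse:
  assumes "sfield R E" "x \<in> E" "x \<noteq> \<zero>"
  obtains y where "y \<in> E" "x \<otimes> y = \<one>" "y \<otimes> x = \<one>" "y \<noteq> \<zero>"
proof -
  obtain y where y: "y \<in> E" "x \<otimes> y = \<one>" using assms by (auto simp: sfield_def)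
  moreover have "x \<in> carrier R" "y \<in> carrier R"
    using y assms sfield_subring subring_closed by blast+
  moreover have "y \<noteq> \<zero>" using assms y calculation by (auto simp: sfield_def)
  ultimately show thesis using that by (simp add: m_comm)
qed

text \<open>A relation with a nonzero coefficient at \<open>b\<close> could be solved for
  \<open>b\<close>.\<close>

lemma indep_Cons:
  assumes E: "sfield R E" and B: "b \<in> carrier R" "set bs \<subseteq> carrier R"
    and ind: "indep R E bs" and b: "b \<notin> lspan R E (set bs)"
  shows "indep R E (b # bs)"
  unfolding indep_def
proof (intro allI impI)
  fix cs assume cs: "length cs = length (b # bs)" "set cs \<subseteq> E" "dot R cs (b # bs) = \<zero>"
  then obtain c ds where cd: "cs = c # ds" "length ds = length bs" by (auto simp: length_Suc_conv)
  have Es: "subring E R" using E sfield_subring by blast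
  note Ec = subring_closed[OF Es]
  have carr: "c \<in> carrier R" "set ds \<subseteq> carrier R" using cs cd Ec by auto
  have dc: "dot R ds bs \<in> carrier R" using carr B by (simp add: dot_closed)
  have eq: "c \<otimes> b \<oplus> dot R ds bs = \<zero>" using cs cd by simp
  have "c = \<zero>"
  proof (rule ccontr)
    assume "c \<noteq> \<zero>"
    moreover have "c \<in> E" using cs cd by auto
    ultimately obtain y where y: "y \<in> E" "y \<otimes> c = \<one>" using sfield_inverse[OF E] by metis
    have yc: "y \<in> carrier R" using y Ec by auto
    have "b = y \<otimes> (c \<otimes> b)" using y yc carr B by (simp add: m_assoc[symmetric])
    also have "c \<otimes> b = \<ominus> dot R ds bs" using eq carr B dc by (simp add: minus_equality)
    also have "y \<otimes> (\<ominus> dot R ds bs) = (\<ominus> y) \<otimes> dot R ds bs" using yc dc by (simp add: l_minus r_minus)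
    also have "\<dots> \<in> lspan R E (set bs)"
      using y cs cd Ec B by (intro lspan_smult Es dot_in_lspan) auto
    finally show False using b by simp
  qed
  moreover from this have "set ds \<subseteq> {\<zero>}"
    using eq B dc ind cd cs by (auto simp: indep_def)
  ultimately show "set cs \<subseteq> {\<zero>}" using cd by simp
qed

text \<open>A tensor in B \<otimes> M is written with \<open>E\<close>-independent first factors.
  The terms are treated one at a time: a new first factor is either added to the family or expressed
  by the earlier ones.\<close>

lemma lspan_indep_repr:
  assumes E: "sfield R E" and B: "subring B R" and M: "M \<subseteq> carrier R"
    and x: "x \<in> lspan R B M"
  shows "\<exists>vs bs. length vs = length bs \<and> set bs \<subseteq> B \<and> set vs \<subseteq> lspan R E M \<and>
    indep R E bs \<and> x = dot R vs bs"
  using x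
proof (induction rule: lspan.induct)
  case lspan_zero
  then show ?case by (intro exI[of _ "[]"]) (auto simp: indep_def)
next
  case (lspan_step x b m)
  then obtain vs bs where r: "length vs = length bs" "set bs \<subseteq> B" "set vs \<subseteq> lspan R E M"
    "indep R E bs" "x = dot R vs bs" by blast
  have Es: "subring E R" using E sfield_subring by blast
  note Ec = subring_closed[OF Es] and Bc = subring_closed[OF B]
  have bc: "b \<in> carrier R" "set bs \<subseteq> carrier R" using lspan_step r Bc by auto
  have S: "lspan R E M \<subseteq> carrier R" using lspan_closed[OF Ec(1) M] .
  have mS: "m \<in> lspan R E M" using lspan_incl[OF Es M] lspan_step by blast
  then have mc: "m \<in> carrier R" using S by auto
  have vc: "set vs \<subseteq> carrier R" using r S by auto
  have dc: "dot R vs bs \<in> carrier R" using vc bc by (simp add: dot_closed)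
  show ?case
  proof (cases "b \<in> lspan R E (set bs)")
    case False
    have "indep R E (b # bs)" using indep_Cons[OF E bc r(4) False] .
    moreover have "x \<oplus> b \<otimes> m = dot R (m # vs) (b # bs)"
      using r bc mc dc by (simp add: m_comm a_comm)
    ultimately show ?thesis using r lspan_step mS
      by (intro exI[of _ "m # vs"] exI[of _ "b # bs"]) auto
  next
    case True
    then obtain cs where cs: "length cs = length bs" "set cs \<subseteq> E" "b = dot R cs bs"
      using lspan_dot[OF Es bc(2)] by blast
    have cc: "set cs \<subseteq> carrier R" using cs Ec by auto
    \<comment> \<open>With b = \<Sum> c_k b_k the new term b m is distributed: c_k m joins the
      coefficient of b_k.\<close>
    let ?ws = "map2 (\<oplus>) vs (map (\<lambda>c. c \<otimes> m) cs)"
    have "x \<oplus> b \<otimes> m = dot R ?ws bs"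
      using r cs cc vc bc mc by (subst dot_add) (auto simp: dot_smult)
    moreover have "set ?ws \<subseteq> lspan R E M"
      using r cs lspan_add[OF Ec(1) M] lspan_smult[OF Es M mS]
      by (intro map2_add_closed) auto
    ultimately show ?thesis using r cs
      by (intro exI[of _ ?ws] exI[of _ bs]) auto
  qed
qed

section \<open>Generated subfields\<close>

text \<open>The inverse found in one member lies in all the others, because inverses in a
  commutative ring are unique.\<close>

lemma sfield_Inter:
  assumes ne: "\<F> \<noteq> {}" and F: "\<And>E. E \<in> \<F> \<Longrightarrow> sfield R E"
  shows "sfield R (\<Inter>\<F>)"
  unfolding sfield_def
proof (intro conjI ballI)
  obtain E0 where E0: "E0 \<in> \<F>" using ne by blast
  show "subring (\<Inter>\<F>) R" using subring_Inter[of \<F>] F ne sfield_subring by blast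
  show "\<one> \<noteq> \<zero>" using F[OF E0] by (simp add: sfield_def)
  fix x assume x: "x \<in> \<Inter>\<F> - {\<zero>}"
  then obtain y where y: "y \<in> E0" "x \<otimes> y = \<one>" using F[OF E0] E0 by (auto simp: sfield_def)
  have "y \<in> E" if E: "E \<in> \<F>" for E
  proof -
    obtain z where z: "z \<in> E" "x \<otimes> z = \<one>" using F[OF E] E x by (auto simp: sfield_def)
    have "x \<in> carrier R" "y \<in> carrier R" "z \<in> carrier R"
      using x y z E E0 subring_closed(7)[OF sfield_subring[OF F]] by auto
    then have "y = z" using y z inv_unique m_comm by metis
    then show ?thesis using z by simp
  qed
  then show "\<exists>y\<in>\<Inter>\<F>. x \<otimes> y = \<one>" using y by blast
qed

lemma fgen_least: "sfield R E \<Longrightarrow> T \<subseteq> E \<Longrightarrow> fgen R T \<subseteq> E"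
  by (auto simp: fgen_def)

lemma fgen_incl: "T \<subseteq> fgen R T"
  by (auto simp: fgen_def)

lemma fgen_mono: "T \<subseteq> T' \<Longrightarrow> fgen R T \<subseteq> fgen R T'"
  by (auto simp: fgen_def)

lemma fgen_sfield: "sfield R E \<Longrightarrow> T \<subseteq> E \<Longrightarrow> sfield R (fgen R T)"
  unfolding fgen_def by (rule sfield_Inter) auto

lemma fgen_Un:
  assumes "sfield R E" "A \<union> B \<subseteq> E"
  shows "fgen R (fgen R A \<union> B) = fgen R (A \<union> B)"
proof
  have 1: "sfield R (fgen R (A \<union> B))" using assms fgen_sfield by blast
  show "fgen R (fgen R A \<union> B) \<subseteq> fgen R (A \<union> B)"
    using fgen_least[OF 1, of A] fgen_incl[of "A \<union> B"] by (intro fgen_least[OF 1]) auto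
  show "fgen R (A \<union> B) \<subseteq> fgen R (fgen R A \<union> B)"
    using fgen_incl[of A] by (intro fgen_mono) auto
qed

section \<open>Polynomial expressions in one element\<close>

lemma pspan_closed: "E \<subseteq> carrier R \<Longrightarrow> s \<in> carrier R \<Longrightarrow> pspan R E s r \<subseteq> carrier R"
  by (induction r) auto

lemma pspan_in_subring: "subring E R \<Longrightarrow> A \<subseteq> E \<Longrightarrow> s \<in> E \<Longrightarrow> pspan R A s r \<subseteq> E"
  by (induction r) (auto simp: subring_closed subring_pow subset_eq)

lemma pspan_SucI: "p \<in> pspan R E s r \<Longrightarrow> e \<in> E \<Longrightarrow> p \<oplus> e \<otimes> s [^] r \<in> pspan R E s (Suc r)"
  by auto

lemma pspan_mono: "E \<subseteq> E' \<Longrightarrow> pspan R E s r \<subseteq> pspan R E' s r"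
  by (induction r) (auto simp del: pspan.simps(2) intro!: pspan_SucI simp: pspan.simps(2)[of R E])

lemma pspan_Suc:
  assumes "subring E R" "s \<in> carrier R"
  shows "pspan R E s r \<subseteq> pspan R E s (Suc r)"
proof
  fix p assume p: "p \<in> pspan R E s r"
  then have "p \<in> carrier R" using pspan_closed[OF subring_closed(1)] assms by blast
  then have "p = p \<oplus> \<zero> \<otimes> s [^] r" using assms by simp
  then show "p \<in> pspan R E s (Suc r)" using p subring_closed(2)[OF assms(1)] by auto
qed

lemma pspan_le:
  assumes "subring E R" "s \<in> carrier R" "r \<le> r'"
  shows "pspan R E s r \<subseteq> pspan R E s r'"
  using assms(3) by (rule lift_Suc_mono_le[of "pspan R E s", OF pspan_Suc[OF assms(1,2)]])

lemma pspan_zero: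
  assumes "subring E R" "s \<in> carrier R"
  shows "\<zero> \<in> pspan R E s r"
  using pspan_le[OF assms, of 0 r] by auto

lemma pspan_add:
  assumes "subring E R" "s \<in> carrier R"
  shows "p \<in> pspan R E s r \<Longrightarrow> q \<in> pspan R E s r \<Longrightarrow> p \<oplus> q \<in> pspan R E s r"
proof (induction r arbitrary: p q)
  case (Suc r)
  then obtain p' e q' f where d: "p = p' \<oplus> e \<otimes> s [^] r" "q = q' \<oplus> f \<otimes> s [^] r"
    "p' \<in> pspan R E s r" "q' \<in> pspan R E s r" "e \<in> E" "f \<in> E" by auto
  have "p' \<in> carrier R" "q' \<in> carrier R" "e \<in> carrier R" "f \<in> carrier R"
    using d pspan_closed[OF subring_closed(1)] subring_closed(1) assms by blast+
  then have "p \<oplus> q = (p' \<oplus> q') \<oplus> (e \<oplus> f) \<otimes> s [^] r" using assms d by (simp add: l_distr a_ac)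
  then show ?case using Suc.IH d subring_closed(4)[OF assms(1)] by (simp only: pspan_SucI)
qed simp

lemma pspan_smult:
  assumes "subring E R" "s \<in> carrier R" "c \<in> E"
  shows "p \<in> pspan R E s r \<Longrightarrow> c \<otimes> p \<in> pspan R E s r"
proof (induction r arbitrary: p)
  case 0
  then show ?case using subring_closed(7)[OF assms(1,3)] by simp
next
  case (Suc r)
  then obtain p' e where d: "p = p' \<oplus> e \<otimes> s [^] r" "p' \<in> pspan R E s r" "e \<in> E" by auto
  have "p' \<in> carrier R" "e \<in> carrier R" "c \<in> carrier R"
    using d pspan_closed[OF subring_closed(1)] subring_closed(1) assms by blast+
  then have "c \<otimes> p = (c \<otimes> p') \<oplus> (c \<otimes> e) \<otimes> s [^] r" using assms d by (simp add: r_distr m_assoc)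
  then show ?case using Suc.IH d subring_closed(5)[OF assms(1)] assms(3) by (simp only: pspan_SucI)
qed

lemma pspan_pow_mult:
  assumes "subring E R" "s \<in> carrier R"
  shows "p \<in> pspan R E s r \<Longrightarrow> s [^] (k::nat) \<otimes> p \<in> pspan R E s (r + k)"
proof (induction r arbitrary: p)
  case 0
  then show ?case using pspan_zero[OF assms] assms by simp
next
  case (Suc r)
  then obtain p' e where d: "p = p' \<oplus> e \<otimes> s [^] r" "p' \<in> pspan R E s r" "e \<in> E" by auto
  have "p' \<in> carrier R" "e \<in> carrier R"
    using d pspan_closed[OF subring_closed(1)] subring_closed(1) assms by blast+
  then have "s [^] k \<otimes> p = (s [^] k \<otimes> p') \<oplus> e \<otimes> s [^] (r + k)"
    using assms d by (simp add: r_distr m_ac nat_pow_mult[symmetric])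
  then show ?case using Suc.IH d by auto
qed

lemma adjoin_subring:
  assumes E: "subring E R" and s: "s \<in> carrier R"
  shows "subring (adjoin R E s) R"
proof (rule subringI)
  note Ec = subring_closed[OF E]
  show sub: "adjoin R E s \<subseteq> carrier R"
    using pspan_closed[OF Ec(1) s] by (auto simp: adjoin_def)
  have one: "e \<in> pspan R E s 1" if "e \<in> E" for e
    using that Ec s by (auto intro!: exI[of _ \<zero>] exI[of _ e])
  show "\<one> \<in> adjoin R E s" using one[OF Ec(3)] unfolding adjoin_def by blast
  fix x y assume x: "x \<in> adjoin R E s" and y: "y \<in> adjoin R E s"
  obtain r r' where r: "x \<in> pspan R E s r" "y \<in> pspan R E s r'" using x y by (auto simp: adjoin_def)
  have xc: "x \<in> carrier R" "y \<in> carrier R" using x y sub by auto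
  have "x \<in> pspan R E s (max r r')" "y \<in> pspan R E s (max r r')"
    using r pspan_le[OF E s, of r "max r r'"] pspan_le[OF E s, of r' "max r r'"] by auto
  then show "x \<oplus> y \<in> adjoin R E s"
    using pspan_add[OF E s] unfolding adjoin_def by blast
  have "\<ominus> x = (\<ominus> \<one>) \<otimes> x" using xc by (simp add: l_minus)
  then have "\<ominus> x \<in> pspan R E s r" using pspan_smult[OF E s _ r(1), of "\<ominus> \<one>"] Ec by simp
  then show "\<ominus> x \<in> adjoin R E s" unfolding adjoin_def by blast
  have "x \<otimes> q \<in> adjoin R E s" if "q \<in> pspan R E s k" for q k
    using that
  proof (induction k arbitrary: q)
    case 0
    then show ?case using xc pspan_zero[OF E s] unfolding adjoin_def by auto
  next
    case (Suc k)
    then obtain p' e where d: "q = p' \<oplus> e \<otimes> s [^] k" "p' \<in> pspan R E s k" "e \<in> E" by auto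
    have c: "p' \<in> carrier R" "e \<in> carrier R" using d pspan_closed[OF Ec(1) s] Ec(1) by blast+
    obtain m where m: "x \<otimes> p' \<in> pspan R E s m" using Suc d by (auto simp: adjoin_def)
    have "s [^] k \<otimes> (e \<otimes> x) \<in> pspan R E s (r + k)"
      by (intro pspan_pow_mult[OF E s] pspan_smult[OF E s d(3)] r)
    then have "s [^] k \<otimes> (e \<otimes> x) \<in> pspan R E s (max m (r + k))" "x \<otimes> p' \<in> pspan R E s (max m (r + k))"
      using m pspan_le[OF E s, of m "max m (r + k)"] pspan_le[OF E s, of "r + k" "max m (r + k)"] by auto
    then have "x \<otimes> p' \<oplus> s [^] k \<otimes> (e \<otimes> x) \<in> adjoin R E s"
      using pspan_add[OF E s] unfolding adjoin_def by blast
    moreover have "x \<otimes> q = x \<otimes> p' \<oplus> s [^] k \<otimes> (e \<otimes> x)"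
      using d c s xc by (simp add: r_distr m_ac)
    ultimately show ?case by simp
  qed
  then show "x \<otimes> y \<in> adjoin R E s" using r by blast
qed

lemma adjoin_incl:
  assumes "subring E R" "s \<in> carrier R"
  shows "E \<subseteq> adjoin R E s" "s \<in> adjoin R E s"
proof -
  note Ec = subring_closed[OF assms(1)]
  have e: "e \<in> pspan R E s 1" if "e \<in> E" for e
    using that Ec assms by (auto intro!: exI[of _ \<zero>] exI[of _ e])
  then show "E \<subseteq> adjoin R E s" unfolding adjoin_def by blast
  have "s [^] (1::nat) \<otimes> \<one> \<in> pspan R E s (1 + 1)"
    using pspan_pow_mult[OF assms e[OF Ec(3)]] by blast
  then have "s \<in> pspan R E s (1 + 1)" using assms by (simp only: nat_pow_eone r_one)
  then show "s \<in> adjoin R E s" unfolding adjoin_def by blast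
qed

lemma adjoin_least: "subring E R \<Longrightarrow> A \<subseteq> E \<Longrightarrow> s \<in> E \<Longrightarrow> adjoin R A s \<subseteq> E"
  unfolding adjoin_def by (intro UN_least pspan_in_subring)

text \<open>The fractions of E[s] inside \<open>L\<close> already form a field containing
  \<open>E\<close> and \<open>s\<close>. The ambient field \<open>L\<close> is what keeps products
  of denominators nonzero, since \<open>R\<close> may have zero divisors.\<close>

lemma fgen_insert_fraction:
  assumes L: "sfield R L" and E: "sfield R E" "E \<subseteq> L" and s: "s \<in> L"
    and x: "x \<in> fgen R (insert s E)"
  shows "\<exists>g\<in>adjoin R E s. g \<noteq> \<zero> \<and> g \<otimes> x \<in> adjoin R E s"
proof -
  let ?A = "adjoin R E s"
  let ?F = "{x \<in> L. \<exists>g\<in>?A. g \<noteq> \<zero> \<and> g \<otimes> x \<in> ?A}"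
  have Ls: "subring L R" and Es: "subring E R" using L E sfield_subring by auto
  note Lc = subring_closed[OF Ls]
  have sc: "s \<in> carrier R" using s Lc by auto
  note A = adjoin_subring[OF Es sc]
  note Ac = subring_closed[OF A]
  have AL: "?A \<subseteq> L" using adjoin_least[OF Ls E(2) s] .
  have nz: "g \<otimes> h \<noteq> \<zero>" if gh: "g \<in> L" "h \<in> L" "g \<noteq> \<zero>" "h \<noteq> \<zero>" for g h
  proof
    assume 0: "g \<otimes> h = \<zero>"
    obtain y where y: "y \<in> L" "y \<otimes> g = \<one>" by (rule sfield_inverse[OF L gh(1,3)])
    have c: "y \<in> carrier R" "g \<in> carrier R" "h \<in> carrier R" using y gh Lc by auto
    have "h = (y \<otimes> g) \<otimes> h" using y c by simp
    also have "\<dots> = y \<otimes> (g \<otimes> h)" using c by (simp add: m_assoc)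
    finally show False using 0 c gh by simp
  qed
  have "sfield R ?F" unfolding sfield_def
  proof (intro conjI subringI ballI)
    show "?F \<subseteq> carrier R" using Lc by auto
    show one: "\<one> \<noteq> \<zero>" using L by (simp add: sfield_def)
    show "\<one> \<in> ?F" using Lc Ac one by (auto intro!: bexI[of _ \<one>])
    { fix x y assume "x \<in> ?F" "y \<in> ?F"
      then obtain g h where g: "x \<in> L" "g \<in> ?A" "g \<noteq> \<zero>" "g \<otimes> x \<in> ?A"
        and h: "y \<in> L" "h \<in> ?A" "h \<noteq> \<zero>" "h \<otimes> y \<in> ?A" by auto
      have c: "x \<in> carrier R" "y \<in> carrier R" "g \<in> carrier R" "h \<in> carrier R" using g h Lc Ac by auto
      have gh: "g \<otimes> h \<noteq> \<zero>" using nz g h AL by blast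
      have "(g \<otimes> h) \<otimes> (x \<oplus> y) = h \<otimes> (g \<otimes> x) \<oplus> g \<otimes> (h \<otimes> y)" using c by (simp add: r_distr m_ac)
      moreover have "(g \<otimes> h) \<otimes> (x \<otimes> y) = (g \<otimes> x) \<otimes> (h \<otimes> y)" using c by (simp add: m_ac)
      moreover have "g \<otimes> (\<ominus> x) = \<ominus> (g \<otimes> x)" using c by (simp add: r_minus)
      ultimately show "x \<oplus> y \<in> ?F" "x \<otimes> y \<in> ?F" "\<ominus> x \<in> ?F"
        using g h gh Lc Ac by (auto intro: bexI[of _ "g \<otimes> h"] bexI[of _ g])
    }
    fix x assume "x \<in> ?F - {\<zero>}"
    then obtain g where g: "x \<in> L" "g \<in> ?A" "g \<noteq> \<zero>" "g \<otimes> x \<in> ?A" "x \<noteq> \<zero>" by auto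
    obtain y where y: "y \<in> L" "x \<otimes> y = \<one>" by (rule sfield_inverse[OF L g(1,5)])
    have c: "x \<in> carrier R" "y \<in> carrier R" "g \<in> carrier R" using g y Lc Ac by auto
    have "(g \<otimes> x) \<otimes> y = g" using c y by (simp add: m_assoc)
    then have "y \<in> ?F" using y g nz AL by (auto intro!: bexI[of _ "g \<otimes> x"])
    then show "\<exists>y\<in>?F. x \<otimes> y = \<one>" using y by blast
  qed
  moreover have "insert s E \<subseteq> ?F"
    using adjoin_incl[OF Es sc] AL Ac L by (auto simp: sfield_def intro!: bexI[of _ \<one>])
  ultimately have "fgen R (insert s E) \<subseteq> ?F" by (rule fgen_least)
  then show ?thesis using x by blast
qed

end

section \<open>Linear disjointness in chains of fields\<close>

text \<open>Linear disjointness of \<open>A\<close> and \<open>B\<close> over \<open>E\<close>, in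
  the one-sided form that is applied later: families from \<open>B\<close>, coefficients enlarged
  from \<open>E\<close> to \<open>A\<close>.\<close>

definition lin_disj :: "('a, 'm) ring_scheme \<Rightarrow> 'a set \<Rightarrow> 'a set \<Rightarrow> 'a set \<Rightarrow> bool" where
  "lin_disj R E A B \<longleftrightarrow> (\<forall>bs. set bs \<subseteq> B \<longrightarrow> indep R E bs \<longrightarrow> indep R A bs)"

text \<open>The powers of \<open>s\<close> below \<open>r\<close> are linearly independent over
  \<open>H\<close>. The condition is stated by leading terms to match the recursion of
  \<open>pspan\<close>.\<close>

definition pfree :: "('a, 'm) ring_scheme \<Rightarrow> 'a set \<Rightarrow> 'a \<Rightarrow> nat \<Rightarrow> bool" where
  "pfree R H s r \<longleftrightarrow> (\<forall>k<r. \<forall>p\<in>pspan R H s k. \<forall>h\<in>H.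
     p \<oplus>\<^bsub>R\<^esub> h \<otimes>\<^bsub>R\<^esub> s [^]\<^bsub>R\<^esub> k = \<zero>\<^bsub>R\<^esub> \<longrightarrow> p = \<zero>\<^bsub>R\<^esub> \<and> h = \<zero>\<^bsub>R\<^esub>)"

context cring
begin

lemma pspan_Suc_list:
  assumes "set as \<subseteq> pspan R E s (Suc r)"
  obtains ps es where "length ps = length as" "length es = length as"
    "set ps \<subseteq> pspan R E s r" "set es \<subseteq> E" "as = map2 (\<oplus>) ps (map (\<lambda>e. e \<otimes> s [^] r) es)"
proof -
  have "\<forall>a\<in>set as. \<exists>p e. a = p \<oplus> e \<otimes> s [^] r \<and> p \<in> pspan R E s r \<and> e \<in> E"
    using assms by auto
  then obtain f g where fg: "\<And>a. a \<in> set as \<Longrightarrow> a = f a \<oplus> g a \<otimes> s [^] r"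
    "\<And>a. a \<in> set as \<Longrightarrow> f a \<in> pspan R E s r" "\<And>a. a \<in> set as \<Longrightarrow> g a \<in> E"
    by metis
  have "as = map2 (\<oplus>) (map f as) (map (\<lambda>e. e \<otimes> s [^] r) (map g as))"
    using fg(1) by (intro nth_equalityI) auto
  then show thesis using fg by (intro that[of "map f as" "map g as"]) auto
qed

lemma dot_in_pspan:
  assumes "subring H R" "s \<in> carrier R"
  shows "set ps \<subseteq> pspan R H s r \<Longrightarrow> set bs \<subseteq> H \<Longrightarrow> dot R ps bs \<in> pspan R H s r"
proof (induction ps bs rule: list_induct2')
  case (4 p ps b bs)
  have "p \<in> carrier R" "b \<in> carrier R"
    using 4 subring_closed(7)[OF assms(1)] pspan_closed[OF subring_closed(1)[OF assms(1)] assms(2), of r]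
    by auto
  then have "p \<otimes> b = b \<otimes> p" by (simp add: m_comm)
  then show ?case using 4 pspan_add[OF assms] pspan_smult[OF assms] by simp
qed (use pspan_zero[OF assms] in auto)

lemma pfree_mono: "pfree R H s r \<Longrightarrow> k \<le> r \<Longrightarrow> pfree R H s k"
  unfolding pfree_def by (meson less_le_trans)

text \<open>Sorting a relation by powers of \<open>s\<close> gives coefficients in \<open>H\<close>,
  which vanish because the powers are free over \<open>H\<close>; each of them is then a relation
  over \<open>E\<close> among the \<open>bs\<close>.\<close>

lemma indep_pspan:
  assumes H: "subring H R" and E: "E \<subseteq> H" and s: "s \<in> carrier R"
    and bs: "set bs \<subseteq> H" "indep R E bs"
  shows "pfree R H s r \<Longrightarrow> length as = length bs \<Longrightarrow> set as \<subseteq> pspan R E s r \<Longrightarrow>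
    dot R as bs = \<zero> \<Longrightarrow> set as \<subseteq> {\<zero>}"
proof (induction r arbitrary: as)
  case (Suc r)
  obtain ps es where pe: "length ps = length as" "length es = length as"
    "set ps \<subseteq> pspan R E s r" "set es \<subseteq> E" "as = map2 (\<oplus>) ps (map (\<lambda>e. e \<otimes> s [^] r) es)"
    by (rule pspan_Suc_list[OF Suc.prems(3)])
  note Hc = subring_closed[OF H]
  have psH: "set ps \<subseteq> pspan R H s r" using pe pspan_mono[OF E] by blast
  have c: "set ps \<subseteq> carrier R" "set es \<subseteq> carrier R" "set bs \<subseteq> carrier R"
    using psH pspan_closed[OF Hc(1) s] pe(4) E bs(1) Hc(1) by blast+
  have "set (map (\<lambda>e. e \<otimes> s [^] r) es) \<subseteq> carrier R" using c s by auto
  then have "dot R as bs = dot R ps bs \<oplus> dot R (map (\<lambda>e. e \<otimes> s [^] r) es) bs"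
    using pe(1,2) Suc.prems(2) c s by (subst pe(5), subst dot_add) simp_all
  then have "dot R as bs = dot R ps bs \<oplus> dot R es bs \<otimes> s [^] r" using c s by (simp add: dot_smult)
  moreover have "dot R ps bs \<in> pspan R H s r" using dot_in_pspan[OF H s psH bs(1)] .
  moreover have "dot R es bs \<in> H" using dot_in_subring[OF H _ bs(1)] pe E by blast
  ultimately have 0: "dot R ps bs = \<zero>" "dot R es bs = \<zero>"
    using Suc.prems by (auto simp: pfree_def)
  have "pfree R H s r" using pfree_mono[OF Suc.prems(1)] by simp
  then have "set ps \<subseteq> {\<zero>}" using Suc.IH[of ps] pe(1,3) Suc.prems(2) 0 by simp
  moreover have "length es = length bs" using pe(2) Suc.prems(2) by simp
  then have "set es \<subseteq> {\<zero>}" using bs(2) 0(2) pe(4) unfolding indep_def by blast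
  ultimately have "set (map2 (\<oplus>) ps (map (\<lambda>e. e \<otimes> s [^] r) es)) \<subseteq> {\<zero>}"
    using s by (intro map2_add_closed) auto
  then show ?case using pe(5) by metis
qed simp

lemma sfield_integral:
  assumes "sfield R L" "x \<in> L" "y \<in> carrier R" "x \<otimes> y = \<zero>"
  shows "x = \<zero> \<or> y = \<zero>"
proof (rule disjCI)
  assume "y \<noteq> \<zero>"
  show "x = \<zero>"
  proof (rule ccontr)
    assume "x \<noteq> \<zero>"
    then obtain z where z: "z \<in> L" "z \<otimes> x = \<one>" by (rule sfield_inverse[OF assms(1,2)])
    have c: "z \<in> carrier R" "x \<in> carrier R"
      using z assms(2) subring_closed(7)[OF sfield_subring[OF assms(1)]] by auto
    have "y = (z \<otimes> x) \<otimes> y" using z assms by simp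
    also have "\<dots> = z \<otimes> (x \<otimes> y)" using c assms by (simp add: m_assoc)
    finally show False using c \<open>y \<noteq> \<zero>\<close> assms by simp
  qed
qed

lemma fgen_insert_denominator:
  assumes L: "sfield R L" and E: "sfield R E" "E \<subseteq> L" and s: "s \<in> L"
  shows "set cs \<subseteq> fgen R (insert s E) \<Longrightarrow>
    \<exists>g\<in>adjoin R E s. g \<noteq> \<zero> \<and> (\<lambda>c. c \<otimes> g) ` set cs \<subseteq> adjoin R E s"
proof (induction cs)
  case Nil
  have "subring (adjoin R E s) R"
    using adjoin_subring[OF sfield_subring[OF E(1)]] s subring_closed(1)[OF sfield_subring[OF L]] by blast
  then have "\<one> \<in> adjoin R E s" by (rule subring_closed(3))
  then show ?case using L by (auto simp: sfield_def)
next
  case (Cons c cs)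
  let ?A = "adjoin R E s"
  obtain g where g: "g \<in> ?A" "g \<noteq> \<zero>" "(\<lambda>c. c \<otimes> g) ` set cs \<subseteq> ?A"
    using Cons.IH Cons.prems by (meson set_subset_Cons subset_trans)
  obtain h where h: "h \<in> ?A" "h \<noteq> \<zero>" "h \<otimes> c \<in> ?A"
    using fgen_insert_fraction[OF assms, of c] Cons.prems by (meson list.set_intros(1) subsetD)
  have Ls: "subring L R" and Es: "subring E R" using L E sfield_subring by auto
  have A: "subring ?A R" using adjoin_subring[OF Es] s subring_closed(1)[OF Ls] by blast
  have AL: "?A \<subseteq> L" using adjoin_least[OF Ls E(2) s] .
  have "fgen R (insert s E) \<subseteq> L" using fgen_least[OF L] E s by simp
  then have c: "set (c # cs) \<subseteq> carrier R" using Cons.prems subring_closed(1)[OF Ls] by blast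
  have gh: "g \<in> carrier R" "h \<in> carrier R" using g h subring_closed(1)[OF A] by auto
  have "g \<otimes> h \<noteq> \<zero>" using sfield_integral[OF L] g h gh AL by blast
  moreover have "c \<otimes> (g \<otimes> h) = g \<otimes> (h \<otimes> c)" using c gh by (simp add: m_ac)
  then have "c \<otimes> (g \<otimes> h) \<in> ?A" using g h subring_closed(5)[OF A] by simp
  moreover have "x \<otimes> (g \<otimes> h) \<in> ?A" if x: "x \<in> set cs" for x
  proof -
    have "x \<otimes> (g \<otimes> h) = (x \<otimes> g) \<otimes> h" using c gh x by (auto simp: m_assoc)
    then show ?thesis using g h x subring_closed(5)[OF A] by auto
  qed
  ultimately show ?case using subring_closed(5)[OF A g(1) h(1)] by (intro bexI[of _ "g \<otimes> h"]) auto
qed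

text \<open>A common denominator turns a relation over E(s) into one over E[s]. Finitely many
  elements of E[s] then have to fit into a range of degrees on which the powers of \<open>s\<close>
  are free over \<open>H\<close>; this is the hypothesis \<open>free\<close>.\<close>

lemma lin_disj_simple:
  assumes L: "sfield R L" and E: "sfield R E" "E \<subseteq> H" and H: "subring H R" "H \<subseteq> L" and s: "s \<in> L"
    and free: "\<And>as. set as \<subseteq> adjoin R E s \<Longrightarrow> \<exists>r. pfree R H s r \<and> set as \<subseteq> pspan R E s r"
  shows "lin_disj R E (fgen R (insert s E)) H"
  unfolding lin_disj_def indep_def[of R "fgen R _"]
proof (intro allI impI)
  fix bs cs
  assume bs: "set bs \<subseteq> H" "indep R E bs" and cs: "length cs = length bs"
    "set cs \<subseteq> fgen R (insert s E)" "dot R cs bs = \<zero>"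
  have EL: "E \<subseteq> L" using E H by simp
  obtain g where g: "g \<in> adjoin R E s" "g \<noteq> \<zero>" "(\<lambda>c. c \<otimes> g) ` set cs \<subseteq> adjoin R E s"
    using fgen_insert_denominator[OF L E(1) EL s cs(2)] by blast
  have Ls: "subring L R" and Es: "subring E R" using L E sfield_subring by auto
  have sc: "s \<in> carrier R" using s subring_closed(1)[OF Ls] by blast
  have gL: "g \<in> L" using g adjoin_least[OF Ls EL s] by blast
  have gc: "g \<in> carrier R" using gL subring_closed(1)[OF Ls] by blast
  have "fgen R (insert s E) \<subseteq> L" using fgen_least[OF L] EL s by simp
  then have csL: "set cs \<subseteq> carrier R" using cs subring_closed(1)[OF Ls] by blast
  have bsc: "set bs \<subseteq> carrier R" using bs subring_closed(1)[OF H(1)] by blast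
  let ?as = "map (\<lambda>c. c \<otimes> g) cs"
  have "dot R ?as bs = \<zero>" using csL bsc gc cs by (simp add: dot_smult)
  moreover obtain r where "pfree R H s r" "set ?as \<subseteq> pspan R E s r" using free[of ?as] g by auto
  ultimately have "set ?as \<subseteq> {\<zero>}" using indep_pspan[OF H(1) E(2) sc bs, of r ?as] cs by simp
  then have "c \<otimes> g = \<zero>" if "c \<in> set cs" for c using that by auto
  then show "set cs \<subseteq> {\<zero>}" using sfield_integral[OF L gL] csL gc g m_comm by (metis insertCI subset_iff)
qed

lemma sfield_chain_Union:
  assumes "\<And>n. sfield R (E n)" "\<And>n. E n \<subseteq> E (Suc n)"
  shows "sfield R (\<Union>(range E))"
  unfolding sfield_def
proof (intro conjI subringI ballI)
  have s: "subring (E n) R" for n using assms(1) by (rule sfield_subring)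
  have mono: "E m \<subseteq> E n" if "m \<le> n" for m n
    using assms(2) that by (rule lift_Suc_mono_le)
  show "\<Union>(range E) \<subseteq> carrier R" using subring_closed(1)[OF s] by (rule UN_least)
  show "\<one> \<noteq> \<zero>" using assms(1) by (simp add: sfield_def)
  show "\<one> \<in> \<Union>(range E)" using subring_closed(3)[OF s[of 0]] by blast
  { fix x y assume "x \<in> \<Union>(range E)" "y \<in> \<Union>(range E)"
    then obtain m n where "x \<in> E m" "y \<in> E n" by blast
    then have *: "x \<in> E (max m n)" "y \<in> E (max m n)" using mono[of m "max m n"] mono[of n "max m n"] by auto
    then show "x \<oplus> y \<in> \<Union>(range E)" "x \<otimes> y \<in> \<Union>(range E)" "\<ominus> x \<in> \<Union>(range E)"
      using subring_closed(4)[OF s *] subring_closed(5)[OF s *] subring_closed(6)[OF s *(1)] by blast+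
  }
  fix x assume "x \<in> \<Union>(range E) - {\<zero>}"
  then obtain n where "x \<in> E n" "x \<noteq> \<zero>" by blast
  then obtain y where "y \<in> E n" "x \<otimes> y = \<one>" by (rule sfield_inverse[OF assms(1)])
  then show "\<exists>y\<in>\<Union>(range E). x \<otimes> y = \<one>" by blast
qed

text \<open>Either \<open>s\<close> is transcendental over the union \<open>H\<close> and every
  \<open>n\<close> works, or its minimal equation over \<open>H\<close> has coefficients in some
  \<open>E N\<close>. From \<open>N\<close> on, \<open>s\<close> has the same degree over
  \<open>E n\<close> as over \<open>H\<close>, which is linear disjointness.\<close>

lemma lin_disj_chain_simple:
  assumes L: "sfield R L" and E: "\<And>n. sfield R (E n)" "\<And>n. E n \<subseteq> E (Suc n)" "\<And>n. E n \<subseteq> L"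
    and s: "s \<in> L"
  shows "\<exists>N. \<forall>n\<ge>N. lin_disj R (E n) (fgen R (insert s (E n))) (\<Union>(range E))"
proof -
  let ?H = "\<Union>(range E)"
  have H: "sfield R ?H" using E(1,2) by (rule sfield_chain_Union)
  have Hs: "subring ?H R" and Ls: "subring L R" and Es: "\<And>n. subring (E n) R"
    using sfield_subring[OF H] sfield_subring[OF L] sfield_subring[OF E(1)] .
  note Hc = subring_closed[OF Hs]
  have HL: "?H \<subseteq> L" and EH: "\<And>n. E n \<subseteq> ?H" using E(3) by blast+
  have sc: "s \<in> carrier R" using s subring_closed(1)[OF Ls] by blast
  have mono: "E m \<subseteq> E n" if "m \<le> n" for m n using E(2) that by (rule lift_Suc_mono_le)
  show ?thesis
  proof (cases "\<forall>r. pfree R ?H s r")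
    case True
    have "\<exists>r. set as \<subseteq> pspan R (E n) s r" if "set as \<subseteq> adjoin R (E n) s" for as n
      using that
    proof (induction as)
      case (Cons a as)
      then obtain r r' where "set as \<subseteq> pspan R (E n) s r" "a \<in> pspan R (E n) s r'"
        by (auto simp: adjoin_def)
      then have "set (a # as) \<subseteq> pspan R (E n) s (max r r')"
        using pspan_le[OF Es sc, of r "max r r'" n] pspan_le[OF Es sc, of r' "max r r'" n] by auto
      then show ?case by blast
    qed simp
    then have "lin_disj R (E n) (fgen R (insert s (E n))) ?H" for n
      using True by (intro lin_disj_simple[OF L E(1) EH Hs HL s]) blast
    then show ?thesis by blast
  next
    case False
    \<comment> \<open>A relation over the union with top exponent \<open>k\<close>; the least such
      \<open>k\<close> is the degree of \<open>s\<close> over the union.\<close>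
    define bad where "bad k \<longleftrightarrow> (\<exists>p\<in>pspan R ?H s k. \<exists>h\<in>?H. p \<oplus> h \<otimes> s [^] k = \<zero> \<and> \<not> (p = \<zero> \<and> h = \<zero>))" for k
    have "\<exists>k. bad k" using False unfolding pfree_def bad_def by blast
    then obtain k where k: "bad k" "\<And>j. j < k \<Longrightarrow> \<not> bad j" using exists_least_iff[of bad] by blast
    have free: "pfree R ?H s k" using k(2) unfolding pfree_def bad_def by blast
    obtain p h where ph: "p \<in> pspan R ?H s k" "h \<in> ?H" "p \<oplus> h \<otimes> s [^] k = \<zero>" "\<not> (p = \<zero> \<and> h = \<zero>)"
      using k(1) unfolding bad_def by blast
    have c: "p \<in> carrier R" "h \<in> carrier R" "s [^] k \<in> carrier R"
      using ph Hc(1) pspan_closed[OF Hc(1) sc] sc by auto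
    have "h \<noteq> \<zero>" using ph c by auto
    then obtain y where y: "y \<in> ?H" "y \<otimes> h = \<one>" by (rule sfield_inverse[OF H ph(2)])
    have yc: "y \<in> carrier R" using y Hc by blast
    have "s [^] k = (y \<otimes> h) \<otimes> s [^] k" using y c by simp
    also have "\<dots> = y \<otimes> (h \<otimes> s [^] k)" using yc c by (simp add: m_assoc)
    also have "h \<otimes> s [^] k = \<ominus> p" using ph(3) c by (metis a_comm m_closed minus_equality)
    also have "y \<otimes> (\<ominus> p) = (\<ominus> y) \<otimes> p" using yc c by (simp add: l_minus r_minus)
    also have "\<dots> \<in> pspan R ?H s k" by (rule pspan_smult[OF Hs sc Hc(6)[OF y(1)] ph(1)])
    \<comment> \<open>The leading coefficient has been inverted, so this is the monic minimal
      equation.\<close>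
    finally have sk: "s [^] k \<in> pspan R ?H s k" .
    have un: "pspan R ?H s r \<subseteq> (\<Union>n. pspan R (E n) s r)" for r
    proof (induction r)
      case (Suc r)
      show ?case
      proof
        fix x assume "x \<in> pspan R ?H s (Suc r)"
        then obtain p e where x: "x = p \<oplus> e \<otimes> s [^] r" "p \<in> pspan R ?H s r" "e \<in> ?H" by auto
        then obtain m n where "p \<in> pspan R (E m) s r" "e \<in> E n" using Suc by blast
        then have "p \<in> pspan R (E (max m n)) s r" "e \<in> E (max m n)"
          using mono[of n "max m n"] pspan_mono[OF mono[of m "max m n"]] by auto
        then have "x \<in> pspan R (E (max m n)) s (Suc r)" using x pspan_SucI by blast
        then show "x \<in> (\<Union>n. pspan R (E n) s (Suc r))" by blast
      qed
    qed simp
    then obtain N where N: "s [^] k \<in> pspan R (E N) s k" using sk by blast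
    have "lin_disj R (E n) (fgen R (insert s (E n))) ?H" if n: "n \<ge> N" for n
    proof (rule lin_disj_simple[OF L E(1) EH Hs HL s])
      note Ec = subring_closed[OF Es[of n]]
      have Nn: "s [^] k \<in> pspan R (E n) s k" using N pspan_mono[OF mono[OF n]] by blast
      \<comment> \<open>The minimal equation rewrites s^k, so multiplying by \<open>s\<close> never
        leads out of the expressions of degree below \<open>k\<close>.\<close>
      have ge: "s [^] (k + j) \<in> pspan R (E n) s k" for j :: nat
      proof (induction j)
        case (Suc j)
        have "s [^] (1::nat) \<otimes> s [^] (k + j) \<in> pspan R (E n) s (k + 1)"
          by (rule pspan_pow_mult[OF Es sc Suc])
        then obtain p e where pe: "s [^] (1::nat) \<otimes> s [^] (k + j) = p \<oplus> e \<otimes> s [^] k"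
          "p \<in> pspan R (E n) s k" "e \<in> E n" by auto
        have "s [^] (k + Suc j) = s [^] (1::nat) \<otimes> s [^] (k + j)" using sc by (simp add: m_comm)
        also have "\<dots> \<in> pspan R (E n) s k"
          unfolding pe(1) using pspan_add[OF Es sc pe(2)] pspan_smult[OF Es sc pe(3) Nn] .
        finally show ?case .
      qed (use Nn in simp)
      have all: "s [^] j \<in> pspan R (E n) s k" for j :: nat
      proof (cases "j < k")
        case True
        have "\<zero> \<oplus> \<one> \<otimes> s [^] j \<in> pspan R (E n) s (Suc j)"
          using pspan_zero[OF Es sc] Ec(3) by (rule pspan_SucI)
        then have "s [^] j \<in> pspan R (E n) s (Suc j)" using sc by simp
        then show ?thesis using pspan_le[OF Es sc, of "Suc j" k n] True by auto
      next
        case False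
        then show ?thesis using ge[of "j - k"] by simp
      qed
      have "pspan R (E n) s r \<subseteq> pspan R (E n) s k" for r
      proof (induction r)
        case 0
        then show ?case using pspan_zero[OF Es sc] by simp
      next
        case (Suc r)
        then show ?case using pspan_add[OF Es sc] pspan_smult[OF Es sc _ all]
          by (auto simp: subset_eq)
      qed
      then have "adjoin R (E n) s \<subseteq> pspan R (E n) s k" by (auto simp: adjoin_def)
      then show "\<exists>r. pfree R ?H s r \<and> set as \<subseteq> pspan R (E n) s r" if "set as \<subseteq> adjoin R (E n) s" for as
        using that free by blast
    qed
    then show ?thesis by blast
  qed
qed

text \<open>Linear disjointness is transitive. Adjoining \<open>s\<close> to every member yields a
  new chain \<open>?F\<close> to which the induction hypothesis for \<open>S\<close> applies, and
  the union of the old chain lies in that of the new one.\<close>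

lemma lin_disj_chain:
  assumes L: "sfield R L" and S: "finite S" "S \<subseteq> L"
    and E: "\<And>n. sfield R (E n)" "\<And>n. E n \<subseteq> E (Suc n)" "\<And>n. E n \<subseteq> L"
  shows "\<exists>N. \<forall>n\<ge>N. lin_disj R (E n) (fgen R (E n \<union> S)) (\<Union>(range E))"
  using S E
proof (induction S arbitrary: E rule: finite_induct)
  case empty
  have "fgen R (E n \<union> {}) \<subseteq> E n" for n using fgen_least[of "E n" "E n \<union> {}"] empty by auto
  then have "lin_disj R (E n) (fgen R (E n \<union> {})) (\<Union>(range E))" for n
    unfolding lin_disj_def indep_def by blast
  then show ?case by blast
next
  case (insert s S)
  let ?F = "\<lambda>n. fgen R (insert s (E n))"
  have F: "sfield R (?F n)" "?F n \<subseteq> ?F (Suc n)" "?F n \<subseteq> L" "E n \<subseteq> ?F n" for n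
    using fgen_sfield[OF L, of "insert s (E n)"] insert.prems fgen_least[OF L, of "insert s (E n)"]
      fgen_mono[of "insert s (E n)" "insert s (E (Suc n))"] fgen_incl[of "insert s (E n)"] by auto
  obtain N where N: "\<And>n. n \<ge> N \<Longrightarrow> lin_disj R (?F n) (fgen R (?F n \<union> S)) (\<Union>(range ?F))"
    using insert.IH[of ?F] F insert.prems by auto
  obtain N' where N': "\<And>n. n \<ge> N' \<Longrightarrow> lin_disj R (E n) (?F n) (\<Union>(range E))"
    using lin_disj_chain_simple[OF L, of E s] insert.prems by auto
  have "lin_disj R (E n) (fgen R (E n \<union> insert s S)) (\<Union>(range E))" if n: "n \<ge> max N N'" for n
  proof -
    have "fgen R (?F n \<union> S) = fgen R (insert s (E n) \<union> S)"
      using insert.prems by (intro fgen_Un[OF L]) auto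
    moreover have "insert s (E n) \<union> S = E n \<union> insert s S" by auto
    moreover have "\<Union>(range E) \<subseteq> \<Union>(range ?F)" using F(4) by blast
    ultimately show ?thesis using N[of n] N'[of n] n unfolding lin_disj_def by auto
  qed
  then show ?case by blast
qed

end

section \<open>Primes of subrings\<close>

definition prime_in :: "('a, 'm) ring_scheme \<Rightarrow> 'a set \<Rightarrow> 'a set \<Rightarrow> bool" where
  "prime_in R A q \<longleftrightarrow> q \<subseteq> A \<and> \<zero>\<^bsub>R\<^esub> \<in> q \<and> \<one>\<^bsub>R\<^esub> \<notin> q \<and> (\<forall>x\<in>q. \<forall>y\<in>q. x \<oplus>\<^bsub>R\<^esub> y \<in> q) \<and>
     (\<forall>a\<in>A. \<forall>x\<in>q. a \<otimes>\<^bsub>R\<^esub> x \<in> q) \<and> (\<forall>x\<in>A. \<forall>y\<in>A. x \<otimes>\<^bsub>R\<^esub> y \<in> q \<longrightarrow> x \<in> q \<or> y \<in> q)"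

text \<open>Minimality of a prime \<open>q\<close> in local form: every element of \<open>q\<close> is nilpotent in the localization at \<open>q\<close>.\<close>

definition minimal_prime_in :: "('a, 'm) ring_scheme \<Rightarrow> 'a set \<Rightarrow> 'a set \<Rightarrow> bool" where
  "minimal_prime_in R A q \<longleftrightarrow> prime_in R A q \<and>
     (\<forall>z\<in>q. \<exists>s\<in>A - q. \<exists>m::nat. s \<otimes>\<^bsub>R\<^esub> z [^]\<^bsub>R\<^esub> m = \<zero>\<^bsub>R\<^esub>)"

lemma prime_inD:
  assumes "prime_in R A q"
  shows "q \<subseteq> A" "\<zero>\<^bsub>R\<^esub> \<in> q" "\<one>\<^bsub>R\<^esub> \<notin> q" "x \<in> q \<Longrightarrow> y \<in> q \<Longrightarrow> x \<oplus>\<^bsub>R\<^esub> y \<in> q"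
    "a \<in> A \<Longrightarrow> x \<in> q \<Longrightarrow> a \<otimes>\<^bsub>R\<^esub> x \<in> q"
    "x \<in> A \<Longrightarrow> y \<in> A \<Longrightarrow> x \<otimes>\<^bsub>R\<^esub> y \<in> q \<Longrightarrow> x \<in> q \<or> y \<in> q"
  using assms by (auto simp: prime_in_def)

lemma minimal_prime_inD:
  assumes "minimal_prime_in R A q"
  shows "prime_in R A q" "z \<in> q \<Longrightarrow> \<exists>s\<in>A - q. \<exists>m::nat. s \<otimes>\<^bsub>R\<^esub> z [^]\<^bsub>R\<^esub> m = \<zero>\<^bsub>R\<^esub>"
  using assms by (auto simp: minimal_prime_in_def)

context cring
begin

lemma prime_in_pow:
  assumes "subring A R" "prime_in R A q" "x \<in> A" "x [^] (n::nat) \<in> q"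
  shows "x \<in> q"
  using assms(4)
proof (induction n)
  case 0
  then show ?case using prime_inD(3)[OF assms(2)] by simp
next
  case (Suc n)
  then show ?case using prime_inD(6)[OF assms(2) subring_pow[OF assms(1,3), of n] assms(3)] by auto
qed

lemma prime_in_Int:
  assumes A: "subring A R" and B: "B \<subseteq> A" and q: "prime_in R A q"
    and Bs: "subring B R"
  shows "prime_in R B (q \<inter> B)"
  unfolding prime_in_def
proof (intro conjI ballI impI)
  note Bc = subring_closed[OF Bs] and qd = prime_inD[OF q]
  show "q \<inter> B \<subseteq> B" "\<zero> \<in> q \<inter> B" "\<one> \<notin> q \<inter> B" using Bc(2) qd(2,3) by auto
  show "x \<oplus> y \<in> q \<inter> B" if "x \<in> q \<inter> B" "y \<in> q \<inter> B" for x y using that Bc(4) qd(4) by auto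
  show "x \<otimes> y \<in> q \<inter> B" if "x \<in> B" "y \<in> q \<inter> B" for x y using that B Bc(5) qd(5) by auto
  show "x \<in> q \<inter> B \<or> y \<in> q \<inter> B" if "x \<in> B" "y \<in> B" "x \<otimes> y \<in> q \<inter> B" for x y
    using that B qd(6)[of x y] by auto
qed

text \<open>The local form of minimality gives the usual one: s z^m = 0 lies in \<open>p\<close>,
  while \<open>s\<close> is outside \<open>q\<close> and hence outside \<open>p\<close>.\<close>

lemma minimal_prime_in_subset_eq:
  assumes A: "subring A R" and q: "minimal_prime_in R A q" and p: "prime_in R A p" and sub: "p \<subseteq> q"
  shows "p = q"
proof
  show "q \<subseteq> p"
  proof
    fix z assume z: "z \<in> q"
    obtain s m where s: "s \<in> A - q" "s \<otimes> z [^] (m::nat) = \<zero>" using minimal_prime_inD(2)[OF q z] by blast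
    have zA: "z \<in> A" using z prime_inD(1)[OF minimal_prime_inD(1)[OF q]] by blast
    have "s \<otimes> z [^] m \<in> p" using s prime_inD(2)[OF p] by simp
    moreover have "s \<notin> p" using s sub by blast
    ultimately have "z [^] m \<in> p" using prime_inD(6)[OF p _ subring_pow[OF A zA]] s by blast
    then show "z \<in> p" using prime_in_pow[OF A p zA] by blast
  qed
qed (rule sub)

text \<open>Splitting off one factor \<open>z \<oplus> w\<close> and moving \<open>z\<close> or
  \<open>w\<close> into the annihilator \<open>t\<close> lowers one of the two exponents, which
  replaces the binomial formula.\<close>

lemma annihilated_sum_pow:
  assumes "z \<in> carrier R" "w \<in> carrier R"
  shows "t \<in> carrier R \<Longrightarrow> t \<otimes> z [^] (m::nat) = \<zero> \<Longrightarrow> t \<otimes> w [^] (k::nat) = \<zero> \<Longrightarrow>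
    t \<otimes> (z \<oplus> w) [^] (m + k) = \<zero>"
proof (induction "m + k" arbitrary: m k t)
  case 0
  then show ?case by simp
next
  case (Suc n)
  show ?case
  proof (cases "m = 0 \<or> k = 0")
    case True
    then have "t = \<zero>" using Suc.prems by auto
    then show ?thesis using assms by simp
  next
    case False
    then obtain m' k' where mk: "m = Suc m'" "k = Suc k'" using not0_implies_Suc by blast
    have tz: "(t \<otimes> z) \<otimes> z [^] m' = \<zero>" "(t \<otimes> z) \<otimes> w [^] k = \<zero>"
    proof -
      have "(t \<otimes> z) \<otimes> z [^] m' = t \<otimes> z [^] m" "(t \<otimes> z) \<otimes> w [^] k = z \<otimes> (t \<otimes> w [^] k)"
        using Suc.prems(1) assms mk by (simp_all add: m_ac)
      then show "(t \<otimes> z) \<otimes> z [^] m' = \<zero>" "(t \<otimes> z) \<otimes> w [^] k = \<zero>"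
        using Suc.prems(2,3) assms by simp_all
    qed
    have tw: "(t \<otimes> w) \<otimes> z [^] m = \<zero>" "(t \<otimes> w) \<otimes> w [^] k' = \<zero>"
    proof -
      have "(t \<otimes> w) \<otimes> z [^] m = w \<otimes> (t \<otimes> z [^] m)" "(t \<otimes> w) \<otimes> w [^] k' = t \<otimes> w [^] k"
        using Suc.prems(1) assms mk by (simp_all add: m_ac)
      then show "(t \<otimes> w) \<otimes> z [^] m = \<zero>" "(t \<otimes> w) \<otimes> w [^] k' = \<zero>"
        using Suc.prems(2,3) assms by simp_all
    qed
    have "(t \<otimes> z) \<otimes> (z \<oplus> w) [^] (m' + k) = \<zero>"
      using Suc.hyps(1)[of m' k "t \<otimes> z"] Suc.hyps(2) Suc.prems(1) assms tz mk by simp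
    moreover have "(t \<otimes> w) \<otimes> (z \<oplus> w) [^] (m + k') = \<zero>"
      using Suc.hyps(1)[of m k' "t \<otimes> w"] Suc.hyps(2) Suc.prems(1) assms tw mk by simp
    moreover have "m + k = Suc (m' + k)" "m + k' = m' + k" using mk by auto
    moreover have "t \<otimes> (z \<oplus> w) [^] Suc (m' + k) =
        (t \<otimes> z) \<otimes> (z \<oplus> w) [^] (m' + k) \<oplus> (t \<otimes> w) \<otimes> (z \<oplus> w) [^] (m' + k)"
      using Suc.prems(1) assms by (simp add: r_distr l_distr m_ac)
    ultimately show ?thesis by simp
  qed
qed

text \<open>The complement of a multiplicative set maximal among those avoiding \<open>0\<close> is a minimal prime.\<close>

lemma minimal_prime_exists:
  assumes A: "subring A R" and S: "S \<subseteq> A" "\<one> \<in> S" "\<zero> \<notin> S"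
    and mult: "\<And>x y. x \<in> S \<Longrightarrow> y \<in> S \<Longrightarrow> x \<otimes> y \<in> S"
  shows "\<exists>q. minimal_prime_in R A q \<and> q \<inter> S = {}"
proof -
  note Ac = subring_closed[OF A]
  let ?\<T> = "{T. S \<subseteq> T \<and> T \<subseteq> A \<and> \<zero> \<notin> T \<and> (\<forall>x\<in>T. \<forall>y\<in>T. x \<otimes> y \<in> T)}"
  have "\<exists>T\<in>?\<T>. \<forall>X\<in>?\<T>. T \<subseteq> X \<longrightarrow> X = T"
  proof (rule subset_Zorn_nonempty)
    have "S \<in> ?\<T>" using S mult by simp
    then show "?\<T> \<noteq> {}" by blast
    fix C assume C: "C \<noteq> {}" "subset.chain ?\<T> C"
    have ch: "X \<subseteq> Y \<or> Y \<subseteq> X" if "X \<in> C" "Y \<in> C" for X Y using C(2) that by (auto simp: subset_chain_def)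
    have CT: "C \<subseteq> ?\<T>" using C(2) by (auto simp: subset_chain_def)
    have "x \<otimes> y \<in> \<Union>C" if xy: "x \<in> \<Union>C" "y \<in> \<Union>C" for x y
    proof -
      obtain X Y where XY: "x \<in> X" "X \<in> C" "y \<in> Y" "Y \<in> C" using xy by blast
      then obtain Z where "Z \<in> C" "x \<in> Z" "y \<in> Z" using ch[of X Y] by blast
      then show ?thesis using CT by blast
    qed
    moreover have "S \<subseteq> \<Union>C" "\<Union>C \<subseteq> A" "\<zero> \<notin> \<Union>C" using C(1) CT by blast+
    ultimately show "\<Union>C \<in> ?\<T>" by blast
  qed
  then obtain T where T0: "T \<in> ?\<T>" and max: "\<forall>X\<in>?\<T>. T \<subseteq> X \<longrightarrow> X = T" by (rule bexE)
  have T: "S \<subseteq> T" "T \<subseteq> A" "\<zero> \<notin> T" using T0 by simp_all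
  have Tm: "x \<otimes> y \<in> T" if "x \<in> T" "y \<in> T" for x y
    using T0 that by simp
  note T = T Tm
  have one: "\<one> \<in> T" using T(1) S(2) by blast
  \<comment> \<open>Otherwise the products of \<open>T\<close> with powers of \<open>z\<close> would
    be a strictly larger multiplicative set that still avoids zero.\<close>
  have key: "\<exists>s\<in>T. \<exists>m::nat. s \<otimes> z [^] m = \<zero>" if z: "z \<in> A" "z \<notin> T" for z
  proof (rule ccontr)
    assume no: "\<not> ?thesis"
    let ?X = "{s \<otimes> z [^] m | s m::nat. s \<in> T}"
    have zc: "z \<in> carrier R" using z Ac(1) by blast
    have sub: "T \<subseteq> ?X"
    proof
      fix s assume "s \<in> T"
      moreover from this have "s = s \<otimes> z [^] (0::nat)" using T(2) Ac(1) by auto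
      ultimately show "s \<in> ?X" by blast
    qed
    have "x \<otimes> y \<in> ?X" if xy: "x \<in> ?X" "y \<in> ?X" for x y
    proof -
      obtain s m s' m' where d: "x = s \<otimes> z [^] (m::nat)" "y = s' \<otimes> z [^] (m'::nat)" "s \<in> T" "s' \<in> T"
        using xy by blast
      have c: "s \<in> carrier R" "s' \<in> carrier R" using d T(2) Ac(1) by blast+
      have "x \<otimes> y = (s \<otimes> s') \<otimes> z [^] (m + m')"
        using d c zc by (simp add: nat_pow_mult[symmetric] m_ac)
      then show ?thesis using T(4)[OF d(3,4)] by blast
    qed
    moreover have "?X \<subseteq> A" using T(2) Ac(5) subring_pow[OF A z(1)] by blast
    moreover have "\<zero> \<notin> ?X"
    proof
      assume "\<zero> \<in> ?X"
      then obtain s m where "\<zero> = s \<otimes> z [^] (m::nat)" "s \<in> T" by blast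
      then show False using no by metis
    qed
    moreover have "S \<subseteq> ?X" using T(1) sub by (rule subset_trans)
    ultimately have "?X \<in> ?\<T>" by simp
    then have "?X = T" using max sub by (elim ballE[of _ _ ?X]) simp_all
    moreover have "\<one> \<otimes> z [^] (1::nat) \<in> ?X" using one by blast
    ultimately show False using z zc by simp
  qed
  let ?q = "A - T"
  have "prime_in R A ?q" unfolding prime_in_def
  proof (intro conjI ballI impI)
    show "\<zero> \<in> ?q" "?q \<subseteq> A" "\<one> \<notin> ?q" using Ac(2) T(3) one by auto
    fix x y assume xy: "x \<in> ?q" "y \<in> ?q"
    obtain s m where s: "s \<in> T" "s \<otimes> x [^] (m::nat) = \<zero>" using key xy by blast
    obtain t k where t: "t \<in> T" "t \<otimes> y [^] (k::nat) = \<zero>" using key xy by blast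
    have c: "x \<in> carrier R" "y \<in> carrier R" "s \<in> carrier R" "t \<in> carrier R"
      using xy s t T(2) Ac(1) by blast+
    have "(s \<otimes> t) \<otimes> x [^] m = t \<otimes> (s \<otimes> x [^] m)" "(s \<otimes> t) \<otimes> y [^] k = s \<otimes> (t \<otimes> y [^] k)"
      using c by (simp_all add: m_ac)
    then have 0: "(s \<otimes> t) \<otimes> (x \<oplus> y) [^] (m + k) = \<zero>"
      using annihilated_sum_pow[OF c(1,2), of "s \<otimes> t" m k] s t c by simp
    have "x \<oplus> y \<notin> T"
    proof
      assume xyT: "x \<oplus> y \<in> T"
      have "(x \<oplus> y) [^] j \<in> T" for j :: nat
        by (induction j) (use one T(4) xyT in auto)
      then have "(s \<otimes> t) \<otimes> (x \<oplus> y) [^] (m + k) \<in> T" using s t T(4) by blast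
      then show False using 0 T(3) by simp
    qed
    then show "x \<oplus> y \<in> ?q" using xy Ac(4) by blast
  next
    fix a x assume ax: "a \<in> A" "x \<in> ?q"
    obtain s m where s: "s \<in> T" "s \<otimes> x [^] (m::nat) = \<zero>" using key ax by blast
    have c: "a \<in> carrier R" "x \<in> carrier R" "s \<in> carrier R" using ax s T(2) Ac(1) by blast+
    have "s \<otimes> (a \<otimes> x) [^] m = a [^] m \<otimes> (s \<otimes> x [^] m)"
      using c by (simp add: nat_pow_distrib m_ac)
    then have 0: "s \<otimes> (a \<otimes> x) [^] m = \<zero>" using s c by simp
    have "a \<otimes> x \<notin> T"
    proof
      assume axT: "a \<otimes> x \<in> T"
      have "(a \<otimes> x) [^] j \<in> T" for j :: nat
        by (induction j) (use one T(4) axT in auto)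
      then have "s \<otimes> (a \<otimes> x) [^] m \<in> T" using s T(4) by blast
      then show False using 0 T(3) by simp
    qed
    then show "a \<otimes> x \<in> ?q" using ax Ac(5) by blast
  next
    fix x y assume "x \<in> A" "y \<in> A" "x \<otimes> y \<in> ?q"
    then show "x \<in> ?q \<or> y \<in> ?q" using T(4) by blast
  qed
  moreover have "\<exists>s\<in>A - ?q. \<exists>m::nat. s \<otimes> z [^] m = \<zero>" if "z \<in> ?q" for z
    using key[of z] that T(2) by blast
  ultimately have "minimal_prime_in R A ?q" by (simp add: minimal_prime_in_def)
  then show ?thesis using T(1) by blast
qed

end

section \<open>Minimal primes of composita\<close>

text \<open>
  The tensor product of two fields \<open>L\<close> and \<open>M\<close> over \<open>K\<close>, described from inside. The maps in
  \<open>\<Lambda>\<close> are the \<open>L\<close>-linear extensions of the \<open>K\<close>-linear functionals on \<open>M\<close>.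
\<close>

locale field_tensor = cring R for R (structure) +
  fixes L K M :: "'a set" and \<Lambda> :: "('a \<Rightarrow> 'a) set"
  assumes L: "sfield R L" and M: "sfield R M" and KL: "K \<subseteq> L" and KM: "K \<subseteq> M" and K: "sfield R K"
    and gen: "carrier R = lspan R L M"
    and \<Lambda>_add: "h \<in> \<Lambda> \<Longrightarrow> x \<in> carrier R \<Longrightarrow> y \<in> carrier R \<Longrightarrow> h (x \<oplus> y) = h x \<oplus> h y"
    and \<Lambda>_smult: "h \<in> \<Lambda> \<Longrightarrow> l \<in> L \<Longrightarrow> x \<in> carrier R \<Longrightarrow> h (l \<otimes> x) = l \<otimes> h x"
    and \<Lambda>_K: "h \<in> \<Lambda> \<Longrightarrow> m \<in> M \<Longrightarrow> h m \<in> K"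
    and \<Lambda>_zero: "x \<in> carrier R \<Longrightarrow> (\<And>h. h \<in> \<Lambda> \<Longrightarrow> h x = \<zero>) \<Longrightarrow> x = \<zero>"
begin

abbreviation ext :: "'a set \<Rightarrow> 'a set" where
  "ext E \<equiv> lspan R E M"

definition intermediate :: "'a set \<Rightarrow> bool" where
  "intermediate E \<longleftrightarrow> sfield R E \<and> K \<subseteq> E \<and> E \<subseteq> L"

lemma intermediateD:
  assumes "intermediate E"
  shows "sfield R E" "subring E R" "K \<subseteq> E" "E \<subseteq> L"
  using assms by (auto simp: intermediate_def sfield_subring)

lemma Lc: "L \<subseteq> carrier R" and Mc: "M \<subseteq> carrier R" and Ms: "subring M R" and Ls: "subring L R"
  using subring_closed(1)[OF sfield_subring[OF L]] subring_closed(1)[OF sfield_subring[OF M]]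
    sfield_subring[OF M] sfield_subring[OF L] by auto

lemma ext_subring: "intermediate E \<Longrightarrow> subring (ext E) R"
  using lspan_subring Ms by (simp add: intermediateD)

lemma ext_incl: "intermediate E \<Longrightarrow> E \<subseteq> ext E" "intermediate E \<Longrightarrow> M \<subseteq> ext E"
proof -
  assume E: "intermediate E"
  note Es = intermediateD(2)[OF E]
  show "M \<subseteq> ext E" using lspan_incl[OF Es Mc] by blast
  have "\<zero> \<oplus> e \<otimes> \<one> \<in> ext E" if "e \<in> E" for e
    using that subring_closed(3)[OF Ms] by (intro lspan.intros)
  moreover have "\<zero> \<oplus> e \<otimes> \<one> = e" if "e \<in> E" for e
    using that subring_closed(7)[OF Es] by simp
  ultimately show "E \<subseteq> ext E" by (metis subsetI)
qed

text \<open>On a product e m the value is e times an element of \<open>K\<close>, and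
  \<open>K\<close> lies in \<open>E\<close>.\<close>

lemma \<Lambda>_in_subfield:
  assumes E: "intermediate E" and l: "h \<in> \<Lambda>" and x: "x \<in> ext E"
  shows "h x \<in> E"
  using x
proof (induction rule: lspan.induct)
  note Ec = subring_closed[OF intermediateD(2)[OF E]]
  case lspan_zero
  have "\<one> \<in> M" using subring_closed(3)[OF Ms] .
  then have o: "h \<one> \<in> E" using \<Lambda>_K[OF l] intermediateD(3)[OF E] by blast
  have "h \<zero> = h (\<zero> \<otimes> \<one>)" by simp
  also have "\<dots> = \<zero> \<otimes> h \<one>" using \<Lambda>_smult[OF l] subring_closed(2)[OF Ls] by blast
  finally show ?case using o Ec by simp
next
  note Ec = subring_closed[OF intermediateD(2)[OF E]]
  case (lspan_step x e a)
  have "x \<in> carrier R" "e \<in> L" "e \<in> carrier R" "a \<in> carrier R"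
    using lspan_step lspan_closed[OF Ec(1) Mc] Ec(1) Mc intermediateD(4)[OF E] by blast+
  then have "h (x \<oplus> e \<otimes> a) = h x \<oplus> e \<otimes> h a" using \<Lambda>_add[OF l] \<Lambda>_smult[OF l] by simp
  moreover have "h a \<in> E" using \<Lambda>_K[OF l] lspan_step intermediateD(3)[OF E] by blast
  ultimately show ?case using lspan_step Ec by simp
qed

lemma intermediate_L: "intermediate L"
  using L KL by (simp add: intermediate_def)

lemma \<Lambda>_dot:
  assumes l: "h \<in> \<Lambda>"
  shows "set vs \<subseteq> carrier R \<Longrightarrow> set bs \<subseteq> L \<Longrightarrow> h (dot R vs bs) = dot R (map h vs) bs"
proof (induction vs bs rule: list_induct2')
  case (4 v vs b bs)
  have c: "v \<in> carrier R" "b \<in> carrier R" "dot R vs bs \<in> carrier R"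
    using 4 Lc by (auto intro!: dot_closed)
  have lv: "h v \<in> carrier R" using \<Lambda>_in_subfield[OF intermediate_L l, of v] c gen Lc by auto
  have "h (v \<otimes> b) = h (b \<otimes> v)" using c by (simp add: m_comm)
  also have "\<dots> = b \<otimes> h v" using \<Lambda>_smult[OF l] 4 c by simp
  also have "\<dots> = h v \<otimes> b" using c lv by (simp add: m_comm)
  finally show ?case using 4 c \<Lambda>_add[OF l] by simp
next
  case 1
  have "h (\<zero> \<otimes> \<zero>) = \<zero> \<otimes> h \<zero>" using \<Lambda>_smult[OF l] subring_closed(2)[OF Ls] by blast
  moreover have "h \<zero> \<in> carrier R" using \<Lambda>_in_subfield[OF intermediate_L l, of \<zero>] gen Lc by auto
  ultimately show ?case by simp
next
  case 2
  have "h (\<zero> \<otimes> \<zero>) = \<zero> \<otimes> h \<zero>" using \<Lambda>_smult[OF l] subring_closed(2)[OF Ls] by blast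
  moreover have "h \<zero> \<in> carrier R" using \<Lambda>_in_subfield[OF intermediate_L l, of \<zero>] gen Lc by auto
  ultimately show ?case by simp
next
  case 3
  have "h (\<zero> \<otimes> \<zero>) = \<zero> \<otimes> h \<zero>" using \<Lambda>_smult[OF l] subring_closed(2)[OF Ls] by blast
  moreover have "h \<zero> \<in> carrier R" using \<Lambda>_in_subfield[OF intermediate_L l, of \<zero>] gen Lc by auto
  ultimately show ?case by simp
qed

text \<open>Every map in \<Lambda> turns a relation over \<open>ext A\<close> into one over
  \<open>A\<close>, and \<Lambda> separates points. So independence over \<open>A\<close> survives
  tensoring with \<open>M\<close>.\<close>

lemma indep_ext:
  assumes A: "intermediate A" and bs: "set bs \<subseteq> L" "indep R A bs"
    and vs: "set vs \<subseteq> ext A" "length vs = length bs" "dot R vs bs = \<zero>"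
  shows "set vs \<subseteq> {\<zero>}"
proof
  fix v assume v: "v \<in> set vs"
  have vc: "set vs \<subseteq> carrier R" using vs(1) subring_closed(1)[OF ext_subring[OF A]] by blast
  have "h v = \<zero>" if l: "h \<in> \<Lambda>" for h
  proof -
    have "h \<zero> = \<zero>" using \<Lambda>_dot[OF l, of "[]" "[]"] by simp
    then have "dot R (map h vs) bs = \<zero>" using \<Lambda>_dot[OF l vc bs(1)] vs(3) by simp
    moreover have "set (map h vs) \<subseteq> A" using \<Lambda>_in_subfield[OF A l] vs(1) by auto
    ultimately have "set (map h vs) \<subseteq> {\<zero>}"
      using bs(2) vs(2) unfolding indep_def by (metis length_map)
    then show ?thesis using v by auto
  qed
  then show "v \<in> {\<zero>}" using \<Lambda>_zero v vc by blast
qed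

text \<open>Base change along \<open>A\<close> over \<open>E\<close> is flat, so annihilators are generated by those over \<open>E\<close>.\<close>

lemma annihilator_lspan:
  assumes E: "intermediate E" and A: "intermediate A" and B: "intermediate B" "E \<subseteq> B" "E \<subseteq> A"
    and ld: "lin_disj R E A B" and s: "s \<in> ext B" and w: "w \<in> ext A" and 0: "s \<otimes> w = \<zero>"
  shows "s \<in> lspan R B {v \<in> ext E. v \<otimes> w = \<zero>}"
proof -
  obtain vs bs where r: "length vs = length bs" "set bs \<subseteq> B" "set vs \<subseteq> ext E" "indep R E bs"
    "s = dot R vs bs"
    using lspan_indep_repr[OF intermediateD(1)[OF E] intermediateD(2)[OF B(1)] Mc s] by blast
  note sA = subring_closed[OF ext_subring[OF A]]
  have bL: "set bs \<subseteq> L" "set bs \<subseteq> carrier R" using r(2) intermediateD(4)[OF B(1)] Lc by auto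
  have EA: "ext E \<subseteq> ext A" using lspan_mono B(3) by blast
  have vc: "set vs \<subseteq> carrier R" using r(3) EA sA(1) by blast
  have wc: "w \<in> carrier R" using w sA(1) by blast
  have "dot R (map (\<lambda>v. v \<otimes> w) vs) bs = \<zero>" using 0 r dot_smult[OF vc bL(2) wc] by simp
  moreover have "set (map (\<lambda>v. v \<otimes> w) vs) \<subseteq> ext A"
    using r(3) EA sA(5)[OF _ w] by auto
  moreover have "indep R A bs" using ld r(2,4) unfolding lin_disj_def by blast
  ultimately have "set (map (\<lambda>v. v \<otimes> w) vs) \<subseteq> {\<zero>}"
    using indep_ext[OF A bL(1)] r(1) by (metis length_map)
  then have vs: "set vs \<subseteq> {v \<in> ext E. v \<otimes> w = \<zero>}" using r(3) by auto
  have comm: "dot R vs bs = dot R bs vs"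
    using vc bL(2) by (induction vs bs rule: list_induct2') (auto simp: m_comm)
  have Bc: "B \<subseteq> carrier R" using subring_closed(1)[OF intermediateD(2)[OF B(1)]] .
  have Ec: "ext E \<subseteq> carrier R" using EA sA(1) by blast
  show ?thesis
    unfolding r(5) comm using dot_in_lspan[OF Bc _ r(2) vs] Ec by blast
qed

lemma lspan_in_prime:
  assumes B: "intermediate B" and p: "prime_in R (ext B) p" and V: "V \<subseteq> p"
  shows "lspan R B V \<subseteq> p"
proof (rule lspan_least)
  show "\<zero> \<in> p" using prime_inD(2)[OF p] .
  fix x e a assume "x \<in> p" "e \<in> B" "a \<in> V"
  then show "x \<oplus> e \<otimes> a \<in> p"
    using V ext_incl(1)[OF B] by (intro prime_inD(4,5)[OF p]) auto
qed

text \<open>Going down along a flat extension: the element \<open>s\<close> that kills z^m is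
  spanned by annihilators already present over \<open>E\<close>, and not all of those can lie in
  \<open>q\<close>.\<close>

lemma minimal_prime_restrict:
  assumes E: "intermediate E" and B: "intermediate B" "E \<subseteq> B" and q: "minimal_prime_in R (ext B) q"
  shows "minimal_prime_in R (ext E) (q \<inter> ext E)"
  unfolding minimal_prime_in_def
proof (intro conjI ballI)
  have EB: "ext E \<subseteq> ext B" using lspan_mono B(2) by blast
  note qp = minimal_prime_inD(1)[OF q]
  show "prime_in R (ext E) (q \<inter> ext E)"
    by (rule prime_in_Int[OF ext_subring[OF B(1)] EB qp ext_subring[OF E]])
  fix z assume z: "z \<in> q \<inter> ext E"
  obtain s m where s: "s \<in> ext B - q" "s \<otimes> z [^] (m::nat) = \<zero>" using minimal_prime_inD(2)[OF q] z by blast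
  have "lin_disj R E E B" by (simp add: lin_disj_def)
  moreover have "z [^] m \<in> ext E" using subring_pow[OF ext_subring[OF E]] z by blast
  ultimately have "s \<in> lspan R B {v \<in> ext E. v \<otimes> z [^] m = \<zero>}"
    using annihilator_lspan[OF E E B order_refl] s by blast
  then have "\<not> {v \<in> ext E. v \<otimes> z [^] m = \<zero>} \<subseteq> q" using lspan_in_prime[OF B(1) qp] s by blast
  then show "\<exists>s\<in>ext E - (q \<inter> ext E). \<exists>m::nat. s \<otimes> z [^] m = \<zero>" by blast
qed

text \<open>Products of elements outside \<open>q\<close> with elements outside \<open>p\<close> do
  not vanish, so some minimal prime of the larger ring avoids them all. Its restrictions are
  contained in \<open>q\<close> and \<open>p\<close>, and minimality of these makes them
  equal.\<close>

lemma minimal_prime_glue: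
  assumes E: "intermediate E" and A: "intermediate A" "E \<subseteq> A" and B: "intermediate B" "E \<subseteq> B"
    and C: "intermediate C" "A \<subseteq> C" "B \<subseteq> C"
    and ld: "lin_disj R E A B"
    and q: "minimal_prime_in R (ext A) q" and p: "minimal_prime_in R (ext B) p"
    and eq: "q \<inter> ext E = p \<inter> ext E"
  shows "\<exists>r. minimal_prime_in R (ext C) r \<and> r \<inter> ext A = q \<and> r \<inter> ext B = p"
proof -
  note qp = minimal_prime_inD(1)[OF q] and pp = minimal_prime_inD(1)[OF p]
  have AC: "ext A \<subseteq> ext C" "ext B \<subseteq> ext C" using lspan_mono C by blast+
  note sA = subring_closed[OF ext_subring[OF A(1)]] and sB = subring_closed[OF ext_subring[OF B(1)]]
    and sC = subring_closed[OF ext_subring[OF C(1)]]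
  let ?S = "{s \<otimes> t | s t. s \<in> ext A - q \<and> t \<in> ext B - p}"
  \<comment> \<open>If t s = 0, linear disjointness writes \<open>t\<close> through annihilators
    \<open>v\<close> of \<open>s\<close> over \<open>E\<close>. Such a \<open>v\<close> lies in
    \<open>q\<close> because \<open>s\<close> does not, hence in \<open>p\<close> by the common
    restriction, and so \<open>t\<close> would lie in \<open>p\<close>.\<close>
  have nz: "t \<otimes> s \<noteq> \<zero>" if st: "s \<in> ext A - q" "t \<in> ext B - p" for s t
  proof
    assume 0: "t \<otimes> s = \<zero>"
    then have "t \<in> lspan R B {v \<in> ext E. v \<otimes> s = \<zero>}"
      using annihilator_lspan[OF E A(1) B(1,2) A(2) ld] st by blast
    moreover have "{v \<in> ext E. v \<otimes> s = \<zero>} \<subseteq> p"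
    proof
      fix v assume v: "v \<in> {v \<in> ext E. v \<otimes> s = \<zero>}"
      have "v \<in> ext A" using v lspan_mono[OF A(2), of M M] by blast
      moreover have "v \<otimes> s \<in> q" using v prime_inD(2)[OF qp] by simp
      ultimately have "v \<in> q" using prime_inD(6)[OF qp] st by blast
      then show "v \<in> p" using v eq by blast
    qed
    ultimately show False using lspan_in_prime[OF B(1) pp] st by blast
  qed
  have "\<exists>r. minimal_prime_in R (ext C) r \<and> r \<inter> ?S = {}"
  proof (rule minimal_prime_exists[OF ext_subring[OF C(1)]])
    show "?S \<subseteq> ext C" using AC sC(5) by blast
    have "\<one> = \<one> \<otimes> \<one>" by simp
    then show "\<one> \<in> ?S" using sA(3) sB(3) prime_inD(3)[OF qp] prime_inD(3)[OF pp] by blast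
    have "t \<otimes> s = s \<otimes> t" if "s \<in> ext A" "t \<in> ext B" for s t
      using that sA(1) sB(1) m_comm by blast
    then show "\<zero> \<notin> ?S" using nz by (smt (verit, best) Diff_iff mem_Collect_eq)
    fix x y assume "x \<in> ?S" "y \<in> ?S"
    then obtain s t s' t' where d: "x = s \<otimes> t" "y = s' \<otimes> t'" "s \<in> ext A - q" "t \<in> ext B - p"
      "s' \<in> ext A - q" "t' \<in> ext B - p" by blast
    have c: "s \<in> carrier R" "t \<in> carrier R" "s' \<in> carrier R" "t' \<in> carrier R"
      using d sA(1) sB(1) by blast+
    have "x \<otimes> y = (s \<otimes> s') \<otimes> (t \<otimes> t')" using d c by (simp add: m_ac)
    moreover have "s \<otimes> s' \<in> ext A - q" "t \<otimes> t' \<in> ext B - p"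
      using d sA(5) sB(5) prime_inD(6)[OF qp] prime_inD(6)[OF pp] by blast+
    ultimately show "x \<otimes> y \<in> ?S" by blast
  qed
  then obtain r where r: "minimal_prime_in R (ext C) r" "r \<inter> ?S = {}" by blast
  note rp = minimal_prime_inD(1)[OF r(1)]
  have "r \<inter> ext A \<subseteq> q"
  proof
    fix x assume x: "x \<in> r \<inter> ext A"
    then have "x = x \<otimes> \<one>" using sA(1) by auto
    then show "x \<in> q" using r(2) x sB(3) prime_inD(3)[OF pp] by blast
  qed
  then have 1: "r \<inter> ext A = q"
    using minimal_prime_in_subset_eq[OF ext_subring[OF A(1)] q
      prime_in_Int[OF ext_subring[OF C(1)] AC(1) rp ext_subring[OF A(1)]]] by blast
  have "r \<inter> ext B \<subseteq> p"
  proof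
    fix x assume x: "x \<in> r \<inter> ext B"
    then have "x = \<one> \<otimes> x" using sB(1) by auto
    then show "x \<in> p" using r(2) x sA(3) prime_inD(3)[OF qp] by blast
  qed
  then have 2: "r \<inter> ext B = p"
    using minimal_prime_in_subset_eq[OF ext_subring[OF B(1)] p
      prime_in_Int[OF ext_subring[OF C(1)] AC(2) rp ext_subring[OF B(1)]]] by blast
  show ?thesis using r(1) 1 2 by blast
qed

end

section \<open>Noetherian subrings\<close>

text \<open>The ascending chain condition for the ideals generated by initial segments of a
  sequence, which needs no separate notion of an ideal of a subring.\<close>

definition noeth :: "('a, 'm) ring_scheme \<Rightarrow> 'a set \<Rightarrow> bool" where
  "noeth R A \<longleftrightarrow> (\<forall>f::nat \<Rightarrow> 'a. range f \<subseteq> A \<longrightarrow> (\<exists>n. f n \<in> lspan R A (f ` {..<n})))"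

context cring
begin

lemma lspan_lspan:
  assumes "subring A R" "Y \<subseteq> carrier R" "X \<subseteq> lspan R A Y"
  shows "lspan R A X \<subseteq> lspan R A Y"
proof (rule lspan_least)
  show "\<zero> \<in> lspan R A Y" by (rule lspan_zero)
  fix x e a assume "x \<in> lspan R A Y" "e \<in> A" "a \<in> X"
  then show "x \<oplus> e \<otimes> a \<in> lspan R A Y"
    using assms subring_closed(1)[OF assms(1)] by (intro lspan_add lspan_smult) auto
qed

text \<open>Two terms suffice: either the first is zero, or the second is a multiple of it.\<close>

lemma noeth_sfield:
  assumes F: "sfield R F"
  shows "noeth R F"
  unfolding noeth_def
proof (intro allI impI)
  fix f :: "nat \<Rightarrow> 'a" assume f: "range f \<subseteq> F"
  show "\<exists>n. f n \<in> lspan R F (f ` {..<n})"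
  proof (cases "f 0 = \<zero>")
    case True
    then show ?thesis using lspan_zero[of R F] by (intro exI[of _ 0]) simp
  next
    case False
    note Fc = subring_closed[OF sfield_subring[OF F]]
    obtain y where y: "y \<in> F" "y \<otimes> f 0 = \<one>"
      by (rule sfield_inverse[OF F _ False]) (use f in auto)
    have c: "y \<in> carrier R" "f 0 \<in> carrier R" "f 1 \<in> carrier R" "f 1 \<in> F"
      using f y Fc(1) by auto
    have "\<zero> \<oplus> (f 1 \<otimes> y) \<otimes> f 0 \<in> lspan R F (f ` {..<1})"
      using Fc(5)[OF c(4) y(1)] by (intro lspan.intros) auto
    moreover have "\<zero> \<oplus> (f 1 \<otimes> y) \<otimes> f 0 = f 1" using c y by (simp add: m_assoc)
    ultimately show ?thesis by metis
  qed
qed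

text \<open>Hilbert's basis theorem. Since \<open>x\<close> may satisfy relations over
  \<open>A\<close>, degree and leading coefficient refer to a shortest polynomial expression of an
  element, not to a polynomial.\<close>

lemma noeth_adjoin:
  assumes A: "subring A R" and x: "x \<in> carrier R" and noeth: "noeth R A"
  shows "noeth R (adjoin R A x)"
proof (rule ccontr)
  let ?B = "adjoin R A x"
  note B = adjoin_subring[OF A x]
  note Ac = subring_closed[OF A] and Bc = subring_closed[OF B]
  assume "\<not> noeth R ?B"
  then obtain f :: "nat \<Rightarrow> 'a" where f: "range f \<subseteq> ?B" "\<And>n. f n \<notin> lspan R ?B (f ` {..<n})"
    unfolding noeth_def by blast
  have fc: "f ` X \<subseteq> carrier R" for X using f(1) Bc(1) by blast
  let ?S = "\<lambda>n. lspan R ?B (f ` {..<n})"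
  let ?I = "\<Union>n. ?S n"
  have Smono: "?S m \<subseteq> ?S n" if "m \<le> n" for m n using that by (intro lspan_mono) auto
  have Sc: "?S n \<subseteq> carrier R" for n using lspan_closed[OF Bc(1) fc] .
  have SB: "?S n \<subseteq> ?B" for n
  proof (rule lspan_least)
    show "\<zero> \<in> ?B" by (rule Bc(2))
    fix y e a assume "y \<in> ?B" "e \<in> ?B" "a \<in> f ` {..<n}"
    then show "y \<oplus> e \<otimes> a \<in> ?B" using f(1) by (intro Bc(4,5)) auto
  qed
  have deg_ex: "\<exists>r. y \<in> pspan R A x r" if "y \<in> ?I" for y using that SB unfolding adjoin_def by blast
  \<comment> \<open>One more than the degree of a shortest expression; zero occurs only for the zero
    element.\<close>
  define deg where "deg y = (LEAST r. y \<in> pspan R A x r)" for y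
  have degI: "y \<in> pspan R A x (deg y)" if "y \<in> ?I" for y
    unfolding deg_def using deg_ex[OF that] by (rule LeastI_ex)
  \<comment> \<open>The classical choice: an element of least degree among those of the ideal not
    generated by the earlier ones. The condition looks at \<open>g\<close> only below
    \<open>n\<close>, as a recursive choice requires.\<close>
  define P :: "(nat \<Rightarrow> 'a) \<Rightarrow> nat \<Rightarrow> 'a \<Rightarrow> bool" where "P g n y \<longleftrightarrow> y \<in> ?I - lspan R ?B (g ` {..<n}) \<and>
    (\<forall>z\<in>?I - lspan R ?B (g ` {..<n}). deg y \<le> deg z)" for g n y
  have "\<exists>g. \<forall>n. P g n (g n)"
  proof (rule dependent_wellorder_choice[where P = P])
    fix r and g h :: "nat \<Rightarrow> 'a" and n
    assume "\<And>y. y < n \<Longrightarrow> g y = h y"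
    then have "g ` {..<n} = h ` {..<n}" by auto
    then show "P g n r = P h n r" unfolding P_def by metis
  next
    fix n and g :: "nat \<Rightarrow> 'a"
    assume "\<And>y. y < n \<Longrightarrow> P g y (g y)"
    then have gI: "g y \<in> ?I" if "y < n" for y using that unfolding P_def by blast
    have "\<exists>m. g ` {..<n} \<subseteq> ?S m"
      using gI
    proof (induction n)
      case (Suc n)
      then obtain m where m: "g ` {..<n} \<subseteq> ?S m" by (meson less_SucI)
      obtain m' where m': "g n \<in> ?S m'" using Suc.prems[of n] by blast
      have "g ` {..<Suc n} \<subseteq> ?S (max m m')"
        using m m' Smono[of m "max m m'"] Smono[of m' "max m m'"] by (auto simp: lessThan_Suc)
      then show ?case by blast
    qed simp
    then obtain m where "g ` {..<n} \<subseteq> ?S m" by blast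
    then have "lspan R ?B (g ` {..<n}) \<subseteq> ?S m" by (rule lspan_lspan[OF B fc])
    moreover have "f m \<in> ?S (Suc m)" using lspan_incl[OF B fc, of "f m"] by auto
    ultimately have "f m \<in> ?I - lspan R ?B (g ` {..<n})" using f(2) by blast
    from ex_has_least_nat[of "\<lambda>y. y \<in> ?I - lspan R ?B (g ` {..<n})", OF this, of deg]
    show "\<exists>r. P g n r" unfolding P_def by (simp only: Ball_def)
  qed
  then obtain g where g0: "P g n (g n)" for n by blast
  have g: "g n \<in> ?I" "g n \<notin> lspan R ?B (g ` {..<n})" for n using g0[of n] unfolding P_def by simp_all
  have gmin: "deg (g n) \<le> deg z" if "z \<in> ?I" "z \<notin> lspan R ?B (g ` {..<n})" for n z
    using g0[of n] that unfolding P_def by (metis DiffI)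
  have gc: "g ` X \<subseteq> carrier R" for X using g(1) Sc by blast
  have "deg (g n) \<noteq> 0" for n
  proof
    assume "deg (g n) = 0"
    then have "g n = \<zero>" using degI[OF g(1), of n] by simp
    then show False using g(2)[of n] lspan_zero[of R ?B] by simp
  qed
  then have "\<exists>e. deg (g n) = Suc e" for n using not0_implies_Suc by blast
  then obtain e where e: "\<And>n. deg (g n) = Suc (e n)" by metis
  have "\<exists>p a. g n = p \<oplus> a \<otimes> x [^] (e n) \<and> p \<in> pspan R A x (e n) \<and> a \<in> A" for n
    using degI[OF g(1), of n] e[of n] by auto
  then obtain p a where pa: "\<And>n. g n = p n \<oplus> a n \<otimes> x [^] (e n)" "\<And>n. p n \<in> pspan R A x (e n)"
    "\<And>n. a n \<in> A" by metis
  have emono: "e i \<le> e n" if "i < n" for i n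
  proof -
    have "lspan R ?B (g ` {..<i}) \<subseteq> lspan R ?B (g ` {..<n})" using that by (intro lspan_mono) auto
    then have "deg (g i) \<le> deg (g n)" using g(1,2)[of n] by (intro gmin) auto
    then show ?thesis using e by simp
  qed
  have "range a \<subseteq> A" using pa(3) by blast
  then obtain N where N: "a N \<in> lspan R A (a ` {..<N})" using noeth unfolding noeth_def by blast
  have pc: "p n \<in> carrier R" "a n \<in> carrier R" for n
    using pa(2,3)[of n] pspan_closed[OF Ac(1) x] Ac(1) by blast+
  \<comment> \<open>A combination of the leading coefficients \<open>a i\<close> is lifted to the
    \<open>g i\<close>, each multiplied by a power of \<open>x\<close> that raises its top exponent
    from \<open>e i\<close> to \<open>e N\<close>; this is where the monotonicity of
    \<open>e\<close> is used.\<close>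
  have "\<exists>h\<in>lspan R ?B (g ` {..<N}). \<exists>q\<in>pspan R A x (e N). h = q \<oplus> y \<otimes> x [^] (e N)"
    if "y \<in> lspan R A (a ` {..<N})" for y
    using that
  proof (induction rule: lspan.induct)
    case lspan_zero
    have "\<zero> = \<zero> \<oplus> \<zero> \<otimes> x [^] e N" using x by simp
    then show ?case using lspan.lspan_zero[of R ?B] pspan_zero[OF A x] by blast
  next
    case (lspan_step y c b)
    then obtain i where i: "i < N" "b = a i" by blast
    obtain h q where hq: "h \<in> lspan R ?B (g ` {..<N})" "q \<in> pspan R A x (e N)" "h = q \<oplus> y \<otimes> x [^] (e N)"
      using lspan_step by blast
    let ?k = "e N - e i"
    have k: "e i + ?k = e N" using emono[OF i(1)] by simp
    have cc: "c \<in> carrier R" "q \<in> carrier R" "y \<in> carrier R"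
      using lspan_step Ac(1) hq(2) pspan_closed[OF Ac(1) x] lspan_closed[OF Ac(1), of "a ` {..<N}"] pc(2)
      by blast+
    have "x [^] ?k \<otimes> (c \<otimes> p i) \<in> pspan R A x (e i + ?k)"
      by (intro pspan_pow_mult[OF A x] pspan_smult[OF A x] lspan_step pa)
    then have q': "q \<oplus> x [^] ?k \<otimes> (c \<otimes> p i) \<in> pspan R A x (e N)"
      unfolding k by (intro pspan_add[OF A x] hq)
    have "c \<otimes> x [^] ?k \<in> ?B"
      using adjoin_incl[OF A x] lspan_step(2) subring_pow[OF B] by (intro Bc(5)) auto
    then have h': "h \<oplus> (c \<otimes> x [^] ?k) \<otimes> g i \<in> lspan R ?B (g ` {..<N})"
      using hq(1) i(1) by (intro lspan.lspan_step) auto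
    have "x [^] e N = x [^] e i \<otimes> x [^] ?k" using nat_pow_mult[OF x, of "e i" ?k] k by simp
    then have "h \<oplus> (c \<otimes> x [^] ?k) \<otimes> g i =
        (q \<oplus> x [^] ?k \<otimes> (c \<otimes> p i)) \<oplus> (y \<oplus> c \<otimes> a i) \<otimes> x [^] (e N)"
      unfolding hq(3) pa(1)[of i] using cc pc x by (simp add: l_distr r_distr m_ac a_ac)
    then show ?case using h' q' i(2) by blast
  qed
  from this[OF N] obtain h q where hq: "h \<in> lspan R ?B (g ` {..<N})" "q \<in> pspan R A x (e N)"
    "h = q \<oplus> a N \<otimes> x [^] (e N)" by blast
  \<comment> \<open>This is g_N - h: the leading terms cancel, so its degree is too small for an
    element outside the span, yet it is outside because \<open>h\<close> is inside.\<close>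
  let ?u = "p N \<oplus> (\<ominus> \<one>) \<otimes> q"
  have c: "h \<in> carrier R" "q \<in> carrier R"
    using hq lspan_closed[OF Bc(1) gc] pspan_closed[OF Ac(1) x] by blast+
  have gN: "g N \<in> carrier R" using gc[of UNIV] by blast
  have u1: "?u = g N \<oplus> (\<ominus> \<one>) \<otimes> h"
    unfolding hq(3) pa(1)[of N] using c pc x
    by (simp add: l_minus minus_add a_ac r_neg r_neg1 r_neg2)
  have m1: "\<ominus> \<one> \<in> A" "\<ominus> \<one> \<in> ?B" using Ac(3,6) Bc(3,6) by auto
  have u2: "?u \<in> pspan R A x (e N)" by (intro pspan_add[OF A x] pspan_smult[OF A x] pa hq m1)
  have hI: "\<exists>m. h \<in> ?S m \<and> g N \<in> ?S m"
  proof -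
    have "\<exists>m. g ` {..<n} \<subseteq> ?S m" for n
    proof (induction n)
      case (Suc n)
      then obtain m where m: "g ` {..<n} \<subseteq> ?S m" by blast
      obtain m' where m': "g n \<in> ?S m'" using g(1)[of n] by blast
      have "g ` {..<Suc n} \<subseteq> ?S (max m m')"
        using m m' Smono[of m "max m m'"] Smono[of m' "max m m'"] by (auto simp: lessThan_Suc)
      then show ?case by blast
    qed simp
    then obtain m where m: "g ` {..<Suc N} \<subseteq> ?S m" by blast
    then have "g ` {..<N} \<subseteq> ?S m" by (auto simp: lessThan_Suc)
    then show ?thesis using lspan_lspan[OF B fc] hq(1) m by blast
  qed
  then have uI: "?u \<in> ?I"
    unfolding u1 using lspan_add[OF Bc(1) fc] lspan_smult[OF B fc _ m1(2)] by blast
  have "?u \<notin> lspan R ?B (g ` {..<N})"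
  proof
    assume u: "?u \<in> lspan R ?B (g ` {..<N})"
    have "g N = ?u \<oplus> h" unfolding u1 using gN c by (simp add: l_minus a_assoc l_neg)
    then show False using lspan_add[OF Bc(1) gc u hq(1)] g(2)[of N] by simp
  qed
  then have "Suc (e N) \<le> deg ?u" using gmin[OF uI] e by metis
  moreover have "deg ?u \<le> e N" unfolding deg_def using u2 by (rule Least_le)
  ultimately show False by simp
qed

section \<open>Finitely generated rings and finitely many primes\<close>

lemma noeth_ring_gen:
  assumes "finite T"
  shows "T \<subseteq> carrier R \<Longrightarrow> subring A R \<Longrightarrow> noeth R A \<Longrightarrow>
    \<exists>B. subring B R \<and> noeth R B \<and> A \<union> T \<subseteq> B \<and> (\<forall>C. subring C R \<longrightarrow> A \<union> T \<subseteq> C \<longrightarrow> B \<subseteq> C)"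
  using assms
proof (induction T rule: finite_induct)
  case (insert t T)
  then obtain B where B: "subring B R" "noeth R B" "A \<union> T \<subseteq> B"
    "\<And>C. subring C R \<Longrightarrow> A \<union> T \<subseteq> C \<Longrightarrow> B \<subseteq> C" by blast
  have t: "t \<in> carrier R" using insert by blast
  have "A \<union> insert t T \<subseteq> adjoin R B t" using adjoin_incl[OF B(1) t] B(3) by blast
  moreover have "adjoin R B t \<subseteq> C" if "subring C R" "A \<union> insert t T \<subseteq> C" for C
    using that B(4)[of C] by (intro adjoin_least) auto
  ultimately show ?case using adjoin_subring[OF B(1) t] noeth_adjoin[OF B(1) t B(2)] by blast
qed blast

lemma lspan_insert:
  assumes A: "subring A R" and I: "I \<subseteq> A" "lspan R A I \<subseteq> I" and x: "x \<in> A"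
    and z: "z \<in> lspan R A (insert x I)"
  shows "\<exists>i\<in>I. \<exists>a\<in>A. z = i \<oplus> a \<otimes> x"
  using z
proof (induction rule: lspan.induct)
  note Ac = subring_closed[OF A]
  case lspan_zero
  have "\<zero> \<in> I" using I(2) lspan.lspan_zero[of R A I] by blast
  moreover have "\<zero> = \<zero> \<oplus> \<zero> \<otimes> x" using Ac(7)[OF x] by simp
  ultimately show ?case using Ac(2) by blast
next
  note Ac = subring_closed[OF A]
  case (lspan_step y e b)
  then obtain i a where ia: "i \<in> I" "a \<in> A" "y = i \<oplus> a \<otimes> x" by blast
  have c: "i \<in> carrier R" "a \<in> carrier R" "x \<in> carrier R" "e \<in> carrier R" "b \<in> carrier R"
    using ia lspan_step I(1) x Ac(1) by blast+
  have II: "i \<in> lspan R A I" using lspan_incl[OF A _ ia(1)] I(1) Ac(1) by blast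
  show ?case
  proof (cases "b = x")
    case True
    have "y \<oplus> e \<otimes> b = i \<oplus> (a \<oplus> e) \<otimes> x" using ia c True by (simp add: l_distr a_ac)
    then show ?thesis using ia Ac(4)[OF ia(2) lspan_step(2)] by blast
  next
    case False
    then have "i \<oplus> e \<otimes> b \<in> lspan R A I" using lspan_step II by (intro lspan.lspan_step) auto
    moreover have "y \<oplus> e \<otimes> b = (i \<oplus> e \<otimes> b) \<oplus> a \<otimes> x" using ia c by (simp add: a_ac)
    ultimately show ?thesis using ia I(2) by blast
  qed
qed

text \<open>Noetherian induction: an ideal maximal among the bad ones is prime, and a prime ideal is
  not bad because it serves alone. The primes produced need not contain \<open>I\<close>; only the
  nilpotence modulo \<open>I\<close> of their intersection is asserted.\<close>

lemma noeth_radical_primes: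
  assumes A: "subring A R" and noeth: "noeth R A" and I: "I \<subseteq> A" "lspan R A I \<subseteq> I"
  shows "\<exists>\<P>. finite \<P> \<and> (\<forall>p\<in>\<P>. prime_in R A p) \<and>
    (\<forall>x\<in>A. (\<forall>p\<in>\<P>. x \<in> p) \<longrightarrow> (\<exists>n::nat. x [^] n \<in> I))"
proof (rule ccontr)
  note Ac = subring_closed[OF A]
  define good where "good J \<longleftrightarrow> (\<exists>\<P>. finite \<P> \<and> (\<forall>p\<in>\<P>. prime_in R A p) \<and>
    (\<forall>x\<in>A. (\<forall>p\<in>\<P>. x \<in> p) \<longrightarrow> (\<exists>n::nat. x [^] n \<in> J)))" for J
  define bad where "bad J \<longleftrightarrow> J \<subseteq> A \<and> lspan R A J \<subseteq> J \<and> \<not> good J" for J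
  assume "\<not> ?thesis"
  then have I0: "bad I" using I unfolding bad_def good_def by blast
  have step: "\<exists>J'. bad J' \<and> J \<subset> J'" if J: "bad J" for J
  proof (rule ccontr)
    assume no: "\<not> ?thesis"
    have J1: "J \<subseteq> A" "lspan R A J \<subseteq> J" using J by (auto simp: bad_def)
    have Jc: "J \<subseteq> carrier R" using J1 Ac(1) by blast
    have zJ: "\<zero> \<in> J" using J1(2) lspan.lspan_zero[of R A J] by blast
    have sm: "a \<otimes> x \<in> J" if "a \<in> A" "x \<in> J" for a x
      using that lspan_smult[OF A Jc lspan_incl[OF A Jc]] J1(2) by blast
    have ad: "x \<oplus> y \<in> J" if "x \<in> J" "y \<in> J" for x y
      using that lspan_add[OF Ac(1) Jc lspan_incl[OF A Jc] lspan_incl[OF A Jc]] J1(2) by blast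
    \<comment> \<open>The zeroth power is one, so the unit ideal is good with no primes at
      all.\<close>
    have one: "\<one> \<notin> J"
    proof
      assume "\<one> \<in> J"
      then have "x [^] (0::nat) \<in> J" for x by simp
      then have "good J" unfolding good_def by (intro exI[of _ "{}"]) blast
      then show False using J by (simp add: bad_def)
    qed
    have "prime_in R A J" unfolding prime_in_def
    proof (intro conjI ballI impI)
      fix x y assume xy: "x \<in> A" "y \<in> A" "x \<otimes> y \<in> J"
      show "x \<in> J \<or> y \<in> J"
      proof (rule ccontr)
        assume nn: "\<not> (x \<in> J \<or> y \<in> J)"
        have gd: "good (lspan R A (insert t J))" if t: "t \<in> A" "t \<notin> J" for t
        proof -
          have tJ: "insert t J \<subseteq> carrier R" using t Jc Ac(1) by blast
          have sub: "insert t J \<subseteq> lspan R A (insert t J)" using lspan_incl[OF A tJ] by blast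
          have "lspan R A (insert t J) \<subseteq> A"
          proof (rule lspan_least)
            show "\<zero> \<in> A" by (rule Ac(2))
            fix x e a assume "x \<in> A" "e \<in> A" "a \<in> insert t J"
            then show "x \<oplus> e \<otimes> a \<in> A" using t J1(1) by (intro Ac(4,5)) auto
          qed
          moreover have "lspan R A (lspan R A (insert t J)) \<subseteq> lspan R A (insert t J)"
            using lspan_lspan[OF A tJ] by blast
          moreover have "J \<subset> lspan R A (insert t J)" using sub t by blast
          ultimately show ?thesis using no unfolding bad_def by blast
        qed
        obtain P1 where P1: "finite P1" "\<forall>p\<in>P1. prime_in R A p"
          "\<forall>z\<in>A. (\<forall>p\<in>P1. z \<in> p) \<longrightarrow> (\<exists>n::nat. z [^] n \<in> lspan R A (insert x J))"
          using gd[OF xy(1)] nn unfolding good_def by blast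
        obtain P2 where P2: "finite P2" "\<forall>p\<in>P2. prime_in R A p"
          "\<forall>z\<in>A. (\<forall>p\<in>P2. z \<in> p) \<longrightarrow> (\<exists>n::nat. z [^] n \<in> lspan R A (insert y J))"
          using gd[OF xy(2)] nn unfolding good_def by blast
        have "\<exists>n::nat. z [^] n \<in> J" if z: "z \<in> A" "\<forall>p\<in>P1 \<union> P2. z \<in> p" for z
        proof -
          obtain n m where n: "z [^] (n::nat) \<in> lspan R A (insert x J)"
            and m: "z [^] (m::nat) \<in> lspan R A (insert y J)" using P1(3) P2(3) z by blast
          obtain i a where ia: "i \<in> J" "a \<in> A" "z [^] n = i \<oplus> a \<otimes> x"
            using lspan_insert[OF A J1 xy(1) n] by blast
          obtain j b where jb: "j \<in> J" "b \<in> A" "z [^] m = j \<oplus> b \<otimes> y"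
            using lspan_insert[OF A J1 xy(2) m] by blast
          have c: "i \<in> carrier R" "a \<in> carrier R" "x \<in> carrier R" "j \<in> carrier R" "b \<in> carrier R"
            "y \<in> carrier R" "z \<in> carrier R" "z [^] m \<in> A"
            using ia jb xy z Jc Ac(1) subring_pow[OF A z(1)] by blast+
          \<comment> \<open>A product of an element of J + (x) and one of J + (y) lies in
            \<open>J\<close>, as x y does.\<close>
          have "z [^] (n + m) = z [^] n \<otimes> z [^] m" using c by (simp add: nat_pow_mult)
          also have "\<dots> = z [^] m \<otimes> i \<oplus> (a \<otimes> x) \<otimes> z [^] m"
            unfolding ia(3) using c by (simp add: r_distr m_ac)
          also have "(a \<otimes> x) \<otimes> z [^] m = (a \<otimes> x) \<otimes> j \<oplus> (a \<otimes> b) \<otimes> (x \<otimes> y)"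
            unfolding jb(3) using c by (simp add: r_distr m_ac)
          finally show ?thesis
            using ad sm ia jb xy c(8) Ac(5) by metis
        qed
        then have "good J" unfolding good_def using P1(1,2) P2(1,2) by (intro exI[of _ "P1 \<union> P2"]) blast
        then show False using J by (simp add: bad_def)
      qed
    qed (use J1 zJ one sm ad in auto)
    moreover have "x [^] (1::nat) \<in> J" if "x \<in> J" for x using that Jc by (simp add: subset_eq)
    ultimately have "good J" unfolding good_def by (intro exI[of _ "{J}"]) blast
    then show False using J by (simp add: bad_def)
  qed
  \<comment> \<open>If no bad ideal is maximal, the bad ideals contain a strictly ascending
    sequence; new elements picked along it contradict \<open>noeth\<close>.\<close>
  obtain J where J: "\<And>n. bad (J n)" "\<And>n. J n \<subset> J (Suc n)"
    using dependent_nat_choice[of "\<lambda>_. bad" "\<lambda>_ X Y. X \<subset> Y"] I0 step by metis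
  have J2: "J n \<subseteq> J (Suc n)" for n using J(2)[of n] by (rule psubset_imp_subset)
  have mono: "J m \<subseteq> J n" if "m \<le> n" for m n using J2 that by (rule lift_Suc_mono_le)
  have "\<exists>a. a \<in> J (Suc n) \<and> a \<notin> J n" for n using J(2)[of n] by blast
  then obtain a where a: "\<And>n. a n \<in> J (Suc n)" "\<And>n. a n \<notin> J n" by metis
  have "range a \<subseteq> A" using a(1) J(1) unfolding bad_def by blast
  then obtain n where n: "a n \<in> lspan R A (a ` {..<n})" using noeth unfolding noeth_def by blast
  have "a ` {..<n} \<subseteq> J n" using a(1) mono by (meson Suc_leI image_subsetI lessThan_iff subsetD)
  then have "lspan R A (a ` {..<n}) \<subseteq> lspan R A (J n)" by (rule lspan_mono[OF order_refl])
  then show False using n a(2) J(1)[of n] unfolding bad_def by blast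
qed

text \<open>Otherwise a product of one element from each \<open>p\<close> outside \<open>q\<close>
  lies in all the \<open>p\<close> and outside \<open>q\<close>, while some power of it lies in
  \<open>q\<close>.\<close>

lemma prime_contains_finite:
  assumes q: "prime_in R A q" and A: "subring A R"
    and fin: "finite \<P>" and \<P>: "\<And>p. p \<in> \<P> \<Longrightarrow> prime_in R A p"
    and nil: "\<And>x. x \<in> A \<Longrightarrow> (\<And>p. p \<in> \<P> \<Longrightarrow> x \<in> p) \<Longrightarrow> \<exists>n::nat. x [^] n \<in> q"
  shows "\<exists>p\<in>\<P>. p \<subseteq> q"
proof (rule ccontr)
  assume no: "\<not> ?thesis"
  have "\<exists>y\<in>A - q. \<forall>p\<in>\<P>. y \<in> p"
    using fin \<P> no
  proof (induction \<P> rule: finite_induct)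
    case empty
    then show ?case using subring_closed(3)[OF A] prime_inD(3)[OF q] by blast
  next
    case (insert p \<P>)
    then obtain y where y: "y \<in> A - q" "\<forall>p\<in>\<P>. y \<in> p" by auto
    obtain x where x: "x \<in> p" "x \<notin> q" using insert.prems(2) by blast
    have p: "prime_in R A p" using insert by blast
    have xA: "x \<in> A" using x prime_inD(1)[OF p] by blast
    have "y \<otimes> x \<in> A - q" using x xA y subring_closed(5)[OF A] prime_inD(6)[OF q] by blast
    moreover have "y \<otimes> x \<in> p" using prime_inD(5)[OF p] y x by blast
    moreover have "y \<otimes> x \<in> p'" if "p' \<in> \<P>" for p'
    proof -
      have "y \<otimes> x = x \<otimes> y" using y xA subring_closed(7)[OF A] m_comm by blast
      then show ?thesis using prime_inD(5)[OF insert.prems(1)[of p'], of x y] that y xA by simp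
    qed
    ultimately show ?case by blast
  qed
  then obtain y where y: "y \<in> A" "y \<notin> q" "\<forall>p\<in>\<P>. y \<in> p" by blast
  then obtain n where "y [^] (n::nat) \<in> q" using nil by blast
  then show False using prime_in_pow[OF A q y(1)] y(2) by blast
qed

end

section \<open>Finiteness of the minimal primes of a compositum\<close>

context field_tensor
begin

text \<open>The compositum is a localization of the noetherian ring B = M[T]. A minimal prime is
  determined by its restriction to \<open>B\<close>, and that restriction belongs to the finite set
  of primes whose intersection is nil.\<close>

lemma finite_minimal_primes:
  assumes T: "finite T" "T \<subseteq> L"
  shows "finite {q. minimal_prime_in R (ext (fgen R (K \<union> T))) q}"
proof -
  let ?A = "fgen R (K \<union> T)"
  have A: "intermediate ?A"
    using fgen_sfield[OF L, of "K \<union> T"] fgen_incl[of "K \<union> T"] fgen_least[OF L, of "K \<union> T"] T KL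
    by (auto simp: intermediate_def)
  have Tc: "T \<subseteq> carrier R" using T Lc by blast
  obtain B where B: "subring B R" "noeth R B" "M \<union> T \<subseteq> B"
    "\<And>C. subring C R \<Longrightarrow> M \<union> T \<subseteq> C \<Longrightarrow> B \<subseteq> C"
    using noeth_ring_gen[OF T(1) Tc Ms noeth_sfield[OF M]] by blast
  note Bc = subring_closed[OF B(1)] and Ac = subring_closed[OF intermediateD(2)[OF A]]
    and Xc = subring_closed[OF ext_subring[OF A]]
  have BX: "B \<subseteq> ext ?A"
    using B(4)[OF ext_subring[OF A]] ext_incl[OF A] fgen_incl[of "K \<union> T"] by blast
  \<comment> \<open>Denominators are taken in \<open>B \<inter> ?A\<close>: there they are units of
    the field \<open>?A\<close>, so clearing them loses nothing.\<close>
  let ?F = "{x \<in> ?A. \<exists>g\<in>B \<inter> ?A. g \<noteq> \<zero> \<and> g \<otimes> x \<in> B}"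
  have nz: "g \<otimes> h \<noteq> \<zero>" if "g \<in> ?A" "h \<in> ?A" "g \<noteq> \<zero>" "h \<noteq> \<zero>" for g h
    using sfield_integral[OF intermediateD(1)[OF A] that(1), of h] that Ac(1) by blast
  have "sfield R ?F" unfolding sfield_def
  proof (intro conjI subringI ballI)
    show "?F \<subseteq> carrier R" using Ac(1) by blast
    show one: "\<one> \<noteq> \<zero>" using L by (simp add: sfield_def)
    show "\<one> \<in> ?F" using Ac(3) Bc(3) one by (auto intro!: bexI[of _ \<one>])
    { fix x y assume "x \<in> ?F" "y \<in> ?F"
      then obtain g h where g: "x \<in> ?A" "g \<in> B" "g \<in> ?A" "g \<noteq> \<zero>" "g \<otimes> x \<in> B"
        and h: "y \<in> ?A" "h \<in> B" "h \<in> ?A" "h \<noteq> \<zero>" "h \<otimes> y \<in> B" by blast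
      have c: "x \<in> carrier R" "y \<in> carrier R" "g \<in> carrier R" "h \<in> carrier R" using g h Ac(1) by blast+
      have gh: "g \<otimes> h \<in> B \<inter> ?A" "g \<otimes> h \<noteq> \<zero>" using nz[of g h] g h Ac(5) Bc(5) by auto
      have 1: "(g \<otimes> h) \<otimes> (x \<oplus> y) = h \<otimes> (g \<otimes> x) \<oplus> g \<otimes> (h \<otimes> y)" using c by (simp add: r_distr m_ac)
      have "(g \<otimes> h) \<otimes> (x \<oplus> y) \<in> B" unfolding 1 by (rule Bc(4)[OF Bc(5)[OF h(2) g(5)] Bc(5)[OF g(2) h(5)]])
      then show "x \<oplus> y \<in> ?F" using gh Ac(4)[OF g(1) h(1)] by blast
      have 2: "(g \<otimes> h) \<otimes> (x \<otimes> y) = (g \<otimes> x) \<otimes> (h \<otimes> y)" using c by (simp add: m_ac)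
      have "(g \<otimes> h) \<otimes> (x \<otimes> y) \<in> B" unfolding 2 by (rule Bc(5)[OF g(5) h(5)])
      then show "x \<otimes> y \<in> ?F" using gh Ac(5)[OF g(1) h(1)] by blast
      have "g \<otimes> (\<ominus> x) = \<ominus> (g \<otimes> x)" using c by (simp add: r_minus)
      then have "g \<otimes> (\<ominus> x) \<in> B" using Bc(6)[OF g(5)] by simp
      then show "\<ominus> x \<in> ?F" using g Ac(6)[OF g(1)] by blast
    }
    fix x assume "x \<in> ?F - {\<zero>}"
    then obtain g where g: "x \<in> ?A" "g \<in> B" "g \<in> ?A" "g \<noteq> \<zero>" "g \<otimes> x \<in> B" "x \<noteq> \<zero>" by blast
    obtain y where y: "y \<in> ?A" "x \<otimes> y = \<one>" by (rule sfield_inverse[OF intermediateD(1)[OF A] g(1,6)])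
    have c: "x \<in> carrier R" "y \<in> carrier R" "g \<in> carrier R" using g y Ac(1) by blast+
    have "(g \<otimes> x) \<otimes> y \<in> B" using c y g by (simp add: m_assoc)
    then have "y \<in> ?F" using y(1) g nz[of g x] Ac(5)[OF g(3,1)] by blast
    then show "\<exists>y\<in>?F. x \<otimes> y = \<one>" using y by blast
  qed
  moreover have "K \<union> T \<subseteq> ?F"
  proof
    fix x assume x: "x \<in> K \<union> T"
    then have "x \<in> B" "x \<in> ?A" using B(3) KM fgen_incl[of "K \<union> T"] by blast+
    moreover have "\<one> \<otimes> x \<in> B" using \<open>x \<in> B\<close> Bc(7) by simp
    moreover have "\<one> \<noteq> \<zero>" using L by (simp add: sfield_def)
    ultimately show "x \<in> ?F" using Bc(3) Ac(3) by blast
  qed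
  ultimately have AF: "?A \<subseteq> ?F" by (rule fgen_least)
  have den: "\<exists>g\<in>B \<inter> ?A. g \<noteq> \<zero> \<and> g \<otimes> x \<in> B" if "x \<in> ext ?A" for x
    using that
  proof (induction rule: lspan.induct)
    case lspan_zero
    have "\<one> \<noteq> \<zero>" using L by (simp add: sfield_def)
    then show ?case using Bc(2,3) Ac(3) by (intro bexI[of _ \<one>]) auto
  next
    case (lspan_step x e m)
    then obtain g where g: "g \<in> B" "g \<in> ?A" "g \<noteq> \<zero>" "g \<otimes> x \<in> B" by blast
    obtain h where h: "h \<in> B" "h \<in> ?A" "h \<noteq> \<zero>" "h \<otimes> e \<in> B" using AF lspan_step by blast
    have mB: "m \<in> B" using lspan_step B(3) by blast
    have c: "x \<in> carrier R" "e \<in> carrier R" "m \<in> carrier R" "g \<in> carrier R" "h \<in> carrier R"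
      using g h lspan_step Ac(1) Mc Xc(1) by blast+
    have 1: "(g \<otimes> h) \<otimes> (x \<oplus> e \<otimes> m) = h \<otimes> (g \<otimes> x) \<oplus> (g \<otimes> m) \<otimes> (h \<otimes> e)"
      using c by (simp add: r_distr m_ac)
    have "(g \<otimes> h) \<otimes> (x \<oplus> e \<otimes> m) \<in> B" unfolding 1 by (rule Bc(4)[OF Bc(5)[OF h(1) g(4)] Bc(5)[OF Bc(5)[OF g(1) mB] h(4)]])
    then show ?case using nz[of g h] g h Bc(5) Ac(5) by blast
  qed
  obtain \<P> where \<P>: "finite \<P>" "\<And>p. p \<in> \<P> \<Longrightarrow> prime_in R B p"
    "\<And>x. x \<in> B \<Longrightarrow> (\<And>p. p \<in> \<P> \<Longrightarrow> x \<in> p) \<Longrightarrow> \<exists>n::nat. x [^] n = \<zero>"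
  proof -
    have z: "lspan R B {\<zero>} \<subseteq> {\<zero>}" using Bc(7) by (intro lspan_least) auto
    have "{\<zero>} \<subseteq> B" using Bc(2) by blast
    from noeth_radical_primes[OF B(1,2) this z] show thesis using that by (metis singletonD)
  qed
  \<comment> \<open>Some prime of the finite set lies below q \<inter> B. Equality holds because the
    local nilpotence at \<open>q\<close>, after clearing the denominator of \<open>s\<close>, takes
    place inside \<open>B\<close>.\<close>
  have mem: "q \<inter> B \<in> \<P>" if q: "minimal_prime_in R (ext ?A) q" for q
  proof -
    note qp = minimal_prime_inD(1)[OF q]
    have qB: "prime_in R B (q \<inter> B)" by (rule prime_in_Int[OF ext_subring[OF A] BX qp B(1)])
    have "\<exists>p\<in>\<P>. p \<subseteq> q \<inter> B"
      using \<P>(3) prime_inD(2)[OF qB] by (intro prime_contains_finite[OF qB B(1) \<P>(1,2)]) metis+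
    then obtain p where p: "p \<in> \<P>" "p \<subseteq> q \<inter> B" by blast
    note pp = \<P>(2)[OF p(1)]
    have "q \<inter> B \<subseteq> p"
    proof
      fix z assume z: "z \<in> q \<inter> B"
      obtain s m where s: "s \<in> ext ?A" "s \<notin> q" "s \<otimes> z [^] (m::nat) = \<zero>"
        using minimal_prime_inD(2)[OF q] z by blast
      obtain g where g: "g \<in> B" "g \<in> ?A" "g \<noteq> \<zero>" "g \<otimes> s \<in> B" using den[OF s(1)] by blast
      obtain y where y: "y \<in> ?A" "y \<otimes> g = \<one>" by (rule sfield_inverse[OF intermediateD(1)[OF A] g(2,3)])
      have c: "g \<in> carrier R" "y \<in> carrier R" "s \<in> carrier R" "z \<in> carrier R"
        using g y s z Ac(1) Xc(1) Bc(1) by blast+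
      have "y \<otimes> (g \<otimes> s) = s" using c y by (simp add: m_assoc[symmetric])
      then have gs: "g \<otimes> s \<notin> q" using prime_inD(5)[OF qp, of y "g \<otimes> s"] y(1) ext_incl(1)[OF A] s(2) by auto
      have "(g \<otimes> s) \<otimes> z [^] m = g \<otimes> (s \<otimes> z [^] m)" using c by (simp add: m_assoc)
      then have "(g \<otimes> s) \<otimes> z [^] m \<in> p" using s(3) c prime_inD(2)[OF pp] by simp
      then have "z [^] m \<in> p"
        using prime_inD(6)[OF pp g(4) subring_pow[OF B(1), of z m]] gs p(2) z by blast
      then show "z \<in> p" using prime_in_pow[OF B(1) pp] z by blast
    qed
    then show ?thesis using p by (simp add: subset_antisym)
  qed
  have inj: "q \<subseteq> q'" if q: "minimal_prime_in R (ext ?A) q" and q': "minimal_prime_in R (ext ?A) q'"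
    and eq: "q \<inter> B = q' \<inter> B" for q q'
  proof
    fix x assume x: "x \<in> q"
    note qp = minimal_prime_inD(1)[OF q] and qp' = minimal_prime_inD(1)[OF q']
    have xX: "x \<in> ext ?A" using x prime_inD(1)[OF qp] by blast
    obtain g where g: "g \<in> B" "g \<in> ?A" "g \<noteq> \<zero>" "g \<otimes> x \<in> B" using den[OF xX] by blast
    obtain y where y: "y \<in> ?A" "y \<otimes> g = \<one>" by (rule sfield_inverse[OF intermediateD(1)[OF A] g(2,3)])
    have c: "g \<in> carrier R" "y \<in> carrier R" "x \<in> carrier R"
      using g y xX Ac(1) Xc(1) by blast+
    have "g \<otimes> x \<in> q" using prime_inD(5)[OF qp _ x] g(1) BX by blast
    then have "g \<otimes> x \<in> q'" using eq g(4) by blast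
    then have "y \<otimes> (g \<otimes> x) \<in> q'" using prime_inD(5)[OF qp', of y] y(1) ext_incl(1)[OF A] by blast
    then show "x \<in> q'" using c y by (simp add: m_assoc[symmetric])
  qed
  have "inj_on (\<lambda>q. q \<inter> B) {q. minimal_prime_in R (ext ?A) q}"
    using inj by (intro inj_onI) blast
  moreover have "(\<lambda>q. q \<inter> B) ` {q. minimal_prime_in R (ext ?A) q} \<subseteq> \<P>" using mem by blast
  ultimately show ?thesis using \<P>(1) by (meson finite_subset inj_on_finite)
qed

end

section \<open>A periodic prime\<close>

locale difference_tensor = field_tensor +
  fixes \<sigma> :: "'a \<Rightarrow> 'a" and S :: "'a set"
  assumes hom: "\<sigma> \<in> ring_hom R R" and inj: "inj_on \<sigma> (carrier R)"
    and \<sigma>L: "\<sigma> ` L = L" and \<sigma>M: "\<sigma> ` M = M" and \<sigma>K: "\<sigma> ` K = K"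
    and S: "finite S" "S \<subseteq> L"
begin

lemma \<sigma>_simps:
  "x \<in> carrier R \<Longrightarrow> \<sigma> x \<in> carrier R"
  "x \<in> carrier R \<Longrightarrow> y \<in> carrier R \<Longrightarrow> \<sigma> (x \<oplus> y) = \<sigma> x \<oplus> \<sigma> y"
  "x \<in> carrier R \<Longrightarrow> y \<in> carrier R \<Longrightarrow> \<sigma> (x \<otimes> y) = \<sigma> x \<otimes> \<sigma> y"
  "\<sigma> \<one> = \<one>" "\<sigma> \<zero> = \<zero>"
  using ring_hom_closed[OF hom] ring_hom_add[OF hom] ring_hom_mult[OF hom] ring_hom_one[OF hom]
    ring_hom_zero[OF hom ring_axioms ring_axioms] by auto

lemma \<sigma>_minus: "x \<in> carrier R \<Longrightarrow> \<sigma> (\<ominus> x) = \<ominus> \<sigma> x"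
proof -
  assume x: "x \<in> carrier R"
  have "\<sigma> (\<ominus> x) \<oplus> \<sigma> x = \<zero>" using x \<sigma>_simps(2)[of "\<ominus> x" x] by (simp add: l_neg \<sigma>_simps)
  then show ?thesis using x by (simp add: minus_equality \<sigma>_simps)
qed

lemma \<sigma>_pow: "x \<in> carrier R \<Longrightarrow> \<sigma> (x [^] (n::nat)) = \<sigma> x [^] n"
  by (induction n) (simp_all add: \<sigma>_simps)

lemma \<sigma>_eq_iff: "x \<in> carrier R \<Longrightarrow> y \<in> carrier R \<Longrightarrow> \<sigma> x = \<sigma> y \<longleftrightarrow> x = y"
  using inj by (auto dest: inj_onD)

lemma \<sigma>_eq_zero: "x \<in> carrier R \<Longrightarrow> \<sigma> x = \<zero> \<longleftrightarrow> x = \<zero>"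
  using \<sigma>_eq_iff[of x \<zero>] by (simp add: \<sigma>_simps)

lemma \<sigma>_lspan:
  assumes "E \<subseteq> carrier R" "A \<subseteq> carrier R"
  shows "\<sigma> ` lspan R E A = lspan R (\<sigma> ` E) (\<sigma> ` A)"
proof
  have "\<sigma> x \<in> lspan R (\<sigma> ` E) (\<sigma> ` A)" if "x \<in> lspan R E A" for x
    using that
  proof (induction rule: lspan.induct)
    case lspan_zero
    then show ?case by (simp add: \<sigma>_simps lspan.lspan_zero)
  next
    case (lspan_step x e a)
    have "x \<in> carrier R" "e \<in> carrier R" "a \<in> carrier R"
      using lspan_step assms lspan_closed[OF assms] by blast+
    then show ?case using lspan_step by (simp add: \<sigma>_simps lspan.lspan_step)
  qed
  then show "\<sigma> ` lspan R E A \<subseteq> lspan R (\<sigma> ` E) (\<sigma> ` A)" by blast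
  show "lspan R (\<sigma> ` E) (\<sigma> ` A) \<subseteq> \<sigma> ` lspan R E A"
  proof (rule lspan_least)
    show "\<zero> \<in> \<sigma> ` lspan R E A" using \<sigma>_simps(5) lspan_zero[of R E A] by (metis imageI)
    fix y f b assume "y \<in> \<sigma> ` lspan R E A" "f \<in> \<sigma> ` E" "b \<in> \<sigma> ` A"
    then obtain x e a where d: "x \<in> lspan R E A" "y = \<sigma> x" "e \<in> E" "f = \<sigma> e" "a \<in> A" "b = \<sigma> a" by blast
    have "x \<in> carrier R" "e \<in> carrier R" "a \<in> carrier R"
      using d assms lspan_closed[OF assms] by blast+
    then have "y \<oplus> f \<otimes> b = \<sigma> (x \<oplus> e \<otimes> a)" using d by (simp add: \<sigma>_simps)
    then show "y \<oplus> f \<otimes> b \<in> \<sigma> ` lspan R E A" using d lspan_step[of x R E A e a] by blast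
  qed
qed

lemma \<sigma>_sfield:
  assumes "sfield R E"
  shows "sfield R (\<sigma> ` E)"
  unfolding sfield_def
proof (intro conjI subringI ballI)
  note Ec = subring_closed[OF sfield_subring[OF assms]]
  show "\<sigma> ` E \<subseteq> carrier R" using Ec(1) \<sigma>_simps(1) by blast
  show "\<one> \<noteq> \<zero>" using assms by (simp add: sfield_def)
  show "\<one> \<in> \<sigma> ` E" using Ec(3) \<sigma>_simps(4) by (metis imageI)
  { fix x y assume "x \<in> \<sigma> ` E" "y \<in> \<sigma> ` E"
    then obtain a b where d: "a \<in> E" "b \<in> E" "x = \<sigma> a" "y = \<sigma> b" by blast
    have c: "a \<in> carrier R" "b \<in> carrier R" using d Ec(1) by blast+
    show "x \<oplus> y \<in> \<sigma> ` E" using d c \<sigma>_simps(2)[of a b] Ec(4)[of a b] by (metis imageI)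
    show "x \<otimes> y \<in> \<sigma> ` E" using d c \<sigma>_simps(3)[of a b] Ec(5)[of a b] by (metis imageI)
    show "\<ominus> x \<in> \<sigma> ` E" using d c \<sigma>_minus[of a] Ec(6)[of a] by (metis imageI)
  }
  fix x assume "x \<in> \<sigma> ` E - {\<zero>}"
  then obtain a where a: "a \<in> E" "x = \<sigma> a" "a \<noteq> \<zero>" using \<sigma>_simps(5) by blast
  obtain b where b: "b \<in> E" "a \<otimes> b = \<one>" by (rule sfield_inverse[OF assms a(1,3)])
  have "\<sigma> a \<otimes> \<sigma> b = \<one>"
    using b a Ec(7)[of a] Ec(7)[of b] \<sigma>_simps(3)[of a b] \<sigma>_simps(4) by simp
  then show "\<exists>y\<in>\<sigma> ` E. x \<otimes> y = \<one>" using a b by blast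
qed

text \<open>For the harder inclusion the generated field is pulled back to \<open>L\<close>. The
  pullback is a field because the image of the inverse taken in \<open>L\<close> must be the inverse
  taken in the generated field.\<close>

lemma \<sigma>_fgen:
  assumes "T \<subseteq> L"
  shows "\<sigma> ` fgen R T = fgen R (\<sigma> ` T)"
proof
  note FT = fgen_sfield[OF L assms]
  show "fgen R (\<sigma> ` T) \<subseteq> \<sigma> ` fgen R T"
    using fgen_incl[of T] by (intro fgen_least \<sigma>_sfield FT) blast
  have sT: "\<sigma> ` T \<subseteq> L" using assms \<sigma>L by blast
  note F = fgen_sfield[OF L sT]
  let ?F = "fgen R (\<sigma> ` T)"
  note Fc = subring_closed[OF sfield_subring[OF F]] and LC = subring_closed[OF Ls]
  let ?P = "{x \<in> L. \<sigma> x \<in> ?F}"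
  have "sfield R ?P" unfolding sfield_def
  proof (intro conjI subringI ballI)
    show "?P \<subseteq> carrier R" using Lc by blast
    show "\<one> \<noteq> \<zero>" using L by (simp add: sfield_def)
    show "\<one> \<in> ?P" using LC(3) Fc(3) \<sigma>_simps(4) by simp
    { fix x y assume "x \<in> ?P" "y \<in> ?P"
      then have d: "x \<in> L" "y \<in> L" "\<sigma> x \<in> ?F" "\<sigma> y \<in> ?F" by auto
      have c: "x \<in> carrier R" "y \<in> carrier R" using d Lc by blast+
      show "x \<oplus> y \<in> ?P" using d c \<sigma>_simps(2) LC(4) Fc(4) by simp
      show "x \<otimes> y \<in> ?P" using d c \<sigma>_simps(3) LC(5) Fc(5) by simp
      show "\<ominus> x \<in> ?P" using d c \<sigma>_minus LC(6) Fc(6) by simp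
    }
    fix x assume "x \<in> ?P - {\<zero>}"
    then have x: "x \<in> L" "\<sigma> x \<in> ?F" "x \<noteq> \<zero>" by auto
    obtain y where y: "y \<in> L" "x \<otimes> y = \<one>" by (rule sfield_inverse[OF L x(1,3)])
    have c: "x \<in> carrier R" "y \<in> carrier R" using x y Lc by blast+
    have sx: "\<sigma> x \<noteq> \<zero>" using x c \<sigma>_eq_zero by simp
    obtain z where z: "z \<in> ?F" "z \<otimes> \<sigma> x = \<one>" by (rule sfield_inverse[OF F x(2) sx])
    have "\<sigma> x \<otimes> \<sigma> y = \<one>" using y c \<sigma>_simps(3)[of x y] \<sigma>_simps(4) by simp
    then have "\<sigma> y = z" using z Fc(7) c \<sigma>_simps(1) inv_unique by blast
    then show "\<exists>y\<in>?P. x \<otimes> y = \<one>" using y z by blast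
  qed
  then have "fgen R T \<subseteq> ?P"
    using fgen_incl[of "\<sigma> ` T"] assms by (intro fgen_least) blast+
  then show "\<sigma> ` fgen R T \<subseteq> ?F" by blast
qed

lemma \<sigma>_surj: "\<sigma> ` carrier R = carrier R"
  using \<sigma>_lspan[OF Lc Mc] \<sigma>L \<sigma>M gen by simp

text \<open>\<open>low n\<close> and \<open>full n\<close> are the fields B_n and A_n of the
  overview; the index range \<open>{1..n}\<close> is empty for \<open>n = 0\<close>, so
  \<open>low 0\<close> is just \<open>K\<close>.\<close>

definition low :: "nat \<Rightarrow> 'a set" where
  "low n = fgen R (K \<union> (\<Union>i\<in>{1..n}. (\<sigma> ^^ i) ` S))"

definition full :: "nat \<Rightarrow> 'a set" where
  "full n = fgen R (K \<union> (\<Union>i\<le>n. (\<sigma> ^^ i) ` S))"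

lemma \<sigma>_pow_L: "x \<in> L \<Longrightarrow> (\<sigma> ^^ i) x \<in> L"
  by (induction i) (use \<sigma>L in auto)

lemma \<sigma>_pow_S: "(\<sigma> ^^ i) ` S \<subseteq> L"
  using \<sigma>_pow_L S(2) by blast

lemma intermediate_fgen: "T \<subseteq> L \<Longrightarrow> intermediate (fgen R (K \<union> T))"
  unfolding intermediate_def
  using fgen_sfield[OF L, of "K \<union> T"] fgen_incl[of "K \<union> T"] fgen_least[OF L, of "K \<union> T"] KL by auto

lemma intermediate_low: "intermediate (low n)"
  unfolding low_def using \<sigma>_pow_S by (intro intermediate_fgen) blast

lemma intermediate_full: "intermediate (full n)"
  unfolding full_def using \<sigma>_pow_S by (intro intermediate_fgen) blast

lemma low_mono: "low n \<subseteq> low (Suc n)"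
  unfolding low_def by (intro fgen_mono Un_mono UN_mono) auto

lemma full_mono: "m \<le> n \<Longrightarrow> full m \<subseteq> full n"
  unfolding full_def by (intro fgen_mono Un_mono UN_mono) auto

lemma low_full: "low n \<subseteq> full n"
  unfolding low_def full_def by (intro fgen_mono Un_mono UN_mono) auto

lemma full_low: "full n = fgen R (low n \<union> S)"
proof -
  have "(\<Union>i\<le>n. (\<sigma> ^^ i) ` S) = (\<Union>i\<in>{1..n}. (\<sigma> ^^ i) ` S) \<union> S"
  proof -
    have "{..n} = insert 0 {1..n}" by auto
    then show ?thesis by auto
  qed
  then have "full n = fgen R ((K \<union> (\<Union>i\<in>{1..n}. (\<sigma> ^^ i) ` S)) \<union> S)"
    unfolding full_def by (simp add: Un_assoc)
  also have "\<dots> = fgen R (low n \<union> S)"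
    unfolding low_def using \<sigma>_pow_S S(2) KL by (intro fgen_Un[symmetric, OF L]) blast
  finally show ?thesis .
qed

lemma \<sigma>_full: "\<sigma> ` full n = low (Suc n)"
proof -
  have "\<sigma> ` (\<Union>i\<le>n. (\<sigma> ^^ i) ` S) = (\<Union>i\<le>n. (\<sigma> ^^ Suc i) ` S)"
    by (simp add: image_UN image_comp)
  also have "\<dots> = (\<Union>i\<in>Suc ` {..n}. (\<sigma> ^^ i) ` S)" by blast
  also have "Suc ` {..n} = {1..Suc n}" by (simp add: image_Suc_atMost)
  finally show ?thesis
    unfolding full_def low_def using \<sigma>_pow_S KL \<sigma>K by (subst \<sigma>_fgen) (auto simp: image_Un)
qed

lemma \<sigma>_ext: "intermediate E \<Longrightarrow> \<sigma> ` ext E = ext (\<sigma> ` E)"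
  using \<sigma>_lspan[OF _ Mc] subring_closed(1)[OF intermediateD(2)] \<sigma>M by simp

section \<open>Transport of minimal primes along \<sigma>\<close>

lemma minimal_prime_image:
  assumes A: "subring A R" and q: "minimal_prime_in R A q"
  shows "minimal_prime_in R (\<sigma> ` A) (\<sigma> ` q)"
proof -
  note Ac = subring_closed[OF A] and qp = minimal_prime_inD(1)[OF q]
  note qd = prime_inD[OF qp]
  have qc: "x \<in> carrier R" if "x \<in> q" for x using that qd(1) Ac(1) by blast
  have mem: "\<sigma> x \<in> \<sigma> ` q \<longleftrightarrow> x \<in> q" if "x \<in> A" for x
    using that qc Ac(1) \<sigma>_eq_iff by (metis image_iff subsetD)
  have "prime_in R (\<sigma> ` A) (\<sigma> ` q)" unfolding prime_in_def
  proof (intro conjI ballI impI)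
    show "\<sigma> ` q \<subseteq> \<sigma> ` A" using qd(1) by blast
    show "\<zero> \<in> \<sigma> ` q" using mem[OF Ac(2)] qd(2) \<sigma>_simps(5) by simp
    show "\<one> \<notin> \<sigma> ` q" using mem[OF Ac(3)] qd(3) \<sigma>_simps(4) by simp
  next
    fix x y assume "x \<in> \<sigma> ` q" "y \<in> \<sigma> ` q"
    then obtain a b where d: "a \<in> q" "b \<in> q" "x = \<sigma> a" "y = \<sigma> b" by blast
    then have "x \<oplus> y = \<sigma> (a \<oplus> b)" using qc \<sigma>_simps(2) by simp
    then show "x \<oplus> y \<in> \<sigma> ` q" using qd(4) d by blast
  next
    fix x y assume "x \<in> \<sigma> ` A" "y \<in> \<sigma> ` q"
    then obtain a b where d: "a \<in> A" "b \<in> q" "x = \<sigma> a" "y = \<sigma> b" by blast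
    then have "x \<otimes> y = \<sigma> (a \<otimes> b)" using qc Ac(7) \<sigma>_simps(3) by simp
    then show "x \<otimes> y \<in> \<sigma> ` q" using qd(5) d by blast
  next
    fix x y assume "x \<in> \<sigma> ` A" "y \<in> \<sigma> ` A" and xy: "x \<otimes> y \<in> \<sigma> ` q"
    then obtain a b where d: "a \<in> A" "b \<in> A" "x = \<sigma> a" "y = \<sigma> b" by blast
    then have "x \<otimes> y = \<sigma> (a \<otimes> b)" using Ac(7) \<sigma>_simps(3) by simp
    then have "a \<otimes> b \<in> q" using mem[OF Ac(5)[OF d(1,2)]] xy by simp
    then show "x \<in> \<sigma> ` q \<or> y \<in> \<sigma> ` q" using qd(6)[OF d(1,2)] d(3,4) by blast
  qed
  moreover have "\<exists>s\<in>\<sigma> ` A - \<sigma> ` q. \<exists>m::nat. s \<otimes> z [^] m = \<zero>" if "z \<in> \<sigma> ` q" for z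
  proof -
    obtain a where a: "a \<in> q" "z = \<sigma> a" using \<open>z \<in> \<sigma> ` q\<close> by blast
    obtain s m where s: "s \<in> A" "s \<notin> q" "s \<otimes> a [^] (m::nat) = \<zero>" using minimal_prime_inD(2)[OF q a(1)] by blast
    have "\<sigma> (s \<otimes> a [^] m) = \<sigma> s \<otimes> \<sigma> a [^] m" using Ac(7)[OF s(1)] qc[OF a(1)] by (simp add: \<sigma>_simps \<sigma>_pow)
    then have "\<sigma> s \<otimes> z [^] m = \<zero>" using s(3) a(2) \<sigma>_simps(5) by simp
    then show ?thesis using s(1,2) mem[OF s(1)] by (metis DiffI imageI)
  qed
  ultimately show ?thesis by (simp add: minimal_prime_in_def)
qed

text \<open>Surjectivity of \<sigma> lifts the annihilator \<open>s\<close>, and injectivity returns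
  the relation s z^m = 0 to the source.\<close>

lemma minimal_prime_vimage:
  assumes q: "minimal_prime_in R (carrier R) q"
  shows "minimal_prime_in R (carrier R) {x \<in> carrier R. \<sigma> x \<in> q}"
proof -
  note qp = minimal_prime_inD(1)[OF q]
  note qd = prime_inD[OF qp]
  have "prime_in R (carrier R) {x \<in> carrier R. \<sigma> x \<in> q}" unfolding prime_in_def
    using qd \<sigma>_simps by auto
  moreover have "\<exists>s\<in>carrier R - {x \<in> carrier R. \<sigma> x \<in> q}. \<exists>m::nat. s \<otimes> z [^] m = \<zero>"
    if z: "z \<in> {x \<in> carrier R. \<sigma> x \<in> q}" for z
  proof -
    obtain s m where s: "s \<in> carrier R" "s \<notin> q" "s \<otimes> \<sigma> z [^] (m::nat) = \<zero>"
      using minimal_prime_inD(2)[OF q, of "\<sigma> z"] z by blast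
    obtain t where t: "t \<in> carrier R" "s = \<sigma> t" using s \<sigma>_surj by blast
    have "\<sigma> (t \<otimes> z [^] m) = \<zero>" using s t z by (simp add: \<sigma>_simps \<sigma>_pow)
    then have "t \<otimes> z [^] m = \<zero>" using t z \<sigma>_eq_zero by simp
    then show ?thesis using t s by blast
  qed
  ultimately show ?thesis by (simp add: minimal_prime_in_def)
qed

text \<open>A periodic sequence of minimal primes of one level in which each is the
  \<sigma>-preimage of its predecessor, as far as a single level can see: \<sigma> raises the level
  by one, so only \<open>z\<close> from levels below \<open>n\<close> can be compared, and for
  \<open>n = 0\<close> nothing is.\<close>

definition cycle :: "nat \<Rightarrow> nat \<Rightarrow> (nat \<Rightarrow> 'a set) \<Rightarrow> bool" where
  "cycle d n q \<longleftrightarrow> (\<forall>k. minimal_prime_in R (ext (full n)) (q k) \<and> q (k + d) = q k \<and>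
     (\<forall>m<n. \<forall>z\<in>ext (full m). \<sigma> z \<in> q k \<longleftrightarrow> z \<in> q (Suc k)))"

lemma \<sigma>_ext_full: "z \<in> ext (full m) \<Longrightarrow> \<sigma> z \<in> ext (full (Suc m))"
proof -
  assume "z \<in> ext (full m)"
  then have "\<sigma> z \<in> \<sigma> ` ext (full m)" by (rule imageI)
  then have "\<sigma> z \<in> ext (low (Suc m))" using \<sigma>_ext[OF intermediate_full, of m] \<sigma>_full[of m] by simp
  then show ?thesis using lspan_mono[OF low_full order_refl] by blast
qed

lemma ext_full_mono: "m \<le> n \<Longrightarrow> ext (full m) \<subseteq> ext (full n)"
  by (intro lspan_mono full_mono order_refl)

lemma cycle_exists: "\<exists>d>0. \<exists>q. cycle d n q"
proof -
  have one: "\<one> \<noteq> \<zero>" using L by (simp add: sfield_def)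
  obtain P where P: "minimal_prime_in R (carrier R) P"
    using minimal_prime_exists[OF carrier_is_subring, of "{\<one>}"] one by auto
  let ?P = "\<lambda>k. {x \<in> carrier R. (\<sigma> ^^ k) x \<in> P}"
  have Pk: "minimal_prime_in R (carrier R) (?P k)" for k
  proof (induction k)
    case 0
    have "?P 0 = P" using prime_inD(1)[OF minimal_prime_inD(1)[OF P]] by auto
    then show ?case using P by simp
  next
    case (Suc k)
    have "?P (Suc k) = {x \<in> carrier R. \<sigma> x \<in> ?P k}"
      using \<sigma>_simps(1) by (auto simp: funpow_Suc_right simp del: funpow.simps)
    then show ?case using minimal_prime_vimage[OF Suc] by simp
  qed
  let ?r = "\<lambda>k. ?P k \<inter> ext (full n)"
  have r: "minimal_prime_in R (ext (full n)) (?r k)" for k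
    using minimal_prime_restrict[OF intermediate_full intermediate_L] intermediateD(4)[OF intermediate_full]
      Pk gen by metis
  have fin: "finite {q. minimal_prime_in R (ext (full n)) q}"
    unfolding full_def using S(1) \<sigma>_pow_S by (intro finite_minimal_primes) blast+
  have "\<not> inj ?r"
  proof
    assume "inj ?r"
    moreover have "range ?r \<subseteq> {q. minimal_prime_in R (ext (full n)) q}" using r by blast
    ultimately show False using fin by (meson finite_subset finite_imageD infinite_UNIV_nat)
  qed
  then obtain a b where ab: "?r a = ?r b" "a \<noteq> b" unfolding inj_def by blast
  define i where "i = min a b"
  define j where "j = max a b"
  have ij: "i < j" using ab(2) by (simp add: i_def j_def min_def max_def)
  have rij: "?r i = ?r j" using ab(1) by (cases "a \<le> b") (simp_all add: i_def j_def min_def max_def)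
  define d where "d = j - i"
  have d: "d > 0" "i + d = j" using ij by (simp_all add: d_def)
  \<comment> \<open>The block of preimages from \<open>i\<close> to \<open>j - 1\<close> is repeated
    for ever. The true sequence of preimages need not repeat after \<open>j\<close>; only the
    equality of two of its members at this level is known.\<close>
  define q where "q k = ?r (i + k mod d)" for k
  \<comment> \<open>At the end of a block the successor is the member with index \<open>j\<close>,
    which at this level equals the one with index \<open>i\<close>; so consecutive members always
    come from consecutive preimages.\<close>
  have qs: "q (Suc k) = ?r (i + Suc (k mod d))" for k
  proof (cases "Suc (k mod d) = d")
    case True
    then have "i + Suc (k mod d) = j" "Suc k mod d = 0" using d(2) by (simp_all add: mod_Suc)
    then show ?thesis unfolding q_def using rij by simp
  next
    case False
    then show ?thesis unfolding q_def by (simp add: mod_Suc)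
  qed
  have "cycle d n q" unfolding cycle_def
  proof (intro allI conjI impI ballI)
    fix k
    show "minimal_prime_in R (ext (full n)) (q k)" unfolding q_def by (rule r)
    show "q (k + d) = q k" by (simp add: q_def)
    fix m z assume m: "m < n" and z: "z \<in> ext (full m)"
    have zn: "z \<in> ext (full n)" "\<sigma> z \<in> ext (full n)"
      using z m ext_full_mono[of m n] \<sigma>_ext_full[OF z] ext_full_mono[of "Suc m" n]
      by (simp_all add: subset_eq)
    have zc: "z \<in> carrier R" using zn(1) subring_closed(1)[OF ext_subring[OF intermediate_full]] by blast
    have "\<sigma> z \<in> q k \<longleftrightarrow> (\<sigma> ^^ (i + k mod d)) (\<sigma> z) \<in> P"
      unfolding q_def using zn zc \<sigma>_simps(1) by simp
    also have "\<dots> \<longleftrightarrow> (\<sigma> ^^ (i + Suc (k mod d))) z \<in> P"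
      by (simp add: funpow_swap1)
    also have "\<dots> \<longleftrightarrow> z \<in> q (Suc k)" unfolding qs using zn zc by simp
    finally show "\<sigma> z \<in> q k \<longleftrightarrow> z \<in> q (Suc k)" .
  qed
  then show ?thesis using d by blast
qed

text \<open>The larger field at level \<open>n\<close> arises from the smaller one by adjoining the
  fixed finite set \<open>S\<close>, so the chain theorem applies to the smaller fields.\<close>

lemma eventually_lin_disj: "\<exists>N. \<forall>n\<ge>N. lin_disj R (low n) (full n) (low (Suc n))"
proof -
  obtain N where N: "\<And>n. n \<ge> N \<Longrightarrow> lin_disj R (low n) (fgen R (low n \<union> S)) (\<Union>(range low))"
    using lin_disj_chain[OF L S, of low] intermediateD(1,4)[OF intermediate_low] low_mono by blast
  have "lin_disj R (low n) (full n) (low (Suc n))" if "n \<ge> N" for n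
    using N[OF that] unfolding full_low[symmetric] lin_disj_def by blast
  then show ?thesis by blast
qed

text \<open>The prime at place \<open>k\<close> and the \<sigma>-image of the prime at place
  \<open>k + 1\<close> live on \<open>full (Suc n)\<close> and \<open>low (Suc (Suc n))\<close>, and
  have to be glued over \<open>low (Suc n)\<close>. Starting from level \<open>Suc n\<close> ensures
  that this common field is itself a \<sigma>-image, so that the compatibility of the cycle speaks
  about it.\<close>

lemma cycle_lift:
  assumes c: "cycle d (Suc n) q" and ld: "lin_disj R (low (Suc n)) (full (Suc n)) (low (Suc (Suc n)))"
  shows "\<exists>q'. cycle d (Suc (Suc n)) q' \<and> (\<forall>k. q' k \<inter> ext (full (Suc n)) = q k)"
proof -
  let ?D = "\<lambda>n. ext (full n)"
  let ?m = "Suc n"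
  have mp: "minimal_prime_in R (?D ?m) (q k)" and per: "q (k + d) = q k"
    and st: "z \<in> ?D n \<Longrightarrow> \<sigma> z \<in> q k \<longleftrightarrow> z \<in> q (Suc k)" for k z
    using c unfolding cycle_def by auto
  have sD: "\<sigma> ` ?D n = ext (low (Suc n))" for n
    using \<sigma>_ext[OF intermediate_full] \<sigma>_full by simp
  have Dc: "?D n \<subseteq> carrier R" for n using subring_closed(1)[OF ext_subring[OF intermediate_full]] .
  have ex: "\<exists>r. minimal_prime_in R (?D (Suc ?m)) r \<and> r \<inter> ?D ?m = q k \<and>
      r \<inter> ext (low (Suc ?m)) = \<sigma> ` q (Suc k)" for k
  proof (rule minimal_prime_glue[OF intermediate_low intermediate_full low_full intermediate_low low_mono
        intermediate_full _ low_full ld mp])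
    show "full ?m \<subseteq> full (Suc ?m)" by (rule full_mono) simp
    show "minimal_prime_in R (ext (low (Suc ?m))) (\<sigma> ` q (Suc k))"
      using minimal_prime_image[OF ext_subring[OF intermediate_full] mp, of "Suc k"] sD[of ?m] by simp
    \<comment> \<open>An element of the common part is \<sigma> z; membership in either prime is
      then equivalent to that of \<open>z\<close> in \<open>q (Suc k)\<close>.\<close>
    have "y \<in> q k \<longleftrightarrow> y \<in> \<sigma> ` q (Suc k)" if y: "y \<in> ext (low ?m)" for y
    proof -
      obtain z where z: "z \<in> ?D n" "y = \<sigma> z" using y sD[of n] by blast
      have zc: "z \<in> carrier R" using z Dc by blast
      have "q (Suc k) \<subseteq> carrier R" using prime_inD(1)[OF minimal_prime_inD(1)[OF mp]] Dc by blast
      then have "\<sigma> z \<in> \<sigma> ` q (Suc k) \<longleftrightarrow> z \<in> q (Suc k)" using zc \<sigma>_eq_iff by blast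
      then show ?thesis using st[OF z(1)] z(2) by simp
    qed
    then show "q k \<inter> ext (low ?m) = \<sigma> ` q (Suc k) \<inter> ext (low ?m)" by blast
  qed
  \<comment> \<open>The glued prime is chosen as a function of the two primes alone and not of the
    index \<open>k\<close>. Hence equal inputs give equal outputs and the period does not
    grow.\<close>
  define G where "G A B = (SOME r. minimal_prime_in R (?D (Suc ?m)) r \<and> r \<inter> ?D ?m = A \<and>
      r \<inter> ext (low (Suc ?m)) = \<sigma> ` B)" for A B
  define q' where "q' k = G (q k) (q (Suc k))" for k
  have q': "minimal_prime_in R (?D (Suc ?m)) (q' k)" "q' k \<inter> ?D ?m = q k"
    "q' k \<inter> ext (low (Suc ?m)) = \<sigma> ` q (Suc k)" for k
    using someI_ex[OF ex[of k]] unfolding q'_def G_def by auto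
  have "cycle d (Suc ?m) q'" unfolding cycle_def
  proof (intro allI conjI impI ballI)
    fix k
    show "minimal_prime_in R (?D (Suc ?m)) (q' k)" by (rule q')
    show "q' (k + d) = q' k" unfolding q'_def using per[of k] per[of "Suc k"] by simp
    fix m z assume m: "m < Suc ?m" and z: "z \<in> ?D m"
    have zD: "z \<in> ?D ?m" using z m lspan_mono[OF full_mono[of m ?m] order_refl] by auto
    have "\<sigma> z \<in> q' k \<longleftrightarrow> \<sigma> z \<in> \<sigma> ` q (Suc k)" using q'(3)[of k] zD sD[of ?m] by blast
    also have "\<dots> \<longleftrightarrow> z \<in> q (Suc k)"
    proof -
      have "q (Suc k) \<subseteq> carrier R" using prime_inD(1)[OF minimal_prime_inD(1)[OF mp]] Dc by blast
      moreover have "z \<in> carrier R" using zD Dc by blast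
      ultimately show ?thesis using \<sigma>_eq_iff by blast
    qed
    also have "\<dots> \<longleftrightarrow> z \<in> q' (Suc k)" using q'(2)[of "Suc k"] zD by blast
    finally show "\<sigma> z \<in> q' k \<longleftrightarrow> z \<in> q' (Suc k)" .
  qed
  then show ?thesis using q'(2) by blast
qed

section \<open>The prime at the limit of the levels\<close>

definition total :: "'a set" where
  "total = (\<Union>n. ext (full n))"

lemma total_subring: "subring total R"
proof (rule subringI)
  have mono: "ext (full m) \<subseteq> ext (full n)" if "m \<le> n" for m n
    using that by (rule ext_full_mono)
  note sc = subring_closed[OF ext_subring[OF intermediate_full]]
  show "total \<subseteq> carrier R" unfolding total_def using sc(1) by (rule UN_least)
  show "\<one> \<in> total" unfolding total_def using sc(3)[of 0] by blast
  fix x y assume "x \<in> total" "y \<in> total"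
  then obtain m n where "x \<in> ext (full m)" "y \<in> ext (full n)" unfolding total_def by blast
  then have xy: "x \<in> ext (full (max m n))" "y \<in> ext (full (max m n))"
    using mono[of m "max m n"] mono[of n "max m n"] by auto
  show "x \<oplus> y \<in> total" "x \<otimes> y \<in> total" "\<ominus> x \<in> total"
    unfolding total_def using sc(4)[OF xy] sc(5)[OF xy] sc(6)[OF xy(1)] by blast+
qed

lemma \<sigma>_total: "z \<in> total \<Longrightarrow> \<sigma> z \<in> total"
  unfolding total_def using \<sigma>_ext_full by blast

lemma M_total: "M \<subseteq> total"
  unfolding total_def using ext_incl(2)[OF intermediate_full, of 0] by blast

lemma fgen_total: "fgen R (K \<union> (\<Union>i. (\<sigma> ^^ i) ` S)) \<subseteq> total"
proof -
  have "sfield R (\<Union>(range full))"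
    using intermediateD(1)[OF intermediate_full] full_mono by (intro sfield_chain_Union) auto
  moreover have "K \<union> (\<Union>i. (\<sigma> ^^ i) ` S) \<subseteq> \<Union>(range full)"
    unfolding full_def using fgen_incl[of "K \<union> (\<Union>i\<le>n. (\<sigma> ^^ i) ` S)" for n] by fast
  ultimately have "fgen R (K \<union> (\<Union>i. (\<sigma> ^^ i) ` S)) \<subseteq> \<Union>(range full)" by (rule fgen_least)
  then show ?thesis unfolding total_def using ext_incl(1)[OF intermediate_full] by blast
qed

theorem periodic_prime:
  "\<exists>d>0. \<exists>Q. prime_in R total Q \<and> (\<forall>z\<in>total. (\<sigma> ^^ d) z \<in> Q \<longleftrightarrow> z \<in> Q)"
proof -
  let ?D = "\<lambda>n. ext (full n)"
  have mono: "?D m \<subseteq> ?D n" if "m \<le> n" for m n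
    using that by (rule ext_full_mono)
  obtain N where N: "\<And>n. n \<ge> N \<Longrightarrow> lin_disj R (low n) (full n) (low (Suc n))"
    using eventually_lin_disj by blast
  obtain d q0 where d: "d > 0" "cycle d (Suc N) q0" using cycle_exists by blast
  have "\<exists>f. \<forall>n. cycle d (Suc (N + n)) (f n) \<and> (\<forall>k. f (Suc n) k \<inter> ?D (Suc (N + n)) = f n k)"
  proof (rule dependent_nat_choice)
    show "\<exists>q. cycle d (Suc (N + 0)) q" using d by auto
    fix q n assume "cycle d (Suc (N + n)) q"
    then show "\<exists>q'. cycle d (Suc (N + Suc n)) q' \<and> (\<forall>k. q' k \<inter> ?D (Suc (N + n)) = q k)"
      using cycle_lift[of d "N + n" q] N[of "Suc (N + n)"] by simp
  qed
  then obtain f where f: "\<And>n. cycle d (Suc (N + n)) (f n)"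
    "\<And>n k. f (Suc n) k \<inter> ?D (Suc (N + n)) = f n k" by blast
  let ?E = "\<lambda>n. ?D (Suc (N + n))"
  have pr: "prime_in R (?E n) (f n k)" for n k
    using f(1) minimal_prime_inD(1) unfolding cycle_def by blast
  have Emono: "?E m \<subseteq> ?E n" if "m \<le> n" for m n using that by (intro mono) simp
  have restr: "f (n + j) k \<inter> ?E n = f n k" for n j k
  proof (induction j)
    case 0
    then show ?case using prime_inD(1)[OF pr[of n k]] by auto
  next
    case (Suc j)
    have "f (n + Suc j) k \<inter> ?E n = (f (Suc (n + j)) k \<inter> ?E (n + j)) \<inter> ?E n"
      using Emono[of n "n + j"] by auto
    then show ?case using f(2)[of "n + j" k] Suc by simp
  qed
  have totE: "total = (\<Union>n. ?E n)"
  proof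
    show "total \<subseteq> (\<Union>n. ?E n)"
    proof
      fix x assume "x \<in> total"
      then obtain n where "x \<in> ?D n" unfolding total_def by blast
      then have "x \<in> ?E n" using mono[of n "Suc (N + n)"] by auto
      then show "x \<in> (\<Union>n. ?E n)" by blast
    qed
  qed (auto simp: total_def)
  \<comment> \<open>The lifted cycles restrict to one another, so at each place the primes of all
    levels unite to a prime of the union.\<close>
  define Q where "Q k = (\<Union>n. f n k)" for k
  have QE: "x \<in> Q k \<longleftrightarrow> x \<in> f n k" if x: "x \<in> ?E n" for x k n
  proof
    assume "x \<in> Q k"
    then obtain m where m: "x \<in> f m k" unfolding Q_def by blast
    then have "x \<in> ?E m" using prime_inD(1)[OF pr] by blast
    then have "x \<in> f (m + n) k" using restr[of m n k] m by blast
    then show "x \<in> f n k" using restr[of n m k] x by (simp add: add.commute) blast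
  qed (auto simp: Q_def)
  have prime: "prime_in R total (Q k)" for k unfolding prime_in_def
  proof (intro conjI ballI impI)
    note Ec = subring_closed[OF ext_subring[OF intermediate_full]]
    have two: "\<exists>n. x \<in> ?E n \<and> y \<in> ?E n" if xy: "x \<in> total" "y \<in> total" for x y
    proof -
      obtain m where "x \<in> ?E m" using xy(1) unfolding totE by blast
      moreover obtain n where "y \<in> ?E n" using xy(2) unfolding totE by blast
      ultimately have "x \<in> ?E (max m n)" "y \<in> ?E (max m n)" using Emono[of m "max m n"] Emono[of n "max m n"] by auto
      then show ?thesis by blast
    qed
    show sub: "Q k \<subseteq> total" unfolding Q_def totE using prime_inD(1)[OF pr] by blast
    show "\<zero> \<in> Q k" using prime_inD(2)[OF pr] unfolding Q_def by blast
    show "\<one> \<notin> Q k" using prime_inD(3)[OF pr] unfolding Q_def by blast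
    fix x y
    { assume xy: "x \<in> Q k" "y \<in> Q k"
      obtain n where n: "x \<in> ?E n" "y \<in> ?E n" using two xy sub by blast
      then show "x \<oplus> y \<in> Q k" using xy QE Ec(4)[OF n] prime_inD(4)[OF pr] by blast
    }
    { assume xy: "x \<in> total" "y \<in> Q k"
      obtain n where n: "x \<in> ?E n" "y \<in> ?E n" using two xy sub by blast
      then show "x \<otimes> y \<in> Q k" using xy QE Ec(5)[OF n] prime_inD(5)[OF pr] by blast
    }
    assume xy: "x \<in> total" "y \<in> total" "x \<otimes> y \<in> Q k"
    obtain n where n: "x \<in> ?E n" "y \<in> ?E n" using two xy by blast
    then show "x \<in> Q k \<or> y \<in> Q k" using xy QE Ec(5)[OF n] prime_inD(6)[OF pr] by blast
  qed
  have step: "\<sigma> z \<in> Q k \<longleftrightarrow> z \<in> Q (Suc k)" if z: "z \<in> total" for z k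
  proof -
    obtain n where n: "z \<in> ?E n" using z totE by blast
    have z': "z \<in> ?E (Suc n)" using n Emono[of n "Suc n"] by auto
    have sz: "\<sigma> z \<in> ?E (Suc n)" using \<sigma>_ext_full[OF n] by simp
    have "\<sigma> z \<in> f (Suc n) k \<longleftrightarrow> z \<in> f (Suc n) (Suc k)"
      using f(1)[of "Suc n"] n unfolding cycle_def by (metis add_Suc_right lessI)
    then show ?thesis using QE[OF z'] QE[OF sz] by simp
  qed
  have "(\<sigma> ^^ j) z \<in> Q k \<longleftrightarrow> z \<in> Q (k + j)" if "z \<in> total" for z j k
    using that
  proof (induction j arbitrary: z)
    case (Suc j)
    have "(\<sigma> ^^ Suc j) z = (\<sigma> ^^ j) (\<sigma> z)" by (simp add: funpow_swap1)
    then show ?case using Suc.IH[OF \<sigma>_total[OF Suc.prems]] step[OF Suc.prems] by simp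
  qed simp
  \<comment> \<open>One and the same \<open>d\<close> is a period at every level, so it survives the
    union.\<close>
  moreover have "Q (0 + d) = Q 0" unfolding Q_def using f(1) unfolding cycle_def by metis
  ultimately have "\<forall>z\<in>total. (\<sigma> ^^ d) z \<in> Q 0 \<longleftrightarrow> z \<in> Q 0" by metis
  then show ?thesis using prime d(1) by blast
qed

end

section \<open>Pseudo fields and von Neumann regular rings\<close>

lemma (in cring) idealI_closed:
  assumes "I \<subseteq> carrier R" "\<zero> \<in> I" "\<And>x y. x \<in> I \<Longrightarrow> y \<in> I \<Longrightarrow> x \<oplus> y \<in> I"
    "\<And>a x. a \<in> carrier R \<Longrightarrow> x \<in> I \<Longrightarrow> a \<otimes> x \<in> I"
  shows "ideal I R"
proof (rule idealI)
  show "ring R" by (rule ring_axioms)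
  show "subgroup I (add_monoid R)"
  proof (rule add.subgroupI)
    show "\<ominus> a \<in> I" if "a \<in> I" for a
    proof -
      have "\<ominus> a = (\<ominus> \<one>) \<otimes> a" using that assms(1) by (simp add: l_minus subset_eq)
      then show ?thesis using assms(4) that by simp
    qed
  qed (use assms in auto)
  show "x \<otimes> a \<in> I" "a \<otimes> x \<in> I" if "a \<in> I" "x \<in> carrier R" for a x
    using assms(4)[of x a] that assms(1) m_comm[of a x] by auto
qed

lemma (in cring) ideal_lspan_subset:
  assumes "ideal I R" "X \<subseteq> I"
  shows "lspan R (carrier R) X \<subseteq> I"
proof (rule lspan_least)
  interpret ideal I R by (rule assms(1))
  show "\<zero> \<in> I" by simp
  show "x \<oplus> e \<otimes> a \<in> I" if "x \<in> I" "e \<in> carrier R" "a \<in> X" for x e a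
    using that assms(2) I_l_closed by auto
qed

context sigma_ring
begin

lemma sigma_simps:
  "x \<in> carrier R \<Longrightarrow> \<sigma> x \<in> carrier R"
  "x \<in> carrier R \<Longrightarrow> y \<in> carrier R \<Longrightarrow> \<sigma> (x \<oplus> y) = \<sigma> x \<oplus> \<sigma> y"
  "x \<in> carrier R \<Longrightarrow> y \<in> carrier R \<Longrightarrow> \<sigma> (x \<otimes> y) = \<sigma> x \<otimes> \<sigma> y"
  "\<sigma> \<one> = \<one>" "\<sigma> \<zero> = \<zero>"
  using ring_hom_closed[OF sigma_hom] ring_hom_add[OF sigma_hom] ring_hom_mult[OF sigma_hom]
    ring_hom_one[OF sigma_hom] ring_hom_zero[OF sigma_hom ring_axioms ring_axioms] by auto

lemma funpow_hom: "\<sigma> ^^ k \<in> ring_hom R R"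
proof (induction k)
  case (Suc k)
  then show ?case using ring_hom_trans[OF Suc sigma_hom] by (simp only: funpow.simps)
qed (simp add: id_ring_hom[unfolded id_def] id_def)

lemma funpow_simps:
  "x \<in> carrier R \<Longrightarrow> (\<sigma> ^^ k) x \<in> carrier R"
  "x \<in> carrier R \<Longrightarrow> y \<in> carrier R \<Longrightarrow> (\<sigma> ^^ k) (x \<oplus> y) = (\<sigma> ^^ k) x \<oplus> (\<sigma> ^^ k) y"
  "x \<in> carrier R \<Longrightarrow> y \<in> carrier R \<Longrightarrow> (\<sigma> ^^ k) (x \<otimes> y) = (\<sigma> ^^ k) x \<otimes> (\<sigma> ^^ k) y"
  "(\<sigma> ^^ k) \<one> = \<one>" "(\<sigma> ^^ k) \<zero> = \<zero>"
  using ring_hom_closed[OF funpow_hom] ring_hom_add[OF funpow_hom] ring_hom_mult[OF funpow_hom]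
    ring_hom_one[OF funpow_hom] ring_hom_zero[OF funpow_hom ring_axioms ring_axioms] by auto

lemma prime_vimage:
  assumes "prime_in R (carrier R) p"
  shows "prime_in R (carrier R) {x \<in> carrier R. (\<sigma> ^^ k) x \<in> p}"
  unfolding prime_in_def using prime_inD[OF assms] funpow_simps[where k = k] by auto

lemma period_mult:
  assumes "\<And>x. x \<in> carrier R \<Longrightarrow> (\<sigma> ^^ r) x \<in> p \<longleftrightarrow> x \<in> p"
  shows "x \<in> carrier R \<Longrightarrow> (\<sigma> ^^ (r * m)) x \<in> p \<longleftrightarrow> x \<in> p"
proof (induction m)
  case (Suc m)
  have "(\<sigma> ^^ (r * Suc m)) x = (\<sigma> ^^ r) ((\<sigma> ^^ (r * m)) x)" by (simp add: funpow_add)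
  then show ?case using Suc assms[of "(\<sigma> ^^ (r * m)) x"] funpow_simps(1) by simp
qed simp

lemma period_mod:
  assumes "\<And>x. x \<in> carrier R \<Longrightarrow> (\<sigma> ^^ r) x \<in> p \<longleftrightarrow> x \<in> p" "x \<in> carrier R"
  shows "(\<sigma> ^^ j) x \<in> p \<longleftrightarrow> (\<sigma> ^^ (j mod r)) x \<in> p"
proof -
  have "(\<sigma> ^^ j) x = (\<sigma> ^^ (r * (j div r))) ((\<sigma> ^^ (j mod r)) x)"
    by (metis comp_apply funpow_add mult_div_mod_eq)
  then show ?thesis using period_mult[OF assms(1)] funpow_simps(1)[OF assms(2)] by simp
qed

text \<open>Elements are viewed through their residues at the preimages of \<open>p\<close>, which
  separate points. In a von Neumann regular ring a finite set \<open>X\<close> generates every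
  \<open>z\<close> that is nonzero only where some member of \<open>X\<close> is nonzero.\<close>

lemma lspan_of_nonvanishing:
  assumes vnr: "\<And>x. x \<in> carrier R \<Longrightarrow> \<exists>y\<in>carrier R. x \<otimes> x \<otimes> y = x"
    and p: "prime_in R (carrier R) p"
    and int: "\<And>x. x \<in> carrier R \<Longrightarrow> (\<And>j. (\<sigma> ^^ j) x \<in> p) \<Longrightarrow> x = \<zero>"
    and X: "finite X" "X \<subseteq> carrier R" and z: "z \<in> carrier R"
    and cov: "\<And>j. (\<sigma> ^^ j) z \<in> p \<or> (\<exists>x\<in>X. (\<sigma> ^^ j) x \<notin> p)"
  shows "z \<in> lspan R (carrier R) X"
proof -
  note Cs = carrier_is_subring and pd = prime_inD[OF p]
  have "\<exists>f\<in>carrier R. \<exists>g\<in>lspan R (carrier R) X. f \<oplus> g = \<one> \<and>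
      (\<forall>j. (\<exists>x\<in>X. (\<sigma> ^^ j) x \<notin> p) \<longrightarrow> (\<sigma> ^^ j) f \<in> p)"
    using X
  proof (induction X rule: finite_induct)
    case empty
    then show ?case using lspan_zero[of R "carrier R" "{}"] by (intro bexI[of _ \<one>] bexI[of _ \<zero>]) auto
  next
    case (insert x X)
    then obtain f g where fg: "f \<in> carrier R" "g \<in> lspan R (carrier R) X" "f \<oplus> g = \<one>"
      "\<And>j y. y \<in> X \<Longrightarrow> (\<sigma> ^^ j) y \<notin> p \<Longrightarrow> (\<sigma> ^^ j) f \<in> p" by blast
    have xc: "x \<in> carrier R" and Xc: "X \<subseteq> carrier R" "insert x X \<subseteq> carrier R" using insert by auto
    have gc: "g \<in> carrier R" using fg(2) lspan_closed[OF order_refl Xc(1)] by blast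
    obtain y where y: "y \<in> carrier R" "x \<otimes> x \<otimes> y = x" using vnr[OF xc] by blast
    \<comment> \<open>x y is an idempotent with residue one where \<open>x\<close> is nonzero and
      zero elsewhere; the factor 1 - x y thus vanishes exactly where \<open>x\<close> does
      not.\<close>
    let ?f = "f \<otimes> (\<one> \<oplus> \<ominus> (x \<otimes> y))"
    have g': "g \<oplus> (f \<otimes> y) \<otimes> x \<in> lspan R (carrier R) (insert x X)"
      using fg y lspan_mono[of "carrier R" "carrier R" X "insert x X" R]
      by (intro lspan.lspan_step) auto
    have e: "(f \<otimes> y) \<otimes> x = f \<otimes> (x \<otimes> y)" using fg y xc by (simp add: m_ac)
    have "?f \<oplus> (g \<oplus> (f \<otimes> y) \<otimes> x) = f \<oplus> g"
      unfolding e using fg(1) y(1) xc gc by (simp add: r_distr r_minus a_ac r_neg1 l_neg r_neg)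
    then have 1: "?f \<oplus> (g \<oplus> (f \<otimes> y) \<otimes> x) = \<one>" using fg(3) by simp
    have "(\<sigma> ^^ j) ?f \<in> p" if w: "w \<in> insert x X" "(\<sigma> ^^ j) w \<notin> p" for j w
    proof (cases "w \<in> X")
      case True
      have "?f = (\<one> \<oplus> \<ominus> (x \<otimes> y)) \<otimes> f" using fg(1) y(1) xc by (simp add: m_comm)
      then have "(\<sigma> ^^ j) ?f = (\<sigma> ^^ j) (\<one> \<oplus> \<ominus> (x \<otimes> y)) \<otimes> (\<sigma> ^^ j) f"
        using fg(1) y(1) xc funpow_simps(3)[of "\<one> \<oplus> \<ominus> (x \<otimes> y)" f j] by simp
      then show ?thesis using pd(5)[OF funpow_simps(1) fg(4)[OF True w(2)]] y(1) xc by simp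
    next
      case False
      then have wx: "w = x" using w by blast
      have "x \<otimes> (\<one> \<oplus> \<ominus> (x \<otimes> y)) = x \<oplus> \<ominus> (x \<otimes> x \<otimes> y)" using xc y(1) by (simp add: r_distr r_minus m_assoc)
      also have "\<dots> = \<zero>" using xc y(2) by (simp add: r_neg)
      finally have "(\<sigma> ^^ j) x \<otimes> (\<sigma> ^^ j) (\<one> \<oplus> \<ominus> (x \<otimes> y)) = \<zero>"
        using xc y(1) funpow_simps(3)[of x "\<one> \<oplus> \<ominus> (x \<otimes> y)" j] funpow_simps(5) by simp
      then have "(\<sigma> ^^ j) (\<one> \<oplus> \<ominus> (x \<otimes> y)) \<in> p"
        using pd(2) pd(6)[OF funpow_simps(1)[OF xc] funpow_simps(1), of "\<one> \<oplus> \<ominus> (x \<otimes> y)" j j] w wx xc y(1)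
        by auto
      then show ?thesis
        using pd(5)[OF funpow_simps(1)[OF fg(1), of j]] fg(1) y(1) xc
          funpow_simps(3)[of f "\<one> \<oplus> \<ominus> (x \<otimes> y)" j] by simp
    qed
    then show ?case using 1 g' fg(1) y(1) xc by (intro bexI[of _ ?f] bexI[OF _ g']) auto
  qed
  then obtain f g where fg: "f \<in> carrier R" "g \<in> lspan R (carrier R) X" "f \<oplus> g = \<one>"
    "\<And>j y. y \<in> X \<Longrightarrow> (\<sigma> ^^ j) y \<notin> p \<Longrightarrow> (\<sigma> ^^ j) f \<in> p" by blast
  have gc: "g \<in> carrier R" using fg(2) lspan_closed[OF order_refl X(2)] by blast
  have "(\<sigma> ^^ j) (z \<otimes> f) \<in> p" for j
  proof (cases "(\<sigma> ^^ j) z \<in> p")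
    case True
    have "(\<sigma> ^^ j) (z \<otimes> f) = (\<sigma> ^^ j) f \<otimes> (\<sigma> ^^ j) z"
      using z fg(1) funpow_simps(3)[of f z j] by (simp add: m_comm)
    then show ?thesis using pd(5)[OF funpow_simps(1)[OF fg(1)] True] by simp
  next
    case False
    then have "(\<sigma> ^^ j) f \<in> p" using cov[of j] fg(4) by blast
    then show ?thesis using pd(5)[OF funpow_simps(1)[OF z]] funpow_simps(3)[OF z fg(1)] by simp
  qed
  then have "z \<otimes> f = \<zero>" using int z fg(1) by simp
  then have "z = z \<otimes> g" using z fg(1,3) gc by (metis l_zero m_closed r_distr r_one)
  then show ?thesis using lspan_smult[OF Cs X(2) fg(2) z] by simp
qed

text \<open>Periodicity leaves only the preimages with exponent below \<open>r\<close>. One element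
  of \<open>I\<close> per such prime generates an ideal, and the iterates of one nonzero element of
  a \<sigma>-ideal are nonzero at all of them in turn, hence generate the unit ideal.\<close>

lemma pseudo_fieldI:
  assumes one: "\<one> \<noteq> \<zero>"
    and vnr: "\<And>x. x \<in> carrier R \<Longrightarrow> \<exists>y\<in>carrier R. x \<otimes> x \<otimes> y = x"
    and p: "prime_in R (carrier R) p"
    and r: "r > 0" "\<And>x. x \<in> carrier R \<Longrightarrow> (\<sigma> ^^ r) x \<in> p \<longleftrightarrow> x \<in> p"
    and int: "\<And>x. x \<in> carrier R \<Longrightarrow> (\<And>j. (\<sigma> ^^ j) x \<in> p) \<Longrightarrow> x = \<zero>"
  shows "sigma_pseudo_field R \<sigma>"
proof (unfold_locales)
  show "\<one> \<noteq> \<zero>" by (rule one)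
next
  fix I assume I: "ideal I R"
  interpret I: ideal I R by (rule I)
  have Ic: "I \<subseteq> carrier R" using I.Icarr by blast
  define w where "w j = (SOME x. x \<in> I \<and> (\<sigma> ^^ j) x \<notin> p)" for j
  have w: "w j \<in> I \<and> (\<sigma> ^^ j) (w j) \<notin> p" if "\<exists>x\<in>I. (\<sigma> ^^ j) x \<notin> p" for j
    unfolding w_def by (rule someI_ex) (use that in blast)
  let ?J = "{j. j < r \<and> (\<exists>x\<in>I. (\<sigma> ^^ j) x \<notin> p)}"
  let ?X = "w ` ?J"
  have XI: "?X \<subseteq> I" by (rule image_subsetI) (use w in simp)
  have "z \<in> lspan R (carrier R) ?X" if z: "z \<in> I" for z
  proof (rule lspan_of_nonvanishing[OF vnr p int])
    show "finite ?X" by simp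
    show "?X \<subseteq> carrier R" using XI Ic by blast
    show zc: "z \<in> carrier R" using z Ic by blast
    fix j
    show "(\<sigma> ^^ j) z \<in> p \<or> (\<exists>x\<in>?X. (\<sigma> ^^ j) x \<notin> p)"
    proof (cases "(\<sigma> ^^ j) z \<in> p")
      case False
      then have "(\<sigma> ^^ (j mod r)) z \<notin> p" using period_mod[OF r(2) zc, of j] by simp
      then have ex: "\<exists>x\<in>I. (\<sigma> ^^ (j mod r)) x \<notin> p" using z by blast
      have "j mod r \<in> ?J" using ex r(1) by simp
      then have "w (j mod r) \<in> ?X" by (rule imageI)
      moreover have "w (j mod r) \<in> carrier R" using w[OF ex] Ic by blast
      then have "(\<sigma> ^^ j) (w (j mod r)) \<notin> p"
        using w[OF ex] period_mod[OF r(2), of "w (j mod r)" j] by simp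
      ultimately show ?thesis by blast
    qed simp
  qed
  then have "I \<subseteq> lspan R (carrier R) ?X" by blast
  also have "\<dots> \<subseteq> Idl ?X"
    using XI Ic by (intro ideal_lspan_subset genideal_ideal genideal_self) auto
  finally have "I = Idl ?X" using genideal_minimal[OF I XI] by blast
  then show "\<exists>A\<subseteq>carrier R. finite A \<and> I = Idl A" using XI Ic by (intro exI[of _ ?X]) auto
next
  fix I assume sI: "sigma_ideal R \<sigma> I"
  then have I: "ideal I R" "\<sigma> ` I \<subseteq> I" by (auto simp: sigma_ideal_def)
  interpret I: ideal I R by (rule I(1))
  have Ic: "I \<subseteq> carrier R" using I.Icarr by blast
  have kI: "(\<sigma> ^^ k) x \<in> I" if "x \<in> I" for x k by (induction k) (use that I(2) in auto)
  show "I = {\<zero>} \<or> I = carrier R"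
  proof (rule disjCI)
    assume "I \<noteq> carrier R"
    show "I = {\<zero>}"
    proof (rule ccontr)
      assume "I \<noteq> {\<zero>}"
      then obtain x where x: "x \<in> I" "x \<noteq> \<zero>" using I.zero_closed by blast
      have xc: "x \<in> carrier R" using x Ic by blast
      obtain j where j: "(\<sigma> ^^ j) x \<notin> p" using int[OF xc] x(2) by blast
      let ?X = "(\<lambda>k. (\<sigma> ^^ k) x) ` {..<r}"
      have XI: "?X \<subseteq> I" using kI[OF x(1)] by blast
      have "\<one> \<in> lspan R (carrier R) ?X"
      proof (rule lspan_of_nonvanishing[OF vnr p int])
        show "?X \<subseteq> carrier R" using XI Ic by blast
        fix i
        \<comment> \<open>Chosen with i + k congruent to j modulo \<open>r\<close>;
          \<open>r - i mod r\<close> stands for -i in the natural numbers.\<close>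
        let ?k = "(j + (r - i mod r)) mod r"
        have "(i + ?k) mod r = (i mod r + (j + (r - i mod r))) mod r"
          by (metis mod_add_left_eq mod_add_right_eq)
        also have "i mod r + (j + (r - i mod r)) = j + r" using mod_less_divisor[OF r(1), of i] by linarith
        finally have "(i + ?k) mod r = j mod r" by simp
        then have "(\<sigma> ^^ (i + ?k)) x \<notin> p"
          using j period_mod[OF r(2) xc, of j] period_mod[OF r(2) xc, of "i + ?k"] by simp
        then have "(\<sigma> ^^ i) ((\<sigma> ^^ ?k) x) \<notin> p" by (simp add: funpow_add)
        moreover have "?k < r" using r(1) by simp
        ultimately show "(\<sigma> ^^ i) \<one> \<in> p \<or> (\<exists>x\<in>?X. (\<sigma> ^^ i) x \<notin> p)" by blast
      qed auto
      then have "\<one> \<in> I" using ideal_lspan_subset[OF I(1) XI] by blast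
      then show False using I.one_imp_carrier \<open>I \<noteq> carrier R\<close> by blast
    qed
  qed
next
  fix a assume a: "non_zero_divisor R a"
  then have ac: "a \<in> carrier R" by (simp add: non_zero_divisor_def)
  obtain y where y: "y \<in> carrier R" "a \<otimes> a \<otimes> y = a" using vnr[OF ac] by blast
  have "a \<otimes> (a \<otimes> y \<oplus> \<ominus> \<one>) = a \<otimes> a \<otimes> y \<oplus> \<ominus> a" using ac y(1) by (simp add: r_distr r_minus m_assoc)
  also have "\<dots> = \<zero>" using ac y(2) by (simp add: r_neg)
  finally have "a \<otimes> y \<oplus> \<ominus> \<one> = \<zero>" using a ac y(1) unfolding non_zero_divisor_def by simp
  then have "a \<otimes> y = \<one>" using ac y(1) by (metis a_minus_def m_closed one_closed r_right_minus_eq)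
  then show "a \<in> Units R" using ac y(1) m_comm[of a y] unfolding Units_def by auto
qed

end

lemma (in noetherian_ring) noeth_carrier:
  assumes "cring R"
  shows "noeth R (carrier R)"
  unfolding noeth_def
proof (intro allI impI)
  interpret cring R by (rule assms)
  fix f :: "nat \<Rightarrow> 'a" assume f: "range f \<subseteq> carrier R"
  let ?I = "\<lambda>n. Idl (f ` {..<n})"
  have fc: "f ` X \<subseteq> carrier R" for X using f by blast
  have mono: "?I m \<subseteq> ?I n" if "m \<le> n" for m n
  proof -
    have "f ` {..<m} \<subseteq> f ` {..<n}" using that by auto
    also have "\<dots> \<subseteq> ?I n" using fc by (rule genideal_self)
    finally show ?thesis by (rule genideal_minimal[OF genideal_ideal[OF fc]])
  qed
  have "\<Union>(range ?I) \<in> range ?I"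
  proof (rule ideal_chain_is_trivial)
    show "subset.chain {I. ideal I R} (range ?I)"
      unfolding subset_chain_def
    proof (intro conjI ballI)
      show "range ?I \<subseteq> {I. ideal I R}" using genideal_ideal[OF fc] by blast
      fix X Y assume "X \<in> range ?I" "Y \<in> range ?I"
      then obtain m n where "X = ?I m" "Y = ?I n" by blast
      then show "X \<subseteq> Y \<or> Y \<subseteq> X" using mono[of m n] mono[of n m] by (cases "m \<le> n") auto
    qed
  qed simp
  then obtain n where n: "\<Union>(range ?I) = ?I n" by blast
  have "f n \<in> ?I (Suc n)" using genideal_self[OF fc[of "{..<Suc n}"]] by blast
  then have fn: "f n \<in> ?I n" using n by blast
  have "ideal (lspan R (carrier R) (f ` {..<n})) R"
    using lspan_closed[OF order_refl fc] lspan_zero lspan_add[OF order_refl fc]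
      lspan_smult[OF carrier_is_subring fc] by (intro idealI_closed) auto
  moreover have "f ` {..<n} \<subseteq> lspan R (carrier R) (f ` {..<n})"
    using lspan_incl[OF carrier_is_subring fc] by blast
  ultimately have "?I n \<subseteq> lspan R (carrier R) (f ` {..<n})" by (rule genideal_minimal)
  then show "\<exists>n. f n \<in> lspan R (carrier R) (f ` {..<n})" using fn by blast
qed

section \<open>Primes and idempotents of a pseudo field\<close>

context sigma_pseudo_field
begin

text \<open>The elements all of whose iterates lie in \<open>p\<close> form a \<sigma>-ideal that
  does not contain one.\<close>

lemma prime_inter_zero:
  assumes p: "prime_in R (carrier R) p" and x: "x \<in> carrier R" "\<And>j. (\<sigma> ^^ j) x \<in> p"
  shows "x = \<zero>"
proof -
  let ?I = "{x \<in> carrier R. \<forall>j. (\<sigma> ^^ j) x \<in> p}"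
  note pd = prime_inD[OF p]
  have "ideal ?I R" using pd funpow_simps by (intro idealI_closed) auto
  moreover have "\<sigma> ` ?I \<subseteq> ?I"
  proof
    fix y assume "y \<in> \<sigma> ` ?I"
    then obtain x where x: "x \<in> carrier R" "\<And>j. (\<sigma> ^^ j) x \<in> p" "y = \<sigma> x" by blast
    have "(\<sigma> ^^ j) y \<in> p" for j using x(2)[of "Suc j"] x(3) by (simp add: funpow_swap1)
    then show "y \<in> ?I" using x sigma_simps(1) by blast
  qed
  ultimately have "?I = {\<zero>} \<or> ?I = carrier R" by (intro sigma_simple) (simp add: sigma_ideal_def)
  moreover have "\<one> \<notin> ?I" using pd(3) funpow_simps(4) by auto
  ultimately show ?thesis using x by blast
qed

lemma nilpotent_zero:
  assumes x: "x \<in> carrier R" "x [^] (n::nat) = \<zero>"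
  shows "x = \<zero>"
proof -
  let ?I = "{x \<in> carrier R. \<exists>n::nat. x [^] n = \<zero>}"
  have "ideal ?I R"
  proof (rule idealI_closed)
    show "\<zero> \<in> ?I" by (auto intro: exI[of _ 1])
    fix x y assume "x \<in> ?I" "y \<in> ?I"
    then obtain m n where d: "x \<in> carrier R" "y \<in> carrier R" "x [^] (m::nat) = \<zero>" "y [^] (n::nat) = \<zero>" by blast
    then have "\<one> \<otimes> (x \<oplus> y) [^] (m + n) = \<zero>" by (intro annihilated_sum_pow) auto
    then have "(x \<oplus> y) [^] (m + n) = \<zero>" using d by simp
    then show "x \<oplus> y \<in> ?I" using d by blast
  next
    fix a x assume a: "a \<in> carrier R" "x \<in> ?I"
    then obtain m where d: "x \<in> carrier R" "x [^] (m::nat) = \<zero>" by blast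
    have "(a \<otimes> x) [^] m = \<zero>" using a d by (simp add: nat_pow_distrib)
    then show "a \<otimes> x \<in> ?I" using a d by blast
  qed blast
  moreover have "\<sigma> ` ?I \<subseteq> ?I"
  proof
    fix y assume "y \<in> \<sigma> ` ?I"
    then obtain x n where x: "x \<in> carrier R" "x [^] (n::nat) = \<zero>" "y = \<sigma> x" by blast
    have "\<sigma> (x [^] k) = \<sigma> x [^] k" for k :: nat using x by (induction k) (simp_all add: sigma_simps)
    then have "y [^] n = \<zero>" using x sigma_simps(5) by metis
    then show "y \<in> ?I" using x sigma_simps(1) by blast
  qed
  ultimately have "?I = {\<zero>} \<or> ?I = carrier R" by (intro sigma_simple) (simp add: sigma_ideal_def)
  moreover have "\<one> \<notin> ?I" using one_neq_zero by simp
  ultimately show ?thesis using x by blast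
qed

lemma irredundant_primes:
  "\<exists>\<P>. finite \<P> \<and> (\<forall>p\<in>\<P>. prime_in R (carrier R) p) \<and>
     (\<forall>x\<in>carrier R. (\<forall>p\<in>\<P>. x \<in> p) \<longrightarrow> x = \<zero>) \<and>
     (\<forall>p\<in>\<P>. \<exists>w\<in>carrier R. w \<notin> p \<and> (\<forall>q\<in>\<P> - {p}. w \<in> q))"
proof -
  define ok where "ok \<P> \<longleftrightarrow> finite \<P> \<and> (\<forall>p\<in>\<P>. prime_in R (carrier R) p) \<and>
    (\<forall>x\<in>carrier R. (\<forall>p\<in>\<P>. x \<in> p) \<longrightarrow> x = \<zero>)" for \<P>
  have z: "lspan R (carrier R) {\<zero>} \<subseteq> {\<zero>}" by (intro lspan_least) auto
  have "\<exists>\<P>. ok \<P>"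
    using noeth_radical_primes[OF carrier_is_subring noeth_carrier[OF cring_axioms] _ z] nilpotent_zero
    unfolding ok_def by (metis empty_subsetI insert_subset singletonD zero_closed)
  then obtain \<P> where \<P>: "ok \<P>" "\<And>\<Q>. ok \<Q> \<Longrightarrow> card \<P> \<le> card \<Q>"
    using ex_has_least_nat[of ok _ card] by blast
  have "\<exists>w\<in>carrier R. w \<notin> p \<and> (\<forall>q\<in>\<P> - {p}. w \<in> q)" if p: "p \<in> \<P>" for p
  proof -
    have "card (\<P> - {p}) < card \<P>" using p \<P>(1) unfolding ok_def by (meson card_Diff1_less)
    then have "\<not> ok (\<P> - {p})" using \<P>(2) by (meson not_less)
    then obtain w where w: "w \<in> carrier R" "\<forall>q\<in>\<P> - {p}. w \<in> q" "w \<noteq> \<zero>"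
      using \<P>(1) unfolding ok_def by auto
    then have "w \<notin> p" using \<P>(1) unfolding ok_def by (metis DiffI singletonD)
    then show ?thesis using w by blast
  qed
  then show ?thesis using \<P>(1) unfolding ok_def by blast
qed

lemma prime_add_notin:
  assumes "prime_in R (carrier R) p" "x \<in> carrier R" "y \<in> carrier R" "x \<in> p" "y \<notin> p"
  shows "x \<oplus> y \<notin> p"
proof
  assume "x \<oplus> y \<in> p"
  moreover have "(\<ominus> \<one>) \<otimes> x \<in> p" by (rule prime_inD(5)[OF assms(1) _ assms(4)]) simp
  ultimately have "(\<ominus> \<one>) \<otimes> x \<oplus> (x \<oplus> y) \<in> p" using prime_inD(4)[OF assms(1)] by blast
  moreover have "(\<ominus> \<one>) \<otimes> x \<oplus> (x \<oplus> y) = y" using assms by (simp add: l_minus r_neg1)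
  ultimately show False using assms by simp
qed

text \<open>With \<open>v\<close> vanishing exactly where \<open>z\<close> does not, z + v lies in
  none of the primes, so it is no zero divisor and has an inverse \<open>y\<close>. As z v = 0, this
  gives z = z (z + v) y = z z y.\<close>

lemma von_neumann_regular:
  assumes z: "z \<in> carrier R"
  shows "\<exists>y\<in>carrier R. z \<otimes> z \<otimes> y = z"
proof -
  obtain \<P> where "finite \<P> \<and> (\<forall>p\<in>\<P>. prime_in R (carrier R) p) \<and>
     (\<forall>x\<in>carrier R. (\<forall>p\<in>\<P>. x \<in> p) \<longrightarrow> x = \<zero>) \<and>
     (\<forall>p\<in>\<P>. \<exists>w\<in>carrier R. w \<notin> p \<and> (\<forall>q\<in>\<P> - {p}. w \<in> q))"
    using irredundant_primes by (rule exE)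
  then have \<P>: "finite \<P>" "\<And>p. p \<in> \<P> \<Longrightarrow> prime_in R (carrier R) p"
    "\<And>x. x \<in> carrier R \<Longrightarrow> (\<And>p. p \<in> \<P> \<Longrightarrow> x \<in> p) \<Longrightarrow> x = \<zero>"
    "\<And>p. p \<in> \<P> \<Longrightarrow> \<exists>w\<in>carrier R. w \<notin> p \<and> (\<forall>q\<in>\<P> - {p}. w \<in> q)"
    by simp_all
  \<comment> \<open>Sums of the irredundancy witnesses realize every subset of the family as a set
    of places of nonvanishing.\<close>
  have "\<exists>v\<in>carrier R. \<forall>p\<in>\<P>. v \<in> p \<longleftrightarrow> p \<notin> A" if "finite A" "A \<subseteq> \<P>" for A
    using that
  proof (induction A rule: finite_induct)
    case empty
    then show ?case using prime_inD(2)[OF \<P>(2)] by (intro bexI[of _ \<zero>]) auto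
  next
    case (insert a A)
    then obtain v where v: "v \<in> carrier R" "\<And>p. p \<in> \<P> \<Longrightarrow> v \<in> p \<longleftrightarrow> p \<notin> A" by blast
    obtain w where w: "w \<in> carrier R" "w \<notin> a" "\<And>q. q \<in> \<P> \<Longrightarrow> q \<noteq> a \<Longrightarrow> w \<in> q"
      using \<P>(4)[of a] insert.prems by blast
    have "v \<oplus> w \<in> p \<longleftrightarrow> p \<notin> insert a A" if p: "p \<in> \<P>" for p
    proof -
      note pp = \<P>(2)[OF p]
      consider "p = a" | "p \<noteq> a" "p \<in> A" | "p \<noteq> a" "p \<notin> A" by blast
      then show ?thesis
      proof cases
        case 1
        then show ?thesis using prime_add_notin[OF pp v(1) w(1)] v(2)[OF p] w(2) insert.hyps(2) by auto
      next
        case 2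
        then show ?thesis
          using prime_add_notin[OF pp w(1) v(1)] v(2)[OF p] w(3)[OF p] a_comm[OF v(1) w(1)] by auto
      next
        case 3
        then show ?thesis using prime_inD(4)[OF pp] v(2)[OF p] w(3)[OF p] by auto
      qed
    qed
    then show ?case using v(1) w(1) by blast
  qed
  from this[of "{p \<in> \<P>. z \<in> p}"] obtain v where v: "v \<in> carrier R" "\<And>p. p \<in> \<P> \<Longrightarrow> v \<in> p \<longleftrightarrow> z \<notin> p"
    using \<P>(1) by auto
  let ?u = "z \<oplus> v"
  have nu: "?u \<notin> p" if p: "p \<in> \<P>" for p
    using prime_add_notin[OF \<P>(2)[OF p] z v(1)] prime_add_notin[OF \<P>(2)[OF p] v(1) z] v(2)[OF p]
      a_comm[OF z v(1)] by (cases "z \<in> p") auto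
  have "non_zero_divisor R ?u" unfolding non_zero_divisor_def
  proof (intro conjI ballI impI)
    fix b assume b: "b \<in> carrier R" "?u \<otimes> b = \<zero>"
    have "b \<in> p" if p: "p \<in> \<P>" for p
      using prime_inD(6)[OF \<P>(2)[OF p], of ?u b] prime_inD(2)[OF \<P>(2)[OF p]] b z v(1) nu[OF p] by auto
    then show "b = \<zero>" using \<P>(3) b(1) by blast
  qed (use z v in simp)
  then have "?u \<in> Units R" by (rule non_zero_divisor_invertible)
  then obtain y where y: "y \<in> carrier R" "?u \<otimes> y = \<one>" unfolding Units_def by blast
  have "z \<otimes> v \<in> p" if p: "p \<in> \<P>" for p
  proof (cases "z \<in> p")
    case True
    then show ?thesis using prime_inD(5)[OF \<P>(2)[OF p] v(1)] m_comm[OF z v(1)] by simp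
  next
    case False
    then show ?thesis using prime_inD(5)[OF \<P>(2)[OF p] z] v(2)[OF p] by simp
  qed
  then have zv: "z \<otimes> v = \<zero>" using \<P>(3) z v(1) by simp
  have "z = z \<otimes> (?u \<otimes> y)" using y z by simp
  also have "\<dots> = (z \<otimes> z \<oplus> z \<otimes> v) \<otimes> y" using y(1) z v(1) by (simp add: r_distr m_assoc l_distr)
  also have "\<dots> = z \<otimes> z \<otimes> y" using zv z by simp
  finally show ?thesis using y(1) by metis
qed

text \<open>From x (x y - 1) = 0 one of the two factors lies in \<open>p\<close>. If
  \<open>x\<close> lies in \<open>q\<close>, the second factor is outside \<open>q\<close> and
  therefore outside \<open>p\<close>.\<close>

lemma prime_subset_eq:
  assumes "prime_in R (carrier R) p" "prime_in R (carrier R) q" "p \<subseteq> q"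
  shows "p = q"
proof
  show "q \<subseteq> p"
  proof
    fix x assume x: "x \<in> q"
    have xc: "x \<in> carrier R" using x prime_inD(1)[OF assms(2)] by blast
    obtain y where y: "y \<in> carrier R" "x \<otimes> x \<otimes> y = x" using von_neumann_regular[OF xc] by blast
    have "x \<otimes> (x \<otimes> y \<oplus> \<ominus> \<one>) = x \<otimes> x \<otimes> y \<oplus> \<ominus> x" using xc y(1) by (simp add: r_distr r_minus m_assoc)
    then have "x \<otimes> (x \<otimes> y \<oplus> \<ominus> \<one>) \<in> p" using xc y(2) prime_inD(2)[OF assms(1)] by (simp add: r_neg)
    then consider "x \<in> p" | "x \<otimes> y \<oplus> \<ominus> \<one> \<in> p"
      using prime_inD(6)[OF assms(1) xc, of "x \<otimes> y \<oplus> \<ominus> \<one>"] xc y(1) by auto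
    then show "x \<in> p"
    proof cases
      case 2
      have "y \<otimes> x \<in> q" using prime_inD(5)[OF assms(2) y(1) x] .
      then have "x \<otimes> y \<in> q" using xc y(1) by (simp add: m_comm)
      moreover have "\<ominus> \<one> \<notin> q"
      proof
        assume "\<ominus> \<one> \<in> q"
        then have "(\<ominus> \<one>) \<otimes> (\<ominus> \<one>) \<in> q" using prime_inD(5)[OF assms(2)] by simp
        then show False using prime_inD(3)[OF assms(2)] by (simp add: l_minus)
      qed
      ultimately have "x \<otimes> y \<oplus> \<ominus> \<one> \<notin> q" using prime_add_notin[OF assms(2)] xc y(1) by simp
      then show ?thesis using 2 assms(3) by blast
    qed
  qed
qed (rule assms(3))

lemma finite_primes: "finite {p. prime_in R (carrier R) p}"
proof -
  obtain \<P> where "finite \<P> \<and> (\<forall>p\<in>\<P>. prime_in R (carrier R) p) \<and>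
     (\<forall>x\<in>carrier R. (\<forall>p\<in>\<P>. x \<in> p) \<longrightarrow> x = \<zero>) \<and>
     (\<forall>p\<in>\<P>. \<exists>w\<in>carrier R. w \<notin> p \<and> (\<forall>q\<in>\<P> - {p}. w \<in> q))"
    using irredundant_primes by (rule exE)
  then have \<P>: "finite \<P>" "\<And>p. p \<in> \<P> \<Longrightarrow> prime_in R (carrier R) p"
    "\<And>x. x \<in> carrier R \<Longrightarrow> (\<And>p. p \<in> \<P> \<Longrightarrow> x \<in> p) \<Longrightarrow> x = \<zero>"
    "\<And>p. p \<in> \<P> \<Longrightarrow> \<exists>w\<in>carrier R. w \<notin> p \<and> (\<forall>q\<in>\<P> - {p}. w \<in> q)"
    by simp_all
  have "q \<in> \<P>" if q: "prime_in R (carrier R) q" for q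
  proof -
    have nil: "\<exists>n::nat. x [^] n \<in> q" if "x \<in> carrier R" "\<And>p. p \<in> \<P> \<Longrightarrow> x \<in> p" for x
    proof -
      have "x = \<zero>" using that by (rule \<P>(3))
      then have "x [^] (1::nat) \<in> q" using prime_inD(2)[OF q] by simp
      then show ?thesis by blast
    qed
    have "\<exists>p\<in>\<P>. p \<subseteq> q"
      by (rule prime_contains_finite[OF q carrier_is_subring \<P>(1,2) nil])
    then show ?thesis using prime_subset_eq[OF \<P>(2) q] by blast
  qed
  then have "{p. prime_in R (carrier R) p} \<subseteq> \<P>" by blast
  then show ?thesis using \<P>(1) by (rule finite_subset)
qed

text \<open>The preimages of \<open>p\<close> are finite in number and intersect in zero, so one of
  them lies below \<open>q\<close>; primes being incomparable, it is \<open>q\<close>.\<close>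

lemma prime_orbit_transitive:
  assumes p: "prime_in R (carrier R) p" and q: "prime_in R (carrier R) q"
  shows "\<exists>m. q = {x \<in> carrier R. (\<sigma> ^^ m) x \<in> p}"
proof -
  let ?p = "\<lambda>m. {x \<in> carrier R. (\<sigma> ^^ m) x \<in> p}"
  have fin: "finite (range ?p)"
    using finite_primes prime_vimage[OF p] by (elim finite_subset[rotated]) blast
  have pr: "prime_in R (carrier R) p'" if "p' \<in> range ?p" for p'
    using that prime_vimage[OF p] by (elim rangeE) simp
  have nil: "\<exists>n::nat. x [^] n \<in> q" if x: "x \<in> carrier R" "\<And>p'. p' \<in> range ?p \<Longrightarrow> x \<in> p'" for x
  proof -
    have "(\<sigma> ^^ j) x \<in> p" for j
    proof -
      have "x \<in> ?p j" by (rule x(2)) (rule rangeI)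
      then show ?thesis by simp
    qed
    then have "x = \<zero>" by (rule prime_inter_zero[OF p x(1)])
    then have "x [^] (1::nat) \<in> q" using prime_inD(2)[OF q] by simp
    then show ?thesis by (rule exI)
  qed
  have "\<exists>p'\<in>range ?p. p' \<subseteq> q"
    by (rule prime_contains_finite[OF q carrier_is_subring fin pr nil])
  then obtain m where "?p m \<subseteq> q" by (elim bexE rangeE) simp
  then have "?p m = q" by (rule prime_subset_eq[OF prime_vimage[OF p] q])
  then show ?thesis by (intro exI[of _ m]) simp
qed

text \<open>Two preimages of a prime coincide for lack of primes. The earlier one is a fixed point
  of the remaining number of steps.\<close>

lemma periodic_prime_exists:
  "\<exists>p r. prime_in R (carrier R) p \<and> r > 0 \<and> (\<forall>x\<in>carrier R. (\<sigma> ^^ r) x \<in> p \<longleftrightarrow> x \<in> p)"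
proof -
  have "\<exists>p. minimal_prime_in R (carrier R) p \<and> p \<inter> {\<one>} = {}"
  proof (rule minimal_prime_exists[OF carrier_is_subring])
    show "{\<one>} \<subseteq> carrier R" by simp
    show "\<one> \<in> {\<one>}" by simp
    show "\<zero> \<notin> {\<one>}" using one_neq_zero by (metis singletonD)
    show "x \<otimes> y \<in> {\<one>}" if "x \<in> {\<one>}" "y \<in> {\<one>}" for x y using that by simp
  qed
  then obtain p where p: "minimal_prime_in R (carrier R) p" by blast
  note pp = minimal_prime_inD(1)[OF p]
  let ?p = "\<lambda>m. {x \<in> carrier R. (\<sigma> ^^ m) x \<in> p}"
  have "\<not> inj ?p"
  proof
    assume "inj ?p"
    moreover have "finite (range ?p)"
      using finite_primes prime_vimage[OF pp] by (elim finite_subset[rotated]) blast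
    ultimately show False by (meson finite_imageD infinite_UNIV_nat)
  qed
  then obtain a b where ab: "?p a = ?p b" "a \<noteq> b" unfolding inj_def by blast
  define i where "i = min a b"
  define j where "j = max a b"
  have ij: "i < j" using ab(2) by (simp add: i_def j_def min_def max_def)
  have pij: "?p i = ?p j" using ab(1) by (cases "a \<le> b") (simp_all add: i_def j_def min_def max_def)
  have "(\<sigma> ^^ (j - i)) x \<in> ?p i \<longleftrightarrow> x \<in> ?p i" if x: "x \<in> carrier R" for x
  proof -
    have "(\<sigma> ^^ i) ((\<sigma> ^^ (j - i)) x) = (\<sigma> ^^ j) x"
      using ij by (metis comp_apply funpow_add le_add_diff_inverse less_imp_le)
    then have "(\<sigma> ^^ (j - i)) x \<in> ?p i \<longleftrightarrow> x \<in> ?p j" using x funpow_simps(1) by simp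
    then show ?thesis using pij by simp
  qed
  then show ?thesis using prime_vimage[OF pp, of i] ij by (intro exI[of _ "?p i"] exI[of _ "j - i"]) auto
qed

end

section \<open>Rings from congruences\<close>

text \<open>A quotient of a structure on \<open>C\<close> by the kernel of \<open>ev\<close>. Any
  map with the right kernel may serve, which leaves the type of the quotient free: sets of
  sequences, evaluations at functionals or coded tuples.\<close>

definition quot_ring :: "'c set \<Rightarrow> ('c \<Rightarrow> 'c \<Rightarrow> 'c) \<Rightarrow> ('c \<Rightarrow> 'c \<Rightarrow> 'c) \<Rightarrow> 'c \<Rightarrow> 'c \<Rightarrow> ('c \<Rightarrow> 'e) \<Rightarrow> 'e ring" where
  "quot_ring C pl mu ze on ev = \<lparr>carrier = ev ` C,
     mult = \<lambda>x y. ev (mu (inv_into C ev x) (inv_into C ev y)), one = ev on, zero = ev ze,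
     add = \<lambda>x y. ev (pl (inv_into C ev x) (inv_into C ev y))\<rparr>"

text \<open>The ring laws are required only up to \<open>ev\<close>. Congruence is stated for the
  left argument, and commutativity carries it to the right one.\<close>

locale ring_congruence =
  fixes C :: "'c set" and pl mu ng ze on and ev :: "'c \<Rightarrow> 'e"
  assumes closed: "x \<in> C \<Longrightarrow> y \<in> C \<Longrightarrow> pl x y \<in> C" "x \<in> C \<Longrightarrow> y \<in> C \<Longrightarrow> mu x y \<in> C"
      "x \<in> C \<Longrightarrow> ng x \<in> C" "ze \<in> C" "on \<in> C"
    and cong: "x \<in> C \<Longrightarrow> x' \<in> C \<Longrightarrow> y \<in> C \<Longrightarrow> ev x = ev x' \<Longrightarrow> ev (pl x y) = ev (pl x' y)"
      "x \<in> C \<Longrightarrow> x' \<in> C \<Longrightarrow> y \<in> C \<Longrightarrow> ev x = ev x' \<Longrightarrow> ev (mu x y) = ev (mu x' y)"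
    and comm: "x \<in> C \<Longrightarrow> y \<in> C \<Longrightarrow> ev (pl x y) = ev (pl y x)"
      "x \<in> C \<Longrightarrow> y \<in> C \<Longrightarrow> ev (mu x y) = ev (mu y x)"
    and assoc: "x \<in> C \<Longrightarrow> y \<in> C \<Longrightarrow> z \<in> C \<Longrightarrow> ev (pl (pl x y) z) = ev (pl x (pl y z))"
      "x \<in> C \<Longrightarrow> y \<in> C \<Longrightarrow> z \<in> C \<Longrightarrow> ev (mu (mu x y) z) = ev (mu x (mu y z))"
    and unit: "x \<in> C \<Longrightarrow> ev (pl ze x) = ev x" "x \<in> C \<Longrightarrow> ev (mu on x) = ev x"
      "x \<in> C \<Longrightarrow> ev (pl (ng x) x) = ev ze"
    and distr: "x \<in> C \<Longrightarrow> y \<in> C \<Longrightarrow> z \<in> C \<Longrightarrow> ev (mu (pl x y) z) = ev (pl (mu x z) (mu y z))"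
begin

abbreviation Q :: "'e ring" where
  "Q \<equiv> quot_ring C pl mu ze on ev"

lemma rep: "x \<in> C \<Longrightarrow> inv_into C ev (ev x) \<in> C" "x \<in> C \<Longrightarrow> ev (inv_into C ev (ev x)) = ev x"
  by (auto intro: inv_into_into f_inv_into_f)

lemma simps:
  "carrier Q = ev ` C" "\<one>\<^bsub>Q\<^esub> = ev on" "\<zero>\<^bsub>Q\<^esub> = ev ze"
  "x \<in> C \<Longrightarrow> y \<in> C \<Longrightarrow> ev x \<oplus>\<^bsub>Q\<^esub> ev y = ev (pl x y)"
  "x \<in> C \<Longrightarrow> y \<in> C \<Longrightarrow> ev x \<otimes>\<^bsub>Q\<^esub> ev y = ev (mu x y)"
proof -
  show "carrier Q = ev ` C" "\<one>\<^bsub>Q\<^esub> = ev on" "\<zero>\<^bsub>Q\<^esub> = ev ze" by (simp_all add: quot_ring_def)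
  assume xy: "x \<in> C" "y \<in> C"
  let ?x = "inv_into C ev (ev x)" and ?y = "inv_into C ev (ev y)"
  note r = rep[OF xy(1)] rep[OF xy(2)]
  have "ev (pl ?x ?y) = ev (pl x ?y)" using r xy by (intro cong) auto
  also have "\<dots> = ev (pl ?y x)" using r xy by (intro comm) auto
  also have "\<dots> = ev (pl y x)" using r xy by (intro cong) auto
  also have "\<dots> = ev (pl x y)" using xy by (intro comm) auto
  finally show "ev x \<oplus>\<^bsub>Q\<^esub> ev y = ev (pl x y)" by (simp add: quot_ring_def)
  have "ev (mu ?x ?y) = ev (mu x ?y)" using r xy by (intro cong) auto
  also have "\<dots> = ev (mu ?y x)" using r xy by (intro comm) auto
  also have "\<dots> = ev (mu y x)" using r xy by (intro cong) auto
  also have "\<dots> = ev (mu x y)" using xy by (intro comm) auto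
  finally show "ev x \<otimes>\<^bsub>Q\<^esub> ev y = ev (mu x y)" by (simp add: quot_ring_def)
qed

lemma cring_Q: "cring Q"
proof (rule cringI)
  show "abelian_group Q"
  proof (rule abelian_groupI)
    fix x assume "x \<in> carrier Q"
    then obtain a where "a \<in> C" "x = ev a" unfolding simps(1) by blast
    then show "\<exists>y\<in>carrier Q. y \<oplus>\<^bsub>Q\<^esub> x = \<zero>\<^bsub>Q\<^esub>"
      using unit(3)[of a] closed(3)[of a] by (intro bexI[of _ "ev (ng a)"]) (auto simp: simps)
  next
    fix x y z assume "x \<in> carrier Q" "y \<in> carrier Q" "z \<in> carrier Q"
    then obtain a b c where "a \<in> C" "x = ev a" "b \<in> C" "y = ev b" "c \<in> C" "z = ev c"
      unfolding simps(1) by blast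
    then show "x \<oplus>\<^bsub>Q\<^esub> y \<oplus>\<^bsub>Q\<^esub> z = x \<oplus>\<^bsub>Q\<^esub> (y \<oplus>\<^bsub>Q\<^esub> z)" using assoc(1)[of a b c] by (simp add: simps closed)
  qed (auto simp: simps closed unit intro: comm)
  show "comm_monoid Q"
  proof (rule comm_monoidI)
    fix x y z assume "x \<in> carrier Q" "y \<in> carrier Q" "z \<in> carrier Q"
    then obtain a b c where "a \<in> C" "x = ev a" "b \<in> C" "y = ev b" "c \<in> C" "z = ev c"
      unfolding simps(1) by blast
    then show "x \<otimes>\<^bsub>Q\<^esub> y \<otimes>\<^bsub>Q\<^esub> z = x \<otimes>\<^bsub>Q\<^esub> (y \<otimes>\<^bsub>Q\<^esub> z)" using assoc(2)[of a b c] by (simp add: simps closed)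
  qed (auto simp: simps closed unit intro: comm)
  fix x y z assume "x \<in> carrier Q" "y \<in> carrier Q" "z \<in> carrier Q"
  then obtain a b c where "a \<in> C" "x = ev a" "b \<in> C" "y = ev b" "c \<in> C" "z = ev c"
    unfolding simps(1) by blast
  then show "(x \<oplus>\<^bsub>Q\<^esub> y) \<otimes>\<^bsub>Q\<^esub> z = x \<otimes>\<^bsub>Q\<^esub> z \<oplus>\<^bsub>Q\<^esub> y \<otimes>\<^bsub>Q\<^esub> z"
    using distr[of a b c] by (simp add: simps closed)
qed

end

context cring
begin

lemma prime_congruence:
  assumes p: "prime_in R (carrier R) p"
  shows "x \<in> carrier R \<Longrightarrow> x \<ominus> x \<in> p"
    "x \<in> carrier R \<Longrightarrow> y \<in> carrier R \<Longrightarrow> x \<ominus> y \<in> p \<Longrightarrow> y \<ominus> x \<in> p"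
    "x \<in> carrier R \<Longrightarrow> y \<in> carrier R \<Longrightarrow> z \<in> carrier R \<Longrightarrow> x \<ominus> y \<in> p \<Longrightarrow> y \<ominus> z \<in> p \<Longrightarrow> x \<ominus> z \<in> p"
    "x \<in> carrier R \<Longrightarrow> y \<in> carrier R \<Longrightarrow> z \<in> carrier R \<Longrightarrow> x \<ominus> y \<in> p \<Longrightarrow> (x \<oplus> z) \<ominus> (y \<oplus> z) \<in> p"
    "x \<in> carrier R \<Longrightarrow> y \<in> carrier R \<Longrightarrow> z \<in> carrier R \<Longrightarrow> x \<ominus> y \<in> p \<Longrightarrow> (x \<otimes> z) \<ominus> (y \<otimes> z) \<in> p"
    "x \<in> carrier R \<Longrightarrow> y \<in> carrier R \<Longrightarrow> x \<ominus> y \<in> p \<Longrightarrow> (\<ominus> x) \<ominus> (\<ominus> y) \<in> p"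
proof -
  note pd = prime_inD[OF p]
  show "x \<ominus> x \<in> p" if "x \<in> carrier R" using that pd(2) by (simp add: a_minus_def r_neg)
  show "y \<ominus> x \<in> p" if "x \<in> carrier R" "y \<in> carrier R" "x \<ominus> y \<in> p"
  proof -
    have "y \<ominus> x = (\<ominus> \<one>) \<otimes> (x \<ominus> y)" using that by (simp add: a_minus_def l_minus minus_add a_comm)
    then show ?thesis using pd(5)[of "\<ominus> \<one>"] that by simp
  qed
  show "x \<ominus> z \<in> p" if "x \<in> carrier R" "y \<in> carrier R" "z \<in> carrier R" "x \<ominus> y \<in> p" "y \<ominus> z \<in> p"
  proof -
    have "x \<ominus> z = (x \<ominus> y) \<oplus> (y \<ominus> z)" using that by (simp add: a_minus_def a_ac r_neg1 r_neg2)
    then show ?thesis using pd(4) that by simp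
  qed
  show "(x \<oplus> z) \<ominus> (y \<oplus> z) \<in> p" if "x \<in> carrier R" "y \<in> carrier R" "z \<in> carrier R" "x \<ominus> y \<in> p"
  proof -
    have "z \<oplus> (\<ominus> y \<oplus> \<ominus> z) = \<ominus> y" using that by (simp add: a_lcomm[of z "\<ominus> y"] r_neg)
    then have "(x \<oplus> z) \<ominus> (y \<oplus> z) = x \<ominus> y" using that by (simp add: a_minus_def minus_add a_assoc)
    then show ?thesis using that by simp
  qed
  show "(x \<otimes> z) \<ominus> (y \<otimes> z) \<in> p" if "x \<in> carrier R" "y \<in> carrier R" "z \<in> carrier R" "x \<ominus> y \<in> p"
  proof -
    have "(x \<otimes> z) \<ominus> (y \<otimes> z) = z \<otimes> (x \<ominus> y)" using that by (simp add: a_minus_def r_distr r_minus m_comm)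
    then show ?thesis using pd(5) that by simp
  qed
  show "(\<ominus> x) \<ominus> (\<ominus> y) \<in> p" if "x \<in> carrier R" "y \<in> carrier R" "x \<ominus> y \<in> p"
  proof -
    have "(\<ominus> x) \<ominus> (\<ominus> y) = (\<ominus> \<one>) \<otimes> (x \<ominus> y)" using that by (simp add: a_minus_def l_minus minus_add a_comm)
    then show ?thesis using pd(5)[of "\<ominus> \<one>"] that by simp
  qed
qed

end

section \<open>The inversive closure of a residue field\<close>

text \<open>
  The direct limit of \<open>R/p \<rightarrow> R/p \<rightarrow> \<dots>\<close> along \<open>\<sigma>\<close>, realized as the germs at infinity of sequences
  that are eventually orbits of \<open>\<sigma>\<close> modulo \<open>p\<close>.
\<close>

locale fixed_prime = sigma_ring +
  fixes p :: "'a set"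
  assumes p: "prime_in R (carrier R) p"
    and fixed: "x \<in> carrier R \<Longrightarrow> \<sigma> x \<in> p \<longleftrightarrow> x \<in> p"
    and maximal: "x \<in> carrier R \<Longrightarrow> x \<notin> p \<Longrightarrow> \<exists>y\<in>carrier R. x \<otimes> y \<ominus> \<one> \<in> p"
begin

definition seqs :: "(nat \<Rightarrow> 'a) set" where
  "seqs = {u. (\<forall>n. u n \<in> carrier R) \<and> (\<forall>\<^sub>F n in sequentially. u (Suc n) \<ominus> \<sigma> (u n) \<in> p)}"

definition germ :: "(nat \<Rightarrow> 'a) \<Rightarrow> (nat \<Rightarrow> 'a) set" where
  "germ u = {v \<in> seqs. \<forall>\<^sub>F n in sequentially. u n \<ominus> v n \<in> p}"

lemmas pc = prime_congruence[OF p]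

lemma seqsD: "u \<in> seqs \<Longrightarrow> u n \<in> carrier R" "u \<in> seqs \<Longrightarrow> \<forall>\<^sub>F n in sequentially. u (Suc n) \<ominus> \<sigma> (u n) \<in> p"
  by (auto simp: seqs_def)

lemma germ_eq_iff:
  assumes u: "u \<in> seqs" and v: "v \<in> seqs"
  shows "germ u = germ v \<longleftrightarrow> (\<forall>\<^sub>F n in sequentially. u n \<ominus> v n \<in> p)"
proof
  assume "germ u = germ v"
  moreover have "v \<in> germ v" using v pc(1)[OF seqsD(1)[OF v]] by (simp add: germ_def)
  ultimately have "v \<in> germ u" by simp
  then show "\<forall>\<^sub>F n in sequentially. u n \<ominus> v n \<in> p" by (simp add: germ_def)
next
  assume uv: "\<forall>\<^sub>F n in sequentially. u n \<ominus> v n \<in> p"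
  have "(\<forall>\<^sub>F n in sequentially. u n \<ominus> w n \<in> p) \<longleftrightarrow> (\<forall>\<^sub>F n in sequentially. v n \<ominus> w n \<in> p)" if w: "w \<in> seqs" for w
  proof
    note c = seqsD(1)[OF u] seqsD(1)[OF v] seqsD(1)[OF w]
    show "\<forall>\<^sub>F n in sequentially. v n \<ominus> w n \<in> p" if "\<forall>\<^sub>F n in sequentially. u n \<ominus> w n \<in> p"
      using that uv
    proof eventually_elim
      case (elim n)
      show ?case by (rule pc(3)[OF c(2) c(1) c(3) pc(2)[OF c(1) c(2) elim(2)] elim(1)])
    qed
    show "\<forall>\<^sub>F n in sequentially. u n \<ominus> w n \<in> p" if "\<forall>\<^sub>F n in sequentially. v n \<ominus> w n \<in> p"
      using that uv
    proof eventually_elim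
      case (elim n)
      show ?case by (rule pc(3)[OF c(1) c(2) c(3) elim(2) elim(1)])
    qed
  qed
  then show "germ u = germ v" by (auto simp: germ_def)
qed

lemma \<sigma>_a_minus: "x \<in> carrier R \<Longrightarrow> y \<in> carrier R \<Longrightarrow> \<sigma> (x \<ominus> y) = \<sigma> x \<ominus> \<sigma> y"
proof -
  assume xy: "x \<in> carrier R" "y \<in> carrier R"
  have "\<sigma> (\<ominus> y) \<oplus> \<sigma> y = \<zero>" using xy sigma_simps(2)[of "\<ominus> y" y] by (simp add: l_neg sigma_simps)
  then have "\<sigma> (\<ominus> y) = \<ominus> \<sigma> y" using xy by (simp add: minus_equality sigma_simps)
  then show ?thesis using xy by (simp add: a_minus_def sigma_simps)
qed

lemma \<sigma>_cong: "x \<in> carrier R \<Longrightarrow> y \<in> carrier R \<Longrightarrow> \<sigma> x \<ominus> \<sigma> y \<in> p \<longleftrightarrow> x \<ominus> y \<in> p"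
  using fixed[of "x \<ominus> y"] \<sigma>_a_minus[of x y] by simp

lemma seqs_closed:
  assumes u: "u \<in> seqs" and v: "v \<in> seqs"
  shows "(\<lambda>n. u n \<oplus> v n) \<in> seqs" "(\<lambda>n. u n \<otimes> v n) \<in> seqs" "(\<lambda>n. \<ominus> u n) \<in> seqs" "(\<lambda>n. \<sigma> (u n)) \<in> seqs"
    "(\<lambda>n. u (n - 1)) \<in> seqs"
proof -
  note c = seqsD(1)[OF u] seqsD(1)[OF v]
  note sc = sigma_simps(1)[OF c(1)] sigma_simps(1)[OF c(2)]
  have uv: "\<forall>\<^sub>F n in sequentially. u (Suc n) \<ominus> \<sigma> (u n) \<in> p \<and> v (Suc n) \<ominus> \<sigma> (v n) \<in> p"
    using seqsD(2)[OF u] seqsD(2)[OF v] by (rule eventually_conj)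
  have a: "x \<oplus> y \<ominus> (x' \<oplus> y') \<in> p" if cc: "x \<in> carrier R" "y \<in> carrier R" "x' \<in> carrier R" "y' \<in> carrier R"
    and xy: "x \<ominus> x' \<in> p" "y \<ominus> y' \<in> p" for x y x' y'
  proof -
    have "x \<oplus> y \<ominus> (x' \<oplus> y) \<in> p" by (rule pc(4)[OF cc(1,3,2) xy(1)])
    moreover have "x' \<oplus> y \<ominus> (x' \<oplus> y') \<in> p" using pc(4)[OF cc(2,4,3) xy(2)] cc by (simp add: a_comm)
    ultimately show ?thesis using pc(3)[of "x \<oplus> y" "x' \<oplus> y" "x' \<oplus> y'"] cc by simp
  qed
  have m: "x \<otimes> y \<ominus> (x' \<otimes> y') \<in> p" if cc: "x \<in> carrier R" "y \<in> carrier R" "x' \<in> carrier R" "y' \<in> carrier R"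
    and xy: "x \<ominus> x' \<in> p" "y \<ominus> y' \<in> p" for x y x' y'
  proof -
    have "x \<otimes> y \<ominus> (x' \<otimes> y) \<in> p" by (rule pc(5)[OF cc(1,3,2) xy(1)])
    moreover have "x' \<otimes> y \<ominus> (x' \<otimes> y') \<in> p" using pc(5)[OF cc(2,4,3) xy(2)] cc by (simp add: m_comm)
    ultimately show ?thesis using pc(3)[of "x \<otimes> y" "x' \<otimes> y" "x' \<otimes> y'"] cc by simp
  qed
  show "(\<lambda>n. u n \<oplus> v n) \<in> seqs"
    unfolding seqs_def mem_Collect_eq
  proof (intro conjI allI)
    show "\<forall>\<^sub>F n in sequentially. u (Suc n) \<oplus> v (Suc n) \<ominus> \<sigma> (u n \<oplus> v n) \<in> p"
      using uv by (rule eventually_mono) (use a[OF c sc] c in \<open>simp add: sigma_simps\<close>)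
  qed (use c in simp)
  show "(\<lambda>n. u n \<otimes> v n) \<in> seqs"
    unfolding seqs_def mem_Collect_eq
  proof (intro conjI allI)
    show "\<forall>\<^sub>F n in sequentially. u (Suc n) \<otimes> v (Suc n) \<ominus> \<sigma> (u n \<otimes> v n) \<in> p"
      using uv by (rule eventually_mono) (use m[OF c sc] c in \<open>simp add: sigma_simps\<close>)
  qed (use c in simp)
  show "(\<lambda>n. \<ominus> u n) \<in> seqs"
    unfolding seqs_def mem_Collect_eq
  proof (intro conjI allI)
    have "\<sigma> (\<ominus> u n) = \<ominus> \<sigma> (u n)" for n
      using \<sigma>_a_minus[of \<zero> "u n"] c by (simp add: a_minus_def sigma_simps)
    then show "\<forall>\<^sub>F n in sequentially. \<ominus> u (Suc n) \<ominus> \<sigma> (\<ominus> u n) \<in> p"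
      using seqsD(2)[OF u] by (auto elim!: eventually_mono intro!: pc(6) c sc)
  qed (use c in simp)
  show "(\<lambda>n. \<sigma> (u n)) \<in> seqs"
    unfolding seqs_def mem_Collect_eq
  proof (intro conjI allI)
    show "\<forall>\<^sub>F n in sequentially. \<sigma> (u (Suc n)) \<ominus> \<sigma> (\<sigma> (u n)) \<in> p"
      using seqsD(2)[OF u] by (rule eventually_mono) (use \<sigma>_cong c sc in simp)
  qed (use sc in simp)
  \<comment> \<open>The delayed sequence will represent the preimage under the induced map. Its
    entry at zero is \<open>u 0\<close> again, which the germ does not see.\<close>
  show "(\<lambda>n. u (n - 1)) \<in> seqs"
    unfolding seqs_def mem_Collect_eq
  proof (intro conjI allI)
    obtain N where N: "\<And>n. n \<ge> N \<Longrightarrow> u (Suc n) \<ominus> \<sigma> (u n) \<in> p"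
      using seqsD(2)[OF u] by (auto simp: eventually_sequentially)
    have "u (Suc n - 1) \<ominus> \<sigma> (u (n - 1)) \<in> p" if n: "n \<ge> Suc N" for n
    proof -
      obtain k where k: "n = Suc k" using n by (cases n) auto
      then show ?thesis using N[of k] n by simp
    qed
    then show "\<forall>\<^sub>F n in sequentially. u (Suc n - 1) \<ominus> \<sigma> (u (n - 1)) \<in> p"
      by (auto simp: eventually_sequentially)
  qed (use c in simp)
qed

lemma const_seqs: "x \<in> carrier R \<Longrightarrow> (\<lambda>n. (\<sigma> ^^ n) x) \<in> seqs"
  using pc(1) by (auto simp: seqs_def funpow_simps sigma_simps)

lemma const_zero_one: "(\<lambda>n. \<zero>) \<in> seqs" "(\<lambda>n. \<one>) \<in> seqs"
  using const_seqs[of \<zero>] const_seqs[of \<one>] by (simp_all add: funpow_simps)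

sublocale G: ring_congruence seqs "\<lambda>u v n. u n \<oplus> v n" "\<lambda>u v n. u n \<otimes> v n" "\<lambda>u n. \<ominus> u n"
  "\<lambda>n. \<zero>" "\<lambda>n. \<one>" germ
proof
  fix x y z :: "nat \<Rightarrow> 'a" assume xyz: "x \<in> seqs" "y \<in> seqs" "z \<in> seqs"
  note c = seqsD(1)[OF xyz(1)] seqsD(1)[OF xyz(2)] seqsD(1)[OF xyz(3)]
  have "(\<lambda>n. x n \<oplus> y n \<oplus> z n) = (\<lambda>n. x n \<oplus> (y n \<oplus> z n))" using c by (simp add: a_assoc)
  then show "germ (\<lambda>n. x n \<oplus> y n \<oplus> z n) = germ (\<lambda>n. x n \<oplus> (y n \<oplus> z n))" by simp
  have "(\<lambda>n. x n \<otimes> y n \<otimes> z n) = (\<lambda>n. x n \<otimes> (y n \<otimes> z n))" using c by (simp add: m_assoc)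
  then show "germ (\<lambda>n. x n \<otimes> y n \<otimes> z n) = germ (\<lambda>n. x n \<otimes> (y n \<otimes> z n))" by simp
  have "(\<lambda>n. (x n \<oplus> y n) \<otimes> z n) = (\<lambda>n. x n \<otimes> z n \<oplus> y n \<otimes> z n)" using c by (simp add: l_distr)
  then show "germ (\<lambda>n. (x n \<oplus> y n) \<otimes> z n) = germ (\<lambda>n. x n \<otimes> z n \<oplus> y n \<otimes> z n)" by simp
next
  fix x x' y :: "nat \<Rightarrow> 'a" assume xyz: "x \<in> seqs" "x' \<in> seqs" "y \<in> seqs" and eq: "germ x = germ x'"
  note c = seqsD(1)[OF xyz(1)] seqsD(1)[OF xyz(2)] seqsD(1)[OF xyz(3)]
  have e: "\<forall>\<^sub>F n in sequentially. x n \<ominus> x' n \<in> p" using eq germ_eq_iff xyz by blast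
  then have "\<forall>\<^sub>F n in sequentially. x n \<oplus> y n \<ominus> (x' n \<oplus> y n) \<in> p"
    by (rule eventually_mono) (rule pc(4)[OF c])
  then show "germ (\<lambda>n. x n \<oplus> y n) = germ (\<lambda>n. x' n \<oplus> y n)"
    using germ_eq_iff seqs_closed(1) xyz by simp
  have "\<forall>\<^sub>F n in sequentially. x n \<otimes> y n \<ominus> (x' n \<otimes> y n) \<in> p"
    using e by (rule eventually_mono) (rule pc(5)[OF c])
  then show "germ (\<lambda>n. x n \<otimes> y n) = germ (\<lambda>n. x' n \<otimes> y n)"
    using germ_eq_iff seqs_closed(2) xyz by simp
next
  fix x y :: "nat \<Rightarrow> 'a" assume xy: "x \<in> seqs" "y \<in> seqs"
  note c = seqsD(1)[OF xy(1)] seqsD(1)[OF xy(2)]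
  show "germ (\<lambda>n. x n \<oplus> y n) = germ (\<lambda>n. y n \<oplus> x n)" using c by (simp add: a_comm)
  show "germ (\<lambda>n. x n \<otimes> y n) = germ (\<lambda>n. y n \<otimes> x n)" using c by (simp add: m_comm)
next
  fix x :: "nat \<Rightarrow> 'a" assume x: "x \<in> seqs"
  note c = seqsD(1)[OF x]
  show "germ (\<lambda>n. \<zero> \<oplus> x n) = germ x" "germ (\<lambda>n. \<one> \<otimes> x n) = germ x" using c by simp_all
  show "germ (\<lambda>n. \<ominus> x n \<oplus> x n) = germ (\<lambda>n. \<zero>)" using c by (simp add: l_neg)
qed (use seqs_closed const_zero_one in auto)

text \<open>Once \<open>u\<close> behaves as an orbit, membership of its terms in \<open>p\<close>
  no longer changes, because \<sigma> fixes \<open>p\<close>. A nonzero germ therefore has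
  invertible terms from some index on, and inverting them one by one is consistent.\<close>

lemma germ_inverse:
  assumes u: "u \<in> seqs" and nz: "germ u \<noteq> germ (\<lambda>n. \<zero>)"
  shows "\<exists>v\<in>seqs. germ (\<lambda>n. u n \<otimes> v n) = germ (\<lambda>n. \<one>)"
proof -
  note c = seqsD(1)[OF u]
  obtain N where N: "\<And>n. n \<ge> N \<Longrightarrow> u (Suc n) \<ominus> \<sigma> (u n) \<in> p"
    using seqsD(2)[OF u] by (auto simp: eventually_sequentially)
  have z: "x \<ominus> \<zero> = x" if "x \<in> carrier R" for x using that by (simp add: a_minus_def)
  have "\<not> (\<forall>\<^sub>F n in sequentially. u n \<in> p)"
    using nz germ_eq_iff[OF u const_zero_one(1)] z[OF c] by simp
  then obtain m where m: "m \<ge> N" "u m \<notin> p" by (auto simp: eventually_sequentially)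
  have st: "u (Suc n) \<in> p \<longleftrightarrow> u n \<in> p" if n: "n \<ge> N" for n
  proof -
    have sc: "\<sigma> (u n) \<in> carrier R" using sigma_simps(1)[OF c] .
    have "u (Suc n) \<in> p \<longleftrightarrow> \<sigma> (u n) \<in> p"
      using pc(3)[OF sc c zero_closed pc(2)[OF c sc N[OF n]]] pc(3)[OF c sc zero_closed N[OF n]]
        z[OF c] z[OF sc] by auto
    then show ?thesis using fixed[OF c] by simp
  qed
  have np: "u n \<notin> p" if "n \<ge> m" for n
    using that by (induction n rule: dec_induct) (use m st in auto)
  define v where "v n = (if n \<ge> m then (SOME y. y \<in> carrier R \<and> u n \<otimes> y \<ominus> \<one> \<in> p) else \<one>)" for n
  have v: "v n \<in> carrier R \<and> u n \<otimes> v n \<ominus> \<one> \<in> p" if "n \<ge> m" for n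
    using someI_ex[of "\<lambda>y. y \<in> carrier R \<and> u n \<otimes> y \<ominus> \<one> \<in> p"] maximal[OF c np[OF that]] that
    by (auto simp: v_def)
  have vc: "v n \<in> carrier R" for n using v[of n] by (cases "n \<ge> m") (auto simp: v_def)
  have "v (Suc n) \<ominus> \<sigma> (v n) \<in> p" if n: "n \<ge> m" for n
  proof -
    have sc: "\<sigma> (u n) \<in> carrier R" "\<sigma> (v n) \<in> carrier R" using sigma_simps(1) c vc by auto
    \<comment> \<open>\<open>v (Suc n)\<close> and \<open>\<sigma> (v n)\<close> both invert
      \<open>u (Suc n)\<close> modulo \<open>p\<close>, so they agree modulo
      \<open>p\<close>.\<close>
    have 1: "u (Suc n) \<otimes> v (Suc n) \<ominus> \<one> \<in> p" using v n by simp
    have "\<sigma> (u n \<otimes> v n) \<ominus> \<sigma> \<one> \<in> p" using v[OF n] \<sigma>_cong c vc by simp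
    then have 2: "\<sigma> (u n) \<otimes> \<sigma> (v n) \<ominus> \<one> \<in> p" using c vc by (simp add: sigma_simps)
    have 3: "u (Suc n) \<otimes> \<sigma> (v n) \<ominus> \<sigma> (u n) \<otimes> \<sigma> (v n) \<in> p"
      using N[of n] n m(1) by (intro pc(5) c sc) simp
    have "u (Suc n) \<otimes> \<sigma> (v n) \<ominus> \<one> \<in> p"
      by (rule pc(3)[OF _ _ _ 3 2]) (use c sc in auto)
    then have "\<one> \<ominus> u (Suc n) \<otimes> \<sigma> (v n) \<in> p" using pc(2)[of "u (Suc n) \<otimes> \<sigma> (v n)" \<one>] c sc by simp
    then have "u (Suc n) \<otimes> v (Suc n) \<ominus> u (Suc n) \<otimes> \<sigma> (v n) \<in> p"
      using pc(3)[OF _ _ _ 1] c sc vc by auto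
    then have "u (Suc n) \<otimes> (v (Suc n) \<ominus> \<sigma> (v n)) \<in> p"
      using c sc vc by (simp add: a_minus_def r_distr r_minus)
    then show ?thesis using prime_inD(6)[OF p c, of "v (Suc n) \<ominus> \<sigma> (v n)" "Suc n"] np[of "Suc n"] n vc sc by auto
  qed
  then have vs: "v \<in> seqs" unfolding seqs_def using vc by (auto simp: eventually_sequentially)
  moreover have "\<forall>\<^sub>F n in sequentially. u n \<otimes> v n \<ominus> \<one> \<in> p" using v by (auto simp: eventually_sequentially)
  then have "germ (\<lambda>n. u n \<otimes> v n) = germ (\<lambda>n. \<one>)"
    using germ_eq_iff[OF seqs_closed(2)[OF u vs] const_zero_one(2)] by simp
  ultimately show ?thesis by blast
qed

text \<open>On germs the action of \<sigma> is the shift to the left, which is invertible by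
  delaying. The last clause says that every element becomes a residue after finitely many
  applications of \<open>s\<close>; it yields both the universal property and a bound on the
  size.\<close>

theorem inversive_residue_field:
  "\<exists>(F :: (nat \<Rightarrow> 'a) set ring) s h. cring F \<and> sfield F (carrier F) \<and>
     s \<in> ring_hom F F \<and> bij_betw s (carrier F) (carrier F) \<and> h \<in> ring_hom R F \<and>
     (\<forall>x\<in>carrier R. h x = \<zero>\<^bsub>F\<^esub> \<longleftrightarrow> x \<in> p) \<and> (\<forall>x\<in>carrier R. h (\<sigma> x) = s (h x)) \<and>
     (\<forall>\<xi>\<in>carrier F. \<exists>n. \<exists>x\<in>carrier R. (s ^^ n) \<xi> = h x)"
proof -
  let ?F = G.Q
  define s where "s X = germ (\<lambda>n. \<sigma> (inv_into seqs germ X n))" for X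
  define h where "h x = germ (\<lambda>n. (\<sigma> ^^ n) x)" for x
  have s: "s (germ u) = germ (\<lambda>n. \<sigma> (u n))" if u: "u \<in> seqs" for u
  proof -
    let ?v = "inv_into seqs germ (germ u)"
    note v = G.rep[OF u]
    have "\<forall>\<^sub>F n in sequentially. ?v n \<ominus> u n \<in> p" using v(2) germ_eq_iff[OF v(1) u] by simp
    then have "\<forall>\<^sub>F n in sequentially. \<sigma> (?v n) \<ominus> \<sigma> (u n) \<in> p"
      by (rule eventually_mono) (use \<sigma>_cong seqsD(1)[OF v(1)] seqsD(1)[OF u] in simp)
    then show ?thesis unfolding s_def using germ_eq_iff seqs_closed(4)[OF v(1) u] seqs_closed(4)[OF u u] by simp
  qed
  have spow: "(s ^^ k) (germ u) = germ (\<lambda>n. (\<sigma> ^^ k) (u n)) \<and> (\<lambda>n. (\<sigma> ^^ k) (u n)) \<in> seqs" if u: "u \<in> seqs" for u k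
  proof (induction k)
    case (Suc k)
    then have k: "(\<lambda>n. (\<sigma> ^^ k) (u n)) \<in> seqs" by blast
    show ?case using Suc s[OF k] seqs_closed(4)[OF k k] by simp
  qed (use u in simp)
  have F: "cring ?F" by (rule G.cring_Q)
  have one: "\<one>\<^bsub>?F\<^esub> \<noteq> \<zero>\<^bsub>?F\<^esub>"
    using prime_inD(3)[OF p] germ_eq_iff[OF const_zero_one(2,1)] by (simp add: G.simps a_minus_def)
  have inv: "\<exists>y\<in>carrier ?F. x \<otimes>\<^bsub>?F\<^esub> y = \<one>\<^bsub>?F\<^esub>" if x: "x \<in> carrier ?F - {\<zero>\<^bsub>?F\<^esub>}" for x
  proof -
    obtain u where u: "u \<in> seqs" "x = germ u" using x unfolding G.simps(1) by blast
    obtain v where v: "v \<in> seqs" "germ (\<lambda>n. u n \<otimes> v n) = germ (\<lambda>n. \<one>)"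
      using germ_inverse[OF u(1)] x u(2) by (auto simp: G.simps)
    show ?thesis using u v by (intro bexI[of _ "germ v"]) (auto simp: G.simps)
  qed
  have fld: "sfield ?F (carrier ?F)"
    unfolding sfield_def using one inv ring.carrier_is_subring[OF cring.axioms(1)[OF F]] by blast
  have sh: "s \<in> ring_hom ?F ?F"
  proof (rule ring_hom_memI)
    fix x assume "x \<in> carrier ?F"
    then obtain u where u: "u \<in> seqs" "x = germ u" unfolding G.simps(1) by blast
    then show "s x \<in> carrier ?F" using s seqs_closed(4)[OF u(1) u(1)] by (auto simp: G.simps)
    fix y assume "y \<in> carrier ?F"
    then obtain v where v: "v \<in> seqs" "y = germ v" unfolding G.simps(1) by blast
    note sc = seqs_closed(4)[OF u(1) u(1)] seqs_closed(4)[OF v(1) v(1)]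
    note c = seqsD(1)[OF u(1)] seqsD(1)[OF v(1)]
    show "s (x \<otimes>\<^bsub>?F\<^esub> y) = s x \<otimes>\<^bsub>?F\<^esub> s y"
      using u v sc c s seqs_closed(2)[OF u(1) v(1)] by (simp add: G.simps sigma_simps)
    show "s (x \<oplus>\<^bsub>?F\<^esub> y) = s x \<oplus>\<^bsub>?F\<^esub> s y"
      using u v sc c s seqs_closed(1)[OF u(1) v(1)] by (simp add: G.simps sigma_simps)
  next
    show "s \<one>\<^bsub>?F\<^esub> = \<one>\<^bsub>?F\<^esub>" using s[OF const_zero_one(2)] by (simp add: G.simps sigma_simps)
  qed
  have bij: "bij_betw s (carrier ?F) (carrier ?F)"
  proof (rule bij_betw_imageI)
    show "inj_on s (carrier ?F)"
    proof (rule inj_onI)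
      fix x y assume "x \<in> carrier ?F" "y \<in> carrier ?F" and eq: "s x = s y"
      then obtain u v where uv: "u \<in> seqs" "x = germ u" "v \<in> seqs" "y = germ v" unfolding G.simps(1) by blast
      have "\<forall>\<^sub>F n in sequentially. \<sigma> (u n) \<ominus> \<sigma> (v n) \<in> p"
        using eq uv s germ_eq_iff seqs_closed(4)[OF uv(1,1)] seqs_closed(4)[OF uv(3,3)] by simp
      then have "\<forall>\<^sub>F n in sequentially. u n \<ominus> v n \<in> p"
        by (rule eventually_mono) (use \<sigma>_cong seqsD(1)[OF uv(1)] seqsD(1)[OF uv(3)] in simp)
      then show "x = y" using uv germ_eq_iff by simp
    qed
    have "germ u \<in> s ` carrier ?F" if u: "u \<in> seqs" for u
    proof -
      note c = seqsD(1)[OF u] and w = seqs_closed(5)[OF u u]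
      obtain N where N: "\<And>n. n \<ge> N \<Longrightarrow> u (Suc n) \<ominus> \<sigma> (u n) \<in> p"
        using seqsD(2)[OF u] by (auto simp: eventually_sequentially)
      have "u n \<ominus> \<sigma> (u (n - 1)) \<in> p" if n: "n \<ge> Suc N" for n
      proof -
        obtain k where k: "n = Suc k" using n by (cases n) auto
        then show ?thesis using N[of k] n by simp
      qed
      then have "\<forall>\<^sub>F n in sequentially. u n \<ominus> \<sigma> (u (n - 1)) \<in> p" by (auto simp: eventually_sequentially)
      then have "germ u = s (germ (\<lambda>n. u (n - 1)))"
        using s[OF w] germ_eq_iff[OF u seqs_closed(4)[OF w w]] by simp
      then show ?thesis using w by (auto simp: G.simps)
    qed
    then show "s ` carrier ?F = carrier ?F" using ring_hom_closed[OF sh] unfolding G.simps(1) by auto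
  qed
  have hh: "h \<in> ring_hom R ?F"
    by (rule ring_hom_memI) (auto simp: h_def G.simps funpow_simps const_seqs intro!: imageI)
  have hp: "h x = \<zero>\<^bsub>?F\<^esub> \<longleftrightarrow> x \<in> p" if x: "x \<in> carrier R" for x
  proof -
    have pow: "(\<sigma> ^^ n) x \<in> p \<longleftrightarrow> x \<in> p" for n
      by (induction n) (use fixed funpow_simps(1)[OF x] in auto)
    have "h x = \<zero>\<^bsub>?F\<^esub> \<longleftrightarrow> (\<forall>\<^sub>F n::nat in sequentially. x \<in> p)"
      unfolding h_def G.simps germ_eq_iff[OF const_seqs[OF x] const_zero_one(1)]
      using pow funpow_simps(1)[OF x] by (simp add: a_minus_def)
    then show ?thesis by simp
  qed
  have hs: "h (\<sigma> x) = s (h x)" if x: "x \<in> carrier R" for x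
    unfolding h_def using s[OF const_seqs[OF x]] by (simp add: funpow_swap1)
  have surj: "\<exists>n. \<exists>x\<in>carrier R. (s ^^ n) \<xi> = h x" if \<xi>: "\<xi> \<in> carrier ?F" for \<xi>
  proof -
    obtain u where u: "u \<in> seqs" "\<xi> = germ u" using \<xi> unfolding G.simps(1) by blast
    note c = seqsD(1)[OF u(1)]
    obtain N where N: "\<And>n. n \<ge> N \<Longrightarrow> u (Suc n) \<ominus> \<sigma> (u n) \<in> p"
      using seqsD(2)[OF u(1)] by (auto simp: eventually_sequentially)
    \<comment> \<open>From \<open>N\<close> on the sequence is the orbit of \<open>u N\<close>,
      starting late; applying \<sigma>^N repairs the delay.\<close>
    have key: "(\<sigma> ^^ N) (u (N + k)) \<ominus> (\<sigma> ^^ (N + k)) (u N) \<in> p" for k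
    proof -
      have "u (N + k) \<ominus> (\<sigma> ^^ k) (u N) \<in> p"
      proof (induction k)
        case 0
        then show ?case using pc(1)[OF c] by simp
      next
        case (Suc k)
        have sc: "\<sigma> (u (N + k)) \<in> carrier R" "(\<sigma> ^^ k) (u N) \<in> carrier R" "(\<sigma> ^^ Suc k) (u N) \<in> carrier R"
          using sigma_simps(1)[OF c] funpow_simps(1)[OF c] by blast+
        have "\<sigma> (u (N + k)) \<ominus> (\<sigma> ^^ Suc k) (u N) \<in> p" using Suc \<sigma>_cong[OF c sc(2)] by simp
        then show ?case using pc(3)[OF c sc(1) sc(3) N[of "N + k"]] by simp
      qed
      moreover have "(\<sigma> ^^ j) x \<ominus> (\<sigma> ^^ j) y \<in> p" if "x \<in> carrier R" "y \<in> carrier R" "x \<ominus> y \<in> p" for x y j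
        by (induction j) (use that \<sigma>_cong funpow_simps(1) in auto)
      ultimately have "(\<sigma> ^^ N) (u (N + k)) \<ominus> (\<sigma> ^^ N) ((\<sigma> ^^ k) (u N)) \<in> p"
        using c funpow_simps(1)[OF c] by blast
      then show ?thesis by (simp add: funpow_add)
    qed
    have "(\<sigma> ^^ N) (u n) \<ominus> (\<sigma> ^^ n) (u N) \<in> p" if "n \<ge> N" for n
      using key[of "n - N"] that by simp
    then have ev: "\<forall>\<^sub>F n in sequentially. (\<sigma> ^^ N) (u n) \<ominus> (\<sigma> ^^ n) (u N) \<in> p"
      by (auto simp: eventually_sequentially)
    have "(s ^^ N) \<xi> = h (u N)"
      unfolding h_def u(2) using spow[OF u(1), of N] germ_eq_iff[OF _ const_seqs[OF c[of N]]] ev by auto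
    then show ?thesis using c by blast
  qed
  show ?thesis
    by (rule exI[of _ ?F], rule exI[of _ s], rule exI[of _ h])
      (intro conjI ballI F fld sh bij hh hp hs surj)
qed

end

lemma ring_hom_funpow: "s \<in> ring_hom R R \<Longrightarrow> s ^^ n \<in> ring_hom R R"
proof (induction n)
  case (Suc n)
  then show ?case using ring_hom_trans[OF Suc.IH[OF Suc.prems] Suc.prems] by (simp only: funpow.simps)
qed (simp add: id_ring_hom[unfolded id_def] id_def)

text \<open>The universal property of the direct limit: the element s^(-n) (h x) has to go to
  s'^(-n) (h' (i x)). Two presentations are compared after being moved to a common
  \<open>n\<close>.\<close>

lemma inversive_extend:
  assumes hK: "h \<in> ring_hom A K" and sK: "s \<in> ring_hom K K"
    and hsK: "\<And>x. x \<in> carrier A \<Longrightarrow> h (\<sigma> x) = s (h x)"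
    and surj: "\<And>\<xi>. \<xi> \<in> carrier K \<Longrightarrow> \<exists>n. \<exists>x\<in>carrier A. (s ^^ n) \<xi> = h x"
    and hL: "h' \<in> ring_hom B L" and sL: "s' \<in> ring_hom L L" "bij_betw s' (carrier L) (carrier L)"
    and hsL: "\<And>x. x \<in> carrier B \<Longrightarrow> h' (\<sigma>' x) = s' (h' x)"
    and i: "i \<in> ring_hom A B" "\<And>x. x \<in> carrier A \<Longrightarrow> i (\<sigma> x) = \<sigma>' (i x)"
    and \<sigma>: "\<And>x. x \<in> carrier A \<Longrightarrow> \<sigma> x \<in> carrier A"
    and ker: "\<And>x y. x \<in> carrier A \<Longrightarrow> y \<in> carrier A \<Longrightarrow> h x = h y \<Longrightarrow> h' (i x) = h' (i y)"
    and rings: "cring A" "cring B" "cring K" "cring L"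
  shows "\<exists>\<iota>\<in>ring_hom K L. (\<forall>x\<in>carrier A. \<iota> (h x) = h' (i x)) \<and> (\<forall>\<xi>\<in>carrier K. \<iota> (s \<xi>) = s' (\<iota> \<xi>))"
proof -
  interpret A: cring A by (rule rings(1))
  interpret B: cring B by (rule rings(2))
  interpret K: cring K by (rule rings(3))
  interpret L: cring L by (rule rings(4))
  have \<sigma>n: "(\<sigma> ^^ n) x \<in> carrier A \<and> h ((\<sigma> ^^ n) x) = (s ^^ n) (h x) \<and>
      h' (i ((\<sigma> ^^ n) x)) = (s' ^^ n) (h' (i x))" if x: "x \<in> carrier A" for x n
    by (induction n) (use x \<sigma> hsK hsL i ring_hom_closed[OF i(1)] in auto)
  have snK: "s ^^ n \<in> ring_hom K K" and snL: "s' ^^ n \<in> ring_hom L L" for n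
    using ring_hom_funpow sK sL(1) by auto
  have bij: "bij_betw (s' ^^ n) (carrier L) (carrier L)" for n
  proof (induction n)
    case (Suc n)
    show ?case using bij_betw_trans[OF Suc sL(2)] by (simp only: funpow.simps)
  qed (simp add: bij_betw_id[unfolded id_def] id_def)
  \<comment> \<open>The graph of the desired map: both sides become residues of the same
    \<open>x\<close> after the same number of steps.\<close>
  define P where "P \<xi> \<eta> \<longleftrightarrow> \<xi> \<in> carrier K \<and> \<eta> \<in> carrier L \<and>
    (\<exists>n. \<exists>x\<in>carrier A. (s ^^ n) \<xi> = h x \<and> (s' ^^ n) \<eta> = h' (i x))" for \<xi> \<eta>
  have shift: "(s ^^ (m + n)) \<xi> = h ((\<sigma> ^^ m) x) \<and> (s' ^^ (m + n)) \<eta> = h' (i ((\<sigma> ^^ m) x)) \<and> (\<sigma> ^^ m) x \<in> carrier A"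
    if "x \<in> carrier A" "(s ^^ n) \<xi> = h x" "(s' ^^ n) \<eta> = h' (i x)" for m n \<xi> \<eta> x
    using that \<sigma>n[OF that(1), of m] by (simp add: funpow_add)
  have common: "\<exists>n. \<exists>x\<in>carrier A. \<exists>y\<in>carrier A. (s ^^ n) \<xi> = h x \<and> (s' ^^ n) \<eta> = h' (i x) \<and>
      (s ^^ n) \<xi>' = h y \<and> (s' ^^ n) \<eta>' = h' (i y)" if P: "P \<xi> \<eta>" "P \<xi>' \<eta>'" for \<xi> \<eta> \<xi>' \<eta>'
  proof -
    obtain m x where x: "x \<in> carrier A" "(s ^^ m) \<xi> = h x" "(s' ^^ m) \<eta> = h' (i x)"
      using P(1) unfolding P_def by blast
    obtain n y where y: "y \<in> carrier A" "(s ^^ n) \<xi>' = h y" "(s' ^^ n) \<eta>' = h' (i y)"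
      using P(2) unfolding P_def by blast
    show ?thesis using shift[OF x, of n] shift[OF y, of m] by (metis add.commute)
  qed
  have ex: "\<exists>\<eta>. P \<xi> \<eta>" if \<xi>: "\<xi> \<in> carrier K" for \<xi>
  proof -
    obtain n x where x: "x \<in> carrier A" "(s ^^ n) \<xi> = h x" using surj[OF \<xi>] by blast
    have "h' (i x) \<in> (s' ^^ n) ` carrier L"
      using bij[of n] ring_hom_closed[OF hL] ring_hom_closed[OF i(1) x(1)] by (simp add: bij_betw_def)
    then obtain \<eta> where \<eta>: "\<eta> \<in> carrier L" "(s' ^^ n) \<eta> = h' (i x)" by (elim imageE) simp
    then show ?thesis unfolding P_def using \<xi> x by blast
  qed
  have uniq: "\<eta> = \<eta>'" if P: "P \<xi> \<eta>" "P \<xi> \<eta>'" for \<xi> \<eta> \<eta>'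
  proof -
    obtain n x y where d: "x \<in> carrier A" "y \<in> carrier A" "(s ^^ n) \<xi> = h x" "(s' ^^ n) \<eta> = h' (i x)"
      "(s ^^ n) \<xi> = h y" "(s' ^^ n) \<eta>' = h' (i y)" using common[OF P] by blast
    then have "(s' ^^ n) \<eta> = (s' ^^ n) \<eta>'" using ker[OF d(1,2)] by simp
    then show ?thesis using bij[of n] P unfolding P_def bij_betw_def by (metis inj_onD)
  qed
  define \<iota> where "\<iota> \<xi> = (SOME \<eta>. P \<xi> \<eta>)" for \<xi>
  have \<iota>: "P \<xi> (\<iota> \<xi>)" if "\<xi> \<in> carrier K" for \<xi> unfolding \<iota>_def using ex[OF that] by (rule someI_ex)
  have \<iota>I: "\<iota> \<xi> = \<eta>" if "P \<xi> \<eta>" for \<xi> \<eta> using uniq that \<iota> unfolding P_def by blast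
  have "\<iota> \<in> ring_hom K L"
  proof (rule ring_hom_memI)
    fix \<xi> \<xi>' assume c: "\<xi> \<in> carrier K" "\<xi>' \<in> carrier K"
    have e: "\<iota> \<xi> \<in> carrier L" "\<iota> \<xi>' \<in> carrier L" using \<iota>[OF c(1)] \<iota>[OF c(2)] by (auto simp: P_def)
    obtain n x y where d: "x \<in> carrier A" "y \<in> carrier A" "(s ^^ n) \<xi> = h x" "(s' ^^ n) (\<iota> \<xi>) = h' (i x)"
      "(s ^^ n) \<xi>' = h y" "(s' ^^ n) (\<iota> \<xi>') = h' (i y)" using common[OF \<iota>[OF c(1)] \<iota>[OF c(2)]] by blast
    note ic = ring_hom_closed[OF i(1) d(1)] ring_hom_closed[OF i(1) d(2)]
    have "(s ^^ n) (\<xi> \<otimes>\<^bsub>K\<^esub> \<xi>') = h (x \<otimes>\<^bsub>A\<^esub> y)"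
      using d c ring_hom_mult[OF snK, of \<xi> \<xi>' n] ring_hom_mult[OF hK d(1,2)] by simp
    moreover have "(s' ^^ n) (\<iota> \<xi> \<otimes>\<^bsub>L\<^esub> \<iota> \<xi>') = h' (i (x \<otimes>\<^bsub>A\<^esub> y))"
      using d e ring_hom_mult[OF snL e, of n] ring_hom_mult[OF i(1) d(1,2)] ring_hom_mult[OF hL ic] by simp
    moreover have "x \<otimes>\<^bsub>A\<^esub> y \<in> carrier A" using d by simp
    ultimately have "P (\<xi> \<otimes>\<^bsub>K\<^esub> \<xi>') (\<iota> \<xi> \<otimes>\<^bsub>L\<^esub> \<iota> \<xi>')" unfolding P_def using c e by auto
    then show "\<iota> (\<xi> \<otimes>\<^bsub>K\<^esub> \<xi>') = \<iota> \<xi> \<otimes>\<^bsub>L\<^esub> \<iota> \<xi>'" by (rule \<iota>I)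
    have "(s ^^ n) (\<xi> \<oplus>\<^bsub>K\<^esub> \<xi>') = h (x \<oplus>\<^bsub>A\<^esub> y)"
      using d c ring_hom_add[OF snK, of \<xi> \<xi>' n] ring_hom_add[OF hK d(1,2)] by simp
    moreover have "(s' ^^ n) (\<iota> \<xi> \<oplus>\<^bsub>L\<^esub> \<iota> \<xi>') = h' (i (x \<oplus>\<^bsub>A\<^esub> y))"
      using d e ring_hom_add[OF snL e, of n] ring_hom_add[OF i(1) d(1,2)] ring_hom_add[OF hL ic] by simp
    moreover have "x \<oplus>\<^bsub>A\<^esub> y \<in> carrier A" using d by simp
    ultimately have "P (\<xi> \<oplus>\<^bsub>K\<^esub> \<xi>') (\<iota> \<xi> \<oplus>\<^bsub>L\<^esub> \<iota> \<xi>')" unfolding P_def using c e by auto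
    then show "\<iota> (\<xi> \<oplus>\<^bsub>K\<^esub> \<xi>') = \<iota> \<xi> \<oplus>\<^bsub>L\<^esub> \<iota> \<xi>'" by (rule \<iota>I)
  next
    show "\<iota> \<xi> \<in> carrier L" if "\<xi> \<in> carrier K" for \<xi> using \<iota>[OF that] by (simp add: P_def)
    have "P \<one>\<^bsub>K\<^esub> \<one>\<^bsub>L\<^esub>" unfolding P_def
      using ring_hom_one[OF hK] ring_hom_one[OF hL] ring_hom_one[OF i(1)]
      by (auto intro!: exI[of _ 0] bexI[of _ "\<one>\<^bsub>A\<^esub>"])
    then show "\<iota> \<one>\<^bsub>K\<^esub> = \<one>\<^bsub>L\<^esub>" by (rule \<iota>I)
  qed
  moreover have "\<iota> (h x) = h' (i x)" if x: "x \<in> carrier A" for x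
  proof (rule \<iota>I)
    show "P (h x) (h' (i x))" unfolding P_def
      using x ring_hom_closed[OF hK x] ring_hom_closed[OF hL ring_hom_closed[OF i(1) x]]
      by (auto intro!: exI[of _ 0])
  qed
  moreover have "\<iota> (s \<xi>) = s' (\<iota> \<xi>)" if \<xi>: "\<xi> \<in> carrier K" for \<xi>
  proof (rule \<iota>I)
    obtain n x where d: "x \<in> carrier A" "(s ^^ n) \<xi> = h x" "(s' ^^ n) (\<iota> \<xi>) = h' (i x)" "\<iota> \<xi> \<in> carrier L"
      using \<iota>[OF \<xi>] unfolding P_def by blast
    have "(s ^^ n) (s \<xi>) = h (\<sigma> x)" using d hsK by (simp add: funpow_swap1[symmetric])
    moreover have "(s' ^^ n) (s' (\<iota> \<xi>)) = h' (i (\<sigma> x))"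
      using d hsL i(2) ring_hom_closed[OF i(1) d(1)] by (simp add: funpow_swap1[symmetric])
    ultimately show "P (s \<xi>) (s' (\<iota> \<xi>))" unfolding P_def
      using \<sigma>[OF d(1)] ring_hom_closed[OF sK \<xi>] ring_hom_closed[OF sL(1) d(4)] by blast
  qed
  ultimately show ?thesis by blast
qed

lemma sfield_hom_image:
  assumes h: "h \<in> ring_hom A B" and rings: "cring A" "cring B" and F: "sfield A E"
    and nz: "\<one>\<^bsub>B\<^esub> \<noteq> \<zero>\<^bsub>B\<^esub>"
  shows "sfield B (h ` E)" "inj_on h E"
proof -
  interpret A: cring A by (rule rings(1))
  interpret B: cring B by (rule rings(2))
  interpret h: ring_hom_cring A B h by unfold_locales (rule h)
  note Ec = subring_closed[OF A.sfield_subring[OF F]]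
  show "sfield B (h ` E)" unfolding sfield_def
  proof (intro conjI ballI)
    have "ring_hom_ring A B h" by (rule ring_hom_ringI2[OF A.ring_axioms B.ring_axioms h])
    then show "subring (h ` E) B" using A.sfield_subring[OF F] by (rule ring_hom_ring.img_is_subring)
    show "\<one>\<^bsub>B\<^esub> \<noteq> \<zero>\<^bsub>B\<^esub>" by (rule nz)
    fix x assume "x \<in> h ` E - {\<zero>\<^bsub>B\<^esub>}"
    then obtain a where a: "a \<in> E" "x = h a" "a \<noteq> \<zero>\<^bsub>A\<^esub>" using h.hom_zero by blast
    obtain b where b: "b \<in> E" "a \<otimes>\<^bsub>A\<^esub> b = \<one>\<^bsub>A\<^esub>" by (rule A.sfield_inverse[OF F a(1,3)])
    have "x \<otimes>\<^bsub>B\<^esub> h b = \<one>\<^bsub>B\<^esub>"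
      using a b ring_hom_mult[OF h, of a b] Ec(7) ring_hom_one[OF h] by simp
    then show "\<exists>y\<in>h ` E. x \<otimes>\<^bsub>B\<^esub> y = \<one>\<^bsub>B\<^esub>" using b(1) by blast
  qed
  show "inj_on h E"
  proof (rule inj_onI)
    fix a b assume ab: "a \<in> E" "b \<in> E" "h a = h b"
    have c: "a \<in> carrier A" "b \<in> carrier A" using ab Ec(7) by auto
    have h0: "h (a \<ominus>\<^bsub>A\<^esub> b) = \<zero>\<^bsub>B\<^esub>" using ab(3) c by (simp add: a_minus_def B.r_neg)
    have abE: "a \<ominus>\<^bsub>A\<^esub> b \<in> E" using ab Ec(4,6) by (simp add: a_minus_def)
    have "a \<ominus>\<^bsub>A\<^esub> b = \<zero>\<^bsub>A\<^esub>"
    proof (rule ccontr)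
      assume "a \<ominus>\<^bsub>A\<^esub> b \<noteq> \<zero>\<^bsub>A\<^esub>"
      then obtain y where y: "y \<in> E" "(a \<ominus>\<^bsub>A\<^esub> b) \<otimes>\<^bsub>A\<^esub> y = \<one>\<^bsub>A\<^esub>" by (rule A.sfield_inverse[OF F abE])
      have "\<one>\<^bsub>B\<^esub> = h (a \<ominus>\<^bsub>A\<^esub> b) \<otimes>\<^bsub>B\<^esub> h y"
        using y(2) c Ec(7)[OF y(1)] ring_hom_mult[OF h, of "a \<ominus>\<^bsub>A\<^esub> b" y] ring_hom_one[OF h] by simp
      then show False using h0 nz Ec(7)[OF y(1)] by simp
    qed
    then show "a = b" using c by simp
  qed
qed

section \<open>Tensor products of fields\<close>

locale field_pair = K: cring K + L: cring L + M: cring M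
  for K :: "'k ring" and L :: "'a ring" and M :: "'b ring" +
  fixes i :: "'k \<Rightarrow> 'a" and j :: "'k \<Rightarrow> 'b" and sK sL sM
  assumes fK: "sfield K (carrier K)" and fL: "sfield L (carrier L)" and fM: "sfield M (carrier M)"
    and i: "i \<in> ring_hom K L" and j: "j \<in> ring_hom K M"
    and sK: "sK \<in> ring_hom K K" "bij_betw sK (carrier K) (carrier K)"
    and sL: "sL \<in> ring_hom L L" "bij_betw sL (carrier L) (carrier L)"
    and sM: "sM \<in> ring_hom M M" "bij_betw sM (carrier M) (carrier M)"
    and i_s: "x \<in> carrier K \<Longrightarrow> i (sK x) = sL (i x)" and j_s: "x \<in> carrier K \<Longrightarrow> j (sK x) = sM (j x)"
begin

lemma hom_simps:
  "x \<in> carrier K \<Longrightarrow> i x \<in> carrier L" "x \<in> carrier K \<Longrightarrow> j x \<in> carrier M"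
  "x \<in> carrier K \<Longrightarrow> sK x \<in> carrier K" "y \<in> carrier L \<Longrightarrow> sL y \<in> carrier L" "z \<in> carrier M \<Longrightarrow> sM z \<in> carrier M"
  using ring_hom_closed[OF i] ring_hom_closed[OF j] ring_hom_closed[OF sK(1)]
    ring_hom_closed[OF sL(1)] ring_hom_closed[OF sM(1)] by auto

definition functionals :: "('b \<Rightarrow> 'k) set" where
  "functionals = {f. (\<forall>x\<in>carrier M. f x \<in> carrier K) \<and>
     (\<forall>x\<in>carrier M. \<forall>y\<in>carrier M. f (x \<oplus>\<^bsub>M\<^esub> y) = f x \<oplus>\<^bsub>K\<^esub> f y) \<and>
     (\<forall>c\<in>carrier K. \<forall>x\<in>carrier M. f (j c \<otimes>\<^bsub>M\<^esub> x) = c \<otimes>\<^bsub>K\<^esub> f x)}"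

lemma functionalsD:
  assumes "f \<in> functionals"
  shows "x \<in> carrier M \<Longrightarrow> f x \<in> carrier K"
    "x \<in> carrier M \<Longrightarrow> y \<in> carrier M \<Longrightarrow> f (x \<oplus>\<^bsub>M\<^esub> y) = f x \<oplus>\<^bsub>K\<^esub> f y"
    "c \<in> carrier K \<Longrightarrow> x \<in> carrier M \<Longrightarrow> f (j c \<otimes>\<^bsub>M\<^esub> x) = c \<otimes>\<^bsub>K\<^esub> f x"
  using assms by (auto simp: functionals_def)

text \<open>A \<open>K\<close>-subspace maximal among those without one is a complement of the image
  of \<open>K\<close>. The projection along it is the functional that later shows the tensor product
  to be nonzero.\<close>

lemma retraction_exists: "\<exists>f\<in>functionals. f \<one>\<^bsub>M\<^esub> = \<one>\<^bsub>K\<^esub>"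
proof -
  let ?\<U> = "{U. U \<subseteq> carrier M \<and> \<zero>\<^bsub>M\<^esub> \<in> U \<and> \<one>\<^bsub>M\<^esub> \<notin> U \<and> (\<forall>x\<in>U. \<forall>y\<in>U. x \<oplus>\<^bsub>M\<^esub> y \<in> U) \<and>
    (\<forall>c\<in>carrier K. \<forall>x\<in>U. j c \<otimes>\<^bsub>M\<^esub> x \<in> U)}"
  have "\<exists>U\<in>?\<U>. \<forall>X\<in>?\<U>. U \<subseteq> X \<longrightarrow> X = U"
  proof (rule subset_Zorn_nonempty)
    have "\<one>\<^bsub>M\<^esub> \<noteq> \<zero>\<^bsub>M\<^esub>" using fM by (simp add: sfield_def)
    then have "{\<zero>\<^bsub>M\<^esub>} \<in> ?\<U>" using hom_simps(2) by simp
    then show "?\<U> \<noteq> {}" by blast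
    fix C assume C: "C \<noteq> {}" "subset.chain ?\<U> C"
    have ch: "X \<subseteq> Y \<or> Y \<subseteq> X" if "X \<in> C" "Y \<in> C" for X Y using C(2) that by (auto simp: subset_chain_def)
    have CU: "C \<subseteq> ?\<U>" using C(2) by (auto simp: subset_chain_def)
    have "x \<oplus>\<^bsub>M\<^esub> y \<in> \<Union>C" if xy: "x \<in> \<Union>C" "y \<in> \<Union>C" for x y
    proof -
      obtain X Y where XY: "x \<in> X" "X \<in> C" "y \<in> Y" "Y \<in> C" using xy by blast
      then obtain Z where "Z \<in> C" "x \<in> Z" "y \<in> Z" using ch[of X Y] by blast
      then show ?thesis using CU by blast
    qed
    moreover have "j c \<otimes>\<^bsub>M\<^esub> x \<in> \<Union>C" if "c \<in> carrier K" "x \<in> \<Union>C" for c x using that CU by blast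
    moreover have "\<zero>\<^bsub>M\<^esub> \<in> \<Union>C" "\<Union>C \<subseteq> carrier M" "\<one>\<^bsub>M\<^esub> \<notin> \<Union>C" using C(1) CU by blast+
    ultimately show "\<Union>C \<in> ?\<U>" by simp
  qed
  then obtain U where U0: "U \<in> ?\<U>" and max: "\<forall>X\<in>?\<U>. U \<subseteq> X \<longrightarrow> X = U" by (rule bexE)
  have U: "U \<subseteq> carrier M" "\<zero>\<^bsub>M\<^esub> \<in> U" "\<one>\<^bsub>M\<^esub> \<notin> U" using U0 by simp_all
  have Ua: "x \<oplus>\<^bsub>M\<^esub> y \<in> U" if "x \<in> U" "y \<in> U" for x y using U0 that by simp
  have Us: "j c \<otimes>\<^bsub>M\<^esub> x \<in> U" if "c \<in> carrier K" "x \<in> U" for c x using U0 that by simp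
  have jm: "j (\<ominus>\<^bsub>K\<^esub> \<one>\<^bsub>K\<^esub>) = \<ominus>\<^bsub>M\<^esub> \<one>\<^bsub>M\<^esub>"
  proof -
    interpret jh: ring_hom_cring K M j by unfold_locales (rule j)
    show ?thesis by simp
  qed
  have Um: "\<ominus>\<^bsub>M\<^esub> x \<in> U" if "x \<in> U" for x
    using Us[of "\<ominus>\<^bsub>K\<^esub> \<one>\<^bsub>K\<^esub>" x] that U(1) jm by (auto simp: M.l_minus)
  have ex: "\<exists>c\<in>carrier K. \<exists>u\<in>U. x = j c \<oplus>\<^bsub>M\<^esub> u" if x: "x \<in> carrier M" for x
  proof (cases "x \<in> U")
    case True
    have "x = j \<zero>\<^bsub>K\<^esub> \<oplus>\<^bsub>M\<^esub> x" using x ring_hom_zero[OF j K.ring_axioms M.ring_axioms] by simp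
    then show ?thesis using True by blast
  next
    case False
    \<comment> \<open>The span of \<open>U\<close> and \<open>x\<close>. By maximality it contains
      one, and since the coefficient of \<open>x\<close> is then nonzero, \<open>x\<close> can be
      solved for.\<close>
    define X where "X = {u \<oplus>\<^bsub>M\<^esub> j c \<otimes>\<^bsub>M\<^esub> x | u c. u \<in> U \<and> c \<in> carrier K}"
    have sub: "U \<subseteq> X"
    proof
      fix u assume u: "u \<in> U"
      have "u = u \<oplus>\<^bsub>M\<^esub> j \<zero>\<^bsub>K\<^esub> \<otimes>\<^bsub>M\<^esub> x"
        using u U(1) x ring_hom_zero[OF j K.ring_axioms M.ring_axioms] by auto
      then show "u \<in> X" using u unfolding X_def by blast
    qed
    have xX: "x \<in> X"
    proof -
      have "x = \<zero>\<^bsub>M\<^esub> \<oplus>\<^bsub>M\<^esub> j \<one>\<^bsub>K\<^esub> \<otimes>\<^bsub>M\<^esub> x" using x ring_hom_one[OF j] by simp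
      then show ?thesis using U(2) unfolding X_def by blast
    qed
    have "\<one>\<^bsub>M\<^esub> \<in> X"
    proof (rule ccontr)
      assume n: "\<one>\<^bsub>M\<^esub> \<notin> X"
      have "X \<subseteq> carrier M" using U(1) x hom_simps(2) unfolding X_def by blast
      moreover have "y \<oplus>\<^bsub>M\<^esub> z \<in> X" if yz: "y \<in> X" "z \<in> X" for y z
      proof -
        obtain u c v d where e: "u \<in> U" "c \<in> carrier K" "y = u \<oplus>\<^bsub>M\<^esub> j c \<otimes>\<^bsub>M\<^esub> x"
          "v \<in> U" "d \<in> carrier K" "z = v \<oplus>\<^bsub>M\<^esub> j d \<otimes>\<^bsub>M\<^esub> x" using yz unfolding X_def by blast
        have cc: "u \<in> carrier M" "v \<in> carrier M" "j c \<in> carrier M" "j d \<in> carrier M"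
          using e U(1) hom_simps(2) by auto
        have "y \<oplus>\<^bsub>M\<^esub> z = (u \<oplus>\<^bsub>M\<^esub> v) \<oplus>\<^bsub>M\<^esub> j (c \<oplus>\<^bsub>K\<^esub> d) \<otimes>\<^bsub>M\<^esub> x"
          using e cc x ring_hom_add[OF j e(2,5)] by (simp add: M.l_distr M.a_ac)
        then show ?thesis using Ua[OF e(1,4)] e unfolding X_def by blast
      qed
      moreover have "j d \<otimes>\<^bsub>M\<^esub> y \<in> X" if d: "d \<in> carrier K" "y \<in> X" for d y
      proof -
        obtain u c where e: "u \<in> U" "c \<in> carrier K" "y = u \<oplus>\<^bsub>M\<^esub> j c \<otimes>\<^bsub>M\<^esub> x" using d unfolding X_def by blast
        have cc: "u \<in> carrier M" "j c \<in> carrier M" "j d \<in> carrier M"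
          using e d U(1) hom_simps(2) by auto
        have "j d \<otimes>\<^bsub>M\<^esub> y = j d \<otimes>\<^bsub>M\<^esub> u \<oplus>\<^bsub>M\<^esub> j (d \<otimes>\<^bsub>K\<^esub> c) \<otimes>\<^bsub>M\<^esub> x"
          using e cc x ring_hom_mult[OF j d(1) e(2)] by (simp add: M.r_distr M.m_assoc)
        then show ?thesis using Us[OF d(1) e(1)] e(2) d(1) unfolding X_def by blast
      qed
      moreover have "\<zero>\<^bsub>M\<^esub> \<in> X" using U(2) sub by blast
      ultimately have "X \<in> ?\<U>" using n by simp
      then have "X = U" using max sub by (elim ballE[of _ _ X]) simp_all
      then show False using xX False by simp
    qed
    then obtain u c where e: "u \<in> U" "c \<in> carrier K" "\<one>\<^bsub>M\<^esub> = u \<oplus>\<^bsub>M\<^esub> j c \<otimes>\<^bsub>M\<^esub> x"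
      unfolding X_def by blast
    have uc: "u \<in> carrier M" using e U(1) by blast
    have "c \<noteq> \<zero>\<^bsub>K\<^esub>"
    proof
      assume "c = \<zero>\<^bsub>K\<^esub>"
      then have "\<one>\<^bsub>M\<^esub> = u" using e uc x ring_hom_zero[OF j K.ring_axioms M.ring_axioms] by simp
      then show False using e(1) U(3) by simp
    qed
    then obtain d where d: "d \<in> carrier K" "d \<otimes>\<^bsub>K\<^esub> c = \<one>\<^bsub>K\<^esub>" by (rule K.sfield_inverse[OF fK e(2)])
    have cc: "j c \<in> carrier M" "j d \<in> carrier M" using e d hom_simps(2) by auto
    have "x = j (d \<otimes>\<^bsub>K\<^esub> c) \<otimes>\<^bsub>M\<^esub> x" using d x ring_hom_one[OF j] by simp
    also have "\<dots> = j d \<otimes>\<^bsub>M\<^esub> (j c \<otimes>\<^bsub>M\<^esub> x)" using ring_hom_mult[OF j d(1) e(2)] cc x by (simp add: M.m_assoc)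
    also have "j c \<otimes>\<^bsub>M\<^esub> x = \<one>\<^bsub>M\<^esub> \<oplus>\<^bsub>M\<^esub> \<ominus>\<^bsub>M\<^esub> u"
      unfolding e(3) using cc uc x by (simp add: M.a_ac M.r_neg1 M.r_neg2)
    also have "j d \<otimes>\<^bsub>M\<^esub> (\<one>\<^bsub>M\<^esub> \<oplus>\<^bsub>M\<^esub> \<ominus>\<^bsub>M\<^esub> u) = j d \<oplus>\<^bsub>M\<^esub> j d \<otimes>\<^bsub>M\<^esub> (\<ominus>\<^bsub>M\<^esub> u)"
      using cc uc by (simp add: M.r_distr)
    finally show ?thesis using d Us[OF d(1) Um[OF e(1)]] by blast
  qed
  \<comment> \<open>Two decompositions would put a nonzero element of the image of \<open>K\<close>
    into \<open>U\<close>, and scaling it would put one there.\<close>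
  have uniq: "c = d" if e: "c \<in> carrier K" "d \<in> carrier K" "u \<in> U" "v \<in> U" "j c \<oplus>\<^bsub>M\<^esub> u = j d \<oplus>\<^bsub>M\<^esub> v" for c d u v
  proof (rule ccontr)
    assume "c \<noteq> d"
    then have "c \<ominus>\<^bsub>K\<^esub> d \<noteq> \<zero>\<^bsub>K\<^esub>" using e by simp
    moreover have cdK: "c \<ominus>\<^bsub>K\<^esub> d \<in> carrier K" using e by simp
    ultimately obtain b where b: "b \<in> carrier K" "b \<otimes>\<^bsub>K\<^esub> (c \<ominus>\<^bsub>K\<^esub> d) = \<one>\<^bsub>K\<^esub>"
      using K.sfield_inverse[OF fK] by metis
    interpret jh: ring_hom_cring K M j by unfold_locales (rule j)
    have cc: "u \<in> carrier M" "v \<in> carrier M" "j c \<in> carrier M" "j d \<in> carrier M"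
      using e U(1) hom_simps(2) by auto
    have "j (c \<ominus>\<^bsub>K\<^esub> d) = j c \<oplus>\<^bsub>M\<^esub> \<ominus>\<^bsub>M\<^esub> j d" using e by (simp add: a_minus_def)
    also have "j c = (j d \<oplus>\<^bsub>M\<^esub> v) \<oplus>\<^bsub>M\<^esub> \<ominus>\<^bsub>M\<^esub> u"
      unfolding e(5)[symmetric] using cc by (simp add: M.a_assoc M.r_neg)
    also have "(j d \<oplus>\<^bsub>M\<^esub> v) \<oplus>\<^bsub>M\<^esub> \<ominus>\<^bsub>M\<^esub> u \<oplus>\<^bsub>M\<^esub> \<ominus>\<^bsub>M\<^esub> j d =
        v \<oplus>\<^bsub>M\<^esub> (j d \<oplus>\<^bsub>M\<^esub> (\<ominus>\<^bsub>M\<^esub> u \<oplus>\<^bsub>M\<^esub> \<ominus>\<^bsub>M\<^esub> j d))"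
      using cc by (simp add: M.a_ac)
    also have "j d \<oplus>\<^bsub>M\<^esub> (\<ominus>\<^bsub>M\<^esub> u \<oplus>\<^bsub>M\<^esub> \<ominus>\<^bsub>M\<^esub> j d) = \<ominus>\<^bsub>M\<^esub> u"
      using cc by (simp add: M.a_lcomm[of "j d" "\<ominus>\<^bsub>M\<^esub> u"] M.r_neg)
    finally have "j (c \<ominus>\<^bsub>K\<^esub> d) \<in> U" using Ua[OF e(4) Um[OF e(3)]] by simp
    then have "j b \<otimes>\<^bsub>M\<^esub> j (c \<ominus>\<^bsub>K\<^esub> d) \<in> U" by (rule Us[OF b(1)])
    then have "\<one>\<^bsub>M\<^esub> \<in> U" using b ring_hom_mult[OF j b(1) cdK] ring_hom_one[OF j] by simp
    then show False using U(3) by blast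
  qed
  define f where "f x = (SOME c. c \<in> carrier K \<and> (\<exists>u\<in>U. x = j c \<oplus>\<^bsub>M\<^esub> u))" for x
  have f: "f x \<in> carrier K \<and> (\<exists>u\<in>U. x = j (f x) \<oplus>\<^bsub>M\<^esub> u)" if "x \<in> carrier M" for x
    unfolding f_def by (rule someI_ex) (use ex[OF that] in blast)
  have fI: "f (j c \<oplus>\<^bsub>M\<^esub> u) = c" if cu: "c \<in> carrier K" "u \<in> U" for c u
  proof -
    have "j c \<oplus>\<^bsub>M\<^esub> u \<in> carrier M" using cu U(1) hom_simps(2) by auto
    from f[OF this] obtain v where "f (j c \<oplus>\<^bsub>M\<^esub> u) \<in> carrier K" "v \<in> U"
      "j c \<oplus>\<^bsub>M\<^esub> u = j (f (j c \<oplus>\<^bsub>M\<^esub> u)) \<oplus>\<^bsub>M\<^esub> v" by blast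
    then show ?thesis using uniq[of "f (j c \<oplus>\<^bsub>M\<^esub> u)" c v u] cu by simp
  qed
  have "f \<in> functionals" unfolding functionals_def mem_Collect_eq
  proof (intro conjI ballI)
    show "f x \<in> carrier K" if "x \<in> carrier M" for x using f[OF that] by blast
    fix x assume x: "x \<in> carrier M"
    obtain u where u: "u \<in> U" "x = j (f x) \<oplus>\<^bsub>M\<^esub> u" "f x \<in> carrier K" using f[OF x] by blast
    have uc: "u \<in> carrier M" "j (f x) \<in> carrier M" using u U(1) hom_simps(2) by auto
    { fix y assume y: "y \<in> carrier M"
      obtain v where v: "v \<in> U" "y = j (f y) \<oplus>\<^bsub>M\<^esub> v" "f y \<in> carrier K" using f[OF y] by blast
      have vc: "v \<in> carrier M" "j (f y) \<in> carrier M" using v U(1) hom_simps(2) by auto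
      have "x \<oplus>\<^bsub>M\<^esub> y = (j (f x) \<oplus>\<^bsub>M\<^esub> u) \<oplus>\<^bsub>M\<^esub> (j (f y) \<oplus>\<^bsub>M\<^esub> v)" using u(2) v(2) by simp
      also have "\<dots> = j (f x \<oplus>\<^bsub>K\<^esub> f y) \<oplus>\<^bsub>M\<^esub> (u \<oplus>\<^bsub>M\<^esub> v)"
        using uc vc ring_hom_add[OF j u(3) v(3)] by (simp add: M.a_ac)
      finally show "f (x \<oplus>\<^bsub>M\<^esub> y) = f x \<oplus>\<^bsub>K\<^esub> f y" using fI[OF _ Ua[OF u(1) v(1)]] u(3) v(3) by simp
    }
    fix c assume c: "c \<in> carrier K"
    have "j c \<otimes>\<^bsub>M\<^esub> x = j c \<otimes>\<^bsub>M\<^esub> (j (f x) \<oplus>\<^bsub>M\<^esub> u)" using u(2) by simp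
    also have "\<dots> = j (c \<otimes>\<^bsub>K\<^esub> f x) \<oplus>\<^bsub>M\<^esub> j c \<otimes>\<^bsub>M\<^esub> u"
      using uc hom_simps(2)[OF c] ring_hom_mult[OF j c u(3)] by (simp add: M.r_distr)
    finally show "f (j c \<otimes>\<^bsub>M\<^esub> x) = c \<otimes>\<^bsub>K\<^esub> f x" using fI[OF _ Us[OF c u(1)]] c u(3) by simp
  qed
  moreover have "f \<one>\<^bsub>M\<^esub> = \<one>\<^bsub>K\<^esub>" using fI[of "\<one>\<^bsub>K\<^esub>" "\<zero>\<^bsub>M\<^esub>"] U(2) ring_hom_one[OF j] by simp
  ultimately show ?thesis by blast
qed

end

section \<open>The ring of formal tensors\<close>

context field_pair
begin

text \<open>
  A list of pairs \<open>(l, x)\<close> stands for the sum of the tensors \<open>l \<otimes> x\<close>. Two lists are equal as tensors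
  iff the \<open>L\<close>-linear extensions of all functionals agree on them.
\<close>

fun pairing :: "('a \<times> 'b) list \<Rightarrow> ('b \<Rightarrow> 'a) \<Rightarrow> 'a" where
  "pairing [] g = \<zero>\<^bsub>L\<^esub>"
| "pairing ((l, x) # u) g = l \<otimes>\<^bsub>L\<^esub> g x \<oplus>\<^bsub>L\<^esub> pairing u g"

definition tensors :: "('a \<times> 'b) list set" where
  "tensors = lists (carrier L \<times> carrier M)"

text \<open>Off the functionals the value is set to \<open>undefined\<close>, so that equality of
  these functions tests functionals only.\<close>

definition value_of :: "('a \<times> 'b) list \<Rightarrow> ('b \<Rightarrow> 'k) \<Rightarrow> 'a" where
  "value_of u = (\<lambda>f. if f \<in> functionals then pairing u (\<lambda>x. i (f x)) else undefined)"

fun times1 :: "'a \<times> 'b \<Rightarrow> ('a \<times> 'b) list \<Rightarrow> ('a \<times> 'b) list" where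
  "times1 (l, x) v = map (\<lambda>(m, y). (l \<otimes>\<^bsub>L\<^esub> m, x \<otimes>\<^bsub>M\<^esub> y)) v"

fun times :: "('a \<times> 'b) list \<Rightarrow> ('a \<times> 'b) list \<Rightarrow> ('a \<times> 'b) list" where
  "times [] v = []"
| "times (a # u) v = times1 a v @ times u v"

definition neg :: "('a \<times> 'b) list \<Rightarrow> ('a \<times> 'b) list" where
  "neg u = map (\<lambda>(l, x). (\<ominus>\<^bsub>L\<^esub> l, x)) u"

lemma tensors_simps [simp]:
  "[] \<in> tensors" "a # u \<in> tensors \<longleftrightarrow> fst a \<in> carrier L \<and> snd a \<in> carrier M \<and> u \<in> tensors"
  "u @ v \<in> tensors \<longleftrightarrow> u \<in> tensors \<and> v \<in> tensors"
  by (auto simp: tensors_def mem_Times_iff)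

abbreviation fns :: "('b \<Rightarrow> 'a) set" where
  "fns \<equiv> {g. \<forall>x\<in>carrier M. g x \<in> carrier L}"

lemma pairing_closed [simp]: "u \<in> tensors \<Longrightarrow> g \<in> fns \<Longrightarrow> pairing u g \<in> carrier L"
  by (induction u) auto

lemma pairing_append: "u \<in> tensors \<Longrightarrow> v \<in> tensors \<Longrightarrow> g \<in> fns \<Longrightarrow>
    pairing (u @ v) g = pairing u g \<oplus>\<^bsub>L\<^esub> pairing v g"
  by (induction u) (auto simp: L.a_assoc)

lemma pairing_cong: "u \<in> tensors \<Longrightarrow> (\<And>x. x \<in> carrier M \<Longrightarrow> g x = g' x) \<Longrightarrow> pairing u g = pairing u g'"
  by (induction u) auto

lemma pairing_add: "u \<in> tensors \<Longrightarrow> g \<in> fns \<Longrightarrow> g' \<in> fns \<Longrightarrow>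
    pairing u (\<lambda>x. g x \<oplus>\<^bsub>L\<^esub> g' x) = pairing u g \<oplus>\<^bsub>L\<^esub> pairing u g'"
  by (induction u) (auto simp: L.r_distr L.a_ac)

lemma pairing_zero: "u \<in> tensors \<Longrightarrow> pairing u (\<lambda>x. \<zero>\<^bsub>L\<^esub>) = \<zero>\<^bsub>L\<^esub>"
  by (induction u) auto

lemma pairing_smult: "u \<in> tensors \<Longrightarrow> g \<in> fns \<Longrightarrow> c \<in> carrier L \<Longrightarrow>
    pairing u (\<lambda>x. c \<otimes>\<^bsub>L\<^esub> g x) = c \<otimes>\<^bsub>L\<^esub> pairing u g"
  by (induction u) (auto simp: L.r_distr L.m_lcomm)

text \<open>Exchange of two finite sums; it underlies both the commutativity of the product and its
  compatibility with equality of tensors.\<close>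

lemma pairing_swap: "u \<in> tensors \<Longrightarrow> v \<in> tensors \<Longrightarrow>
    (\<And>x y. x \<in> carrier M \<Longrightarrow> y \<in> carrier M \<Longrightarrow> g x y \<in> carrier L) \<Longrightarrow>
    pairing u (\<lambda>x. pairing v (g x)) = pairing v (\<lambda>y. pairing u (\<lambda>x. g x y))"
proof (induction u)
  case (Cons a u)
  obtain l x where a: "a = (l, x)" by (cases a)
  have c: "l \<in> carrier L" "x \<in> carrier M" "u \<in> tensors" using Cons.prems a by auto
  have 1: "g x \<in> fns" "(\<lambda>y. pairing u (\<lambda>x. g x y)) \<in> fns" using c Cons.prems(3) by auto
  then have 2: "(\<lambda>y. l \<otimes>\<^bsub>L\<^esub> g x y) \<in> fns" using c by auto
  have "pairing (a # u) (\<lambda>x. pairing v (g x)) =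
      l \<otimes>\<^bsub>L\<^esub> pairing v (g x) \<oplus>\<^bsub>L\<^esub> pairing v (\<lambda>y. pairing u (\<lambda>x. g x y))"
    using Cons.IH[OF c(3) Cons.prems(2,3)] a by simp
  also have "\<dots> = pairing v (\<lambda>y. l \<otimes>\<^bsub>L\<^esub> g x y \<oplus>\<^bsub>L\<^esub> pairing u (\<lambda>x. g x y))"
    using pairing_add[OF Cons.prems(2) 2 1(2)] pairing_smult[OF Cons.prems(2) 1(1) c(1)] by simp
  finally show ?case using a by simp
qed (simp add: pairing_zero)

lemma times1_closed: "fst a \<in> carrier L \<Longrightarrow> snd a \<in> carrier M \<Longrightarrow> v \<in> tensors \<Longrightarrow> times1 a v \<in> tensors"
  by (cases a, induction v) auto

lemma times_closed: "u \<in> tensors \<Longrightarrow> v \<in> tensors \<Longrightarrow> times u v \<in> tensors"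
  by (induction u) (auto simp: times1_closed)

lemma pairing_times1: "l \<in> carrier L \<Longrightarrow> x \<in> carrier M \<Longrightarrow> v \<in> tensors \<Longrightarrow> g \<in> fns \<Longrightarrow>
    pairing (times1 (l, x) v) g = l \<otimes>\<^bsub>L\<^esub> pairing v (\<lambda>y. g (x \<otimes>\<^bsub>M\<^esub> y))"
proof (induction v)
  case (Cons b v)
  have "(\<lambda>y. g (x \<otimes>\<^bsub>M\<^esub> y)) \<in> fns" using Cons.prems by auto
  then have "pairing v (\<lambda>y. g (x \<otimes>\<^bsub>M\<^esub> y)) \<in> carrier L" using Cons.prems by auto
  then show ?case using Cons by (cases b) (auto simp: L.r_distr L.m_assoc)
qed auto

lemma pairing_times: "u \<in> tensors \<Longrightarrow> v \<in> tensors \<Longrightarrow> g \<in> fns \<Longrightarrow>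
    pairing (times u v) g = pairing u (\<lambda>x. pairing v (\<lambda>y. g (x \<otimes>\<^bsub>M\<^esub> y)))"
proof (induction u)
  case (Cons a u)
  obtain l x where a: "a = (l, x)" by (cases a)
  then show ?case
    using Cons times1_closed[of a v] times_closed[of u v] pairing_append[of "times1 a v" "times u v" g]
      pairing_times1[of l x v g] by simp
qed simp

lemma value_of_eq_iff: "value_of u = value_of v \<longleftrightarrow>
    (\<forall>f\<in>functionals. pairing u (\<lambda>x. i (f x)) = pairing v (\<lambda>x. i (f x)))"
  by (auto simp: value_of_def fun_eq_iff)

lemma value_of_eqD: "value_of u = value_of v \<Longrightarrow> f \<in> functionals \<Longrightarrow>
    pairing u (\<lambda>x. i (f x)) = pairing v (\<lambda>x. i (f x))"
  by (simp add: value_of_eq_iff)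

lemma functional_fns: "f \<in> functionals \<Longrightarrow> (\<lambda>x. i (f x)) \<in> fns"
  using functionalsD(1) hom_simps(1) by auto

text \<open>Laws that do not split a sum inside \<open>M\<close> hold against arbitrary functions
  \<open>g\<close>, which spares the linearity conditions.\<close>

lemma value_of_eqI: "(\<And>g. g \<in> fns \<Longrightarrow> pairing u g = pairing v g) \<Longrightarrow> value_of u = value_of v"
  using functional_fns by (auto simp: value_of_eq_iff)

lemma functional_mult: "f \<in> functionals \<Longrightarrow> b \<in> carrier M \<Longrightarrow> (\<lambda>a. f (a \<otimes>\<^bsub>M\<^esub> b)) \<in> functionals"
  unfolding functionals_def by (auto simp: M.l_distr M.m_assoc hom_simps)

lemma neg_closed: "u \<in> tensors \<Longrightarrow> neg u \<in> tensors"
  unfolding neg_def by (induction u) auto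

lemma pairing_neg: "u \<in> tensors \<Longrightarrow> g \<in> fns \<Longrightarrow> pairing (neg u) g = \<ominus>\<^bsub>L\<^esub> pairing u g"
  unfolding neg_def by (induction u) (auto simp: L.l_minus L.minus_add)

lemma fns_shift: "g \<in> fns \<Longrightarrow> x \<in> carrier M \<Longrightarrow> (\<lambda>y. g (x \<otimes>\<^bsub>M\<^esub> y)) \<in> fns"
  by auto

lemma fns_pairing: "g \<in> fns \<Longrightarrow> v \<in> tensors \<Longrightarrow> (\<lambda>x. pairing v (\<lambda>y. g (x \<otimes>\<^bsub>M\<^esub> y))) \<in> fns"
  by auto

sublocale T: ring_congruence tensors "(@)" times neg "[]" "[(\<one>\<^bsub>L\<^esub>, \<one>\<^bsub>M\<^esub>)]" value_of
proof
  fix u u' v assume c: "u \<in> tensors" "u' \<in> tensors" "v \<in> tensors" and eq: "value_of u = value_of u'"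
  show "value_of (u @ v) = value_of (u' @ v)"
    using eq c functional_fns by (simp add: value_of_eq_iff pairing_append)
  show "value_of (times u v) = value_of (times u' v)"
    unfolding value_of_eq_iff
  proof
    fix f assume f: "f \<in> functionals"
    \<comment> \<open>With the sum over \<open>v\<close> outside, the inner one tests
      \<open>w\<close> against f(_ y) for fixed y, which is again a functional; there
      \<open>u\<close> and \<open>u'\<close> cannot be told apart.\<close>
    have *: "pairing (times w v) (\<lambda>x. i (f x)) = pairing v (\<lambda>y. pairing w (\<lambda>x. i (f (x \<otimes>\<^bsub>M\<^esub> y))))"
      if w: "w \<in> tensors" for w
      using pairing_times[OF w c(3) functional_fns[OF f]] functionalsD(1)[OF f] hom_simps(1)
        pairing_swap[OF w c(3), of "\<lambda>x y. i (f (x \<otimes>\<^bsub>M\<^esub> y))"] by simp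
    have "pairing u (\<lambda>x. i (f (x \<otimes>\<^bsub>M\<^esub> y))) = pairing u' (\<lambda>x. i (f (x \<otimes>\<^bsub>M\<^esub> y)))" if "y \<in> carrier M" for y
      using eq functional_mult[OF f that] by (simp add: value_of_eq_iff)
    then show "pairing (times u v) (\<lambda>x. i (f x)) = pairing (times u' v) (\<lambda>x. i (f x))"
      unfolding *[OF c(1)] *[OF c(2)] by (intro pairing_cong c(3)) auto
  qed
next
  fix u v assume c: "u \<in> tensors" "v \<in> tensors"
  show "value_of (u @ v) = value_of (v @ u)"
    by (rule value_of_eqI) (use c in \<open>simp add: pairing_append L.a_comm\<close>)
  show "value_of (times u v) = value_of (times v u)"
  proof (rule value_of_eqI)
    fix g assume g: "g \<in> fns"
    have "pairing (times u v) g = pairing v (\<lambda>y. pairing u (\<lambda>x. g (x \<otimes>\<^bsub>M\<^esub> y)))"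
      using pairing_times[OF c g] pairing_swap[OF c, of "\<lambda>x y. g (x \<otimes>\<^bsub>M\<^esub> y)"] g by simp
    also have "\<dots> = pairing v (\<lambda>y. pairing u (\<lambda>x. g (y \<otimes>\<^bsub>M\<^esub> x)))"
      by (intro pairing_cong c) (simp add: M.m_comm)
    finally show "pairing (times u v) g = pairing (times v u) g" using pairing_times[OF c(2,1) g] by simp
  qed
next
  fix u v w assume c: "u \<in> tensors" "v \<in> tensors" "w \<in> tensors"
  show "value_of ((u @ v) @ w) = value_of (u @ (v @ w))" by simp
  show "value_of (times (times u v) w) = value_of (times u (times v w))"
  proof (rule value_of_eqI)
    fix g assume g: "g \<in> fns"
    have "pairing (times (times u v) w) g =
        pairing u (\<lambda>x. pairing v (\<lambda>y. pairing w (\<lambda>z. g ((x \<otimes>\<^bsub>M\<^esub> y) \<otimes>\<^bsub>M\<^esub> z))))"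
      using pairing_times[OF times_closed[OF c(1,2)] c(3) g] pairing_times[OF c(1,2) fns_pairing[OF g c(3)]] by simp
    also have "\<dots> = pairing u (\<lambda>x. pairing (times v w) (\<lambda>y. g (x \<otimes>\<^bsub>M\<^esub> y)))"
      using pairing_times[OF c(2,3) fns_shift[OF g]]
      by (intro pairing_cong c) (auto intro!: pairing_cong c simp: M.m_assoc)
    also have "\<dots> = pairing (times u (times v w)) g"
      using pairing_times[OF c(1) times_closed[OF c(2,3)] g] by simp
    finally show "pairing (times (times u v) w) g = pairing (times u (times v w)) g" .
  qed
  show "value_of (times (u @ v) w) = value_of (times u w @ times v w)"
    by (rule value_of_eqI)
      (use c in \<open>simp add: pairing_times times_closed pairing_append fns_pairing\<close>)
next
  fix u assume c: "u \<in> tensors"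
  show "value_of ([] @ u) = value_of u" by simp
  show "value_of (times [(\<one>\<^bsub>L\<^esub>, \<one>\<^bsub>M\<^esub>)] u) = value_of u"
  proof (rule value_of_eqI)
    fix g assume g: "g \<in> fns"
    have "pairing u (\<lambda>y. g (\<one>\<^bsub>M\<^esub> \<otimes>\<^bsub>M\<^esub> y)) = pairing u g" by (rule pairing_cong[OF c]) simp
    moreover have "[(\<one>\<^bsub>L\<^esub>, \<one>\<^bsub>M\<^esub>)] \<in> tensors" by simp
    ultimately show "pairing (times [(\<one>\<^bsub>L\<^esub>, \<one>\<^bsub>M\<^esub>)] u) g = pairing u g"
      using pairing_times[OF _ c g, of "[(\<one>\<^bsub>L\<^esub>, \<one>\<^bsub>M\<^esub>)]"] c g by simp
  qed
  show "value_of (neg u @ u) = value_of []"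
    by (rule value_of_eqI) (use c in \<open>simp add: pairing_append neg_closed pairing_neg L.l_neg\<close>)
qed (use times_closed neg_closed in auto)

abbreviation emb_L :: "'a \<Rightarrow> ('b \<Rightarrow> 'k) \<Rightarrow> 'a" where
  "emb_L l \<equiv> value_of [(l, \<one>\<^bsub>M\<^esub>)]"

abbreviation emb_M :: "'b \<Rightarrow> ('b \<Rightarrow> 'k) \<Rightarrow> 'a" where
  "emb_M x \<equiv> value_of [(\<one>\<^bsub>L\<^esub>, x)]"

lemma value_of_single: "f \<in> functionals \<Longrightarrow> l \<in> carrier L \<Longrightarrow> x \<in> carrier M \<Longrightarrow>
    value_of [(l, x)] f = l \<otimes>\<^bsub>L\<^esub> i (f x)"
  using functional_fns[of f] by (simp add: value_of_def)

lemma emb_L_hom: "emb_L \<in> ring_hom L T.Q"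
proof (rule ring_hom_memI)
  fix x y assume c: "x \<in> carrier L" "y \<in> carrier L"
  show "emb_L (x \<otimes>\<^bsub>L\<^esub> y) = emb_L x \<otimes>\<^bsub>T.Q\<^esub> emb_L y" using c by (simp add: T.simps)
  have "emb_L (x \<oplus>\<^bsub>L\<^esub> y) = value_of ([(x, \<one>\<^bsub>M\<^esub>)] @ [(y, \<one>\<^bsub>M\<^esub>)])"
    by (rule value_of_eqI) (use c in \<open>simp add: L.l_distr\<close>)
  then show "emb_L (x \<oplus>\<^bsub>L\<^esub> y) = emb_L x \<oplus>\<^bsub>T.Q\<^esub> emb_L y" using c by (simp add: T.simps)
qed (auto simp: T.simps intro!: imageI)

lemma emb_M_hom: "emb_M \<in> ring_hom M T.Q"
proof (rule ring_hom_memI)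
  fix x y assume c: "x \<in> carrier M" "y \<in> carrier M"
  show "emb_M (x \<otimes>\<^bsub>M\<^esub> y) = emb_M x \<otimes>\<^bsub>T.Q\<^esub> emb_M y" using c by (simp add: T.simps)
  have "emb_M (x \<oplus>\<^bsub>M\<^esub> y) = value_of ([(\<one>\<^bsub>L\<^esub>, x)] @ [(\<one>\<^bsub>L\<^esub>, y)])"
    unfolding value_of_eq_iff
  proof
    fix f assume f: "f \<in> functionals"
    show "pairing [(\<one>\<^bsub>L\<^esub>, x \<oplus>\<^bsub>M\<^esub> y)] (\<lambda>x. i (f x)) =
        pairing ([(\<one>\<^bsub>L\<^esub>, x)] @ [(\<one>\<^bsub>L\<^esub>, y)]) (\<lambda>x. i (f x))"
      using c functionalsD(1,2)[OF f] hom_simps(1) ring_hom_add[OF i] by simp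
  qed
  then show "emb_M (x \<oplus>\<^bsub>M\<^esub> y) = emb_M x \<oplus>\<^bsub>T.Q\<^esub> emb_M y" using c by (simp add: T.simps)
qed (auto simp: T.simps intro!: imageI)

lemma emb_compat: "c \<in> carrier K \<Longrightarrow> emb_L (i c) = emb_M (j c)"
proof -
  assume c: "c \<in> carrier K"
  show ?thesis
    unfolding value_of_eq_iff
  proof (intro ballI)
    fix f assume f: "f \<in> functionals"
    have "f \<one>\<^bsub>M\<^esub> \<in> carrier K" using functionalsD(1)[OF f] by simp
    moreover have "f (j c) = c \<otimes>\<^bsub>K\<^esub> f \<one>\<^bsub>M\<^esub>"
      using functionalsD(3)[OF f c, of "\<one>\<^bsub>M\<^esub>"] hom_simps(2)[OF c] by simp
    ultimately show "pairing [(i c, \<one>\<^bsub>M\<^esub>)] (\<lambda>x. i (f x)) = pairing [(\<one>\<^bsub>L\<^esub>, j c)] (\<lambda>x. i (f x))"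
      using f c hom_simps(1) ring_hom_mult[OF i c] by simp
  qed
qed

lemma Q_one_zero: "\<one>\<^bsub>T.Q\<^esub> \<noteq> \<zero>\<^bsub>T.Q\<^esub>"
proof
  assume "\<one>\<^bsub>T.Q\<^esub> = \<zero>\<^bsub>T.Q\<^esub>"
  then have eq: "value_of [(\<one>\<^bsub>L\<^esub>, \<one>\<^bsub>M\<^esub>)] = value_of []" by (simp add: T.simps)
  obtain f where f: "f \<in> functionals" "f \<one>\<^bsub>M\<^esub> = \<one>\<^bsub>K\<^esub>" using retraction_exists by blast
  have "\<one>\<^bsub>L\<^esub> = \<zero>\<^bsub>L\<^esub>" using eq f ring_hom_one[OF i] unfolding value_of_eq_iff by auto
  then show False using fL by (simp add: sfield_def)
qed

text \<open>Evaluation of a tensor at \<open>f\<close> is the \<open>L\<close>-linear extension of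
  \<open>f\<close>; \<open>emb_L\<close> returns its value to the tensor ring, where the abstract
  description expects it.\<close>

definition \<Lambda> :: "((('b \<Rightarrow> 'k) \<Rightarrow> 'a) \<Rightarrow> (('b \<Rightarrow> 'k) \<Rightarrow> 'a)) set" where
  "\<Lambda> = {\<lambda>\<xi>. emb_L (\<xi> f) | f. f \<in> functionals}"

lemma value_of_apply: "f \<in> functionals \<Longrightarrow> value_of u f = pairing u (\<lambda>x. i (f x))"
  by (simp add: value_of_def)

lemma tensor_field_tensor: "field_tensor T.Q (emb_L ` carrier L) (emb_L ` i ` carrier K) (emb_M ` carrier M) \<Lambda>"
proof -
  interpret Q: cring T.Q by (rule T.cring_Q)
  note eL = ring_hom_closed[OF emb_L_hom] and eM = ring_hom_closed[OF emb_M_hom]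
  have sL: "sfield T.Q (emb_L ` carrier L)"
    by (rule sfield_hom_image(1)[OF emb_L_hom L.is_cring T.cring_Q fL Q_one_zero])
  have injL: "inj_on emb_L (carrier L)"
    by (rule sfield_hom_image(2)[OF emb_L_hom L.is_cring T.cring_Q fL Q_one_zero])
  have sMf: "sfield T.Q (emb_M ` carrier M)"
    by (rule sfield_hom_image(1)[OF emb_M_hom M.is_cring T.cring_Q fM Q_one_zero])
  have "sfield L (i ` carrier K)"
    by (rule sfield_hom_image(1)[OF i K.is_cring L.is_cring fK]) (use fL in \<open>simp add: sfield_def\<close>)
  then have sKf: "sfield T.Q (emb_L ` i ` carrier K)"
    by (rule sfield_hom_image(1)[OF emb_L_hom L.is_cring T.cring_Q _ Q_one_zero])
  show ?thesis
  proof
    show "sfield T.Q (emb_L ` carrier L)" "sfield T.Q (emb_M ` carrier M)"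
      "sfield T.Q (emb_L ` i ` carrier K)" by (rule sL sMf sKf)+
    show "emb_L ` i ` carrier K \<subseteq> emb_L ` carrier L" using hom_simps(1) by blast
    show "emb_L ` i ` carrier K \<subseteq> emb_M ` carrier M" using emb_compat hom_simps(2) by auto
    show "carrier T.Q = lspan T.Q (emb_L ` carrier L) (emb_M ` carrier M)"
    proof
      have "value_of u \<in> lspan T.Q (emb_L ` carrier L) (emb_M ` carrier M)" if "u \<in> tensors" for u
        using that
      proof (induction u)
        case Nil
        show ?case using lspan_zero[of T.Q] by (simp add: T.simps)
      next
        case (Cons a u)
        obtain l x where a: "a = (l, x)" by (cases a)
        have c: "l \<in> carrier L" "x \<in> carrier M" "u \<in> tensors" using Cons.prems a by auto
        have "emb_L l \<otimes>\<^bsub>T.Q\<^esub> emb_M x = value_of [(l, x)]" using c by (simp add: T.simps)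
        then have "value_of u \<oplus>\<^bsub>T.Q\<^esub> emb_L l \<otimes>\<^bsub>T.Q\<^esub> emb_M x = value_of (u @ [(l, x)])"
          using c by (simp add: T.simps)
        also have "\<dots> = value_of ([(l, x)] @ u)" using c by (intro T.comm) auto
        finally show ?case
          using lspan_step[OF Cons.IH[OF c(3)], of "emb_L l" "emb_M x"] c a by simp
      qed
      then show "carrier T.Q \<subseteq> lspan T.Q (emb_L ` carrier L) (emb_M ` carrier M)"
        unfolding T.simps(1) by blast
      show "lspan T.Q (emb_L ` carrier L) (emb_M ` carrier M) \<subseteq> carrier T.Q"
        using eL eM by (intro Q.lspan_closed) auto
    qed
  next
    fix h x y assume h: "h \<in> \<Lambda>" and x: "x \<in> carrier T.Q" and y: "y \<in> carrier T.Q"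
    obtain f where f: "f \<in> functionals" "h = (\<lambda>\<xi>. emb_L (\<xi> f))" using h unfolding \<Lambda>_def by blast
    obtain u v where uv: "u \<in> tensors" "x = value_of u" "v \<in> tensors" "y = value_of v"
      using x y unfolding T.simps(1) by blast
    have "(x \<oplus>\<^bsub>T.Q\<^esub> y) f = x f \<oplus>\<^bsub>L\<^esub> y f"
      using uv f functional_fns[OF f(1)] by (simp add: T.simps value_of_apply pairing_append)
    moreover have "x f \<in> carrier L" "y f \<in> carrier L"
      using uv f functional_fns[OF f(1)] by (simp_all add: value_of_apply)
    ultimately show "h (x \<oplus>\<^bsub>T.Q\<^esub> y) = h x \<oplus>\<^bsub>T.Q\<^esub> h y" using f(2) ring_hom_add[OF emb_L_hom] by simp
  next
    fix h l x assume h: "h \<in> \<Lambda>" and l: "l \<in> emb_L ` carrier L" and x: "x \<in> carrier T.Q"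
    obtain f where f: "f \<in> functionals" "h = (\<lambda>\<xi>. emb_L (\<xi> f))" using h unfolding \<Lambda>_def by blast
    obtain u where u: "u \<in> tensors" "x = value_of u" using x unfolding T.simps(1) by blast
    obtain m where m: "m \<in> carrier L" "l = emb_L m" using l by blast
    note g = functional_fns[OF f(1)]
    have "pairing u (\<lambda>y. i (f (\<one>\<^bsub>M\<^esub> \<otimes>\<^bsub>M\<^esub> y))) = pairing u (\<lambda>y. i (f y))"
      by (rule pairing_cong[OF u(1)]) simp
    moreover have "l \<otimes>\<^bsub>T.Q\<^esub> x = value_of (times [(m, \<one>\<^bsub>M\<^esub>)] u)" using m u by (simp add: T.simps)
    moreover have "[(m, \<one>\<^bsub>M\<^esub>)] \<in> tensors" using m by simp
    ultimately have "(l \<otimes>\<^bsub>T.Q\<^esub> x) f = m \<otimes>\<^bsub>L\<^esub> x f"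
      using pairing_times[OF _ u(1) g, of "[(m, \<one>\<^bsub>M\<^esub>)]"] m u g f(1) by (simp add: value_of_apply)
    moreover have "x f \<in> carrier L" using u f g by (simp add: value_of_apply)
    ultimately show "h (l \<otimes>\<^bsub>T.Q\<^esub> x) = l \<otimes>\<^bsub>T.Q\<^esub> h x"
      using f(2) m ring_hom_mult[OF emb_L_hom] by simp
  next
    fix h m assume h: "h \<in> \<Lambda>" and m: "m \<in> emb_M ` carrier M"
    obtain f where f: "f \<in> functionals" "h = (\<lambda>\<xi>. emb_L (\<xi> f))" using h unfolding \<Lambda>_def by blast
    obtain x where x: "x \<in> carrier M" "m = emb_M x" using m by blast
    have "i (f x) \<in> carrier L" using functionalsD(1)[OF f(1) x(1)] hom_simps(1) by blast
    then have "h m = emb_L (i (f x))" using f x value_of_single[of f "\<one>\<^bsub>L\<^esub>" x] by simp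
    then show "h m \<in> emb_L ` i ` carrier K" using functionalsD(1)[OF f(1) x(1)] by blast
  next
    fix x assume x: "x \<in> carrier T.Q" and 0: "\<And>h. h \<in> \<Lambda> \<Longrightarrow> h x = \<zero>\<^bsub>T.Q\<^esub>"
    obtain u where u: "u \<in> tensors" "x = value_of u" using x unfolding T.simps(1) by blast
    have z: "\<zero>\<^bsub>T.Q\<^esub> = emb_L \<zero>\<^bsub>L\<^esub>" using ring_hom_zero[OF emb_L_hom L.ring_axioms Q.ring_axioms] by simp
    have "pairing u (\<lambda>x. i (f x)) = \<zero>\<^bsub>L\<^esub>" if f: "f \<in> functionals" for f
    proof -
      have "emb_L (x f) = \<zero>\<^bsub>T.Q\<^esub>" using 0[of "\<lambda>\<xi>. emb_L (\<xi> f)"] f unfolding \<Lambda>_def by blast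
      moreover have "x f \<in> carrier L" using u functional_fns[OF f] f by (simp add: value_of_apply)
      ultimately have "x f = \<zero>\<^bsub>L\<^esub>" using injL z by (metis L.zero_closed inj_onD)
      then show ?thesis using u f by (simp add: value_of_apply)
    qed
    then have "value_of u = value_of []" unfolding value_of_eq_iff by simp
    then show "x = \<zero>\<^bsub>T.Q\<^esub>" using u by (simp add: T.simps)
  qed
qed

section \<open>The endomorphism of the tensor product\<close>

definition twist :: "('a \<times> 'b) list \<Rightarrow> ('a \<times> 'b) list" where
  "twist u = map (\<lambda>(l, x). (sL l, sM x)) u"

lemma twist_closed: "u \<in> tensors \<Longrightarrow> twist u \<in> tensors"
  unfolding twist_def by (induction u) (auto simp: hom_simps)

lemma twist_append: "twist (u @ v) = twist u @ twist v"
  by (simp add: twist_def)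

lemma twist_times: "u \<in> tensors \<Longrightarrow> v \<in> tensors \<Longrightarrow> twist (times u v) = times (twist u) (twist v)"
proof (induction u)
  case (Cons a u)
  obtain l x where a: "a = (l, x)" by (cases a)
  have c: "l \<in> carrier L" "x \<in> carrier M" "u \<in> tensors" using Cons.prems a by auto
  have "twist (times1 (l, x) v) = times1 (sL l, sM x) (twist v)"
    using Cons.prems(2) unfolding twist_def
    by (induction v) (auto simp: ring_hom_mult[OF sL(1) c(1)] ring_hom_mult[OF sM(1) c(2)])
  moreover have "twist (a # u) = (sL l, sM x) # twist u" using a by (simp add: twist_def)
  ultimately show ?case using Cons a c by (simp add: twist_append)
qed (simp add: twist_def)

lemma pairing_twist:
  "u \<in> tensors \<Longrightarrow> g \<in> fns \<Longrightarrow> g' \<in> fns \<Longrightarrow> (\<And>x. x \<in> carrier M \<Longrightarrow> g (sM x) = sL (g' x)) \<Longrightarrow>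
    pairing (twist u) g = sL (pairing u g')"
proof (induction u)
  case Nil
  then show ?case using ring_hom_zero[OF sL(1) L.ring_axioms L.ring_axioms] by (simp add: twist_def)
next
  case (Cons a u)
  obtain l x where a: "a = (l, x)" by (cases a)
  have c: "l \<in> carrier L" "x \<in> carrier M" "u \<in> tensors" "g' x \<in> carrier L" "pairing u g' \<in> carrier L"
    using Cons.prems a by auto
  have "twist (a # u) = (sL l, sM x) # twist u" using a by (simp add: twist_def)
  then show ?case
    using Cons a c ring_hom_mult[OF sL(1) c(1,4)] ring_hom_add[OF sL(1), of "l \<otimes>\<^bsub>L\<^esub> g' x" "pairing u g'"] by simp
qed

text \<open>Twisting tensors corresponds to conjugating functionals: one direction tests with
  sK^(-1) f sM, the other with sK f sM^(-1). This is where bijectivity on \<open>K\<close> and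
  \<open>M\<close> is used; it makes the induced map well defined and injective at once.\<close>

lemma value_of_twist:
  assumes u: "u \<in> tensors" and v: "v \<in> tensors"
  shows "value_of (twist u) = value_of (twist v) \<longleftrightarrow> value_of u = value_of v"
proof
  let ?invK = "inv_into (carrier K) sK" and ?invM = "inv_into (carrier M) sM"
  have iK: "?invK x \<in> carrier K" "sK (?invK x) = x" if "x \<in> carrier K" for x
    using sK(2) that by (auto simp: bij_betw_def inv_into_into f_inv_into_f)
  have iM: "?invM x \<in> carrier M" "sM (?invM x) = x" if "x \<in> carrier M" for x
    using sM(2) that by (auto simp: bij_betw_def inv_into_into f_inv_into_f)
  have injK: "x = y" if "x \<in> carrier K" "y \<in> carrier K" "sK x = sK y" for x y
    using sK(2) that by (meson bij_betw_def inj_onD)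
  have injM: "x = y" if "x \<in> carrier M" "y \<in> carrier M" "sM x = sM y" for x y
    using sM(2) that by (meson bij_betw_def inj_onD)
  have injL: "x = y" if "x \<in> carrier L" "y \<in> carrier L" "sL x = sL y" for x y
    using sL(2) that by (meson bij_betw_def inj_onD)
  { assume eq: "value_of u = value_of v"
    show "value_of (twist u) = value_of (twist v)"
      unfolding value_of_eq_iff
    proof
      fix f assume f: "f \<in> functionals"
      let ?g = "\<lambda>x. ?invK (f (sM x))"
      note fD = functionalsD[OF f]
      have gf: "?g \<in> functionals" unfolding functionals_def mem_Collect_eq
      proof (intro conjI ballI)
        show gc: "?g x \<in> carrier K" if "x \<in> carrier M" for x using that iK fD(1) hom_simps by simp
        fix x assume x: "x \<in> carrier M"
        { fix y assume y: "y \<in> carrier M"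
          have "sK (?g x \<oplus>\<^bsub>K\<^esub> ?g y) = f (sM x) \<oplus>\<^bsub>K\<^esub> f (sM y)"
            using x y gc iK(2) fD(1) hom_simps ring_hom_add[OF sK(1)] by simp
          also have "\<dots> = f (sM (x \<oplus>\<^bsub>M\<^esub> y))" using x y fD(2) hom_simps ring_hom_add[OF sM(1)] by simp
          also have "\<dots> = sK (?g (x \<oplus>\<^bsub>M\<^esub> y))" using x y iK(2) fD(1) hom_simps by simp
          finally show "?g (x \<oplus>\<^bsub>M\<^esub> y) = ?g x \<oplus>\<^bsub>K\<^esub> ?g y"
            using injK[of "?g (x \<oplus>\<^bsub>M\<^esub> y)" "?g x \<oplus>\<^bsub>K\<^esub> ?g y"] gc x y by simp
        }
        fix c assume c: "c \<in> carrier K"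
        have "sK (c \<otimes>\<^bsub>K\<^esub> ?g x) = sK c \<otimes>\<^bsub>K\<^esub> f (sM x)"
          using x c gc iK(2) fD(1) hom_simps ring_hom_mult[OF sK(1)] by simp
        also have "\<dots> = f (sM (j c \<otimes>\<^bsub>M\<^esub> x))"
          using x c fD(3)[of "sK c" "sM x"] hom_simps ring_hom_mult[OF sM(1)] j_s[OF c] by simp
        also have "\<dots> = sK (?g (j c \<otimes>\<^bsub>M\<^esub> x))" using x c iK(2) fD(1) hom_simps by simp
        finally show "?g (j c \<otimes>\<^bsub>M\<^esub> x) = c \<otimes>\<^bsub>K\<^esub> ?g x"
          using injK[of "?g (j c \<otimes>\<^bsub>M\<^esub> x)" "c \<otimes>\<^bsub>K\<^esub> ?g x"] gc x c hom_simps by simp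
      qed
      have "i (f (sM x)) = sL (i (?g x))" if x: "x \<in> carrier M" for x
        using i_s[of "?g x"] iK fD(1) hom_simps x by simp
      then have "pairing (twist w) (\<lambda>x. i (f x)) = sL (pairing w (\<lambda>x. i (?g x)))" if "w \<in> tensors" for w
        using that functional_fns[OF f] functional_fns[OF gf] by (intro pairing_twist) auto
      moreover have "pairing u (\<lambda>x. i (?g x)) = pairing v (\<lambda>x. i (?g x))"
        by (rule value_of_eqD[OF eq gf])
      ultimately show "pairing (twist u) (\<lambda>x. i (f x)) = pairing (twist v) (\<lambda>x. i (f x))" using u v by simp
    qed
  }
  assume eq: "value_of (twist u) = value_of (twist v)"
  show "value_of u = value_of v"
    unfolding value_of_eq_iff
  proof
    fix f assume f: "f \<in> functionals"
    let ?g = "\<lambda>x. sK (f (?invM x))"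
    note fD = functionalsD[OF f]
    have gf: "?g \<in> functionals" unfolding functionals_def mem_Collect_eq
    proof (intro conjI ballI)
      show "?g x \<in> carrier K" if "x \<in> carrier M" for x using that iM fD(1) hom_simps by simp
      fix x assume x: "x \<in> carrier M"
      { fix y assume y: "y \<in> carrier M"
        have "?invM (x \<oplus>\<^bsub>M\<^esub> y) = ?invM x \<oplus>\<^bsub>M\<^esub> ?invM y"
          using x y iM ring_hom_add[OF sM(1)] by - (rule injM, simp_all)
        then show "?g (x \<oplus>\<^bsub>M\<^esub> y) = ?g x \<oplus>\<^bsub>K\<^esub> ?g y"
          using x y iM fD(1,2) ring_hom_add[OF sK(1)] by simp
      }
      fix c assume c: "c \<in> carrier K"
      have "?invM (j c \<otimes>\<^bsub>M\<^esub> x) = j (?invK c) \<otimes>\<^bsub>M\<^esub> ?invM x"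
        using x c iM iK hom_simps ring_hom_mult[OF sM(1)] j_s[of "?invK c"] by - (rule injM, simp_all)
      then show "?g (j c \<otimes>\<^bsub>M\<^esub> x) = c \<otimes>\<^bsub>K\<^esub> ?g x"
        using x c iM iK fD(1,3) ring_hom_mult[OF sK(1)] by simp
    qed
    have "i (?g (sM x)) = sL (i (f x))" if x: "x \<in> carrier M" for x
    proof -
      have "?invM (sM x) = x" using sM(2) x by (simp add: bij_betw_def)
      then show ?thesis using i_s[of "f x"] fD(1)[OF x] by simp
    qed
    then have *: "pairing (twist w) (\<lambda>x. i (?g x)) = sL (pairing w (\<lambda>x. i (f x)))" if "w \<in> tensors" for w
      using that functional_fns[OF f] functional_fns[OF gf] by (intro pairing_twist) auto
    have "pairing (twist u) (\<lambda>x. i (?g x)) = pairing (twist v) (\<lambda>x. i (?g x))"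
      by (rule value_of_eqD[OF eq gf])
    then show "pairing u (\<lambda>x. i (f x)) = pairing v (\<lambda>x. i (f x))"
      using *[OF u] *[OF v] u v functional_fns[OF f] by - (rule injL, auto)
  qed
qed

definition sT :: "(('b \<Rightarrow> 'k) \<Rightarrow> 'a) \<Rightarrow> (('b \<Rightarrow> 'k) \<Rightarrow> 'a)" where
  "sT \<xi> = value_of (twist (inv_into tensors value_of \<xi>))"

lemma sT_value_of: "u \<in> tensors \<Longrightarrow> sT (value_of u) = value_of (twist u)"
  unfolding sT_def using value_of_twist[OF T.rep(1)] T.rep(2) by simp

lemma sT_hom: "sT \<in> ring_hom T.Q T.Q"
proof (rule ring_hom_memI)
  fix x y assume "x \<in> carrier T.Q" "y \<in> carrier T.Q"
  then obtain u v where uv: "u \<in> tensors" "x = value_of u" "v \<in> tensors" "y = value_of v"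
    unfolding T.simps(1) by blast
  show "sT (x \<otimes>\<^bsub>T.Q\<^esub> y) = sT x \<otimes>\<^bsub>T.Q\<^esub> sT y"
    using uv by (simp add: T.simps sT_value_of times_closed twist_times twist_closed)
  show "sT (x \<oplus>\<^bsub>T.Q\<^esub> y) = sT x \<oplus>\<^bsub>T.Q\<^esub> sT y"
    using uv by (simp add: T.simps sT_value_of twist_append twist_closed)
next
  show "sT x \<in> carrier T.Q" if "x \<in> carrier T.Q" for x
    using that sT_value_of twist_closed by (auto simp: T.simps)
  show "sT \<one>\<^bsub>T.Q\<^esub> = \<one>\<^bsub>T.Q\<^esub>"
    using ring_hom_one[OF sL(1)] ring_hom_one[OF sM(1)] by (simp add: T.simps sT_value_of) (simp add: twist_def)
qed

lemma sT_emb: "l \<in> carrier L \<Longrightarrow> sT (emb_L l) = emb_L (sL l)" "x \<in> carrier M \<Longrightarrow> sT (emb_M x) = emb_M (sM x)"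
  using ring_hom_one[OF sL(1)] ring_hom_one[OF sM(1)] by (simp_all add: sT_value_of) (simp_all add: twist_def)

lemma sT_inj: "inj_on sT (carrier T.Q)"
proof (rule inj_onI)
  fix x y assume "x \<in> carrier T.Q" "y \<in> carrier T.Q" and eq: "sT x = sT y"
  then obtain u v where uv: "u \<in> tensors" "x = value_of u" "v \<in> tensors" "y = value_of v"
    unfolding T.simps(1) by blast
  then show "x = y" using eq sT_value_of value_of_twist by simp
qed

lemma tensor_difference_tensor:
  assumes S: "finite S" "S \<subseteq> carrier L"
  shows "difference_tensor T.Q (emb_L ` carrier L) (emb_L ` i ` carrier K) (emb_M ` carrier M) \<Lambda> sT (emb_L ` S)"
proof -
  interpret F: field_tensor T.Q "emb_L ` carrier L" "emb_L ` i ` carrier K" "emb_M ` carrier M" \<Lambda>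
    by (rule tensor_field_tensor)
  show ?thesis
  proof
    show "sT \<in> ring_hom T.Q T.Q" "inj_on sT (carrier T.Q)" by (rule sT_hom sT_inj)+
    have "sT ` emb_L ` carrier L = emb_L ` sL ` carrier L"
      using sT_emb(1) by (simp add: image_image)
    then show "sT ` emb_L ` carrier L = emb_L ` carrier L" using sL(2) by (simp add: bij_betw_def)
    have "sT ` emb_M ` carrier M = emb_M ` sM ` carrier M"
      using sT_emb(2) by (simp add: image_image)
    then show "sT ` emb_M ` carrier M = emb_M ` carrier M" using sM(2) by (simp add: bij_betw_def)
    have "sT ` emb_L ` i ` carrier K = emb_L ` i ` sK ` carrier K"
      using sT_emb(1) hom_simps(1) i_s by (simp add: image_image)
    then show "sT ` emb_L ` i ` carrier K = emb_L ` i ` carrier K" using sK(2) by (simp add: bij_betw_def)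
    show "finite (emb_L ` S)" "emb_L ` S \<subseteq> emb_L ` carrier L" using S by auto
  qed
qed

end

section \<open>The fraction field of a residue domain\<close>

context sigma_ring
begin

text \<open>Residue ring and fractions are formed in one step. That \<sigma> fixes \<open>Q\<close>
  in both directions keeps denominators outside \<open>Q\<close>. The representation as fractions in
  the last clause later bounds the size of the field.\<close>

theorem residue_fraction_field:
  assumes Q: "prime_in R (carrier R) Q" and fixed: "\<And>x. x \<in> carrier R \<Longrightarrow> \<sigma> x \<in> Q \<longleftrightarrow> x \<in> Q"
  shows "\<exists>(F :: ('a \<times> 'a) set ring) \<tau> h. cring F \<and> sfield F (carrier F) \<and> \<tau> \<in> ring_hom F F \<and>
     h \<in> ring_hom R F \<and> (\<forall>x\<in>carrier R. \<tau> (h x) = h (\<sigma> x)) \<and>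
     (\<forall>\<xi>\<in>carrier F. \<exists>x\<in>carrier R. \<exists>w\<in>carrier R. h w \<noteq> \<zero>\<^bsub>F\<^esub> \<and> \<xi> \<otimes>\<^bsub>F\<^esub> h w = h x)"
proof -
  note qd = prime_inD[OF Q] and pc = prime_congruence[OF Q]
  define C where "C = {(x, w). x \<in> carrier R \<and> w \<in> carrier R \<and> w \<notin> Q}"
  define ev where "ev a = {b \<in> C. fst a \<otimes> snd b \<ominus> fst b \<otimes> snd a \<in> Q}" for a
  define pl where "pl a b = (fst a \<otimes> snd b \<oplus> fst b \<otimes> snd a, snd a \<otimes> snd b)" for a b
  define mu where "mu a b = (fst a \<otimes> fst b, snd a \<otimes> snd b)" for a b
  define ng where "ng a = (\<ominus> fst a, snd a)" for a :: "'a \<times> 'a"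
  have CI: "(x, w) \<in> C \<longleftrightarrow> x \<in> carrier R \<and> w \<in> carrier R \<and> w \<notin> Q" for x w by (simp add: C_def)
  have ww: "w \<otimes> v \<notin> Q" if "w \<in> carrier R" "v \<in> carrier R" "w \<notin> Q" "v \<notin> Q" for w v
    using qd(6)[of w v] that by blast
  have eq: "ev (x, w) = ev (y, v) \<longleftrightarrow> x \<otimes> v \<ominus> y \<otimes> w \<in> Q" if xw: "(x, w) \<in> C" and yv: "(y, v) \<in> C" for x w y v
  proof
    assume "ev (x, w) = ev (y, v)"
    moreover have "(y, v) \<in> ev (y, v)" using yv pc(1)[of "y \<otimes> v"] by (simp add: ev_def CI)
    ultimately have "(y, v) \<in> ev (x, w)" by simp
    then show "x \<otimes> v \<ominus> y \<otimes> w \<in> Q" by (simp add: ev_def)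
  next
    assume 1: "x \<otimes> v \<ominus> y \<otimes> w \<in> Q"
    \<comment> \<open>Transitivity of equality of fractions: the middle denominator is cancelled
      because \<open>Q\<close> is prime.\<close>
    have tr: "x \<otimes> u \<ominus> z \<otimes> w \<in> Q"
      if c: "(x, w) \<in> C" "(y, v) \<in> C" "(z, u) \<in> C" and "x \<otimes> v \<ominus> y \<otimes> w \<in> Q" "y \<otimes> u \<ominus> z \<otimes> v \<in> Q" for x w y v z u
    proof -
      have cc: "x \<in> carrier R" "w \<in> carrier R" "y \<in> carrier R" "v \<in> carrier R" "z \<in> carrier R" "u \<in> carrier R" "v \<notin> Q"
        using c by (auto simp: CI)
      have "(x \<otimes> v) \<otimes> u \<ominus> (y \<otimes> w) \<otimes> u \<in> Q" using pc(5)[of "x \<otimes> v" "y \<otimes> w" u] that(4) cc by simp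
      moreover have "(y \<otimes> u) \<otimes> w \<ominus> (z \<otimes> v) \<otimes> w \<in> Q" using pc(5)[of "y \<otimes> u" "z \<otimes> v" w] that(5) cc by simp
      moreover have "(y \<otimes> u) \<otimes> w = (y \<otimes> w) \<otimes> u" using cc by (simp add: m_ac)
      ultimately have "(x \<otimes> v) \<otimes> u \<ominus> (z \<otimes> v) \<otimes> w \<in> Q"
        using pc(3)[of "x \<otimes> v \<otimes> u" "y \<otimes> w \<otimes> u" "z \<otimes> v \<otimes> w"] cc by simp
      moreover have "(x \<otimes> v) \<otimes> u \<ominus> (z \<otimes> v) \<otimes> w = v \<otimes> (x \<otimes> u \<ominus> z \<otimes> w)"
        using cc by (simp add: a_minus_def r_distr r_minus m_ac)
      ultimately show ?thesis using qd(6)[of v "x \<otimes> u \<ominus> z \<otimes> w"] cc by auto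
    qed
    have 2: "y \<otimes> w \<ominus> x \<otimes> v \<in> Q" using pc(2)[OF _ _ 1] xw yv by (simp add: CI)
    show "ev (x, w) = ev (y, v)"
    proof (intro equalityI subsetI)
      fix b assume "b \<in> ev (x, w)"
      then obtain z u where b: "b = (z, u)" "(z, u) \<in> C" "x \<otimes> u \<ominus> z \<otimes> w \<in> Q" by (cases b) (auto simp: ev_def)
      then show "b \<in> ev (y, v)" using tr[OF yv xw b(2) 2 b(3)] by (simp add: ev_def)
    next
      fix b assume "b \<in> ev (y, v)"
      then obtain z u where b: "b = (z, u)" "(z, u) \<in> C" "y \<otimes> u \<ominus> z \<otimes> v \<in> Q" by (cases b) (auto simp: ev_def)
      then show "b \<in> ev (x, w)" using tr[OF xw yv b(2) 1 b(3)] by (simp add: ev_def)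
    qed
  qed
  have eqI: "ev (x, w) = ev (y, v)" if "(x, w) \<in> C" "(y, v) \<in> C" "x \<otimes> v = y \<otimes> w" for x w y v
    using eq[OF that(1,2)] that pc(1)[of "y \<otimes> w"] by (simp add: CI)
  interpret G: ring_congruence C pl mu ng "(\<zero>, \<one>)" "(\<one>, \<one>)" ev
  proof
    fix a b assume "a \<in> C" "b \<in> C"
    then obtain x w y v where d: "a = (x, w)" "b = (y, v)" "x \<in> carrier R" "w \<in> carrier R" "w \<notin> Q"
      "y \<in> carrier R" "v \<in> carrier R" "v \<notin> Q" by (auto simp: C_def)
    show 1: "pl a b \<in> C" and 2: "mu a b \<in> C" using d ww by (simp_all add: pl_def mu_def CI)
    have "pl a b = pl b a" "mu a b = mu b a" using d by (simp_all add: pl_def mu_def m_comm a_comm)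
    then show "ev (pl a b) = ev (pl b a)" "ev (mu a b) = ev (mu b a)" by simp_all
    { fix c assume "c \<in> C"
      then obtain z u where e: "c = (z, u)" "z \<in> carrier R" "u \<in> carrier R" "u \<notin> Q" by (auto simp: C_def)
      have "pl (pl a b) c = pl a (pl b c)" "mu (mu a b) c = mu a (mu b c)"
        using d e by (simp_all add: pl_def mu_def l_distr r_distr m_ac a_ac)
      then show "ev (pl (pl a b) c) = ev (pl a (pl b c))" "ev (mu (mu a b) c) = ev (mu a (mu b c))" by simp_all
      have "((x \<otimes> v \<oplus> y \<otimes> w) \<otimes> z) \<otimes> ((w \<otimes> u) \<otimes> (v \<otimes> u)) =
          ((x \<otimes> z) \<otimes> (v \<otimes> u) \<oplus> (y \<otimes> z) \<otimes> (w \<otimes> u)) \<otimes> ((w \<otimes> v) \<otimes> u)"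
        using d e by (simp add: l_distr r_distr m_ac a_ac)
      then show "ev (mu (pl a b) c) = ev (pl (mu a c) (mu b c))"
        unfolding pl_def mu_def d(1,2) e(1) using d e ww by (intro eqI) (simp_all add: CI)
    }
    fix a' assume a': "a' \<in> C" "ev a = ev a'"
    obtain x' w' where e: "a' = (x', w')" "x' \<in> carrier R" "w' \<in> carrier R" "w' \<notin> Q"
      using a'(1) by (auto simp: C_def)
    have "(x, w) \<in> C" "(x', w') \<in> C" using d e by (simp_all add: CI)
    then have r: "x \<otimes> w' \<ominus> x' \<otimes> w \<in> Q" using a'(2) eq d(1) e(1) by simp
    have rv: "(x \<otimes> w') \<otimes> c \<ominus> (x' \<otimes> w) \<otimes> c \<in> Q" if "c \<in> carrier R" for c
      using pc(5)[of "x \<otimes> w'" "x' \<otimes> w" c] r that d e by simp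
    have p1: "(x \<otimes> v \<oplus> y \<otimes> w) \<otimes> (w' \<otimes> v) = (x \<otimes> w') \<otimes> (v \<otimes> v) \<oplus> y \<otimes> w \<otimes> w' \<otimes> v"
      and p2: "(x' \<otimes> v \<oplus> y \<otimes> w') \<otimes> (w \<otimes> v) = (x' \<otimes> w) \<otimes> (v \<otimes> v) \<oplus> y \<otimes> w \<otimes> w' \<otimes> v"
      using d e by (simp_all add: l_distr r_distr m_ac)
    have "(x \<otimes> v \<oplus> y \<otimes> w) \<otimes> (w' \<otimes> v) \<ominus> (x' \<otimes> v \<oplus> y \<otimes> w') \<otimes> (w \<otimes> v) \<in> Q"
      unfolding p1 p2 using rv[of "v \<otimes> v"] d e by (intro pc(4)) simp_all
    then show "ev (pl a b) = ev (pl a' b)"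
      unfolding pl_def d(1,2) e(1) fst_conv snd_conv using d e ww by (subst eq) (simp_all add: CI)
    have m1: "(x \<otimes> y) \<otimes> (w' \<otimes> v) = (x \<otimes> w') \<otimes> (y \<otimes> v)" "(x' \<otimes> y) \<otimes> (w \<otimes> v) = (x' \<otimes> w) \<otimes> (y \<otimes> v)"
      using d e by (simp_all add: m_ac)
    have "(x \<otimes> y) \<otimes> (w' \<otimes> v) \<ominus> (x' \<otimes> y) \<otimes> (w \<otimes> v) \<in> Q" unfolding m1 using rv[of "y \<otimes> v"] d by simp
    then show "ev (mu a b) = ev (mu a' b)"
      unfolding mu_def d(1,2) e(1) fst_conv snd_conv using d e ww by (subst eq) (simp_all add: CI)
  next
    fix a assume "a \<in> C"
    then obtain x w where d: "a = (x, w)" "x \<in> carrier R" "w \<in> carrier R" "w \<notin> Q" by (auto simp: C_def)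
    show "ng a \<in> C" using d by (simp add: ng_def CI)
    have "pl (\<zero>, \<one>) a = a" "mu (\<one>, \<one>) a = a" using d by (simp_all add: pl_def mu_def)
    then show "ev (pl (\<zero>, \<one>) a) = ev a" "ev (mu (\<one>, \<one>) a) = ev a" by simp_all
    have "(\<ominus> x \<otimes> w \<oplus> x \<otimes> w) = \<zero>" using d by (simp add: l_minus l_neg)
    then show "ev (pl (ng a) a) = ev (\<zero>, \<one>)"
      unfolding pl_def ng_def d(1) using d ww qd(3) by (intro eqI) (simp_all add: CI)
  qed (use qd(3) in \<open>simp_all add: CI\<close>)
  let ?F = G.Q
  have F: "cring ?F" by (rule G.cring_Q)
  define h where "h x = ev (x, \<one>)" for x
  define \<tau> where "\<tau> X = ev (\<sigma> (fst (inv_into C ev X)), \<sigma> (snd (inv_into C ev X)))" for X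
  have CR: "(x, \<one>) \<in> C \<longleftrightarrow> x \<in> carrier R" for x using qd(3) by (simp add: CI)
  have h0: "h x = \<zero>\<^bsub>?F\<^esub> \<longleftrightarrow> x \<in> Q" if "x \<in> carrier R" for x
    using eq[of x \<one> \<zero> \<one>] that by (simp add: h_def G.simps CR a_minus_def)
  have hh: "h \<in> ring_hom R ?F"
    by (rule ring_hom_memI) (auto simp: h_def G.simps CR pl_def mu_def intro!: imageI)
  have one: "\<one>\<^bsub>?F\<^esub> \<noteq> \<zero>\<^bsub>?F\<^esub>" using h0[of \<one>] qd(3) ring_hom_one[OF hh] by auto
  have frac: "ev (x, w) \<otimes>\<^bsub>?F\<^esub> h w = h x" if xw: "(x, w) \<in> C" for x w
  proof -
    have "ev (x, w) \<otimes>\<^bsub>?F\<^esub> h w = ev (x \<otimes> w, w)"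
      unfolding h_def using xw CR[of w] by (simp add: G.simps CI mu_def)
    also have "\<dots> = h x" unfolding h_def using xw qd(3) by (intro eqI) (simp_all add: CI)
    finally show ?thesis .
  qed
  have inv: "\<exists>Y\<in>carrier ?F. X \<otimes>\<^bsub>?F\<^esub> Y = \<one>\<^bsub>?F\<^esub>" if X: "X \<in> carrier ?F - {\<zero>\<^bsub>?F\<^esub>}" for X
  proof -
    obtain x w where d: "X = ev (x, w)" "(x, w) \<in> C" using X unfolding G.simps(1) by (auto simp: C_def)
    have "x \<notin> Q"
    proof
      assume "x \<in> Q"
      then have "ev (x, w) = ev (\<zero>, \<one>)" using d(2) qd(3) by (subst eq) (simp_all add: CI a_minus_def)
      then show False using X d(1) by (simp add: G.simps)
    qed
    then have wx: "(w, x) \<in> C" using d(2) by (simp add: CI)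
    have "ev (x, w) \<otimes>\<^bsub>?F\<^esub> ev (w, x) = ev (x \<otimes> w, w \<otimes> x)" using d(2) wx by (simp add: G.simps mu_def)
    also have "\<dots> = ev (\<one>, \<one>)" using d(2) wx qd(3) ww by (intro eqI) (simp_all add: CI m_comm)
    finally show ?thesis using wx d(1) by (auto simp: G.simps)
  qed
  have fld: "sfield ?F (carrier ?F)"
    unfolding sfield_def using one inv ring.carrier_is_subring[OF cring.axioms(1)[OF F]] by blast
  have sC: "(\<sigma> x, \<sigma> w) \<in> C" if "(x, w) \<in> C" for x w using that fixed sigma_simps(1) by (simp add: CI)
  have \<tau>: "\<tau> (ev (x, w)) = ev (\<sigma> x, \<sigma> w)" if xw: "(x, w) \<in> C" for x w
  proof -
    obtain y v where yv: "inv_into C ev (ev (x, w)) = (y, v)" by (cases "inv_into C ev (ev (x, w))")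
    have yC: "(y, v) \<in> C" and e: "ev (y, v) = ev (x, w)" using G.rep[OF xw] yv by auto
    have c: "x \<in> carrier R" "w \<in> carrier R" "y \<in> carrier R" "v \<in> carrier R" using xw yC by (auto simp: CI)
    have "y \<otimes> w \<ominus> x \<otimes> v \<in> Q" using e eq[OF yC xw] by simp
    then have "\<sigma> (y \<otimes> w \<ominus> x \<otimes> v) \<in> Q" using fixed c by simp
    moreover have "\<sigma> (y \<otimes> w \<ominus> x \<otimes> v) = \<sigma> y \<otimes> \<sigma> w \<ominus> \<sigma> x \<otimes> \<sigma> v"
    proof -
      have "\<sigma> (\<ominus> (x \<otimes> v)) = \<ominus> \<sigma> (x \<otimes> v)"
        using c sigma_simps(1,5) sigma_simps(2)[of "\<ominus> (x \<otimes> v)" "x \<otimes> v"]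
        by (metis a_inv_closed l_neg m_closed minus_equality)
      then show ?thesis using c by (simp add: a_minus_def sigma_simps)
    qed
    ultimately have "ev (\<sigma> y, \<sigma> v) = ev (\<sigma> x, \<sigma> w)" using eq[OF sC[OF yC] sC[OF xw]] by simp
    then show ?thesis unfolding \<tau>_def yv by simp
  qed
  have \<tau>h: "\<tau> (h x) = h (\<sigma> x)" if "x \<in> carrier R" for x
    unfolding h_def using \<tau>[of x \<one>] that by (simp add: CR sigma_simps)
  have \<tau>r: "\<tau> \<in> ring_hom ?F ?F"
  proof (rule ring_hom_memI)
    fix X assume "X \<in> carrier ?F"
    then obtain x w where d: "X = ev (x, w)" "(x, w) \<in> C" unfolding G.simps(1) by (auto simp: C_def)
    then show "\<tau> X \<in> carrier ?F" using \<tau> sC by (auto simp: G.simps)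
    fix Y assume "Y \<in> carrier ?F"
    then obtain y v where e: "Y = ev (y, v)" "(y, v) \<in> C" unfolding G.simps(1) by (auto simp: C_def)
    note s = sC[OF d(2)] sC[OF e(2)]
    have c: "x \<in> carrier R" "w \<in> carrier R" "y \<in> carrier R" "v \<in> carrier R" using d e by (auto simp: CI)
    have m: "mu (x, w) (y, v) \<in> C" "pl (x, w) (y, v) \<in> C" using G.closed(1,2)[OF d(2) e(2)] by auto
    show "\<tau> (X \<otimes>\<^bsub>?F\<^esub> Y) = \<tau> X \<otimes>\<^bsub>?F\<^esub> \<tau> Y"
      unfolding d(1) e(1) \<tau>[OF d(2)] \<tau>[OF e(2)] G.simps(5)[OF d(2) e(2)] G.simps(5)[OF s]
      using \<tau>[of "x \<otimes> y" "w \<otimes> v"] m c by (simp add: mu_def sigma_simps)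
    show "\<tau> (X \<oplus>\<^bsub>?F\<^esub> Y) = \<tau> X \<oplus>\<^bsub>?F\<^esub> \<tau> Y"
      unfolding d(1) e(1) \<tau>[OF d(2)] \<tau>[OF e(2)] G.simps(4)[OF d(2) e(2)] G.simps(4)[OF s]
      using \<tau>[of "x \<otimes> v \<oplus> y \<otimes> w" "w \<otimes> v"] m c by (simp add: pl_def sigma_simps)
  next
    show "\<tau> \<one>\<^bsub>?F\<^esub> = \<one>\<^bsub>?F\<^esub>" using \<tau>[of \<one> \<one>] by (simp add: G.simps CR sigma_simps)
  qed
  have "\<exists>x\<in>carrier R. \<exists>w\<in>carrier R. h w \<noteq> \<zero>\<^bsub>?F\<^esub> \<and> X \<otimes>\<^bsub>?F\<^esub> h w = h x" if X: "X \<in> carrier ?F" for X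
  proof -
    obtain x w where d: "X = ev (x, w)" "(x, w) \<in> C" using X unfolding G.simps(1) by (auto simp: C_def)
    have c: "x \<in> carrier R" "w \<in> carrier R" "w \<notin> Q" using d(2) by (simp_all add: CI)
    show ?thesis
      by (rule bexI[OF bexI[OF conjI c(2)] c(1)]) (use frac[OF d(2)] h0[OF c(2)] c(3) d(1) in simp_all)
  qed
  then have "cring ?F \<and> sfield ?F (carrier ?F) \<and> \<tau> \<in> ring_hom ?F ?F \<and> h \<in> ring_hom R ?F \<and>
      (\<forall>x\<in>carrier R. \<tau> (h x) = h (\<sigma> x)) \<and>
      (\<forall>\<xi>\<in>carrier ?F. \<exists>x\<in>carrier R. \<exists>w\<in>carrier R. h w \<noteq> \<zero>\<^bsub>?F\<^esub> \<and> \<xi> \<otimes>\<^bsub>?F\<^esub> h w = h x)"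
    using F fld \<tau>r hh \<tau>h by simp
  then show ?thesis by (intro exI)
qed

end

section \<open>Cyclic powers of a field\<close>

text \<open>The kernel is a \<sigma>-ideal without one.\<close>

lemma (in sigma_pseudo_field) sigma_morphism_inj:
  assumes f: "sigma_morphism R \<sigma> S \<tau> f" and S: "cring S" "\<one>\<^bsub>S\<^esub> \<noteq> \<zero>\<^bsub>S\<^esub>" "\<tau> \<zero>\<^bsub>S\<^esub> = \<zero>\<^bsub>S\<^esub>"
  shows "inj_on f (carrier R)"
proof -
  interpret S: cring S by (rule S(1))
  have fh: "f \<in> ring_hom R S" and f\<sigma>: "\<And>x. x \<in> carrier R \<Longrightarrow> f (\<sigma> x) = \<tau> (f x)"
    using f by (auto simp: sigma_morphism_def)
  interpret f: ring_hom_cring R S f by unfold_locales (rule fh)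
  let ?I = "{x \<in> carrier R. f x = \<zero>\<^bsub>S\<^esub>}"
  have "ideal ?I R" by (rule idealI_closed) auto
  moreover have "\<sigma> ` ?I \<subseteq> ?I" using f\<sigma> S(3) sigma_simps(1) by auto
  ultimately have "?I = {\<zero>} \<or> ?I = carrier R" by (intro sigma_simple) (simp add: sigma_ideal_def)
  moreover have "\<one> \<notin> ?I" using S(2) by simp
  ultimately have I: "?I = {\<zero>}" by blast
  show ?thesis
  proof (rule inj_onI)
    fix x y assume xy: "x \<in> carrier R" "y \<in> carrier R" "f x = f y"
    then have "f (x \<ominus> y) = \<zero>\<^bsub>S\<^esub>" by (simp add: a_minus_def S.r_neg)
    then have "x \<ominus> y = \<zero>" using I xy by blast
    then show "x = y" using xy by simp
  qed
qed

text \<open>Padding by zero makes equality of functions the same as equality of tuples.\<close>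

definition tuples :: "'f ring \<Rightarrow> nat \<Rightarrow> (nat \<Rightarrow> 'f) set" where
  "tuples F d = {u. (\<forall>k<d. u k \<in> carrier F) \<and> (\<forall>k\<ge>d. u k = \<zero>\<^bsub>F\<^esub>)}"

text \<open>The injection \<open>c\<close> lets the power of \<open>F\<close> live in any type large
  enough to code the tuples, in particular in the prescribed one.\<close>

locale cyclic_power = F: cring F for F :: "'f ring" +
  fixes \<tau> :: "'f \<Rightarrow> 'f" and d :: nat and c :: "(nat \<Rightarrow> 'f) \<Rightarrow> 't"
  assumes field: "sfield F (carrier F)" and \<tau>: "\<tau> \<in> ring_hom F F" and d: "d > 0"
    and c: "inj_on c (tuples F d)"
begin

lemma tuplesD: "u \<in> tuples F d \<Longrightarrow> u k \<in> carrier F" "u \<in> tuples F d \<Longrightarrow> k \<ge> d \<Longrightarrow> u k = \<zero>\<^bsub>F\<^esub>"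
  by (cases "k < d") (simp_all add: tuples_def)

sublocale P: ring_congruence "tuples F d" "\<lambda>u v k. u k \<oplus>\<^bsub>F\<^esub> v k" "\<lambda>u v k. u k \<otimes>\<^bsub>F\<^esub> v k"
  "\<lambda>u k. \<ominus>\<^bsub>F\<^esub> u k" "\<lambda>k. \<zero>\<^bsub>F\<^esub>" "\<lambda>k. if k < d then \<one>\<^bsub>F\<^esub> else \<zero>\<^bsub>F\<^esub>" c
proof
  fix x x' y assume a: "x \<in> tuples F d" "x' \<in> tuples F d" "y \<in> tuples F d" and "c x = c x'"
  then have "x = x'" using c by (meson inj_onD)
  then show "c (\<lambda>k. x k \<oplus>\<^bsub>F\<^esub> y k) = c (\<lambda>k. x' k \<oplus>\<^bsub>F\<^esub> y k)" "c (\<lambda>k. x k \<otimes>\<^bsub>F\<^esub> y k) = c (\<lambda>k. x' k \<otimes>\<^bsub>F\<^esub> y k)"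
    by simp_all
next
  fix x y z assume a: "x \<in> tuples F d" "y \<in> tuples F d" "z \<in> tuples F d"
  note t = tuplesD(1)[OF a(1)] tuplesD(1)[OF a(2)] tuplesD(1)[OF a(3)]
  show "c (\<lambda>k. x k \<oplus>\<^bsub>F\<^esub> y k \<oplus>\<^bsub>F\<^esub> z k) = c (\<lambda>k. x k \<oplus>\<^bsub>F\<^esub> (y k \<oplus>\<^bsub>F\<^esub> z k))"
    using t by (simp add: F.a_assoc)
  show "c (\<lambda>k. x k \<otimes>\<^bsub>F\<^esub> y k \<otimes>\<^bsub>F\<^esub> z k) = c (\<lambda>k. x k \<otimes>\<^bsub>F\<^esub> (y k \<otimes>\<^bsub>F\<^esub> z k))"
    using t by (simp add: F.m_assoc)
  show "c (\<lambda>k. (x k \<oplus>\<^bsub>F\<^esub> y k) \<otimes>\<^bsub>F\<^esub> z k) = c (\<lambda>k. x k \<otimes>\<^bsub>F\<^esub> z k \<oplus>\<^bsub>F\<^esub> y k \<otimes>\<^bsub>F\<^esub> z k)"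
    using t by (simp add: F.l_distr)
next
  fix x y assume a: "x \<in> tuples F d" "y \<in> tuples F d"
  note t = tuplesD(1)[OF a(1)] tuplesD(1)[OF a(2)]
  show "c (\<lambda>k. x k \<oplus>\<^bsub>F\<^esub> y k) = c (\<lambda>k. y k \<oplus>\<^bsub>F\<^esub> x k)" using t by (simp add: F.a_comm)
  show "c (\<lambda>k. x k \<otimes>\<^bsub>F\<^esub> y k) = c (\<lambda>k. y k \<otimes>\<^bsub>F\<^esub> x k)" using t by (simp add: F.m_comm)
next
  fix x assume a: "x \<in> tuples F d"
  note t = tuplesD(1)[OF a]
  show "c (\<lambda>k. \<zero>\<^bsub>F\<^esub> \<oplus>\<^bsub>F\<^esub> x k) = c x" using t by simp
  have "(\<lambda>k. (if k < d then \<one>\<^bsub>F\<^esub> else \<zero>\<^bsub>F\<^esub>) \<otimes>\<^bsub>F\<^esub> x k) = x" using t tuplesD(2)[OF a] by (auto simp: fun_eq_iff)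
  then show "c (\<lambda>k. (if k < d then \<one>\<^bsub>F\<^esub> else \<zero>\<^bsub>F\<^esub>) \<otimes>\<^bsub>F\<^esub> x k) = c x" by simp
  show "c (\<lambda>k. \<ominus>\<^bsub>F\<^esub> x k \<oplus>\<^bsub>F\<^esub> x k) = c (\<lambda>k. \<zero>\<^bsub>F\<^esub>)" using t by (simp add: F.l_neg)
qed (auto simp: tuples_def)

definition rot :: "(nat \<Rightarrow> 'f) \<Rightarrow> nat \<Rightarrow> 'f" where
  "rot u k = (if Suc k < d then u (Suc k) else if Suc k = d then \<tau> (u 0) else \<zero>\<^bsub>F\<^esub>)"

definition shift :: "'t \<Rightarrow> 't" where
  "shift x = c (rot (inv_into (tuples F d) c x))"

lemma rot_closed: "u \<in> tuples F d \<Longrightarrow> rot u \<in> tuples F d"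
  unfolding tuples_def[of F d] using tuplesD(1)[of u] ring_hom_closed[OF \<tau>] by (simp add: rot_def)

lemma shift_c: "u \<in> tuples F d \<Longrightarrow> shift (c u) = c (rot u)"
  unfolding shift_def using c by (simp add: inv_into_f_f)

lemma shift_pow_c: "u \<in> tuples F d \<Longrightarrow> (shift ^^ j) (c u) = c ((rot ^^ j) u) \<and> (rot ^^ j) u \<in> tuples F d"
proof (induction j)
  case (Suc j)
  then show ?case using shift_c[of "(rot ^^ j) u"] rot_closed[of "(rot ^^ j) u"] by simp
qed simp

text \<open>Rotation applies \<tau> to a coordinate when it passes the end. Up to \<open>d\<close>
  steps this happens at most once; the case \<open>j = 0\<close> is apart because \<open>u\<close>
  is not assumed to be padded by zero.\<close>

lemma rot_pow: "j \<le> d \<Longrightarrow> (rot ^^ j) u k = (if k + j < d then u (k + j) else if k < d then \<tau> (u (k + j - d))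
    else if j = 0 then u k else \<zero>\<^bsub>F\<^esub>)"
proof (induction j arbitrary: k)
  case (Suc j)
  have IH: "(rot ^^ j) u l = (if l + j < d then u (l + j) else if l < d then \<tau> (u (l + j - d))
      else if j = 0 then u l else \<zero>\<^bsub>F\<^esub>)" for l
    by (rule Suc.IH) (use Suc.prems in simp)
  have step: "(rot ^^ Suc j) u k = rot ((rot ^^ j) u) k" by (simp only: funpow.simps comp_apply)
  consider "Suc k < d" "Suc k + j < d" | "Suc k < d" "\<not> Suc k + j < d" | "Suc k = d" | "k \<ge> d" by linarith
  then show ?case
  proof cases
    case 1
    then show ?thesis unfolding step rot_def[of "(rot ^^ j) u"] IH by simp
  next
    case 2
    then show ?thesis unfolding step rot_def[of "(rot ^^ j) u"] IH by simp
  next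
    case 3
    then have "k + Suc j - d = j" "j < d" using Suc.prems by auto
    then show ?thesis unfolding step rot_def[of "(rot ^^ j) u"] IH using 3 by simp
  next
    case 4
    then show ?thesis unfolding step rot_def[of "(rot ^^ j) u"] by simp
  qed
qed simp

lemma cring_P: "cring P.Q" by (rule P.cring_Q)

lemma shift_hom: "shift \<in> ring_hom P.Q P.Q"
proof (rule ring_hom_memI)
  fix x y assume "x \<in> carrier P.Q" "y \<in> carrier P.Q"
  then obtain u v where uv: "u \<in> tuples F d" "x = c u" "v \<in> tuples F d" "y = c v" unfolding P.simps(1) by blast
  note t = tuplesD(1)[OF uv(1)] tuplesD(1)[OF uv(3)]
  have "rot (\<lambda>k. u k \<otimes>\<^bsub>F\<^esub> v k) = (\<lambda>k. rot u k \<otimes>\<^bsub>F\<^esub> rot v k)"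
    using t ring_hom_mult[OF \<tau>] by (auto simp: rot_def fun_eq_iff)
  then show "shift (x \<otimes>\<^bsub>P.Q\<^esub> y) = shift x \<otimes>\<^bsub>P.Q\<^esub> shift y"
    using uv P.closed(2)[OF uv(1,3)] by (simp add: P.simps shift_c rot_closed)
  have "rot (\<lambda>k. u k \<oplus>\<^bsub>F\<^esub> v k) = (\<lambda>k. rot u k \<oplus>\<^bsub>F\<^esub> rot v k)"
    using t ring_hom_add[OF \<tau>] by (auto simp: rot_def fun_eq_iff)
  then show "shift (x \<oplus>\<^bsub>P.Q\<^esub> y) = shift x \<oplus>\<^bsub>P.Q\<^esub> shift y"
    using uv P.closed(1)[OF uv(1,3)] by (simp add: P.simps shift_c rot_closed)
next
  show "shift x \<in> carrier P.Q" if "x \<in> carrier P.Q" for x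
    using that shift_c rot_closed by (auto simp: P.simps)
  have "rot (\<lambda>k. if k < d then \<one>\<^bsub>F\<^esub> else \<zero>\<^bsub>F\<^esub>) = (\<lambda>k. if k < d then \<one>\<^bsub>F\<^esub> else \<zero>\<^bsub>F\<^esub>)"
    using ring_hom_one[OF \<tau>] by (auto simp: rot_def fun_eq_iff)
  then show "shift \<one>\<^bsub>P.Q\<^esub> = \<one>\<^bsub>P.Q\<^esub>" using P.closed(5) by (simp add: P.simps shift_c)
qed

lemma sigma_ring_P: "sigma_ring P.Q shift"
  by (intro sigma_ring.intro cring_P sigma_ring_axioms.intro shift_hom)

lemma one_zero: "\<one>\<^bsub>F\<^esub> \<noteq> \<zero>\<^bsub>F\<^esub>"
  using field by (simp add: sfield_def)

lemma c_eq_iff: "u \<in> tuples F d \<Longrightarrow> v \<in> tuples F d \<Longrightarrow> c u = c v \<longleftrightarrow> u = v"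
  using c by (meson inj_onD)

end

section \<open>Coding into lists\<close>

text \<open>A prefix code: \<open>o'\<close> announces a further letter and \<open>z\<close> the
  end, so that a coded word can be followed by anything and still be read off.\<close>

fun tag :: "'u \<Rightarrow> 'u \<Rightarrow> 'u list \<Rightarrow> 'u list" where
  "tag z o' [] = [z]"
| "tag z o' (a # u) = o' # a # tag z o' u"

lemma tag_append_inject: "z \<noteq> o' \<Longrightarrow> tag z o' u @ r = tag z o' v @ s \<longleftrightarrow> u = v \<and> r = s"
  by (induction u arbitrary: v) (case_tac v; auto)+

fun code_list :: "'u \<Rightarrow> 'u \<Rightarrow> ('x \<Rightarrow> 'u list) \<Rightarrow> 'x list \<Rightarrow> 'u list" where
  "code_list z o' f [] = [z]"
| "code_list z o' f (x # xs) = o' # tag z o' (f x) @ code_list z o' f xs"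

lemma code_list_inj: "z \<noteq> o' \<Longrightarrow> inj f \<Longrightarrow> code_list z o' f xs = code_list z o' f ys \<longleftrightarrow> xs = ys"
proof (induction xs arbitrary: ys)
  case Nil
  then show ?case by (cases ys) auto
next
  case (Cons x xs)
  then show ?case by (cases ys) (auto simp: tag_append_inject inj_eq)
qed

lemma coding_list: "(z::'u) \<noteq> o' \<Longrightarrow> (\<exists>f::'x \<Rightarrow> 'u list. inj f) \<Longrightarrow> \<exists>f::'x list \<Rightarrow> 'u list. inj f"
  using code_list_inj by (metis injI)

lemma coding_pair:
  assumes "(z::'u) \<noteq> o'" "\<exists>f::'x \<Rightarrow> 'u list. inj f" "\<exists>g::'y \<Rightarrow> 'u list. inj g"
  shows "\<exists>f::'x \<times> 'y \<Rightarrow> 'u list. inj f"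
proof -
  obtain f :: "'x \<Rightarrow> 'u list" and g :: "'y \<Rightarrow> 'u list" where fg: "inj f" "inj g" using assms by blast
  have "inj (\<lambda>(x, y). tag z o' (f x) @ g y)"
    using fg by (auto intro!: injI simp: tag_append_inject[OF assms(1)] inj_eq)
  then show ?thesis by blast
qed

lemma coding_nat: "\<exists>f::nat \<Rightarrow> 'u list. inj f"
proof -
  have "inj (\<lambda>n. replicate n (undefined::'u))" by (rule injI) (metis length_replicate)
  then show ?thesis by blast
qed

text \<open>A coordinate is coded through a preimage under the covering \<open>r\<close>, and the
  whole tuple through a list of such codes. The first component of the target is large enough for
  this; the second stays empty.\<close>

lemma coding_tuples:
  fixes F :: "'f ring" and r :: "'w \<Rightarrow> 'f" and z :: 'u
  assumes zo: "z \<noteq> o'" and f: "\<exists>f::'w \<Rightarrow> 'u list. inj f" and r: "carrier F \<subseteq> range r"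
  shows "\<exists>c::(nat \<Rightarrow> 'f) \<Rightarrow> 'u list \<times> 'u list. inj_on c (tuples F d)"
proof -
  obtain g :: "'w list \<Rightarrow> 'u list" where g: "inj g" using coding_list[OF zo f] by blast
  let ?c = "\<lambda>u. (g (map (\<lambda>k. inv_into UNIV r (u k)) [0..<d]), [])"
  have "inj_on ?c (tuples F d)"
  proof (rule inj_onI)
    fix u v assume uv: "u \<in> tuples F d" "v \<in> tuples F d" and "?c u = ?c v"
    then have "map (\<lambda>k. inv_into UNIV r (u k)) [0..<d] = map (\<lambda>k. inv_into UNIV r (v k)) [0..<d]" using g by (simp add: inj_eq)
    then have "inv_into UNIV r (u k) = inv_into UNIV r (v k)" if "k < d" for k using that by (auto simp: map_eq_conv)
    moreover have "r (inv_into UNIV r (u k)) = u k" "r (inv_into UNIV r (v k)) = v k" if "k < d" for k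
      using that uv r by (auto simp: tuples_def intro!: f_inv_into_f)
    ultimately have "u k = v k" if "k < d" for k using that by metis
    moreover have "u k = v k" if "k \<ge> d" for k using that uv by (simp add: tuples_def)
    ultimately show "u = v" by (intro ext) (metis not_le)
  qed
  then show ?thesis by blast
qed

section \<open>The cyclic power as a pseudo field\<close>

context cyclic_power
begin

lemma pseudo_field_P: "sigma_pseudo_field P.Q shift"
proof -
  interpret sigma_ring P.Q shift by (rule sigma_ring_P)
  \<comment> \<open>The kernel of the zeroth coordinate; its preimages under the rotation are the
    kernels of the other coordinates and intersect in zero.\<close>
  let ?p = "{c u | u. u \<in> tuples F d \<and> u 0 = \<zero>\<^bsub>F\<^esub>}"
  have mem: "c u \<in> ?p \<longleftrightarrow> u 0 = \<zero>\<^bsub>F\<^esub>" if u: "u \<in> tuples F d" for u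
    using u c_eq_iff[OF u] by blast
  have comp: "(shift ^^ j) (c u) \<in> ?p \<longleftrightarrow> u j = \<zero>\<^bsub>F\<^esub>" if "u \<in> tuples F d" "j < d" for u j
    using shift_pow_c[OF that(1), of j] mem[of "(rot ^^ j) u"] rot_pow[of j u 0] that(2) by simp
  have \<tau>0: "\<tau> x = \<zero>\<^bsub>F\<^esub> \<longleftrightarrow> x = \<zero>\<^bsub>F\<^esub>" if x: "x \<in> carrier F" for x
  proof -
    have "inj_on \<tau> (carrier F)"
      by (rule sfield_hom_image(2)[OF \<tau> F.is_cring F.is_cring field one_zero])
    moreover have "\<tau> \<zero>\<^bsub>F\<^esub> = \<zero>\<^bsub>F\<^esub>" using ring_hom_zero[OF \<tau> F.ring_axioms F.ring_axioms] .
    ultimately show ?thesis using x by (metis F.zero_closed inj_onD)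
  qed
  show ?thesis
  proof (rule pseudo_fieldI)
    show "\<one>\<^bsub>P.Q\<^esub> \<noteq> \<zero>\<^bsub>P.Q\<^esub>"
      using one_zero d c_eq_iff[OF P.closed(5) P.closed(4)] by (auto simp: P.simps fun_eq_iff)
    show "d > 0" by (rule d)
    show "(shift ^^ d) x \<in> ?p \<longleftrightarrow> x \<in> ?p" if x: "x \<in> carrier P.Q" for x
    proof -
      obtain u where u: "u \<in> tuples F d" "x = c u" using x unfolding P.simps(1) by blast
      show ?thesis
        using shift_pow_c[OF u(1), of d] mem[OF u(1)] mem[of "(rot ^^ d) u"] rot_pow[of d u 0] d u(2)
          \<tau>0[OF tuplesD(1)[OF u(1)], of 0] by simp
    qed
    show "x = \<zero>\<^bsub>P.Q\<^esub>" if x: "x \<in> carrier P.Q" "\<And>j. (shift ^^ j) x \<in> ?p" for x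
    proof -
      obtain u where u: "u \<in> tuples F d" "x = c u" using x(1) unfolding P.simps(1) by blast
      have "u j = \<zero>\<^bsub>F\<^esub>" for j
        using x(2)[of j] comp[OF u(1), of j] tuplesD(2)[OF u(1), of j] unfolding u(2) by (cases "j < d") simp_all
      then have "u = (\<lambda>k. \<zero>\<^bsub>F\<^esub>)" by auto
      then show ?thesis using u(2) by (simp add: P.simps)
    qed
    show "\<exists>y\<in>carrier P.Q. x \<otimes>\<^bsub>P.Q\<^esub> x \<otimes>\<^bsub>P.Q\<^esub> y = x" if x: "x \<in> carrier P.Q" for x
    proof -
      obtain u where u: "u \<in> tuples F d" "x = c u" using x unfolding P.simps(1) by blast
      have "\<exists>y\<in>carrier F. u k \<otimes>\<^bsub>F\<^esub> u k \<otimes>\<^bsub>F\<^esub> y = u k" for k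
      proof (cases "u k = \<zero>\<^bsub>F\<^esub>")
        case True
        then show ?thesis by (intro bexI[of _ "\<zero>\<^bsub>F\<^esub>"]) auto
      next
        case False
        then obtain y where "y \<in> carrier F" "u k \<otimes>\<^bsub>F\<^esub> y = \<one>\<^bsub>F\<^esub>"
          by (rule F.sfield_inverse[OF field tuplesD(1)[OF u(1)]])
        then show ?thesis using tuplesD(1)[OF u(1), of k] by (intro bexI[of _ y]) (auto simp: F.m_assoc)
      qed
      then obtain y where y: "\<And>k. y k \<in> carrier F" "\<And>k. u k \<otimes>\<^bsub>F\<^esub> u k \<otimes>\<^bsub>F\<^esub> y k = u k" by metis
      let ?y = "\<lambda>k. if k < d then y k else \<zero>\<^bsub>F\<^esub>"
      have yt: "?y \<in> tuples F d" using y(1) by (auto simp: tuples_def)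
      have "(\<lambda>k. u k \<otimes>\<^bsub>F\<^esub> u k \<otimes>\<^bsub>F\<^esub> ?y k) = u" using y(2) tuplesD[OF u(1)] by (auto simp: fun_eq_iff)
      then have "x \<otimes>\<^bsub>P.Q\<^esub> x \<otimes>\<^bsub>P.Q\<^esub> c ?y = x"
        using u yt P.closed(2)[OF u(1,1)] P.simps(5)[OF P.closed(2)[OF u(1,1)] yt] P.simps(5)[OF u(1,1)] by simp
      then show ?thesis using yt by (auto simp: P.simps)
    qed
    show "prime_in P.Q (carrier P.Q) ?p" unfolding prime_in_def
    proof (intro conjI ballI impI)
      show "?p \<subseteq> carrier P.Q" by (auto simp: P.simps)
      show "\<zero>\<^bsub>P.Q\<^esub> \<in> ?p" using mem[OF P.closed(4)] by (simp add: P.simps)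
      show "\<one>\<^bsub>P.Q\<^esub> \<notin> ?p" using mem[OF P.closed(5)] one_zero d by (simp add: P.simps)
    next
      fix x y assume "x \<in> ?p" "y \<in> ?p"
      then obtain u v where uv: "u \<in> tuples F d" "x = c u" "v \<in> tuples F d" "y = c v" "u 0 = \<zero>\<^bsub>F\<^esub>" "v 0 = \<zero>\<^bsub>F\<^esub>" by blast
      then show "x \<oplus>\<^bsub>P.Q\<^esub> y \<in> ?p" using mem[OF P.closed(1)[OF uv(1,3)]] by (simp add: P.simps)
    next
      fix x y assume "x \<in> carrier P.Q" "y \<in> ?p"
      then obtain u v where uv: "u \<in> tuples F d" "x = c u" "v \<in> tuples F d" "y = c v" "v 0 = \<zero>\<^bsub>F\<^esub>"
        unfolding P.simps(1) by blast
      then show "x \<otimes>\<^bsub>P.Q\<^esub> y \<in> ?p" using mem[OF P.closed(2)[OF uv(1,3)]] tuplesD(1)[OF uv(1), of 0] by (simp add: P.simps)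
    next
      fix x y assume xy: "x \<in> carrier P.Q" "y \<in> carrier P.Q" "x \<otimes>\<^bsub>P.Q\<^esub> y \<in> ?p"
      obtain u v where uv: "u \<in> tuples F d" "x = c u" "v \<in> tuples F d" "y = c v"
        using xy(1,2) unfolding P.simps(1) by blast
      have "u 0 \<otimes>\<^bsub>F\<^esub> v 0 = \<zero>\<^bsub>F\<^esub>" using xy(3) uv mem[OF P.closed(2)[OF uv(1,3)]] by (simp add: P.simps)
      then have "u 0 = \<zero>\<^bsub>F\<^esub> \<or> v 0 = \<zero>\<^bsub>F\<^esub>" using F.sfield_integral[OF field] tuplesD(1) uv by blast
      then show "x \<in> ?p \<or> y \<in> ?p" using uv mem by blast
    qed
  qed
qed

definition diag :: "('x \<Rightarrow> 'x) \<Rightarrow> ('x \<Rightarrow> 'f) \<Rightarrow> 'x \<Rightarrow> 't" where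
  "diag \<sigma> f x = c (\<lambda>k. if k < d then f ((\<sigma> ^^ k) x) else \<zero>\<^bsub>F\<^esub>)"

text \<open>The hypothesis on \<sigma>^d supplies the last coordinate, where rotation applies
  \<tau>. Injectivity is owed to the simplicity of \<open>A\<close>: the map \<open>f\<close> itself
  is a residue map in the application and may have a kernel.\<close>

lemma diag_embedding:
  fixes A :: "('x, 'm) ring_scheme"
  assumes A: "sigma_pseudo_field A \<sigma>" and f: "f \<in> ring_hom A F"
    and f\<tau>: "\<And>x. x \<in> carrier A \<Longrightarrow> f ((\<sigma> ^^ d) x) = \<tau> (f x)"
  shows "sigma_embedding A \<sigma> P.Q shift (diag \<sigma> f)"
proof -
  interpret A: sigma_pseudo_field A \<sigma> by (rule A)
  let ?t = "\<lambda>x k. if k < d then f ((\<sigma> ^^ k) x) else \<zero>\<^bsub>F\<^esub>"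
  have t: "?t x \<in> tuples F d" if "x \<in> carrier A" for x
    using that A.funpow_simps(1) ring_hom_closed[OF f] by (auto simp: tuples_def)
  have mor: "sigma_morphism A \<sigma> P.Q shift (diag \<sigma> f)"
    unfolding sigma_morphism_def
  proof (intro conjI ballI)
    show "diag \<sigma> f \<in> ring_hom A P.Q"
    proof (rule ring_hom_memI)
      fix x y assume xy: "x \<in> carrier A" "y \<in> carrier A"
      have "?t (x \<otimes>\<^bsub>A\<^esub> y) = (\<lambda>k. ?t x k \<otimes>\<^bsub>F\<^esub> ?t y k)"
        using xy A.funpow_simps ring_hom_mult[OF f] by (auto simp: fun_eq_iff)
      then show "diag \<sigma> f (x \<otimes>\<^bsub>A\<^esub> y) = diag \<sigma> f x \<otimes>\<^bsub>P.Q\<^esub> diag \<sigma> f y"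
        using xy t by (simp only: diag_def P.simps)
      have "?t (x \<oplus>\<^bsub>A\<^esub> y) = (\<lambda>k. ?t x k \<oplus>\<^bsub>F\<^esub> ?t y k)"
        using xy A.funpow_simps ring_hom_add[OF f] by (auto simp: fun_eq_iff)
      then show "diag \<sigma> f (x \<oplus>\<^bsub>A\<^esub> y) = diag \<sigma> f x \<oplus>\<^bsub>P.Q\<^esub> diag \<sigma> f y"
        using xy t by (simp only: diag_def P.simps)
    next
      show "diag \<sigma> f x \<in> carrier P.Q" if "x \<in> carrier A" for x
        using t[OF that] by (simp add: diag_def P.simps)
      have "?t \<one>\<^bsub>A\<^esub> = (\<lambda>k. if k < d then \<one>\<^bsub>F\<^esub> else \<zero>\<^bsub>F\<^esub>)"
        using A.funpow_simps(4) ring_hom_one[OF f] by (auto simp: fun_eq_iff)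
      then show "diag \<sigma> f \<one>\<^bsub>A\<^esub> = \<one>\<^bsub>P.Q\<^esub>" by (simp only: diag_def P.simps)
    qed
    fix x assume x: "x \<in> carrier A"
    have "?t (\<sigma> x) = rot (?t x)"
    proof
      fix k
      have "(\<sigma> ^^ k) (\<sigma> x) = (\<sigma> ^^ Suc k) x" by (simp add: funpow_swap1)
      then show "?t (\<sigma> x) k = rot (?t x) k"
        using f\<tau>[OF x] d by (cases "Suc k = d") (auto simp: rot_def simp del: funpow.simps)
    qed
    then show "diag \<sigma> f (\<sigma> x) = shift (diag \<sigma> f x)"
      unfolding diag_def using shift_c[OF t[OF x]] by simp
  qed
  moreover have "inj_on (diag \<sigma> f) (carrier A)"
  proof (rule A.sigma_morphism_inj[OF mor cring_P])
    interpret P: sigma_pseudo_field P.Q shift by (rule pseudo_field_P)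
    show "\<one>\<^bsub>P.Q\<^esub> \<noteq> \<zero>\<^bsub>P.Q\<^esub>" by (rule P.one_neq_zero)
    show "shift \<zero>\<^bsub>P.Q\<^esub> = \<zero>\<^bsub>P.Q\<^esub>" by (rule P.sigma_simps(5))
  qed
  ultimately show ?thesis by (simp add: sigma_embedding_def)
qed

end

section \<open>Composita of residue fields\<close>

lemma sfield_vimage:
  assumes h: "h \<in> ring_hom A B" and rings: "cring A" "cring B" and D: "sfield A D" and E: "sfield B E"
  shows "sfield A {x \<in> D. h x \<in> E}"
proof -
  interpret A: cring A by (rule rings(1))
  interpret B: cring B by (rule rings(2))
  interpret h: ring_hom_cring A B h by unfold_locales (rule h)
  note Dc = subring_closed[OF A.sfield_subring[OF D]] and Ec = subring_closed[OF B.sfield_subring[OF E]]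
  show ?thesis
    unfolding sfield_def
  proof (intro conjI ballI)
    show "subring {x \<in> D. h x \<in> E} A"
    proof (rule A.subringI)
      show "{x \<in> D. h x \<in> E} \<subseteq> carrier A" using Dc(1) by blast
      show "\<one>\<^bsub>A\<^esub> \<in> {x \<in> D. h x \<in> E}" using Dc(3) Ec(3) by simp
      show "\<ominus>\<^bsub>A\<^esub> x \<in> {x \<in> D. h x \<in> E}" if "x \<in> {x \<in> D. h x \<in> E}" for x
        using that Dc(6,7)[of x] Ec(6) by simp
      fix x y assume "x \<in> {x \<in> D. h x \<in> E}" "y \<in> {x \<in> D. h x \<in> E}"
      then show "x \<otimes>\<^bsub>A\<^esub> y \<in> {x \<in> D. h x \<in> E}" "x \<oplus>\<^bsub>A\<^esub> y \<in> {x \<in> D. h x \<in> E}"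
        using Dc(4,5)[of x y] Dc(7)[of x] Dc(7)[of y] Ec(4,5)[of "h x" "h y"] by simp_all
    qed
    show "\<one>\<^bsub>A\<^esub> \<noteq> \<zero>\<^bsub>A\<^esub>" using D by (simp add: sfield_def)
    fix x assume x: "x \<in> {x \<in> D. h x \<in> E} - {\<zero>\<^bsub>A\<^esub>}"
    have nz: "\<one>\<^bsub>B\<^esub> \<noteq> \<zero>\<^bsub>B\<^esub>" using E by (simp add: sfield_def)
    obtain y where y: "y \<in> D" "x \<otimes>\<^bsub>A\<^esub> y = \<one>\<^bsub>A\<^esub>" using x D by (auto simp: sfield_def)
    have c: "x \<in> carrier A" "y \<in> carrier A" using x y Dc(7) by auto
    have hxy: "h x \<otimes>\<^bsub>B\<^esub> h y = \<one>\<^bsub>B\<^esub>" using arg_cong[OF y(2), of h] c by simp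
    then have "h x \<noteq> \<zero>\<^bsub>B\<^esub>" using nz c by auto
    then obtain z where z: "z \<in> E" "z \<otimes>\<^bsub>B\<^esub> h x = \<one>\<^bsub>B\<^esub>"
      using B.sfield_inverse[OF E, of "h x"] x by auto
    have "z = z \<otimes>\<^bsub>B\<^esub> (h x \<otimes>\<^bsub>B\<^esub> h y)" using hxy Ec(7)[OF z(1)] by simp
    also have "\<dots> = h y" using z c Ec(7)[OF z(1)] by (simp add: B.m_assoc[symmetric])
    finally show "\<exists>y\<in>{x \<in> D. h x \<in> E}. x \<otimes>\<^bsub>A\<^esub> y = \<one>\<^bsub>A\<^esub>" using y z(1) by auto
  qed
qed

lemma (in cring) sfield_fraction_unique:
  assumes E: "sfield R E" and c: "x \<in> E" "y \<in> E" "w \<in> E" "w \<noteq> \<zero>" and eq: "x \<otimes> w = y \<otimes> w"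
  shows "x = y"
proof -
  obtain v where v: "v \<in> E" "w \<otimes> v = \<one>" using sfield_inverse[OF E c(3,4)] by blast
  have cc: "x \<in> carrier R" "y \<in> carrier R" "w \<in> carrier R" "v \<in> carrier R"
    using subring_closed(7)[OF sfield_subring[OF E]] c v by auto
  have "(x \<otimes> w) \<otimes> v = (y \<otimes> w) \<otimes> v" using eq by simp
  then show ?thesis using cc v by (simp add: m_assoc)
qed

text \<open>\<open>F\<close> is the fraction field of the union of all levels modulo a periodic
  prime. Only the field generated by the orbit of \<open>S\<close> is mapped to it, as
  \<open>L\<close> may be larger. The map \<open>r\<close> records that numerators and denominators
  given as lists exhaust \<open>F\<close>.\<close>

theorem (in field_pair) field_compositum:
  assumes S: "finite S" "S \<subseteq> carrier L"
  shows "\<exists>(F :: ((('b \<Rightarrow> 'k) \<Rightarrow> 'a) \<times> (('b \<Rightarrow> 'k) \<Rightarrow> 'a)) set ring) \<tau> e \<phi> \<psi> r. 0 < e \<and> cring F \<and> sfield F (carrier F) \<and>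
     \<tau> \<in> ring_hom F F \<and>
     \<phi> \<in> ring_hom (L\<lparr>carrier := fgen L (i ` carrier K \<union> (\<Union>n. (sL ^^ n) ` S))\<rparr>) F \<and> \<psi> \<in> ring_hom M F \<and>
     (\<forall>x\<in>carrier K. \<phi> (i x) = \<psi> (j x)) \<and>
     (\<forall>x\<in>fgen L (i ` carrier K \<union> (\<Union>n. (sL ^^ n) ` S)). \<phi> ((sL ^^ e) x) = \<tau> (\<phi> x)) \<and>
     (\<forall>x\<in>carrier M. \<psi> ((sM ^^ e) x) = \<tau> (\<psi> x)) \<and>
     carrier F \<subseteq> r ` (lists (carrier L \<times> carrier M) \<times> lists (carrier L \<times> carrier M))"
proof -
  interpret D: difference_tensor T.Q "emb_L ` carrier L" "emb_L ` i ` carrier K" "emb_M ` carrier M" \<Lambda> sT "emb_L ` S"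
    by (rule tensor_difference_tensor[OF S])
  obtain e Q where e: "e > 0" and Q: "prime_in T.Q D.total Q"
    and fixed: "\<And>z. z \<in> D.total \<Longrightarrow> (sT ^^ e) z \<in> Q \<longleftrightarrow> z \<in> Q"
    using D.periodic_prime by blast
  let ?R = "T.Q\<lparr>carrier := D.total\<rparr>" and ?Z = "fgen L (i ` carrier K \<union> (\<Union>n. (sL ^^ n) ` S))"
  note tc = subring_closed[OF D.total_subring]
  have cR: "cring ?R"
    using D.subcring_iff[OF tc(1)] D.subcringI'[OF D.total_subring] by simp
  have tot: "(sT ^^ n) z \<in> D.total" if "z \<in> D.total" for n z
    using that by (induction n) (simp_all add: D.\<sigma>_total)
  have sTe: "sT ^^ e \<in> ring_hom T.Q T.Q" by (rule ring_hom_funpow[OF sT_hom])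
  have sTR: "sT ^^ e \<in> ring_hom ?R ?R"
    by (rule ring_hom_memI)
      (use tot ring_hom_add[OF sTe] ring_hom_mult[OF sTe] ring_hom_one[OF sTe] tc(7) in simp_all)
  interpret sR: sigma_ring ?R "sT ^^ e" by (intro sigma_ring.intro cR sigma_ring_axioms.intro sTR)
  have "prime_in ?R (carrier ?R) Q" using Q by (simp add: prime_in_def)
  from sR.residue_fraction_field[OF this] fixed
  obtain F :: "((('b \<Rightarrow> 'k) \<Rightarrow> 'a) \<times> (('b \<Rightarrow> 'k) \<Rightarrow> 'a)) set ring" and \<tau> g where F: "cring F" "sfield F (carrier F)"
    and \<tau>: "\<tau> \<in> ring_hom F F" and g: "g \<in> ring_hom ?R F"
    and \<tau>g: "\<And>x. x \<in> D.total \<Longrightarrow> \<tau> (g x) = g ((sT ^^ e) x)"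
    and frac: "\<And>\<xi>. \<xi> \<in> carrier F \<Longrightarrow> \<exists>x\<in>D.total. \<exists>w\<in>D.total. g w \<noteq> \<zero>\<^bsub>F\<^esub> \<and> \<xi> \<otimes>\<^bsub>F\<^esub> g w = g x"
    by auto
  interpret F: cring F by (rule F(1))
  have gc: "g x \<in> carrier F" if "x \<in> D.total" for x using ring_hom_closed[OF g, of x] that by simp
  have ga: "g (x \<oplus>\<^bsub>T.Q\<^esub> y) = g x \<oplus>\<^bsub>F\<^esub> g y" "g (x \<otimes>\<^bsub>T.Q\<^esub> y) = g x \<otimes>\<^bsub>F\<^esub> g y"
    if "x \<in> D.total" "y \<in> D.total" for x y
    using ring_hom_add[OF g, of x y] ring_hom_mult[OF g, of x y] that by simp_all
  have g1: "g \<one>\<^bsub>T.Q\<^esub> = \<one>\<^bsub>F\<^esub>" using ring_hom_one[OF g] by simp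
  have powL: "(sT ^^ n) (emb_L x) = emb_L ((sL ^^ n) x) \<and> (sL ^^ n) x \<in> carrier L" if "x \<in> carrier L" for n x
    using that by (induction n) (simp_all add: sT_emb ring_hom_closed[OF sL(1)])
  have powM: "(sT ^^ n) (emb_M x) = emb_M ((sM ^^ n) x) \<and> (sM ^^ n) x \<in> carrier M" if "x \<in> carrier M" for n x
    using that by (induction n) (simp_all add: sT_emb ring_hom_closed[OF sM(1)])
  have iK: "i ` carrier K \<subseteq> carrier L" using ring_hom_closed[OF i] by blast
  have gensub: "i ` carrier K \<union> (\<Union>n. (sL ^^ n) ` S) \<subseteq> carrier L" using iK powL S(2) by blast
  have ZL: "?Z \<subseteq> carrier L" by (rule L.fgen_least[OF fL gensub])
  have Zt: "emb_L x \<in> D.total" if "x \<in> ?Z" for x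
  proof -
    let ?T = "emb_L ` i ` carrier K \<union> (\<Union>n. (sT ^^ n) ` (emb_L ` S))"
    \<comment> \<open>The elements of \<open>L\<close> whose image is generated in the tensor ring
      form a field that contains the generators, hence all of \<open>?Z\<close>.\<close>
    let ?V = "{x \<in> carrier L. emb_L x \<in> fgen T.Q ?T}"
    have TL: "?T \<subseteq> emb_L ` carrier L" using powL S(2) iK by auto
    have "sfield T.Q (fgen T.Q ?T)" by (rule D.fgen_sfield[OF D.L TL])
    then have V: "sfield L ?V" by (rule sfield_vimage[OF emb_L_hom L.is_cring T.cring_Q fL])
    have incl: "?T \<subseteq> fgen T.Q ?T" by (rule D.fgen_incl)
    have "i ` carrier K \<union> (\<Union>n. (sL ^^ n) ` S) \<subseteq> ?V"
    proof
      fix x assume x: "x \<in> i ` carrier K \<union> (\<Union>n. (sL ^^ n) ` S)"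
      then have "emb_L x \<in> ?T"
      proof
        assume "x \<in> (\<Union>n. (sL ^^ n) ` S)"
        then obtain n a where a: "a \<in> S" "x = (sL ^^ n) a" by blast
        then have "emb_L x = (sT ^^ n) (emb_L a)" using powL[of a n] S(2) by auto
        then show ?thesis using a(1) by blast
      qed blast
      then have "emb_L x \<in> fgen T.Q ?T" by (rule subsetD[OF incl])
      then show "x \<in> ?V" by (intro CollectI conjI subsetD[OF gensub x])
    qed
    then have "?Z \<subseteq> ?V" by (rule L.fgen_least[OF V])
    from subsetD[OF this that] have "emb_L x \<in> fgen T.Q ?T" by (simp only: mem_Collect_eq)
    then show ?thesis by (rule subsetD[OF D.fgen_total])
  qed
  have Mt: "emb_M x \<in> D.total" if "x \<in> carrier M" for x by (rule subsetD[OF D.M_total imageI[OF that]])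
  define \<phi> where "\<phi> x = g (emb_L x)" for x
  define \<psi> where "\<psi> x = g (emb_M x)" for x
  have \<phi>: "\<phi> \<in> ring_hom (L\<lparr>carrier := ?Z\<rparr>) F"
  proof (rule ring_hom_memI)
    show "\<phi> x \<in> carrier F" if "x \<in> carrier (L\<lparr>carrier := ?Z\<rparr>)" for x using that gc[OF Zt] by (simp add: \<phi>_def)
    show "\<phi> \<one>\<^bsub>L\<lparr>carrier := ?Z\<rparr>\<^esub> = \<one>\<^bsub>F\<^esub>" using ring_hom_one[OF emb_L_hom] g1 by (simp add: \<phi>_def)
    fix x y assume "x \<in> carrier (L\<lparr>carrier := ?Z\<rparr>)" "y \<in> carrier (L\<lparr>carrier := ?Z\<rparr>)"
    then have xy: "x \<in> ?Z" "y \<in> ?Z" by simp_all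
    then have c: "x \<in> carrier L" "y \<in> carrier L" using ZL by auto
    show "\<phi> (x \<otimes>\<^bsub>L\<lparr>carrier := ?Z\<rparr>\<^esub> y) = \<phi> x \<otimes>\<^bsub>F\<^esub> \<phi> y"
      using ring_hom_mult[OF emb_L_hom c] ga(2)[OF Zt[OF xy(1)] Zt[OF xy(2)]] by (simp add: \<phi>_def)
    show "\<phi> (x \<oplus>\<^bsub>L\<lparr>carrier := ?Z\<rparr>\<^esub> y) = \<phi> x \<oplus>\<^bsub>F\<^esub> \<phi> y"
      using ring_hom_add[OF emb_L_hom c] ga(1)[OF Zt[OF xy(1)] Zt[OF xy(2)]] by (simp add: \<phi>_def)
  qed
  have \<psi>: "\<psi> \<in> ring_hom M F"
  proof (rule ring_hom_memI)
    show "\<psi> x \<in> carrier F" if "x \<in> carrier M" for x using that gc[OF Mt] by (simp add: \<psi>_def)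
    show "\<psi> \<one>\<^bsub>M\<^esub> = \<one>\<^bsub>F\<^esub>" using ring_hom_one[OF emb_M_hom] g1 by (simp add: \<psi>_def)
    fix x y assume c: "x \<in> carrier M" "y \<in> carrier M"
    show "\<psi> (x \<otimes>\<^bsub>M\<^esub> y) = \<psi> x \<otimes>\<^bsub>F\<^esub> \<psi> y"
      using ring_hom_mult[OF emb_M_hom c] ga(2)[OF Mt[OF c(1)] Mt[OF c(2)]] by (simp add: \<psi>_def)
    show "\<psi> (x \<oplus>\<^bsub>M\<^esub> y) = \<psi> x \<oplus>\<^bsub>F\<^esub> \<psi> y"
      using ring_hom_add[OF emb_M_hom c] ga(1)[OF Mt[OF c(1)] Mt[OF c(2)]] by (simp add: \<psi>_def)
  qed
  define r where "r uv = (THE \<xi>. \<xi> \<in> carrier F \<and> \<xi> \<otimes>\<^bsub>F\<^esub> g (value_of (snd uv)) = g (value_of (fst uv)))" for uv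
  have "\<xi> \<in> r ` (lists (carrier L \<times> carrier M) \<times> lists (carrier L \<times> carrier M))" if \<xi>: "\<xi> \<in> carrier F" for \<xi>
  proof -
    obtain x w where xw: "x \<in> D.total" "w \<in> D.total" "g w \<noteq> \<zero>\<^bsub>F\<^esub>" "\<xi> \<otimes>\<^bsub>F\<^esub> g w = g x" using frac[OF \<xi>] by blast
    obtain u where u: "u \<in> tensors" "x = value_of u" using tc(7)[OF xw(1)] unfolding T.simps(1) by blast
    obtain v where v: "v \<in> tensors" "w = value_of v" using tc(7)[OF xw(2)] unfolding T.simps(1) by blast
    have "r (u, v) = \<xi>"
      unfolding r_def fst_conv snd_conv u(2)[symmetric] v(2)[symmetric]
    proof (rule the_equality)
      show "\<xi> \<in> carrier F \<and> \<xi> \<otimes>\<^bsub>F\<^esub> g w = g x" using \<xi> xw(4) by simp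
      show "\<eta> = \<xi>" if "\<eta> \<in> carrier F \<and> \<eta> \<otimes>\<^bsub>F\<^esub> g w = g x" for \<eta>
        using F.sfield_fraction_unique[OF F(2) _ \<xi> gc[OF xw(2)] xw(3), of \<eta>] that xw(4) by simp
    qed
    then show ?thesis using u(1) v(1) unfolding tensors_def by (intro image_eqI[of _ _ "(u, v)"]) simp_all
  qed
  then have r: "carrier F \<subseteq> r ` (lists (carrier L \<times> carrier M) \<times> lists (carrier L \<times> carrier M))" by (rule subsetI)
  have \<phi>\<psi>: "\<phi> (i x) = \<psi> (j x)" if "x \<in> carrier K" for x using emb_compat[OF that] by (simp add: \<phi>_def \<psi>_def)
  have \<phi>\<tau>: "\<phi> ((sL ^^ e) x) = \<tau> (\<phi> x)" if x: "x \<in> ?Z" for x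
  proof -
    have "x \<in> carrier L" by (rule subsetD[OF ZL x])
    then show ?thesis using powL[of x e] \<tau>g[OF Zt[OF x]] by (simp add: \<phi>_def)
  qed
  have \<psi>\<tau>: "\<psi> ((sM ^^ e) x) = \<tau> (\<psi> x)" if "x \<in> carrier M" for x
    using powM[OF that, of e] \<tau>g[OF Mt[OF that]] by (simp add: \<psi>_def)
  have "0 < e \<and> cring F \<and> sfield F (carrier F) \<and> \<tau> \<in> ring_hom F F \<and>
     \<phi> \<in> ring_hom (L\<lparr>carrier := ?Z\<rparr>) F \<and> \<psi> \<in> ring_hom M F \<and>
     (\<forall>x\<in>carrier K. \<phi> (i x) = \<psi> (j x)) \<and> (\<forall>x\<in>?Z. \<phi> ((sL ^^ e) x) = \<tau> (\<phi> x)) \<and>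
     (\<forall>x\<in>carrier M. \<psi> ((sM ^^ e) x) = \<tau> (\<psi> x)) \<and>
     carrier F \<subseteq> r ` (lists (carrier L \<times> carrier M) \<times> lists (carrier L \<times> carrier M))"
    by (intro conjI ballI e F \<tau> \<phi> \<psi> \<phi>\<psi> \<phi>\<tau> \<psi>\<tau> r)
  then show ?thesis by (intro exI)
qed

section \<open>From pseudo fields to residue fields\<close>

lemma prime_hom_vimage:
  assumes f: "f \<in> ring_hom A B" and rings: "cring A" "cring B" and q: "prime_in B (carrier B) q"
  shows "prime_in A (carrier A) {x \<in> carrier A. f x \<in> q}"
proof -
  interpret A: cring A by (rule rings(1))
  interpret B: cring B by (rule rings(2))
  interpret f: ring_hom_cring A B f by unfold_locales (rule f)
  note qd = prime_inD[OF q]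
  show ?thesis
    unfolding prime_in_def
  proof (intro conjI ballI impI)
    fix x y assume "x \<in> carrier A" "y \<in> carrier A" "x \<otimes>\<^bsub>A\<^esub> y \<in> {x \<in> carrier A. f x \<in> q}"
    then show "x \<in> {x \<in> carrier A. f x \<in> q} \<or> y \<in> {x \<in> carrier A. f x \<in> q}"
      using qd(6)[of "f x" "f y"] by simp
  qed (use qd(2-5) in simp_all)
qed

context sigma_pseudo_field
begin

lemma fixed_prime_power:
  assumes p: "prime_in R (carrier R) p" and per: "\<And>x. x \<in> carrier R \<Longrightarrow> (\<sigma> ^^ d) x \<in> p \<longleftrightarrow> x \<in> p"
  shows "fixed_prime R (\<sigma> ^^ d) p"
proof (intro fixed_prime.intro sigma_ring.intro is_cring sigma_ring_axioms.intro funpow_hom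
    fixed_prime_axioms.intro p)
  show "\<exists>y\<in>carrier R. x \<otimes> y \<ominus> \<one> \<in> p" if x: "x \<in> carrier R" "x \<notin> p" for x
  proof -
    obtain y where y: "y \<in> carrier R" "x \<otimes> x \<otimes> y = x" using von_neumann_regular[OF x(1)] by blast
    have "x \<otimes> (x \<otimes> y \<ominus> \<one>) = x \<otimes> x \<otimes> y \<ominus> x" using x y(1) by (simp add: a_minus_def r_distr r_minus m_assoc)
    also have "\<dots> = \<zero>" using y(2) x(1) by (simp add: a_minus_def r_neg)
    finally have "x \<otimes> (x \<otimes> y \<ominus> \<one>) \<in> p" using prime_inD(2)[OF p] by simp
    then show ?thesis using prime_inD(6)[OF p, of x "x \<otimes> y \<ominus> \<one>"] x y(1) by auto
  qed
qed (rule per)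

text \<open>This converts generation as a pseudo field into generation of residue fields: a pseudo
  subfield that contains \<open>K\<close> and the generators is all of \<open>L\<close>, so all
  residues of \<open>L\<close> lie in \<open>Z\<close>.\<close>

lemma sigma_pseudo_subfield_of_values:
  assumes p: "prime_in R (carrier R) p" and d: "d > 0"
    and per: "\<And>x. x \<in> carrier R \<Longrightarrow> (\<sigma> ^^ d) x \<in> p \<longleftrightarrow> x \<in> p"
    and F: "cring F" and h: "h \<in> ring_hom R F" and Z: "sfield F Z"
  shows "sigma_pseudo_subfield R \<sigma> {x \<in> carrier R. \<forall>j. h ((\<sigma> ^^ j) x) \<in> Z}"
proof -
  interpret F: cring F by (rule F)
  interpret h: ring_hom_cring R F h by unfold_locales (rule h)
  let ?G = "{x \<in> carrier R. \<forall>j. h ((\<sigma> ^^ j) x) \<in> Z}"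
  note Zc = subring_closed[OF F.sfield_subring[OF Z]]
  have fm: "(\<sigma> ^^ j) (\<ominus> x) = \<ominus> (\<sigma> ^^ j) x" if x: "x \<in> carrier R" for j x
  proof -
    have "(\<sigma> ^^ j) (\<ominus> x) \<oplus> (\<sigma> ^^ j) x = \<zero>"
      using funpow_simps(2)[of "\<ominus> x" x j] x by (simp add: l_neg funpow_simps(5))
    then show ?thesis using x by (intro minus_equality[symmetric]) (simp_all add: funpow_simps(1))
  qed
  have sub: "subring ?G R"
  proof (rule subringI)
    show "\<one> \<in> ?G" using Zc(3) by (simp add: funpow_simps)
    show "\<ominus> x \<in> ?G" if "x \<in> ?G" for x using that fm Zc(6) by (simp add: funpow_simps)
    fix x y assume "x \<in> ?G" "y \<in> ?G"
    then show "x \<otimes> y \<in> ?G" "x \<oplus> y \<in> ?G" using Zc(4,5) by (simp_all add: funpow_simps)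
  qed simp
  have step: "(\<sigma> ^^ j) ((\<sigma> ^^ k) x) = (\<sigma> ^^ (j + k)) x" for j k x by (simp add: funpow_add)
  have Gk: "(\<sigma> ^^ k) x \<in> ?G" if "x \<in> ?G" for x k using that by (simp add: step funpow_simps)
  have G\<sigma>: "\<sigma> ` ?G \<subseteq> ?G" using Gk[of _ 1] by auto
  let ?R = "R\<lparr>carrier := ?G\<rparr>"
  have cR: "cring ?R" using subcring_iff[of ?G] subcringI'[OF sub] by simp
  have "\<sigma> \<in> ring_hom ?R ?R"
    by (rule ring_hom_memI) (use G\<sigma> sigma_simps in auto)
  then interpret G: sigma_ring ?R \<sigma> by (intro sigma_ring.intro cR sigma_ring_axioms.intro)
  note pd = prime_inD[OF p]
  have "sigma_pseudo_field ?R \<sigma>"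
  proof (rule G.pseudo_fieldI)
    show "\<one>\<^bsub>?R\<^esub> \<noteq> \<zero>\<^bsub>?R\<^esub>" using one_neq_zero by simp
    show "d > 0" by (rule d)
    show "(\<sigma> ^^ d) x \<in> p \<inter> ?G \<longleftrightarrow> x \<in> p \<inter> ?G" if "x \<in> carrier ?R" for x
      using that per[of x] Gk[of x d] by auto
    show "x = \<zero>\<^bsub>?R\<^esub>" if "x \<in> carrier ?R" "\<And>j. (\<sigma> ^^ j) x \<in> p \<inter> ?G" for x
      using prime_inter_zero[OF p, of x] that by auto
    show "prime_in ?R (carrier ?R) (p \<inter> ?G)" unfolding prime_in_def
    proof (intro conjI ballI impI)
      show "\<zero>\<^bsub>?R\<^esub> \<in> p \<inter> ?G" using pd(2) subring_closed(2)[OF sub] by simp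
      show "\<one>\<^bsub>?R\<^esub> \<notin> p \<inter> ?G" using pd(3) by simp
      show "x \<oplus>\<^bsub>?R\<^esub> y \<in> p \<inter> ?G" if "x \<in> p \<inter> ?G" "y \<in> p \<inter> ?G" for x y
        using that pd(4)[of x y] subring_closed(4)[OF sub, of x y] by simp
      show "a \<otimes>\<^bsub>?R\<^esub> x \<in> p \<inter> ?G" if "a \<in> carrier ?R" "x \<in> p \<inter> ?G" for a x
        using that pd(5)[of a x] subring_closed(5)[OF sub, of a x] by simp
      show "x \<in> p \<inter> ?G \<or> y \<in> p \<inter> ?G" if "x \<in> carrier ?R" "y \<in> carrier ?R" "x \<otimes>\<^bsub>?R\<^esub> y \<in> p \<inter> ?G" for x y
        using that pd(6)[of x y] by simp
    qed simp
    show "\<exists>y\<in>carrier ?R. x \<otimes>\<^bsub>?R\<^esub> x \<otimes>\<^bsub>?R\<^esub> y = x" if "x \<in> carrier ?R" for x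
    proof -
      have x: "x \<in> carrier R" "\<And>j. h ((\<sigma> ^^ j) x) \<in> Z" using that by simp_all
      obtain y where y: "y \<in> carrier R" "x \<otimes> x \<otimes> y = x" using von_neumann_regular[OF x(1)] by blast
      \<comment> \<open>The first quasi-inverse may have arbitrary values where \<open>x\<close>
        vanishes. Replacing it by y x y makes every value either zero or the inverse of the value of
        \<open>x\<close>, hence an element of \<open>Z\<close>.\<close>
      let ?y = "y \<otimes> x \<otimes> y"
      have "h ((\<sigma> ^^ j) ?y) \<in> Z" for j
      proof -
        let ?a = "h ((\<sigma> ^^ j) x)" and ?b = "h ((\<sigma> ^^ j) y)"
        have c: "?a \<in> carrier F" "?b \<in> carrier F" using x(1) y(1) by (simp_all add: funpow_simps)
        have hy: "h ((\<sigma> ^^ j) ?y) = ?b \<otimes>\<^bsub>F\<^esub> ?a \<otimes>\<^bsub>F\<^esub> ?b" using x(1) y(1) by (simp add: funpow_simps)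
        have aab: "?a \<otimes>\<^bsub>F\<^esub> ?a \<otimes>\<^bsub>F\<^esub> ?b = ?a"
          using arg_cong[OF y(2), of "\<lambda>z. h ((\<sigma> ^^ j) z)"] x(1) y(1) by (simp add: funpow_simps)
        show ?thesis
        proof (cases "?a = \<zero>\<^bsub>F\<^esub>")
          case True
          then show ?thesis unfolding hy using c Zc(2) by simp
        next
          case False
          then obtain z where z: "z \<in> Z" "z \<otimes>\<^bsub>F\<^esub> ?a = \<one>\<^bsub>F\<^esub>" using F.sfield_inverse[OF Z x(2)] by blast
          have zc: "z \<in> carrier F" by (rule Zc(7)[OF z(1)])
          have "z \<otimes>\<^bsub>F\<^esub> (?a \<otimes>\<^bsub>F\<^esub> ?a \<otimes>\<^bsub>F\<^esub> ?b) = \<one>\<^bsub>F\<^esub>" using aab z(2) by simp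
          then have ab: "?a \<otimes>\<^bsub>F\<^esub> ?b = \<one>\<^bsub>F\<^esub>" using z(2) zc c by (simp add: F.m_assoc[symmetric])
          then have "z \<otimes>\<^bsub>F\<^esub> (?a \<otimes>\<^bsub>F\<^esub> ?b) = z" using zc by simp
          then have "?b = z" using z(2) zc c by (simp add: F.m_assoc[symmetric])
          moreover have "?b \<otimes>\<^bsub>F\<^esub> ?a \<otimes>\<^bsub>F\<^esub> ?b = ?b" using ab c by (simp add: F.m_assoc)
          ultimately show ?thesis unfolding hy using z(1) by simp
        qed
      qed
      then have "?y \<in> ?G" using x(1) y(1) by simp
      moreover have "x \<otimes> x \<otimes> ?y = x"
      proof -
        have "x \<otimes> x \<otimes> ?y = (x \<otimes> x \<otimes> y) \<otimes> x \<otimes> y" using x(1) y(1) by (simp add: m_assoc)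
        then show ?thesis using y(2) by simp
      qed
      ultimately show ?thesis by (intro bexI[of _ ?y]) simp_all
    qed
  qed
  then show ?thesis using sub G\<sigma> by (simp add: sigma_pseudo_subfield_def)
qed

end

type_synonym ('k, 'a, 'b) residue =
  "((((nat \<Rightarrow> 'b) set \<Rightarrow> (nat \<Rightarrow> 'k) set) \<Rightarrow> (nat \<Rightarrow> 'a) set) \<times>
    (((nat \<Rightarrow> 'b) set \<Rightarrow> (nat \<Rightarrow> 'k) set) \<Rightarrow> (nat \<Rightarrow> 'a) set)) set"

text \<open>Numerator and denominator as formal sums of tensors; an entry (n, x) stands for s^(-n)
  applied to the residue of \<open>x\<close>.\<close>

type_synonym ('a, 'b) code =
  "((nat \<times> 'a) \<times> (nat \<times> 'b)) list \<times> ((nat \<times> 'a) \<times> (nat \<times> 'b)) list"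

lemma range_map_prod: "range (map_prod f g) = range f \<times> range g"
  using map_prod_surj_on[of f UNIV "range f" g UNIV "range g"] by simp

text \<open>Only a bound on the size is wanted: each element is recovered from \<open>n\<close> and
  \<open>x\<close> because the iterates of \<open>s\<close> are injective.\<close>

lemma inversive_hull_covered:
  fixes R :: "'c ring" and F :: "'f ring"
  assumes F: "cring F" "sfield F (carrier F)" and s: "s \<in> ring_hom F F"
    and cov: "\<And>\<xi>. \<xi> \<in> carrier F \<Longrightarrow> \<exists>n. \<exists>x\<in>carrier R. (s ^^ n) \<xi> = h x"
  shows "\<exists>q :: nat \<Rightarrow> 'c \<Rightarrow> 'f. carrier F \<subseteq> range (\<lambda>(n, x). q n x)"
proof -
  have "\<xi> \<in> range (\<lambda>(n, x). inv_into (carrier F) (s ^^ n) (h x))" if \<xi>: "\<xi> \<in> carrier F" for \<xi>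
  proof -
    obtain n x where nx: "(s ^^ n) \<xi> = h x" using cov[OF \<xi>] by blast
    have nz: "\<one>\<^bsub>F\<^esub> \<noteq> \<zero>\<^bsub>F\<^esub>" using F(2) by (simp add: sfield_def)
    have "inj_on (s ^^ n) (carrier F)"
      by (rule sfield_hom_image(2)[OF ring_hom_funpow[OF s] F(1) F(1) F(2) nz])
    then have "inv_into (carrier F) (s ^^ n) (h x) = \<xi>" using \<xi> nx by (metis inv_into_f_f)
    then show ?thesis by (intro image_eqI[of _ _ "(n, x)"]) simp_all
  qed
  then have "carrier F \<subseteq> range (\<lambda>(n, x). inv_into (carrier F) (s ^^ n) (h x))" by (rule subsetI)
  then show ?thesis by (intro exI[of _ "\<lambda>n x. inv_into (carrier F) (s ^^ n) (h x)"])
qed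

theorem residue_compositum:
  fixes K :: "'k ring" and L :: "'a ring" and L' :: "'b ring"
  assumes L: "sigma_pseudo_field_extension K \<sigma>K L \<sigma>L i"
    and L': "sigma_pseudo_field_extension K \<sigma>K L' \<sigma>L' i'"
    and fg: "finitely_sigma_generated K L \<sigma>L i"
  shows "\<exists>(F :: ('k, 'a, 'b) residue ring) \<tau> d \<phi> \<psi> (r :: ('a, 'b) code \<Rightarrow> ('k, 'a, 'b) residue).
    0 < d \<and> cring F \<and> sfield F (carrier F) \<and> \<tau> \<in> ring_hom F F \<and> \<phi> \<in> ring_hom L F \<and> \<psi> \<in> ring_hom L' F \<and>
    (\<forall>x\<in>carrier K. \<phi> (i x) = \<psi> (i' x)) \<and> (\<forall>x\<in>carrier L. \<phi> ((\<sigma>L ^^ d) x) = \<tau> (\<phi> x)) \<and>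
    (\<forall>x\<in>carrier L'. \<psi> ((\<sigma>L' ^^ d) x) = \<tau> (\<psi> x)) \<and> carrier F \<subseteq> range r"
proof -
  interpret K: sigma_pseudo_field K \<sigma>K using L by (simp add: sigma_pseudo_field_extension_def)
  interpret L: sigma_pseudo_field L \<sigma>L using L by (simp add: sigma_pseudo_field_extension_def)
  interpret L': sigma_pseudo_field L' \<sigma>L' using L' by (simp add: sigma_pseudo_field_extension_def)
  have i: "i \<in> ring_hom K L" and i\<sigma>: "\<And>x. x \<in> carrier K \<Longrightarrow> i (\<sigma>K x) = \<sigma>L (i x)"
    and i': "i' \<in> ring_hom K L'" and i'\<sigma>: "\<And>x. x \<in> carrier K \<Longrightarrow> i' (\<sigma>K x) = \<sigma>L' (i' x)"
    using L L' by (simp_all add: sigma_pseudo_field_extension_def sigma_embedding_def sigma_morphism_def)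
  note ic = ring_hom_closed[OF i] and i'c = ring_hom_closed[OF i']
  have ip: "i ((\<sigma>K ^^ n) x) = (\<sigma>L ^^ n) (i x)" if x: "x \<in> carrier K" for n x
    by (induction n) (simp_all add: i\<sigma> x K.funpow_simps)
  have i'p: "i' ((\<sigma>K ^^ n) x) = (\<sigma>L' ^^ n) (i' x)" if x: "x \<in> carrier K" for n x
    by (induction n) (simp_all add: i'\<sigma> x K.funpow_simps)
  obtain p r where p: "prime_in L (carrier L) p" and r: "r > 0"
    and per0: "\<And>x. x \<in> carrier L \<Longrightarrow> (\<sigma>L ^^ r) x \<in> p \<longleftrightarrow> x \<in> p" using L.periodic_prime_exists by blast
  obtain p1 r1 where p1: "prime_in L' (carrier L') p1" and r1: "r1 > 0"
    and per1: "\<And>x. x \<in> carrier L' \<Longrightarrow> (\<sigma>L' ^^ r1) x \<in> p1 \<longleftrightarrow> x \<in> p1" using L'.periodic_prime_exists by blast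
  define k where "k = {x \<in> carrier K. i x \<in> p}"
  have k: "prime_in K (carrier K) k"
    unfolding k_def by (rule prime_hom_vimage[OF i K.is_cring L.is_cring p])
  have "prime_in K (carrier K) {x \<in> carrier K. i' x \<in> p1}"
    by (rule prime_hom_vimage[OF i' K.is_cring L'.is_cring p1])
  \<comment> \<open>The traces of the two primes on \<open>K\<close> may differ, but \<sigma>^m
    joins them. Pulling \<open>p1\<close> back along \<sigma>^m gives a prime \<open>p'\<close> with
    the same trace as \<open>p\<close>.\<close>
  from K.prime_orbit_transitive[OF this k] obtain m where
    m: "k = {x \<in> carrier K. (\<sigma>K ^^ m) x \<in> {x \<in> carrier K. i' x \<in> p1}}" by blast
  define p' where "p' = {x \<in> carrier L'. (\<sigma>L' ^^ m) x \<in> p1}"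
  have p': "prime_in L' (carrier L') p'" unfolding p'_def by (rule L'.prime_vimage[OF p1])
  have kp: "x \<in> k \<longleftrightarrow> i x \<in> p" if "x \<in> carrier K" for x using that by (simp add: k_def)
  have kp': "x \<in> k \<longleftrightarrow> i' x \<in> p'" if "x \<in> carrier K" for x
    using that i'c[OF that] by (simp add: m p'_def i'p K.funpow_simps)
  \<comment> \<open>A common multiple of both periods, so that \<sigma>^d fixes \<open>p\<close> and
    \<open>p'\<close>, and with them \<open>k\<close>.\<close>
  define d where "d = r * r1"
  have d0: "d > 0" using r r1 by (simp add: d_def)
  have per: "(\<sigma>L ^^ d) x \<in> p \<longleftrightarrow> x \<in> p" if "x \<in> carrier L" for x
    unfolding d_def using per0 that by (rule L.period_mult)
  have per': "(\<sigma>L' ^^ d) x \<in> p' \<longleftrightarrow> x \<in> p'" if x: "x \<in> carrier L'" for x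
  proof -
    have "(\<sigma>L' ^^ m) ((\<sigma>L' ^^ d) x) = (\<sigma>L' ^^ (r1 * r)) ((\<sigma>L' ^^ m) x)"
      by (metis add.commute comp_apply d_def funpow_add mult.commute)
    moreover have "(\<sigma>L' ^^ (r1 * r)) ((\<sigma>L' ^^ m) x) \<in> p1 \<longleftrightarrow> (\<sigma>L' ^^ m) x \<in> p1"
      using per1 L'.funpow_simps(1)[OF x] by (rule L'.period_mult)
    ultimately show ?thesis using x L'.funpow_simps(1)[OF x] by (simp add: p'_def)
  qed
  have perK: "(\<sigma>K ^^ d) x \<in> k \<longleftrightarrow> x \<in> k" if x: "x \<in> carrier K" for x
    using kp[OF x] kp[OF K.funpow_simps(1)[OF x]] ip[OF x] per[OF ic[OF x]] by simp
  from fixed_prime.inversive_residue_field[OF L.fixed_prime_power[OF p per]]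
  obtain Ls :: "(nat \<Rightarrow> 'a) set ring" and s h where Ls: "cring Ls" "sfield Ls (carrier Ls)"
    and s: "s \<in> ring_hom Ls Ls" "bij_betw s (carrier Ls) (carrier Ls)" and h: "h \<in> ring_hom L Ls"
    and h0: "\<And>x. x \<in> carrier L \<Longrightarrow> h x = \<zero>\<^bsub>Ls\<^esub> \<longleftrightarrow> x \<in> p"
    and hs: "\<And>x. x \<in> carrier L \<Longrightarrow> h ((\<sigma>L ^^ d) x) = s (h x)"
    and hc: "\<And>\<xi>. \<xi> \<in> carrier Ls \<Longrightarrow> \<exists>n. \<exists>x\<in>carrier L. (s ^^ n) \<xi> = h x"
    by blast
  from fixed_prime.inversive_residue_field[OF L'.fixed_prime_power[OF p' per']]
  obtain Ms :: "(nat \<Rightarrow> 'b) set ring" and s' h' where Ms: "cring Ms" "sfield Ms (carrier Ms)"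
    and s': "s' \<in> ring_hom Ms Ms" "bij_betw s' (carrier Ms) (carrier Ms)" and h': "h' \<in> ring_hom L' Ms"
    and h'0: "\<And>x. x \<in> carrier L' \<Longrightarrow> h' x = \<zero>\<^bsub>Ms\<^esub> \<longleftrightarrow> x \<in> p'"
    and h's: "\<And>x. x \<in> carrier L' \<Longrightarrow> h' ((\<sigma>L' ^^ d) x) = s' (h' x)"
    and h'c: "\<And>\<xi>. \<xi> \<in> carrier Ms \<Longrightarrow> \<exists>n. \<exists>x\<in>carrier L'. (s' ^^ n) \<xi> = h' x"
    by blast
  from fixed_prime.inversive_residue_field[OF K.fixed_prime_power[OF k perK]]
  obtain Ks :: "(nat \<Rightarrow> 'k) set ring" and t g where Ks: "cring Ks" "sfield Ks (carrier Ks)"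
    and t: "t \<in> ring_hom Ks Ks" "bij_betw t (carrier Ks) (carrier Ks)" and g: "g \<in> ring_hom K Ks"
    and g0: "\<And>x. x \<in> carrier K \<Longrightarrow> g x = \<zero>\<^bsub>Ks\<^esub> \<longleftrightarrow> x \<in> k"
    and gt: "\<And>x. x \<in> carrier K \<Longrightarrow> g ((\<sigma>K ^^ d) x) = t (g x)"
    and gc: "\<And>\<xi>. \<xi> \<in> carrier Ks \<Longrightarrow> \<exists>n. \<exists>x\<in>carrier K. (t ^^ n) \<xi> = g x"
    by blast
  interpret Ks: cring Ks by (rule Ks(1))
  interpret Ls: cring Ls by (rule Ls(1))
  interpret Ms: cring Ms by (rule Ms(1))
  interpret h: ring_hom_cring L Ls h by unfold_locales (rule h)
  interpret h': ring_hom_cring L' Ms h' by unfold_locales (rule h')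
  interpret g: ring_hom_cring K Ks g by unfold_locales (rule g)
  interpret i: ring_hom_cring K L i by unfold_locales (rule i)
  interpret i': ring_hom_cring K L' i' by unfold_locales (rule i')
  have diff: "x \<ominus>\<^bsub>K\<^esub> y \<in> k" if "x \<in> carrier K" "y \<in> carrier K" "g x = g y" for x y
    using that g0[of "x \<ominus>\<^bsub>K\<^esub> y"] by (simp add: a_minus_def Ks.r_neg)
  have kerL: "h (i x) = h (i y)" if x: "x \<in> carrier K" and y: "y \<in> carrier K" and e: "g x = g y" for x y
  proof -
    have "i (x \<ominus>\<^bsub>K\<^esub> y) = i x \<ominus>\<^bsub>L\<^esub> i y" using x y by (simp add: a_minus_def)
    then have "h (i x \<ominus>\<^bsub>L\<^esub> i y) = \<zero>\<^bsub>Ls\<^esub>"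
      using diff[OF x y e] kp[of "x \<ominus>\<^bsub>K\<^esub> y"] h0[of "i x \<ominus>\<^bsub>L\<^esub> i y"] x y by simp
    moreover have "h (i x \<ominus>\<^bsub>L\<^esub> i y) = h (i x) \<ominus>\<^bsub>Ls\<^esub> h (i y)" using x y by (simp add: a_minus_def)
    ultimately show ?thesis using x y by simp
  qed
  have kerL': "h' (i' x) = h' (i' y)" if x: "x \<in> carrier K" and y: "y \<in> carrier K" and e: "g x = g y" for x y
  proof -
    have "i' (x \<ominus>\<^bsub>K\<^esub> y) = i' x \<ominus>\<^bsub>L'\<^esub> i' y" using x y by (simp add: a_minus_def)
    then have "h' (i' x \<ominus>\<^bsub>L'\<^esub> i' y) = \<zero>\<^bsub>Ms\<^esub>"
      using diff[OF x y e] kp'[of "x \<ominus>\<^bsub>K\<^esub> y"] h'0[of "i' x \<ominus>\<^bsub>L'\<^esub> i' y"] x y by simp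
    moreover have "h' (i' x \<ominus>\<^bsub>L'\<^esub> i' y) = h' (i' x) \<ominus>\<^bsub>Ms\<^esub> h' (i' y)" using x y by (simp add: a_minus_def)
    ultimately show ?thesis using x y by simp
  qed
  have "\<exists>\<iota>\<in>ring_hom Ks Ls. (\<forall>x\<in>carrier K. \<iota> (g x) = h (i x)) \<and> (\<forall>\<xi>\<in>carrier Ks. \<iota> (t \<xi>) = s (\<iota> \<xi>))"
    using inversive_extend[where \<sigma> = "\<sigma>K ^^ d" and \<sigma>' = "\<sigma>L ^^ d",
      OF g t(1) gt gc h s hs i ip K.funpow_simps(1) kerL K.is_cring L.is_cring Ks(1) Ls(1)] .
  then obtain \<iota> where \<iota>: "\<iota> \<in> ring_hom Ks Ls" and \<iota>g: "\<And>x. x \<in> carrier K \<Longrightarrow> \<iota> (g x) = h (i x)"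
    and \<iota>s: "\<And>\<xi>. \<xi> \<in> carrier Ks \<Longrightarrow> \<iota> (t \<xi>) = s (\<iota> \<xi>)" by blast
  have "\<exists>\<iota>\<in>ring_hom Ks Ms. (\<forall>x\<in>carrier K. \<iota> (g x) = h' (i' x)) \<and> (\<forall>\<xi>\<in>carrier Ks. \<iota> (t \<xi>) = s' (\<iota> \<xi>))"
    using inversive_extend[where \<sigma> = "\<sigma>K ^^ d" and \<sigma>' = "\<sigma>L' ^^ d",
      OF g t(1) gt gc h' s' h's i' i'p K.funpow_simps(1) kerL' K.is_cring L'.is_cring Ks(1) Ms(1)] .
  then obtain \<iota>' where \<iota>': "\<iota>' \<in> ring_hom Ks Ms" and \<iota>'g: "\<And>x. x \<in> carrier K \<Longrightarrow> \<iota>' (g x) = h' (i' x)"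
    and \<iota>'s: "\<And>\<xi>. \<xi> \<in> carrier Ks \<Longrightarrow> \<iota>' (t \<xi>) = s' (\<iota>' \<xi>)" by blast
  interpret P: field_pair Ks Ls Ms \<iota> \<iota>' t s s'
    by unfold_locales (use Ks Ls Ms \<iota> \<iota>' t s s' \<iota>s \<iota>'s in simp_all)
  obtain S where S: "finite S" "S \<subseteq> carrier L" "carrier L = sigma_pseudo_field_gen K L \<sigma>L i S"
    using fg by (auto simp: finitely_sigma_generated_def)
  \<comment> \<open>One step of \<open>s\<close> is \<open>d\<close> steps of \<sigma>: the
    \<sigma>-orbit of a generator splits into \<open>d\<close> orbits of \<open>s\<close>, starting
    at its first \<open>d\<close> iterates.\<close>
  define T where "T = (\<Union>q<d. (\<lambda>x. h ((\<sigma>L ^^ q) x)) ` S)"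
  have T: "finite T" "T \<subseteq> carrier Ls" using S(1,2) by (auto simp: T_def L.funpow_simps)
  define Z where "Z = fgen Ls (\<iota> ` carrier Ks \<union> (\<Union>n. (s ^^ n) ` T))"
  have sn: "(s ^^ n) \<xi> \<in> carrier Ls" if "\<xi> \<in> carrier Ls" for \<xi> n
    using ring_hom_closed[OF ring_hom_funpow[OF s(1)] that] .
  have hpow: "h ((\<sigma>L ^^ (d * n)) x) = (s ^^ n) (h x)" if x: "x \<in> carrier L" for n x
  proof (induction n)
    case (Suc n)
    have "(\<sigma>L ^^ (d * Suc n)) x = (\<sigma>L ^^ d) ((\<sigma>L ^^ (d * n)) x)" by (simp add: funpow_add)
    then show ?case using Suc hs[OF L.funpow_simps(1)[OF x]] by simp
  qed simp
  have h'pow: "h' ((\<sigma>L' ^^ (d * n)) x) = (s' ^^ n) (h' x)" if x: "x \<in> carrier L'" for n x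
  proof (induction n)
    case (Suc n)
    have "(\<sigma>L' ^^ (d * Suc n)) x = (\<sigma>L' ^^ d) ((\<sigma>L' ^^ (d * n)) x)" by (simp add: funpow_add)
    then show ?case using Suc h's[OF L'.funpow_simps(1)[OF x]] by simp
  qed simp
  have gens: "\<iota> ` carrier Ks \<union> (\<Union>n. (s ^^ n) ` T) \<subseteq> carrier Ls"
    using ring_hom_closed[OF \<iota>] sn T(2) by blast
  have Zf: "sfield Ls Z" unfolding Z_def by (rule Ls.fgen_sfield[OF Ls(2) gens])
  have Zi: "\<iota> ` carrier Ks \<union> (\<Union>n. (s ^^ n) ` T) \<subseteq> Z" unfolding Z_def by (rule Ls.fgen_incl)
  have hZ: "h x \<in> Z" if x: "x \<in> carrier L" for x
  proof -
    let ?G = "{x \<in> carrier L. \<forall>j. h ((\<sigma>L ^^ j) x) \<in> Z}"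
    have G: "sigma_pseudo_subfield L \<sigma>L ?G"
      by (rule L.sigma_pseudo_subfield_of_values[OF p d0 per Ls(1) h Zf])
    have iG: "i ` carrier K \<subseteq> ?G"
    proof
      fix y assume "y \<in> i ` carrier K"
      then obtain c where c: "c \<in> carrier K" "y = i c" by blast
      have "h ((\<sigma>L ^^ j) y) \<in> \<iota> ` carrier Ks" for j
        using ip[OF c(1), of j] \<iota>g[OF K.funpow_simps(1)[OF c(1)], of j] K.funpow_simps(1)[OF c(1), of j]
        unfolding c(2) by (metis g.hom_closed imageI)
      then show "y \<in> ?G" using Zi ic c by blast
    qed
    have SG: "S \<subseteq> ?G"
    proof
      fix y assume y: "y \<in> S"
      then have yL: "y \<in> carrier L" using S(2) by blast
      have "h ((\<sigma>L ^^ j) y) \<in> Z" for j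
      proof -
        have "(\<sigma>L ^^ j) y = (\<sigma>L ^^ (d * (j div d))) ((\<sigma>L ^^ (j mod d)) y)"
          by (metis comp_apply funpow_add mult_div_mod_eq)
        then have "h ((\<sigma>L ^^ j) y) = (s ^^ (j div d)) (h ((\<sigma>L ^^ (j mod d)) y))"
          using hpow[OF L.funpow_simps(1)[OF yL]] by simp
        moreover have "h ((\<sigma>L ^^ (j mod d)) y) \<in> T" using y d0 by (auto simp: T_def)
        ultimately show ?thesis using Zi by blast
      qed
      then show "y \<in> ?G" using yL by simp
    qed
    have "x \<in> ?G" using x G iG SG unfolding S(3) sigma_pseudo_field_gen_def by blast
    then have "h ((\<sigma>L ^^ 0) x) \<in> Z" by blast
    then show ?thesis by simp
  qed
  from P.field_compositum[OF T, folded Z_def]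
  obtain F :: "('k, 'a, 'b) residue ring" and \<tau> e \<phi> \<psi> and c where
    e: "0 < e" and F: "cring F" "sfield F (carrier F)" "\<tau> \<in> ring_hom F F"
    and \<phi>: "\<phi> \<in> ring_hom (Ls\<lparr>carrier := Z\<rparr>) F" and \<psi>: "\<psi> \<in> ring_hom Ms F"
    and \<phi>\<psi>: "\<And>x. x \<in> carrier Ks \<Longrightarrow> \<phi> (\<iota> x) = \<psi> (\<iota>' x)"
    and \<phi>\<tau>: "\<And>x. x \<in> Z \<Longrightarrow> \<phi> ((s ^^ e) x) = \<tau> (\<phi> x)" and \<psi>\<tau>: "\<And>x. x \<in> carrier Ms \<Longrightarrow> \<psi> ((s' ^^ e) x) = \<tau> (\<psi> x)"
    and c: "carrier F \<subseteq> c ` (lists (carrier Ls \<times> carrier Ms) \<times> lists (carrier Ls \<times> carrier Ms))"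
    by (elim exE conjE) (rule that; (assumption | (erule bspec, assumption)))
  define f where "f x = \<phi> (h x)" for x
  define f' where "f' x = \<psi> (h' x)" for x
  have f: "f \<in> ring_hom L F"
  proof (rule ring_hom_memI)
    fix x y assume xy: "x \<in> carrier L" "y \<in> carrier L"
    show "f (x \<otimes>\<^bsub>L\<^esub> y) = f x \<otimes>\<^bsub>F\<^esub> f y"
      using ring_hom_mult[OF \<phi>, of "h x" "h y"] hZ xy by (simp add: f_def)
    show "f (x \<oplus>\<^bsub>L\<^esub> y) = f x \<oplus>\<^bsub>F\<^esub> f y"
      using ring_hom_add[OF \<phi>, of "h x" "h y"] hZ xy by (simp add: f_def)
  next
    show "f x \<in> carrier F" if "x \<in> carrier L" for x
      using ring_hom_closed[OF \<phi>, of "h x"] hZ[OF that] by (simp add: f_def)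
    show "f \<one>\<^bsub>L\<^esub> = \<one>\<^bsub>F\<^esub>" using ring_hom_one[OF \<phi>] by (simp add: f_def)
  qed
  have f': "f' \<in> ring_hom L' F" using ring_hom_trans[OF h' \<psi>] by (simp add: f'_def[abs_def] comp_def)
  have ff': "f (i x) = f' (i' x)" if x: "x \<in> carrier K" for x
    using \<phi>\<psi>[of "g x"] \<iota>g[OF x] \<iota>'g[OF x] x by (simp add: f_def f'_def)
  have f\<tau>: "f ((\<sigma>L ^^ (d * e)) x) = \<tau> (f x)" if x: "x \<in> carrier L" for x
    using hpow[OF x, of e] \<phi>\<tau>[OF hZ[OF x]] by (simp add: f_def)
  have f'\<tau>: "f' ((\<sigma>L' ^^ (d * e)) x) = \<tau> (f' x)" if x: "x \<in> carrier L'" for x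
    using h'pow[OF x, of e] \<psi>\<tau>[of "h' x"] x by (simp add: f'_def)
  obtain a where a: "carrier Ls \<subseteq> range (\<lambda>(n::nat, x :: 'a). a n x)"
    using inversive_hull_covered[OF Ls s(1) hc] by blast
  obtain b where b: "carrier Ms \<subseteq> range (\<lambda>(n::nat, x :: 'b). b n x)"
    using inversive_hull_covered[OF Ms s'(1) h'c] by blast
  \<comment> \<open>Composing the coverings of the two inversive closures with that of the
    compositum covers \<open>F\<close> by codes built from elements of \<open>L\<close>,
    \<open>L'\<close> and natural numbers; the type of \<open>K\<close> has disappeared.\<close>
  let ?q = "map (map_prod (\<lambda>(n, x). a n x) (\<lambda>(n, x). b n x))"
  have "carrier Ls \<times> carrier Ms \<subseteq> range (map_prod (\<lambda>(n, x). a n x) (\<lambda>(n, x). b n x))"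
    unfolding range_map_prod by (intro Sigma_mono a b)
  then have "lists (carrier Ls \<times> carrier Ms) \<subseteq> range ?q"
    by (metis lists_UNIV lists_image lists_mono)
  then have lq: "lists (carrier Ls \<times> carrier Ms) \<times> lists (carrier Ls \<times> carrier Ms) \<subseteq> range (map_prod ?q ?q)"
    unfolding range_map_prod by (intro Sigma_mono)
  have "carrier F \<subseteq> range (\<lambda>z. c (map_prod ?q ?q z))"
    using order_trans[OF c image_mono[OF lq]] by (simp add: image_image)
  moreover have "0 < d * e" using d0 e by simp
  ultimately have "0 < d * e \<and> cring F \<and> sfield F (carrier F) \<and> \<tau> \<in> ring_hom F F \<and> f \<in> ring_hom L F \<and> f' \<in> ring_hom L' F \<and>
    (\<forall>x\<in>carrier K. f (i x) = f' (i' x)) \<and> (\<forall>x\<in>carrier L. f ((\<sigma>L ^^ (d * e)) x) = \<tau> (f x)) \<and>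
    (\<forall>x\<in>carrier L'. f' ((\<sigma>L' ^^ (d * e)) x) = \<tau> (f' x)) \<and> carrier F \<subseteq> range (\<lambda>z. c (map_prod ?q ?q z))"
    by (intro conjI ballI F f f' ff' f\<tau> f'\<tau>)
  then show ?thesis by (intro exI)
qed

section \<open>The common extension in the prescribed type\<close>

lemma coding_code:
  assumes zo: "(z::'u) \<noteq> o'" and f: "\<exists>f::'a \<Rightarrow> 'u list. inj f" and g: "\<exists>g::'b \<Rightarrow> 'u list. inj g"
  shows "\<exists>f::('a, 'b) code \<Rightarrow> 'u list. inj f"
proof -
  note pair = coding_pair[OF zo] and list = coding_list[OF zo]
  show ?thesis by (intro pair list coding_nat f g)
qed

lemma compatibleI:
  fixes K :: "'k ring" and L :: "'a ring" and L' :: "'b ring" and F :: "'f ring" and r :: "'w \<Rightarrow> 'f"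
  assumes L: "sigma_pseudo_field_extension K \<sigma>K L \<sigma>L i"
    and L': "sigma_pseudo_field_extension K \<sigma>K L' \<sigma>L' i'"
    and d: "0 < d" and F: "cring F" "sfield F (carrier F)" and \<tau>: "\<tau> \<in> ring_hom F F"
    and \<phi>: "\<phi> \<in> ring_hom L F" "\<And>x. x \<in> carrier L \<Longrightarrow> \<phi> ((\<sigma>L ^^ d) x) = \<tau> (\<phi> x)"
    and \<psi>: "\<psi> \<in> ring_hom L' F" "\<And>x. x \<in> carrier L' \<Longrightarrow> \<psi> ((\<sigma>L' ^^ d) x) = \<tau> (\<psi> x)"
    and \<phi>\<psi>: "\<And>x. x \<in> carrier K \<Longrightarrow> \<phi> (i x) = \<psi> (i' x)"
    and r: "carrier F \<subseteq> range r"
    and code: "\<And>(z :: 'a \<times> 'b) o'. z \<noteq> o' \<Longrightarrow> \<exists>f :: 'w \<Rightarrow> ('a \<times> 'b) list. inj f"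
  shows "compatible K \<sigma>K L \<sigma>L i L' \<sigma>L' i'"
proof -
  interpret K: sigma_pseudo_field K \<sigma>K using L by (simp add: sigma_pseudo_field_extension_def)
  interpret L: sigma_pseudo_field L \<sigma>L using L by (simp add: sigma_pseudo_field_extension_def)
  interpret L': sigma_pseudo_field L' \<sigma>L' using L' by (simp add: sigma_pseudo_field_extension_def)
  interpret F: cring F by (rule F(1))
  have i: "i \<in> ring_hom K L" and i\<sigma>: "\<And>x. x \<in> carrier K \<Longrightarrow> i (\<sigma>K x) = \<sigma>L (i x)" and ii: "inj_on i (carrier K)"
    and i': "i' \<in> ring_hom K L'" and i'\<sigma>: "\<And>x. x \<in> carrier K \<Longrightarrow> i' (\<sigma>K x) = \<sigma>L' (i' x)"
    using L L' by (simp_all add: sigma_pseudo_field_extension_def sigma_embedding_def sigma_morphism_def)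
  have ip: "i ((\<sigma>K ^^ n) x) = (\<sigma>L ^^ n) (i x)" if x: "x \<in> carrier K" for n x
    by (induction n) (simp_all add: i\<sigma> x K.funpow_simps)
  have i'p: "i' ((\<sigma>K ^^ n) x) = (\<sigma>L' ^^ n) (i' x)" if x: "x \<in> carrier K" for n x
    by (induction n) (simp_all add: i'\<sigma> x K.funpow_simps)
  \<comment> \<open>Two distinct letters of the alphabet \<open>'a \<times> 'b\<close> are needed
    for coding; zero and one of \<open>L\<close> differ, and the second components are
    arbitrary.\<close>
  let ?z = "(\<zero>\<^bsub>L\<^esub>, undefined :: 'b)" and ?o = "(\<one>\<^bsub>L\<^esub>, undefined :: 'b)"
  have zo: "?z \<noteq> ?o" using L.one_neq_zero by simp
  obtain c :: "(nat \<Rightarrow> 'f) \<Rightarrow> ('a, 'b) compositum" where c: "inj_on c (tuples F d)"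
    using coding_tuples[OF zo code[OF zo] r] by blast
  interpret M: cyclic_power F \<tau> d c by unfold_locales (use F \<tau> d c in simp_all)
  let ?f = "M.diag \<sigma>L \<phi>" and ?g = "M.diag \<sigma>L' \<psi>" and ?j = "\<lambda>x. M.diag \<sigma>L \<phi> (i x)"
  have f: "sigma_embedding L \<sigma>L M.P.Q M.shift ?f"
    by (rule M.diag_embedding[OF L.sigma_pseudo_field_axioms \<phi>])
  have g: "sigma_embedding L' \<sigma>L' M.P.Q M.shift ?g"
    by (rule M.diag_embedding[OF L'.sigma_pseudo_field_axioms \<psi>])
  have fh: "?f \<in> ring_hom L M.P.Q" and f\<sigma>: "\<And>x. x \<in> carrier L \<Longrightarrow> ?f (\<sigma>L x) = M.shift (?f x)"
    and fi: "inj_on ?f (carrier L)"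
    using f by (simp_all add: sigma_embedding_def sigma_morphism_def)
  have ic: "i x \<in> carrier L" if "x \<in> carrier K" for x using ring_hom_closed[OF i that] .
  have "?j \<in> ring_hom K M.P.Q" using ring_hom_trans[OF i fh] by (simp add: comp_def)
  moreover have "?j (\<sigma>K x) = M.shift (?j x)" if "x \<in> carrier K" for x using f\<sigma>[OF ic[OF that]] i\<sigma>[OF that] by simp
  moreover have "inj_on ?j (carrier K)"
  proof (rule inj_onI)
    fix x y assume xy: "x \<in> carrier K" "y \<in> carrier K" "?j x = ?j y"
    have "i x = i y" by (rule inj_onD[OF fi xy(3) ic[OF xy(1)] ic[OF xy(2)]])
    then show "x = y" using inj_onD[OF ii] xy by blast
  qed
  ultimately have j: "sigma_pseudo_field_extension K \<sigma>K M.P.Q M.shift ?j"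
    using K.sigma_pseudo_field_axioms M.pseudo_field_P
    by (simp add: sigma_pseudo_field_extension_def sigma_embedding_def sigma_morphism_def)
  have "?g (i' x) = ?j x" if x: "x \<in> carrier K" for x
  proof -
    \<comment> \<open>The structure map of the common extension runs through \<open>L\<close>. It
      agrees with the one through \<open>L'\<close> coordinate by coordinate, since both field maps
      coincide on all iterates of elements of \<open>K\<close>.\<close>
    have "\<phi> ((\<sigma>L ^^ n) (i x)) = \<psi> ((\<sigma>L' ^^ n) (i' x))" for n
      using \<phi>\<psi>[OF K.funpow_simps(1)[OF x], of n] ip[OF x] i'p[OF x] by simp
    then show ?thesis unfolding M.diag_def by presburger
  qed
  then have "K_sigma_embedding K L \<sigma>L i M.P.Q M.shift ?j ?f" "K_sigma_embedding K L' \<sigma>L' i' M.P.Q M.shift ?j ?g"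
    using f g by (simp_all add: K_sigma_embedding_def)
  with j show ?thesis unfolding compatible_def
    by (intro exI[of _ "M.P.Q"] exI[of _ "M.shift"] exI[of _ ?j] exI[of _ ?f] exI[of _ ?g] conjI)
qed

theorem theorem1p2:
  fixes K :: "'k ring" and \<sigma>K :: "'k \<Rightarrow> 'k"
    and L :: "'a ring" and \<sigma>L :: "'a \<Rightarrow> 'a" and i :: "'k \<Rightarrow> 'a"
    and L' :: "'b ring" and \<sigma>L' :: "'b \<Rightarrow> 'b" and i' :: "'k \<Rightarrow> 'b"
  assumes "sigma_pseudo_field K \<sigma>K"
    and "sigma_pseudo_field_extension K \<sigma>K L \<sigma>L i"
    and "sigma_pseudo_field_extension K \<sigma>K L' \<sigma>L' i'"
    and "finitely_sigma_generated K L \<sigma>L i \<or> finitely_sigma_generated K L' \<sigma>L' i'"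
  shows "compatible K \<sigma>K L \<sigma>L i L' \<sigma>L' i'"
proof -
  have a: "\<exists>f :: 'a \<Rightarrow> ('a \<times> 'b) list. inj f"
    by (intro exI[of _ "\<lambda>x. [(x, undefined)]"] injI) simp
  have b: "\<exists>f :: 'b \<Rightarrow> ('a \<times> 'b) list. inj f"
    by (intro exI[of _ "\<lambda>x. [(undefined, x)]"] injI) simp
  from assms(4) show ?thesis
  proof
    assume "finitely_sigma_generated K L \<sigma>L i"
    from residue_compositum[OF assms(2,3) this]
    obtain F :: "('k, 'a, 'b) residue ring" and \<tau> d \<phi> \<psi> and r :: "('a, 'b) code \<Rightarrow> ('k, 'a, 'b) residue" where
      *: "0 < d" "cring F" "sfield F (carrier F)" "\<tau> \<in> ring_hom F F" "\<phi> \<in> ring_hom L F" "\<psi> \<in> ring_hom L' F"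
      "\<forall>x\<in>carrier K. \<phi> (i x) = \<psi> (i' x)" "\<forall>x\<in>carrier L. \<phi> ((\<sigma>L ^^ d) x) = \<tau> (\<phi> x)"
      "\<forall>x\<in>carrier L'. \<psi> ((\<sigma>L' ^^ d) x) = \<tau> (\<psi> x)" "carrier F \<subseteq> range r"
      by (elim exE conjE) (rule that)
    show ?thesis
      using assms(2,3) *(1-5) *(8)[rule_format] *(6) *(9)[rule_format] *(7)[rule_format] *(10) coding_code[OF _ a b]
      by (rule compatibleI)
  next
    assume "finitely_sigma_generated K L' \<sigma>L' i'"
    \<comment> \<open>The roles of the two extensions are exchanged here, but the codes are still
      written in the letters \<open>'a \<times> 'b\<close>, so the extension lands in the same
      type.\<close>
    from residue_compositum[OF assms(3,2) this]
    obtain F :: "('k, 'b, 'a) residue ring" and \<tau> d \<phi> \<psi> and r :: "('b, 'a) code \<Rightarrow> ('k, 'b, 'a) residue" where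
      *: "0 < d" "cring F" "sfield F (carrier F)" "\<tau> \<in> ring_hom F F" "\<phi> \<in> ring_hom L' F" "\<psi> \<in> ring_hom L F"
      "\<forall>x\<in>carrier K. \<phi> (i' x) = \<psi> (i x)" "\<forall>x\<in>carrier L'. \<phi> ((\<sigma>L' ^^ d) x) = \<tau> (\<phi> x)"
      "\<forall>x\<in>carrier L. \<psi> ((\<sigma>L ^^ d) x) = \<tau> (\<psi> x)" "carrier F \<subseteq> range r"
      by (elim exE conjE) (rule that)
    show ?thesis
      using assms(2,3) *(1-4,6) *(9)[rule_format] *(5) *(8)[rule_format] *(7)[rule_format, symmetric] *(10)
        coding_code[OF _ b a]
      by (rule compatibleI)
  qed
qed

end
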